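(* Assume $(H_\xi)$, $(H_f)$ and $(H_{b\ell})$ (as written out in the context). Then there exists a unique deterministic flat solution to the BSDE with mean reflection, i.e. a unique triple $(Y,Z,K)\in\mathcal S^2\times\mathcal H^2\times\mathcal A^2_D$ such that $$Y_t=\xi+\int_t^T f(s,Y_s,Z_s)\,ds-\int_t^T Z_s\cdot dB_s+K_T-K_t,\qquad \mathbb E[\ell(t,Y_t)]\ge0,\qquad 0\le t\le T,$$ $$\int_0^T\mathbb E[\ell(t,Y_t)]\,dK_t=0.$$
   Context: $T>0$ is finite; $(\Omega,\mathcal F,\mathbb P)$ is a complete probability space carrying a $d$-dimensional standard Brownian motion $B=(B_t)_{0\le t\le T}$, with usual augmented filtration $\{\mathcal F_t\}_{0\le t\le T}$. $\mathcal S^2$: real-valued adapted continuous processes $Y$ with $\mathbb E[\sup_{0\le t\le T}|Y_t|^2]<\infty$. $\mathcal H^2$: predictable $\mathbb R^d$-valued processes $Z$ with $\mathbb E[\int_0^T|Z_s|^2ds]<\infty$. $\mathcal A^2$: nondecreasing processes $K\in\mathcal S^2$ with $K_0=0$; $\mathcal A^2_D$: the deterministic elements of $\mathcal A^2$. Uniqueness is understood in these spaces (indistinguishability for $Y$ and $K$, $d\mathbb P\otimes dt$-a.e. equality for $Z$). Assumptions: $(H_f)$: $f:\Omega\times[0,T]\times\mathbb R\times\mathbb R^d\to\mathbb R$ is measurable with respect to $\mathcal P\otimes\mathcal B(\mathbb R)\otimes\mathcal B(\mathbb R^d)$, $\mathcal P$ being the progressive $\sigma$-algebra on $\Omega\times[0,T]$;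 there is $\lambda\ge0$ such that $\mathbb P$-a.s., for all $t\in[0,T]$ and all $y,p\in\mathbb R$, $z,q\in\mathbb R^d$, $|f(t,y,z)-f(t,p,q)|\le\lambda(|y-p|+|z-q|)$; and $\mathbb E[\int_0^T|f(t,0,0)|^2dt]<\infty$. $(H_\xi)$: $\xi$ is a square-integrable $\mathcal F_T$-measurable random variable with $\mathbb E[\ell(T,\xi)]\ge0$. $(H_{b\ell})$: $\ell:\Omega\times[0,T]\times\mathbb R\to\mathbb R$ is $\mathcal F_T\otimes\mathcal B([0,T])\otimes\mathcal B(\mathbb R)$-measurable and there exist constants $0<c_\ell\le C_\ell$ such that $\mathbb P$-a.s.: (1) for all $y\in\mathbb R$, $t\mapsto\ell(t,y)$ is continuous; (2) for all $t\in[0,T]$, $y\mapsto\ell(t,y)$ is strictly increasing; (3) for all $t\in[0,T]$ and $y\in\mathbb R$, $|\ell(t,y)|\le C_\ell(1+|y|)$; (4) for all $t\in[0,T]$ and $x,y\in\mathbb R$, $c_\ell|x-y|\le|\ell(t,x)-\ell(t,y)|\le C_\ell|x-y|$. *)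

theory Defs
  imports "HOL-Probability.Probability"
begin

text \<open>
  Processes are curried as \<open>X :: real \<Rightarrow> 'w \<Rightarrow> 'b\<close> and only their values at times in
  \<open>{0..T}\<close> matter. The random coefficients \<open>f\<close> and \<open>l\<close> take the sample point first.
\<close>

subsection \<open>Brownian motion and its augmented filtration\<close>

definition nat_filtration :: "'w measure \<Rightarrow> (real \<Rightarrow> 'w \<Rightarrow> 'b::topological_space) \<Rightarrow> real \<Rightarrow> 'w measure"
  where "nat_filtration M B t =
    sigma (space M) (\<Union>s\<in>{0..t}. {B s -` A \<inter> space M | A. A \<in> sets borel})"

text \<open>On a complete space \<open>null_sets M\<close> consists of all negligible sets. For a Brownian motion
  the resulting filtration is automatically right-continuous.\<close>

definition aug_filtration :: "'w measure \<Rightarrow> (real \<Rightarrow> 'w \<Rightarrow> 'b::topological_space) \<Rightarrow> real \<Rightarrow> 'w measure"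
  where "aug_filtration M B t =
    sigma (space M) (sets (nat_filtration M B t) \<union> null_sets M)"

definition standard_brownian_motion ::
    "'w measure \<Rightarrow> real \<Rightarrow> (real \<Rightarrow> 'w \<Rightarrow> real^'d::finite) \<Rightarrow> bool"
  where "standard_brownian_motion M T B \<longleftrightarrow>
    (\<forall>t\<in>{0..T}. B t \<in> borel_measurable M) \<and>
    (AE w in M. B 0 w = 0) \<and>
    (AE w in M. continuous_on {0..T} (\<lambda>t. B t w)) \<and>
    (\<forall>s t. 0 \<le> s \<and> s < t \<and> t \<le> T \<longrightarrow>
      prob_space.indep_set M (sets (nat_filtration M B s))
        {(\<lambda>w. B t w - B s w) -` A \<inter> space M | A. A \<in> sets borel} \<and>
      prob_space.indep_vars M (\<lambda>_. borel) (\<lambda>i w. (B t w - B s w) $ i) UNIV \<and>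
      (\<forall>i. distributed M lborel (\<lambda>w. (B t w - B s w) $ i) (normal_density 0 (sqrt (t - s)))))"

subsection \<open>Measurability of processes\<close>

definition adapted :: "(real \<Rightarrow> 'w measure) \<Rightarrow> real \<Rightarrow> (real \<Rightarrow> 'w \<Rightarrow> 'b::topological_space) \<Rightarrow> bool"
  where "adapted F T X \<longleftrightarrow> (\<forall>t\<in>{0..T}. X t \<in> borel_measurable (F t))"

definition progressive_sigma :: "'w measure \<Rightarrow> (real \<Rightarrow> 'w measure) \<Rightarrow> real \<Rightarrow> ('w \<times> real) measure"
  where "progressive_sigma M F T = sigma (space M \<times> {0..T})
    {A. A \<subseteq> space M \<times> {0..T} \<and>
        (\<forall>t\<in>{0..T}. A \<inter> (space M \<times> {0..t}) \<in> sets (F t \<Otimes>\<^sub>M restrict_space borel {0..t}))}"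

definition predictable_sigma :: "'w measure \<Rightarrow> (real \<Rightarrow> 'w measure) \<Rightarrow> real \<Rightarrow> ('w \<times> real) measure"
  where "predictable_sigma M F T = sigma (space M \<times> {0..T})
    ({A \<times> {0} | A. A \<in> sets (F 0)} \<union>
     {A \<times> {s<..t} | A s t. 0 \<le> s \<and> s \<le> t \<and> t \<le> T \<and> A \<in> sets (F s)})"

subsection \<open>Spaces of processes\<close>

definition S2 :: "'w measure \<Rightarrow> (real \<Rightarrow> 'w measure) \<Rightarrow> real \<Rightarrow> (real \<Rightarrow> 'w \<Rightarrow> real) set"
  where "S2 M F T = {Y. adapted F T Y \<and>
    (\<forall>w\<in>space M. continuous_on {0..T} (\<lambda>t. Y t w)) \<and>
    (\<integral>\<^sup>+w. (SUP t\<in>{0..T}. ennreal (\<bar>Y t w\<bar>\<^sup>2)) \<partial>M) < \<infinity>}"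

definition H2 :: "'w measure \<Rightarrow> (real \<Rightarrow> 'w measure) \<Rightarrow> real \<Rightarrow> (real \<Rightarrow> 'w \<Rightarrow> real^'d::finite) set"
  where "H2 M F T = {Z. (\<lambda>(w, t). Z t w) \<in> borel_measurable (predictable_sigma M F T) \<and>
    (\<integral>\<^sup>+w. (\<integral>\<^sup>+s\<in>{0..T}. ennreal ((norm (Z s w))\<^sup>2) \<partial>lborel) \<partial>M) < \<infinity>}"

definition A2 :: "'w measure \<Rightarrow> (real \<Rightarrow> 'w measure) \<Rightarrow> real \<Rightarrow> (real \<Rightarrow> 'w \<Rightarrow> real) set"
  where "A2 M F T = {K \<in> S2 M F T.
    \<forall>w\<in>space M. mono_on {0..T} (\<lambda>t. K t w) \<and> K 0 w = 0}"

text \<open>Deterministic processes are represented by functions of time.\<close>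

definition A2D :: "'w measure \<Rightarrow> (real \<Rightarrow> 'w measure) \<Rightarrow> real \<Rightarrow> (real \<Rightarrow> real) set"
  where "A2D M F T = {k. (\<lambda>t w. k t) \<in> A2 M F T}"

subsection \<open>The stochastic integral\<close>

text \<open>
  A list of triples \<open>(a, b, x)\<close> stands for the simple predictable integrand
  \<open>\<Sum> x \<cdot> 1\<^bsub>(a, b]\<^esub>\<close>. The integral of \<open>Z \<in> H2\<close> is the continuous adapted process that is the
  mean-square limit of the elementary integrals along simple integrands converging to \<open>Z\<close>
  in \<open>H2\<close>; by the isometry it is unique up to indistinguishability.
\<close>

definition simple_integrand ::
    "(real \<Rightarrow> 'w measure) \<Rightarrow> real \<Rightarrow> (real \<times> real \<times> ('w \<Rightarrow> real^'d::finite)) list \<Rightarrow> bool"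
  where "simple_integrand F T S \<longleftrightarrow>
    (\<forall>(a, b, x)\<in>set S. 0 \<le> a \<and> a \<le> b \<and> b \<le> T \<and>
       x \<in> borel_measurable (F a) \<and> bounded (x ` space (F a)))"

definition simple_process ::
    "(real \<times> real \<times> ('w \<Rightarrow> real^'d::finite)) list \<Rightarrow> real \<Rightarrow> 'w \<Rightarrow> real^'d"
  where "simple_process S t w = (\<Sum>(a, b, x)\<leftarrow>S. indicator {a<..b} t *\<^sub>R x w)"

definition simple_integral :: "(real \<Rightarrow> 'w \<Rightarrow> real^'d::finite) \<Rightarrow>
    (real \<times> real \<times> ('w \<Rightarrow> real^'d)) list \<Rightarrow> real \<Rightarrow> 'w \<Rightarrow> real"
  where "simple_integral B S t w = (\<Sum>(a, b, x)\<leftarrow>S. x w \<bullet> (B (min b t) w - B (min a t) w))"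

definition is_ito_integral :: "'w measure \<Rightarrow> real \<Rightarrow> (real \<Rightarrow> 'w \<Rightarrow> real^'d::finite) \<Rightarrow>
    (real \<Rightarrow> 'w \<Rightarrow> real^'d) \<Rightarrow> (real \<Rightarrow> 'w \<Rightarrow> real) \<Rightarrow> bool"
  where "is_ito_integral M T B Z I \<longleftrightarrow>
    adapted (aug_filtration M B) T I \<and>
    (\<forall>w\<in>space M. continuous_on {0..T} (\<lambda>t. I t w)) \<and>
    (\<exists>S. (\<forall>n. simple_integrand (aug_filtration M B) T (S n)) \<and>
      (\<lambda>n. \<integral>\<^sup>+w. (\<integral>\<^sup>+s\<in>{0..T}. ennreal ((norm (simple_process (S n) s w - Z s w))\<^sup>2) \<partial>lborel) \<partial>M)
        \<longlonglongrightarrow> 0 \<and>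
      (\<forall>t\<in>{0..T}. (\<lambda>n. \<integral>\<^sup>+w. ennreal ((simple_integral B (S n) t w - I t w)\<^sup>2) \<partial>M) \<longlonglongrightarrow> 0))"

subsection \<open>Assumptions on the data\<close>

definition H_f :: "'w measure \<Rightarrow> (real \<Rightarrow> 'w measure) \<Rightarrow> real \<Rightarrow>
    ('w \<Rightarrow> real \<Rightarrow> real \<Rightarrow> real^'d::finite \<Rightarrow> real) \<Rightarrow> bool"
  where "H_f M F T f \<longleftrightarrow>
    (\<lambda>((w, t), y, z). f w t y z) \<in> borel_measurable (progressive_sigma M F T \<Otimes>\<^sub>M borel \<Otimes>\<^sub>M borel) \<and>
    (\<exists>L\<ge>0. AE w in M. \<forall>t\<in>{0..T}. \<forall>y p z q.
       \<bar>f w t y z - f w t p q\<bar> \<le> L * (\<bar>y - p\<bar> + norm (z - q))) \<and>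
    (\<integral>\<^sup>+w. (\<integral>\<^sup>+t\<in>{0..T}. ennreal (\<bar>f w t 0 0\<bar>\<^sup>2) \<partial>lborel) \<partial>M) < \<infinity>"

definition H_xi :: "'w measure \<Rightarrow> (real \<Rightarrow> 'w measure) \<Rightarrow> real \<Rightarrow>
    ('w \<Rightarrow> real \<Rightarrow> real \<Rightarrow> real) \<Rightarrow> ('w \<Rightarrow> real) \<Rightarrow> bool"
  where "H_xi M F T l \<xi> \<longleftrightarrow>
    \<xi> \<in> borel_measurable (F T) \<and> integrable M (\<lambda>w. (\<xi> w)\<^sup>2) \<and>
    prob_space.expectation M (\<lambda>w. l w T (\<xi> w)) \<ge> 0"

definition H_bl :: "'w measure \<Rightarrow> (real \<Rightarrow> 'w measure) \<Rightarrow> real \<Rightarrow>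
    ('w \<Rightarrow> real \<Rightarrow> real \<Rightarrow> real) \<Rightarrow> bool"
  where "H_bl M F T l \<longleftrightarrow>
    (\<lambda>(w, t, y). l w t y) \<in> borel_measurable (F T \<Otimes>\<^sub>M restrict_space borel {0..T} \<Otimes>\<^sub>M borel) \<and>
    (\<exists>c C. 0 < c \<and> c \<le> C \<and>
      (AE w in M.
        (\<forall>y. continuous_on {0..T} (\<lambda>t. l w t y)) \<and>
        (\<forall>t\<in>{0..T}. strict_mono (\<lambda>y. l w t y)) \<and>
        (\<forall>t\<in>{0..T}. \<forall>y. \<bar>l w t y\<bar> \<le> C * (1 + \<bar>y\<bar>)) \<and>
        (\<forall>t\<in>{0..T}. \<forall>x y. c * \<bar>x - y\<bar> \<le> \<bar>l w t x - l w t y\<bar> \<and>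
                                \<bar>l w t x - l w t y\<bar> \<le> C * \<bar>x - y\<bar>)))"

subsection \<open>Deterministic flat solutions\<close>

text \<open>The Lebesgue--Stieltjes measure \<open>dk\<close> on \<open>[0, T]\<close>: \<open>interval_measure\<close> needs a distribution
  function on the whole line, so \<open>k\<close> is extended by constants outside \<open>[0, T]\<close>.\<close>

definition stieltjes_measure :: "real \<Rightarrow> (real \<Rightarrow> real) \<Rightarrow> real measure"
  where "stieltjes_measure T k = interval_measure (\<lambda>t. k (max 0 (min t T)))"

text \<open>Under the assumptions on the data, for \<open>Y\<close> in \<open>S2\<close> and \<open>Z\<close> in \<open>H2\<close>, all integrals below
  exist (almost surely): \<open>t \<mapsto> f w t (Y t w) (Z t w)\<close> is square integrable, \<open>l w t (Y t w)\<close>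
  is dominated by an integrable variable uniformly in \<open>t\<close>, and its expectation is continuous
  in \<open>t\<close>.\<close>

definition deterministic_flat_solution :: "'w measure \<Rightarrow> real \<Rightarrow> (real \<Rightarrow> 'w \<Rightarrow> real^'d::finite) \<Rightarrow>
    ('w \<Rightarrow> real) \<Rightarrow> ('w \<Rightarrow> real \<Rightarrow> real \<Rightarrow> real^'d \<Rightarrow> real) \<Rightarrow> ('w \<Rightarrow> real \<Rightarrow> real \<Rightarrow> real) \<Rightarrow>
    (real \<Rightarrow> 'w \<Rightarrow> real) \<Rightarrow> (real \<Rightarrow> 'w \<Rightarrow> real^'d) \<Rightarrow> (real \<Rightarrow> real) \<Rightarrow> bool"
  where "deterministic_flat_solution M T B \<xi> f l Y Z K \<longleftrightarrow>
    Y \<in> S2 M (aug_filtration M B) T \<and>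
    Z \<in> H2 M (aug_filtration M B) T \<and>
    K \<in> A2D M (aug_filtration M B) T \<and>
    (\<exists>I. is_ito_integral M T B Z I \<and>
      (AE w in M. \<forall>t\<in>{0..T}.
        Y t w = \<xi> w + (LINT s:{t..T}|lborel. f w s (Y s w) (Z s w)) - (I T w - I t w) + K T - K t)) \<and>
    (\<forall>t\<in>{0..T}. prob_space.expectation M (\<lambda>w. l w t (Y t w)) \<ge> 0) \<and>
    (LINT t:{0..T}|stieltjes_measure T K. prob_space.expectation M (\<lambda>w. l w t (Y t w))) = 0"

end

(*
  For a driver g not depending on (Y, Z) the equation is solved explicitly: martingale representation
  gives Z and the reflection-free solution X, and Y = X + k with the deterministic push
  k(t) = sup {rho(s)^+ : t <= s <= T}, where rho(s) is the root of x |-> E[l(s, X_s + x)].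
  Flatness forces K = k(0) - k.

  For two such solutions with the same terminal value, the adapted difference X_t - X'_t is orthogonal to the
  increment over [t, T] of the stochastic integral of Z - Z', and their sum is int_t^T (g - g') ds.  Hence
  E|X_t - X'_t|^2 + E int_t^T |Z - Z'|^2 ds = E|int_t^T (g - g') ds|^2, without Ito's formula.
  With exponential weights in time, this makes the Picard map (Y, Z) |-> (solution with driver f(., Y, Z))
  a contraction, which gives existence and uniqueness.

  Martingale representation holds because the representable variables are closed under L^2 limits and
  contain the exponentials of Brownian increments, limits of products of martingale differences; a
  monotone class argument then covers all of L^2(F_T).
*)
theory Submission
  imports Defs
begin

section \<open>L2 calculus over an arbitrary measure, with completeness\<close>

section \<open>Square integrable functions\<close>

text \<open>The constraint couples all sample points through an expectation, so two solutions cannot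
  be compared path by path. What can be compared are the real functions x |-> E[l(t, X_t + x)],
  whose slopes lie between \<open>c\<close> and \<open>C\<close>; this bounds the difference of the
  deterministic pushes at time t by \<open>C / c\<close> times a bound for E|X_s - X'_s| valid for
  all s in [t, T]. Such a supremum over later times does not fit a weighted L2 norm. The obstacle is
  removed by \<open>tail_bound\<close>, which dominates E|X_t - X'_t|^2 and is antitone in t, so its
  value at t already controls the supremum. Cauchy-Schwarz with the weight exp(\<gamma> s) gives it
  a factor 1/\<gamma>, and integration against the larger weight exp(2 \<gamma> t) gains another
  one. Large \<gamma> then yields a contraction on all of [0, T] at once, without cutting the
  interval into short pieces.

  Determinism of the push is used a second time in the orthogonality argument:
  \<open>K T - K t\<close> is a constant, hence subtracting it keeps the difference adapted.

  Conditional expectations are avoided throughout. Being a martingale means orthogonality of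
  increments to the square integrable past, a property that passes to L2 limits.\<close>

definition sqint :: "'a measure \<Rightarrow> ('a \<Rightarrow> 'b::{banach, second_countable_topology}) \<Rightarrow> bool"
  where "sqint M X \<longleftrightarrow> X \<in> borel_measurable M \<and> integrable M (\<lambda>w. (norm (X w))\<^sup>2)"

lemma sqint_measurable: "sqint M X \<Longrightarrow> X \<in> borel_measurable M"
  by (simp add: sqint_def)

lemma sqint_iff:
  "sqint M X \<longleftrightarrow> X \<in> borel_measurable M \<and> (\<integral>\<^sup>+w. ennreal ((norm (X w))\<^sup>2) \<partial>M) < \<infinity>"
  unfolding sqint_def integrable_iff_bounded by auto

lemma sqint_nn_integral:
  "sqint M X \<Longrightarrow> (\<integral>\<^sup>+w. ennreal ((norm (X w))\<^sup>2) \<partial>M) = ennreal (\<integral>w. (norm (X w))\<^sup>2 \<partial>M)"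
  unfolding sqint_def by (intro nn_integral_eq_integral) auto

lemma sqint_real_iff:
  "sqint M (X :: 'a \<Rightarrow> real) \<longleftrightarrow> X \<in> borel_measurable M \<and> integrable M (\<lambda>w. (X w)\<^sup>2)"
  by (simp add: sqint_def)

lemma sqint_square_integrable: "sqint M (X :: 'a \<Rightarrow> real) \<Longrightarrow> integrable M (\<lambda>w. (X w)\<^sup>2)"
  by (simp add: sqint_def)

lemma sqint_mono:
  assumes "sqint M X" "Y \<in> borel_measurable M" "AE w in M. norm (Y w) \<le> K * norm (X w)"
  shows "sqint M Y"
  unfolding sqint_def
proof
  show "integrable M (\<lambda>w. (norm (Y w))\<^sup>2)"
  proof (rule Bochner_Integration.integrable_bound)
    show "integrable M (\<lambda>w. K\<^sup>2 * (norm (X w))\<^sup>2)" using assms(1) by (simp add: sqint_def)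
    show "AE w in M. norm ((norm (Y w))\<^sup>2) \<le> norm (K\<^sup>2 * (norm (X w))\<^sup>2)"
      using assms(3)
    proof eventually_elim
      case (elim w)
      then show ?case using power_mono[OF elim, of 2] by (simp add: power_mult_distrib)
    qed
  qed (use assms in measurable)
qed fact

lemma norm_add_squared_le: "(norm (a + b))\<^sup>2 \<le> 2 * (norm a)\<^sup>2 + 2 * (norm b)\<^sup>2"
proof -
  have "(norm (a + b))\<^sup>2 \<le> (norm a + norm b)\<^sup>2" by (intro power_mono norm_triangle_ineq) auto
  also have "\<dots> \<le> 2 * (norm a)\<^sup>2 + 2 * (norm b)\<^sup>2" using zero_le_power2[of "norm a - norm b"]
    by (simp add: power2_eq_square algebra_simps)
  finally show ?thesis .
qed

lemma sqint_add:
  assumes "sqint M X" "sqint M Y" shows "sqint M (\<lambda>w. X w + Y w)"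
  unfolding sqint_def
proof
  have [measurable]: "X \<in> borel_measurable M" "Y \<in> borel_measurable M"
    using assms by (auto simp: sqint_def)
  show "(\<lambda>w. X w + Y w) \<in> borel_measurable M" by measurable
  show "integrable M (\<lambda>w. (norm (X w + Y w))\<^sup>2)"
  proof (rule Bochner_Integration.integrable_bound)
    show "integrable M (\<lambda>w. 2 * (norm (X w))\<^sup>2 + 2 * (norm (Y w))\<^sup>2)"
      using assms by (simp add: sqint_def)
    show "AE w in M. norm ((norm (X w + Y w))\<^sup>2) \<le> norm (2 * (norm (X w))\<^sup>2 + 2 * (norm (Y w))\<^sup>2)"
      using norm_add_squared_le by auto
  qed measurable
qed

lemma sqint_scaleR: "sqint M X \<Longrightarrow> sqint M (\<lambda>w. c *\<^sub>R X w)"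
  by (rule sqint_mono[where K="\<bar>c\<bar>"]) (auto simp: sqint_def)

lemma sqint_cmult: "sqint M X \<Longrightarrow> sqint M (\<lambda>w. c * X w :: real)"
  using sqint_scaleR[of M X c] by simp

lemma sqint_minus: "sqint M X \<Longrightarrow> sqint M (\<lambda>w. - X w)"
  using sqint_scaleR[of M X "-1"] by simp

lemma sqint_diff: "sqint M X \<Longrightarrow> sqint M Y \<Longrightarrow> sqint M (\<lambda>w. X w - Y w)"
  using sqint_add[OF _ sqint_minus, of M X Y] by simp

lemma sqint_zero: "sqint M (\<lambda>w. 0)"
  by (simp add: sqint_def)

lemma sqint_sum: "(\<And>i. i \<in> A \<Longrightarrow> sqint M (X i)) \<Longrightarrow> sqint M (\<lambda>w. \<Sum>i\<in>A. X i w)"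
  by (induction A rule: infinite_finite_induct) (auto intro: sqint_add simp: sqint_zero)

lemma sqint_sum_list: "(\<And>i. i \<in> set A \<Longrightarrow> sqint M (X i)) \<Longrightarrow> sqint M (\<lambda>w. \<Sum>i\<leftarrow>A. X i w)"
  by (induction A) (auto intro: sqint_add simp: sqint_zero)

lemma (in finite_measure) sqint_bounded:
  "X \<in> borel_measurable M \<Longrightarrow> (\<And>w. w \<in> space M \<Longrightarrow> norm (X w) \<le> K) \<Longrightarrow> sqint M X"
  unfolding sqint_def
  by (auto intro!: integrable_const_bound[where B="K\<^sup>2"] AE_I2 power_mono)

lemma (in finite_measure) sqint_const: "sqint M (\<lambda>w. c)"
  by (simp add: sqint_def)

lemma (in finite_measure) sqint_integrable:
  assumes "sqint M X" shows "integrable M X"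
proof -
  have [measurable]: "X \<in> borel_measurable M" using assms by (simp add: sqint_def)
  have "integrable M (\<lambda>w. norm (X w))"
    using square_integrable_imp_integrable[of "\<lambda>w. norm (X w)"] assms by (simp add: sqint_def)
  then show ?thesis by (simp add: integrable_norm_iff)
qed

lemma sqint_mult_bounded:
  fixes X :: "'a \<Rightarrow> 'b::{banach, second_countable_topology, real_normed_div_algebra}"
  assumes "sqint M X" "Y \<in> borel_measurable M" "AE w in M. norm (Y w) \<le> K"
  shows "sqint M (\<lambda>w. Y w * X w)"
proof (rule sqint_mono[OF assms(1), where K=K])
  show "AE w in M. norm (Y w * X w) \<le> K * norm (X w)"
    using assms(3) by eventually_elim (auto simp: norm_mult mult_right_mono)
qed (use assms in \<open>auto simp: sqint_def\<close>)

lemma sqint_mult_integrable: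
  fixes X Y :: "'a \<Rightarrow> 'b::{banach, second_countable_topology, real_normed_div_algebra}"
  assumes "sqint M X" "sqint M Y" shows "integrable M (\<lambda>w. X w * Y w)"
proof (rule Bochner_Integration.integrable_bound)
  show "integrable M (\<lambda>w. (norm (X w))\<^sup>2 + (norm (Y w))\<^sup>2)" using assms by (simp add: sqint_def)
  show "(\<lambda>w. X w * Y w) \<in> borel_measurable M" using assms by (auto simp: sqint_def)
  have "norm x * norm y \<le> (norm x)\<^sup>2 + (norm y)\<^sup>2" for x y :: 'b
    using sum_squares_bound[of "norm x" "norm y"] mult_nonneg_nonneg[of "norm x" "norm y", OF norm_ge_zero norm_ge_zero]
    by linarith
  then show "AE w in M. norm (X w * Y w) \<le> norm ((norm (X w))\<^sup>2 + (norm (Y w))\<^sup>2)"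
    by (auto simp: norm_mult)
qed

lemma sqint_inner_integrable:
  fixes X Y :: "'a \<Rightarrow> 'b::{euclidean_space}"
  assumes "sqint M X" "sqint M Y" shows "integrable M (\<lambda>w. X w \<bullet> Y w)"
proof (rule Bochner_Integration.integrable_bound)
  show "integrable M (\<lambda>w. norm (X w) * norm (Y w))"
    using assms by (intro sqint_mult_integrable) (auto simp: sqint_def)
  show "(\<lambda>w. X w \<bullet> Y w) \<in> borel_measurable M" using assms by (auto simp: sqint_def)
  show "AE w in M. norm (X w \<bullet> Y w) \<le> norm (norm (X w) * norm (Y w))"
    by (auto simp: Cauchy_Schwarz_ineq2)
qed

lemma Cauchy_Schwarz_integral:
  assumes "sqint M X" "sqint M (Y :: 'a \<Rightarrow> real)"
  shows "(\<integral>w. X w * Y w \<partial>M)\<^sup>2 \<le> (\<integral>w. (X w)\<^sup>2 \<partial>M) * (\<integral>w. (Y w)\<^sup>2 \<partial>M)"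
proof -
  have [measurable]: "X \<in> borel_measurable M" "Y \<in> borel_measurable M"
    using assms by (auto simp: sqint_def)
  have i: "integrable M (\<lambda>w. \<bar>X w * Y w\<bar>)" using sqint_mult_integrable[OF assms] by simp
  have "ennreal ((\<integral>w. \<bar>X w * Y w\<bar> \<partial>M)\<^sup>2) = (\<integral>\<^sup>+w. ennreal \<bar>X w\<bar> * ennreal \<bar>Y w\<bar> \<partial>M)\<^sup>2"
    using nn_integral_eq_integral[OF i]
    by (simp add: ennreal_power[symmetric] abs_mult ennreal_mult)
  also have "\<dots> \<le> (\<integral>\<^sup>+w. (ennreal \<bar>X w\<bar>)\<^sup>2 \<partial>M) * (\<integral>\<^sup>+w. (ennreal \<bar>Y w\<bar>)\<^sup>2 \<partial>M)"
    by (rule Cauchy_Schwarz_nn_integral) auto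
  also have "\<dots> = ennreal ((\<integral>w. (X w)\<^sup>2 \<partial>M) * (\<integral>w. (Y w)\<^sup>2 \<partial>M))"
    using sqint_nn_integral[OF assms(1)] sqint_nn_integral[OF assms(2)]
    by (simp add: ennreal_power ennreal_mult)
  finally have "(\<integral>w. \<bar>X w * Y w\<bar> \<partial>M)\<^sup>2 \<le> (\<integral>w. (X w)\<^sup>2 \<partial>M) * (\<integral>w. (Y w)\<^sup>2 \<partial>M)"
    by (subst (asm) ennreal_le_iff) (auto intro!: mult_nonneg_nonneg)
  moreover have "(\<integral>w. X w * Y w \<partial>M)\<^sup>2 \<le> (\<integral>w. \<bar>X w * Y w\<bar> \<partial>M)\<^sup>2"
    using integral_abs_bound[of M "\<lambda>w. X w * Y w"] by (intro abs_le_square_iff[THEN iffD1]) auto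
  ultimately show ?thesis by simp
qed

lemma sqint_of_L2_close:
  assumes "sqint M X" "Y \<in> borel_measurable M" "(\<integral>\<^sup>+w. ennreal ((norm (X w - Y w))\<^sup>2) \<partial>M) < \<infinity>"
  shows "sqint M Y"
proof -
  have "sqint M (\<lambda>w. X w - Y w)" using assms by (auto simp: sqint_iff)
  then have "sqint M (\<lambda>w. X w - (X w - Y w))" by (rule sqint_diff[OF assms(1)])
  moreover have "(\<lambda>w. X w - (X w - Y w)) = Y" by auto
  ultimately show ?thesis by metis
qed

lemma L2_lim_integral_norm:
  assumes "\<And>n. sqint M (X n)" "sqint M Y"
    and "(\<lambda>n. \<integral>\<^sup>+w. ennreal ((norm (X n w - Y w))\<^sup>2) \<partial>M) \<longlonglongrightarrow> 0"
  shows "(\<lambda>n. \<integral>w. (norm (X n w - Y w))\<^sup>2 \<partial>M) \<longlonglongrightarrow> 0"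
proof -
  have "(\<lambda>n. ennreal (\<integral>w. (norm (X n w - Y w))\<^sup>2 \<partial>M)) \<longlonglongrightarrow> ennreal 0"
    using assms(3) by (subst (asm) sqint_nn_integral) (auto intro!: sqint_diff assms)
  then show ?thesis by (subst (asm) tendsto_ennreal_iff) auto
qed

lemma L2_lim_mult:
  fixes X :: "nat \<Rightarrow> 'a \<Rightarrow> real"
  assumes X: "\<And>n. sqint M (X n)" and Y: "sqint M Y" and Z: "sqint M Z"
    and lim: "(\<lambda>n. \<integral>\<^sup>+w. ennreal ((X n w - Y w)\<^sup>2) \<partial>M) \<longlonglongrightarrow> 0"
  shows "(\<lambda>n. \<integral>w. X n w * Z w \<partial>M) \<longlonglongrightarrow> (\<integral>w. Y w * Z w \<partial>M)"
proof -
  have *: "(\<lambda>n. \<integral>w. (X n w - Y w)\<^sup>2 \<partial>M) \<longlonglongrightarrow> 0"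
    using L2_lim_integral_norm[OF X Y] lim by simp
  have "(\<lambda>n. (\<integral>w. (X n w - Y w)\<^sup>2 \<partial>M) * (\<integral>w. (Z w)\<^sup>2 \<partial>M)) \<longlonglongrightarrow> 0 * (\<integral>w. (Z w)\<^sup>2 \<partial>M)"
    by (intro tendsto_intros *)
  then have "(\<lambda>n. (\<integral>w. (X n w - Y w) * Z w \<partial>M)\<^sup>2) \<longlonglongrightarrow> 0"
    using Cauchy_Schwarz_integral[OF sqint_diff[OF X Y] Z]
    by (intro Lim_null_comparison[of "\<lambda>n. (\<integral>w. (X n w - Y w) * Z w \<partial>M)\<^sup>2"]) simp_all
  then have "(\<lambda>n. \<integral>w. (X n w - Y w) * Z w \<partial>M) \<longlonglongrightarrow> 0"
    using tendsto_real_sqrt[of "\<lambda>n. (\<integral>w. (X n w - Y w) * Z w \<partial>M)\<^sup>2" 0 sequentially]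
    by (simp add: tendsto_rabs_zero_iff)
  moreover have "(\<integral>w. (X n w - Y w) * Z w \<partial>M) = (\<integral>w. X n w * Z w \<partial>M) - (\<integral>w. Y w * Z w \<partial>M)" for n
    by (simp add: left_diff_distrib sqint_mult_integrable X Y Z)
  ultimately show ?thesis by (simp add: LIM_zero_iff)
qed

lemma L2_lim_square:
  fixes X :: "nat \<Rightarrow> 'a \<Rightarrow> real"
  assumes X: "\<And>n. sqint M (X n)" and Y: "sqint M Y"
    and lim: "(\<lambda>n. \<integral>\<^sup>+w. ennreal ((X n w - Y w)\<^sup>2) \<partial>M) \<longlonglongrightarrow> 0"
  shows "(\<lambda>n. \<integral>w. (X n w)\<^sup>2 \<partial>M) \<longlonglongrightarrow> (\<integral>w. (Y w)\<^sup>2 \<partial>M)"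
proof -
  have 1: "(\<lambda>n. \<integral>w. (X n w - Y w)\<^sup>2 \<partial>M) \<longlonglongrightarrow> 0"
    using L2_lim_integral_norm[OF X Y] lim by simp
  have "(\<lambda>n. (\<integral>w. (X n w - Y w)\<^sup>2 \<partial>M) + 2 * (\<integral>w. X n w * Y w \<partial>M) - (\<integral>w. Y w * Y w \<partial>M))
     \<longlonglongrightarrow> 0 + 2 * (\<integral>w. Y w * Y w \<partial>M) - (\<integral>w. Y w * Y w \<partial>M)"
    by (intro tendsto_intros 1 L2_lim_mult assms)
  moreover have "(\<integral>w. (X n w - Y w)\<^sup>2 \<partial>M) + 2 * (\<integral>w. X n w * Y w \<partial>M) - (\<integral>w. Y w * Y w \<partial>M)
     = (\<integral>w. (X n w)\<^sup>2 \<partial>M)" for n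
  proof -
    have "(\<integral>w. (X n w - Y w)\<^sup>2 \<partial>M) = (\<integral>w. X n w * X n w - 2 * (X n w * Y w) + Y w * Y w \<partial>M)"
      by (intro Bochner_Integration.integral_cong) (auto simp: power2_eq_square algebra_simps)
    also have "\<dots> = (\<integral>w. X n w * X n w \<partial>M) - 2 * (\<integral>w. X n w * Y w \<partial>M) + (\<integral>w. Y w * Y w \<partial>M)"
      using X Y by (simp add: sqint_mult_integrable)
    finally show ?thesis by (simp add: power2_eq_square)
  qed
  ultimately show ?thesis by (simp add: power2_eq_square)
qed

text \<open>A substitute for Minkowski's inequality: the factor 2 is harmless in every limit below,
  and the statement remains meaningful for infinite integrals.\<close>

lemma nn_integral_norm_add_le:
  assumes [measurable]: "X \<in> borel_measurable M" "Y \<in> borel_measurable M"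
  shows "(\<integral>\<^sup>+w. ennreal ((norm (X w + Y w :: 'b::{banach, second_countable_topology}))\<^sup>2) \<partial>M)
    \<le> 2 * (\<integral>\<^sup>+w. ennreal ((norm (X w))\<^sup>2) \<partial>M) + 2 * (\<integral>\<^sup>+w. ennreal ((norm (Y w))\<^sup>2) \<partial>M)"
proof -
  have "(\<integral>\<^sup>+w. ennreal ((norm (X w + Y w))\<^sup>2) \<partial>M) \<le>
     (\<integral>\<^sup>+w. 2 * ennreal ((norm (X w))\<^sup>2) + 2 * ennreal ((norm (Y w))\<^sup>2) \<partial>M)"
  proof (rule nn_integral_mono)
    fix w
    have "ennreal ((norm (X w + Y w))\<^sup>2) \<le> ennreal (2 * (norm (X w))\<^sup>2 + 2 * (norm (Y w))\<^sup>2)"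
      by (intro ennreal_leI norm_add_squared_le)
    also have "\<dots> = 2 * ennreal ((norm (X w))\<^sup>2) + 2 * ennreal ((norm (Y w))\<^sup>2)"
      by (simp add: ennreal_mult)
    finally show "ennreal ((norm (X w + Y w))\<^sup>2) \<le> \<dots>" .
  qed
  also have "\<dots> = 2 * (\<integral>\<^sup>+w. ennreal ((norm (X w))\<^sup>2) \<partial>M) + 2 * (\<integral>\<^sup>+w. ennreal ((norm (Y w))\<^sup>2) \<partial>M)"
    by (simp add: nn_integral_add nn_integral_cmult)
  finally show ?thesis .
qed

text \<open>The series of \<open>2^n * V n\<close> has finite integral, so it is finite almost
  everywhere, and its value serves as the random constant \<open>K\<close> for all its terms. This
  replaces a Borel-Cantelli argument.\<close>

lemma AE_geometric_bound:
  fixes V :: "nat \<Rightarrow> 'a \<Rightarrow> ennreal" and C :: real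
  assumes [measurable]: "\<And>n. V n \<in> borel_measurable M" and "C \<ge> 0"
    and le: "\<And>n. (\<integral>\<^sup>+w. V n w \<partial>M) \<le> ennreal (C * (1/4)^n)"
  shows "AE w in M. \<exists>K. \<forall>n. V n w \<le> ennreal (K * (1/2)^n)"
proof -
  have "(\<integral>\<^sup>+w. (\<Sum>n. 2^n * V n w) \<partial>M) = (\<Sum>n. 2^n * (\<integral>\<^sup>+w. V n w \<partial>M))"
    by (subst nn_integral_suminf) (auto simp: nn_integral_cmult)
  also have "\<dots> \<le> (\<Sum>n. ennreal (C * (1/2)^n))"
  proof (intro suminf_le allI)
    fix n
    have "2^n * (\<integral>\<^sup>+w. V n w \<partial>M) \<le> ennreal (2^n) * ennreal (C * (1/4)^n)"
      using mult_left_mono[OF le[of n], of "2^n"]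
      by (metis ennreal_numeral ennreal_power zero_le zero_le_numeral)
    also have "\<dots> = ennreal (C * (1/2)^n)"
      using \<open>C \<ge> 0\<close> by (subst ennreal_mult[symmetric]) (auto simp: power_mult_distrib[symmetric] field_simps)
    finally show "2^n * (\<integral>\<^sup>+w. V n w \<partial>M) \<le> ennreal (C * (1/2)^n)" .
  qed auto
  also have "\<dots> = ennreal (\<Sum>n. C * (1/2)^n)"
    using \<open>C \<ge> 0\<close> by (intro suminf_ennreal2) (auto intro!: summable_mult summable_geometric)
  also have "\<dots> < \<infinity>" by simp
  finally have "AE w in M. (\<Sum>n. 2^n * V n w) < \<infinity>"
    by (intro finite_nn_integral_imp_ae_finite) auto
  then show ?thesis
  proof eventually_elim
    case (elim w)
    then obtain K where K: "K \<ge> 0" "(\<Sum>n. 2^n * V n w) = ennreal K"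
      by (cases "\<Sum>n. 2^n * V n w") auto
    have "V n w \<le> ennreal (K * (1/2)^n)" for n
    proof -
      have "2^n * V n w = (\<Sum>k\<in>{n}. 2^k * V k w)" by simp
      also have "\<dots> \<le> (\<Sum>k. 2^k * V k w)" by (intro sum_le_suminf) auto
      finally have 1: "ennreal ((1/2)^n) * (2^n * V n w) \<le> ennreal ((1/2)^n) * ennreal K"
        using K by (intro mult_left_mono) auto
      have "ennreal ((1/2)^n) * 2^n = ennreal ((1/2)^n * 2^n)"
        by (subst ennreal_mult) (auto simp flip: ennreal_power)
      also have "\<dots> = 1" by (simp flip: power_mult_distrib)
      finally have 2: "ennreal ((1/2)^n) * 2^n = 1" .
      have "V n w = ennreal ((1/2)^n) * (2^n * V n w)"
        unfolding mult.assoc[symmetric] 2 by simp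
      also have "\<dots> \<le> ennreal ((1/2)^n * K)" using 1 K by (simp add: ennreal_mult)
      finally show ?thesis by (simp only: mult.commute)
    qed
    then show ?case by blast
  qed
qed

text \<open>Square roots of the bounds form a geometric series with ratio sqrt(1/2), so the
  Weierstrass test applies to the telescoping sum.\<close>

lemma uniformly_convergent_geometric:
  fixes f :: "nat \<Rightarrow> 'a \<Rightarrow> 'b::banach"
  assumes "\<And>n t. t \<in> A \<Longrightarrow> (norm (f (Suc n) t - f n t))\<^sup>2 \<le> K * (1/2)^n"
  shows "uniformly_convergent_on A f"
proof -
  have "uniformly_convergent_on A (\<lambda>n t. \<Sum>i<n. f (Suc i) t - f i t)"
  proof (rule Weierstrass_m_test'[where M="\<lambda>n. sqrt K * (sqrt (1/2))^n"])
    fix n t assume "t \<in> A"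
    then have "sqrt ((norm (f (Suc n) t - f n t))\<^sup>2) \<le> sqrt (K * (1/2)^n)"
      using assms by (intro real_sqrt_le_mono) auto
    then show "norm (f (Suc n) t - f n t) \<le> sqrt K * (sqrt (1/2))^n"
      by (simp add: real_sqrt_mult real_sqrt_power)
  next
    show "summable (\<lambda>n. sqrt K * (sqrt (1/2))^n)"
      by (intro summable_mult summable_geometric) (auto simp: real_sqrt_divide)
  qed
  moreover have "(\<Sum>i<n. f (Suc i) t - f i t) = f n t - f 0 t" for n t
    by (rule sum_lessThan_telescope)
  ultimately have "uniformly_convergent_on A (\<lambda>n t. f n t - f 0 t)"
    by simp
  then obtain g where "uniform_limit A (\<lambda>n t. f n t - f 0 t) g sequentially"
    unfolding uniformly_convergent_on_def by auto
  then have "uniform_limit A f (\<lambda>t. g t + f 0 t) sequentially"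
    by (auto simp: uniform_limit_iff dist_norm algebra_simps)
  then show ?thesis unfolding uniformly_convergent_on_def by auto
qed

lemma nn_integral_le_of_AE_lim:
  fixes u :: "nat \<Rightarrow> 'a \<Rightarrow> ennreal"
  assumes [measurable]: "\<And>k. u k \<in> borel_measurable M"
    and lim: "AE w in M. (\<lambda>k. u k w) \<longlonglongrightarrow> v w"
    and le: "eventually (\<lambda>k. (\<integral>\<^sup>+w. u k w \<partial>M) \<le> e) sequentially"
  shows "(\<integral>\<^sup>+w. v w \<partial>M) \<le> e"
proof -
  have "(\<integral>\<^sup>+w. v w \<partial>M) = (\<integral>\<^sup>+w. liminf (\<lambda>k. u k w) \<partial>M)"
    using lim by (intro nn_integral_cong_AE) (auto elim!: eventually_mono simp: lim_imp_Liminf)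
  also have "\<dots> \<le> liminf (\<lambda>k. \<integral>\<^sup>+w. u k w \<partial>M)" by (rule nn_integral_liminf) simp
  also have "\<dots> \<le> limsup (\<lambda>k. \<integral>\<^sup>+w. u k w \<partial>M)" by (rule Liminf_le_Limsup) simp
  also have "\<dots> \<le> e" by (rule Limsup_bounded[OF le])
  finally show ?thesis .
qed

text \<open>Peeling off the first increment costs a factor 2 on both parts. The constant 4 is the
  fixed point of this recursion, since 2 * 4 / 4 + 2 = 4, and therefore does not grow with
  \<open>m\<close>.\<close>

lemma L2_Cauchy_geometric:
  fixes X :: "nat \<Rightarrow> 'a \<Rightarrow> 'b::{banach, second_countable_topology}" and C :: real
  assumes [measurable]: "\<And>n. X n \<in> borel_measurable M"
    and le: "\<And>n. (\<integral>\<^sup>+w. ennreal ((norm (X (Suc n) w - X n w))\<^sup>2) \<partial>M) \<le> ennreal (C * (1/4)^n)"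
    and "C \<ge> 0"
  shows "(\<integral>\<^sup>+w. ennreal ((norm (X (n + m) w - X n w))\<^sup>2) \<partial>M) \<le> ennreal (4 * C * (1/4)^n)"
proof (induction m arbitrary: n)
  case 0
  then show ?case by simp
next
  case (Suc m)
  have "(\<integral>\<^sup>+w. ennreal ((norm (X (n + Suc m) w - X n w))\<^sup>2) \<partial>M)
      = (\<integral>\<^sup>+w. ennreal ((norm ((X (Suc n + m) w - X (Suc n) w) + (X (Suc n) w - X n w)))\<^sup>2) \<partial>M)"
    by simp
  also have "\<dots> \<le> 2 * (\<integral>\<^sup>+w. ennreal ((norm (X (Suc n + m) w - X (Suc n) w))\<^sup>2) \<partial>M) +
       2 * (\<integral>\<^sup>+w. ennreal ((norm (X (Suc n) w - X n w))\<^sup>2) \<partial>M)"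
    by (rule nn_integral_norm_add_le) auto
  also have "\<dots> \<le> 2 * ennreal (4 * C * (1/4)^(Suc n)) + 2 * ennreal (C * (1/4)^n)"
    by (intro add_mono mult_left_mono Suc.IH le) auto
  also have "\<dots> = ennreal (2 * (4 * C * (1/4)^(Suc n)) + 2 * (C * (1/4)^n))"
  proof -
    have "2 * ennreal x + 2 * ennreal y = ennreal (2 * x + 2 * y)" if "x \<ge> 0" "y \<ge> 0" for x y
      using that by (simp add: ennreal_mult)
    from this[of "4 * C * (1/4)^(Suc n)" "C * (1/4)^n"] show ?thesis using \<open>C \<ge> 0\<close> by (simp del: ennreal_plus)
  qed
  also have "2 * (4 * C * (1/4)^(Suc n)) + 2 * (C * (1/4)^n) = 4 * C * (1/4)^n" by simp
  finally show ?case .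
qed

text \<open>Riesz-Fischer with two sigma-algebras: distances are measured in \<open>M\<close>, while
  the limit stays measurable for the smaller \<open>G\<close>, because it is taken pointwise with
  \<open>lim\<close> everywhere. With \<open>G\<close> the predictable sigma-algebra this yields
  predictable limits.\<close>

lemma L2_complete:
  fixes X :: "nat \<Rightarrow> 'a \<Rightarrow> 'b::{banach, second_countable_topology}"
  assumes X: "\<And>n. X n \<in> borel_measurable G" and G: "space G = space M" "sets G \<subseteq> sets M"
    and Cauchy: "\<And>e::real. e > 0 \<Longrightarrow> \<exists>n0. \<forall>m\<ge>n0. \<forall>n\<ge>n0. (\<integral>\<^sup>+w. ennreal ((norm (X m w - X n w))\<^sup>2) \<partial>M) < ennreal e"
  obtains Y where "Y \<in> borel_measurable G" "(\<lambda>n. \<integral>\<^sup>+w. ennreal ((norm (X n w - Y w))\<^sup>2) \<partial>M) \<longlonglongrightarrow> 0"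
proof -
  have sub: "Z \<in> borel_measurable M" if "Z \<in> borel_measurable G" for Z :: "'a \<Rightarrow> 'b"
    using that G by (auto simp: measurable_def)
  note [measurable] = sub[OF X]
  obtain N where N: "\<And>k m n. m \<ge> N k \<Longrightarrow> n \<ge> N k \<Longrightarrow>
      (\<integral>\<^sup>+w. ennreal ((norm (X m w - X n w))\<^sup>2) \<partial>M) < ennreal ((1/4)^k)"
    using Cauchy[of "(1/4)^_"] by (auto) metis
  \<comment> \<open>Adding \<open>k\<close> and all earlier thresholds makes \<open>r\<close>
    monotone, at least \<open>k\<close>, and at least \<open>N k\<close> at the same time.\<close>
  define r where "r k = k + (\<Sum>j\<le>k. N j)" for k
  have rN: "r k \<ge> N k" for k unfolding r_def by (simp add: trans_le_add2 member_le_sum)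
  have rmono: "r k \<le> r (Suc k)" for k unfolding r_def by simp
  have rk: "r k \<ge> k" for k unfolding r_def by simp
  define Y where "Y w = lim (\<lambda>k. X (r k) w)" for w
  have Y: "Y \<in> borel_measurable G" unfolding Y_def using X by (intro borel_measurable_lim_metric) auto
  have "AE w in M. \<exists>K. \<forall>n. ennreal ((norm (X (r (Suc n)) w - X (r n) w))\<^sup>2) \<le> ennreal (K * (1/2)^n)"
  proof (rule AE_geometric_bound[where C=1])
    show "(\<integral>\<^sup>+w. ennreal ((norm (X (r (Suc n)) w - X (r n) w))\<^sup>2) \<partial>M) \<le> ennreal (1 * (1/4)^n)" for n
      using N[of n "r (Suc n)" "r n"] rN[of n] rmono[of n] by simp
  qed auto
  then have lim: "AE w in M. (\<lambda>k. X (r k) w) \<longlonglongrightarrow> Y w"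
  proof eventually_elim
    case (elim w)
    then obtain K where K: "\<And>n. ennreal ((norm (X (r (Suc n)) w - X (r n) w))\<^sup>2) \<le> ennreal (K * (1/2)^n)"
      by auto
    have "uniformly_convergent_on {()} (\<lambda>k u. X (r k) w)"
    proof (rule uniformly_convergent_geometric[where K="max K 0"])
      fix n
      have "ennreal ((norm (X (r (Suc n)) w - X (r n) w))\<^sup>2) \<le> ennreal (max K 0 * (1/2)^n)"
        by (rule order_trans[OF K]) (intro ennreal_leI mult_right_mono, auto)
      then show "(norm (X (r (Suc n)) w - X (r n) w))\<^sup>2 \<le> max K 0 * (1/2)^n"
        by (subst (asm) ennreal_le_iff) auto
    qed
    then have "convergent (\<lambda>k. X (r k) w)" by (rule uniformly_convergent_imp_convergent) simp
    then show ?case unfolding Y_def by (simp add: convergent_LIMSEQ_iff)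
  qed
  have "(\<lambda>n. \<integral>\<^sup>+w. ennreal ((norm (X n w - Y w))\<^sup>2) \<partial>M) \<longlonglongrightarrow> 0"
  proof (rule order_tendstoI)
    fix a :: ennreal assume "0 < a"
    then obtain e :: real where e: "e > 0" "ennreal e < a"
    proof (cases a)
      case (real r)
      then show ?thesis using \<open>0 < a\<close> by (intro that[of "r/2"]) (auto simp: ennreal_less_iff)
    next
      case top
      then show ?thesis by (intro that[of 1]) auto
    qed
    obtain n0 where n0: "\<And>m n. m \<ge> n0 \<Longrightarrow> n \<ge> n0 \<Longrightarrow> (\<integral>\<^sup>+w. ennreal ((norm (X m w - X n w))\<^sup>2) \<partial>M) < ennreal e"
      using Cauchy[OF e(1)] by auto
    \<comment> \<open>Fatou's lemma along the subsequence turns the Cauchy bound into a bound for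
      the distance to the limit, for the full sequence.\<close>
    have "(\<integral>\<^sup>+w. ennreal ((norm (X n w - Y w))\<^sup>2) \<partial>M) \<le> ennreal e" if "n \<ge> n0" for n
    proof (rule nn_integral_le_of_AE_lim)
      show "(\<lambda>w. ennreal ((norm (X n w - X (r k) w))\<^sup>2)) \<in> borel_measurable M" for k by measurable
      show "AE w in M. (\<lambda>k. ennreal ((norm (X n w - X (r k) w))\<^sup>2)) \<longlonglongrightarrow> ennreal ((norm (X n w - Y w))\<^sup>2)"
        using lim by eventually_elim (intro tendsto_intros, auto)
      show "\<forall>\<^sub>F k in sequentially. (\<integral>\<^sup>+w. ennreal ((norm (X n w - X (r k) w))\<^sup>2) \<partial>M) \<le> ennreal e"
        using n0[OF that] rk by (intro eventually_sequentiallyI[of n0]) (meson less_imp_le order_trans)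
    qed
    then show "\<forall>\<^sub>F n in sequentially. (\<integral>\<^sup>+w. ennreal ((norm (X n w - Y w))\<^sup>2) \<partial>M) < a"
      using e(2) by (intro eventually_sequentiallyI[of n0]) (meson order_le_less_trans)
  qed auto
  with Y show ?thesis by (rule that)
qed

section \<open>Moments of a centred Gaussian against the complex exponential\<close>

section \<open>Gaussian moments\<close>

text \<open>Supplies the vanishing boundary terms of the integration by parts that follows.\<close>

lemma std_normal_density_tendsto_0:
  "(std_normal_density \<longlongrightarrow> 0) at_top" "(std_normal_density \<longlongrightarrow> 0) at_bot"
proof -
  have "filterlim (\<lambda>x::real. 1/2 * x ^ 2) at_top at_top"
    by (intro filterlim_tendsto_pos_mult_at_top[OF tendsto_const] filterlim_pow_at_top filterlim_ident) auto
  then have "filterlim (\<lambda>x::real. - (1/2 * x ^ 2)) at_bot at_top"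
    by (simp add: filterlim_uminus_at_top)
  then have "((\<lambda>x::real. exp (- (1/2 * x ^ 2))) \<longlongrightarrow> 0) at_top"
    by (rule filterlim_compose[OF exp_at_bot])
  then have "((\<lambda>x::real. 1 / sqrt (2 * pi) * exp (- (1/2 * x ^ 2))) \<longlongrightarrow> 1 / sqrt (2 * pi) * 0) at_top"
    by (intro tendsto_mult tendsto_const)
  moreover have "std_normal_density = (\<lambda>x. 1 / sqrt (2 * pi) * exp (- (1/2 * x ^ 2)))"
    by (simp add: normal_density_def fun_eq_iff)
  ultimately show "(std_normal_density \<longlongrightarrow> 0) at_top" by simp
  then have "((\<lambda>x. std_normal_density (- x)) \<longlongrightarrow> 0) at_bot"
    by (rule filterlim_compose[OF _ filterlim_uminus_at_top_at_bot])
  then show "(std_normal_density \<longlongrightarrow> 0) at_bot"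
    by (subst (asm) filterlim_cong[OF refl refl, where g=std_normal_density])
      (auto simp: normal_density_def)
qed

text \<open>Gaussian integration by parts: the density \<phi> satisfies \<phi>'(x) = - x \<phi>(x),
  and the derivative of \<phi>(x) exp(i t x) integrates to 0. This expresses the unknown integral by
  the characteristic function.\<close>

lemma integral_std_normal_id_iexp:
  "(CLINT x|std_normal_distribution. complex_of_real x * iexp (t * x)) = \<i> * t * exp (- (t\<^sup>2) / 2)"
proof -
  interpret N: real_distribution std_normal_distribution by (rule real_dist_normal_dist)
  let ?\<phi> = std_normal_density
  define G where "G x = complex_of_real (?\<phi> x) * iexp (t * x)" for x
  define g where "g x = complex_of_real (?\<phi> x) * (iexp (t * x) * (\<i> * t) - x * iexp (t * x))" for x
  have int1: "integrable std_normal_distribution (\<lambda>x. iexp (t * x))"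
    by (rule N.integrable_const_bound[of _ 1]) auto
  have int2: "integrable std_normal_distribution (\<lambda>x. complex_of_real x * iexp (t * x))"
  proof (rule Bochner_Integration.integrable_bound)
    show "integrable std_normal_distribution (\<lambda>x::real. x)"
      using integrable_std_normal_distribution_moment[of 1] by simp
  qed (auto simp: norm_mult)
  have int3: "integrable std_normal_distribution (\<lambda>x. iexp (t * x) * (\<i> * t) - x * iexp (t * x))"
    by (intro Bochner_Integration.integrable_diff int2 Bochner_Integration.integrable_mult_left impI int1)
  have g_int: "integrable lborel g"
    using int3 unfolding g_def
    by (subst (asm) integrable_density) (auto simp: normal_density_nonneg scaleR_conv_of_real)
  have D\<phi>: "(?\<phi> has_real_derivative - x * ?\<phi> x) (at x)" for x
  proof -
    have "((\<lambda>x. 1 / sqrt (2 * pi) * exp (- (x\<^sup>2) / 2)) has_real_derivative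
        1 / sqrt (2 * pi) * (exp (- (x\<^sup>2) / 2) * (- x))) (at x)"
      by (intro DERIV_cmult) (auto intro!: derivative_eq_intros)
    moreover have "std_normal_density = (\<lambda>x. 1 / sqrt (2 * pi) * exp (- (x\<^sup>2) / 2))"
      by (simp add: normal_density_def fun_eq_iff)
    ultimately show ?thesis by simp (simp add: algebra_simps)
  qed
  have DG: "(G has_vector_derivative g x) (at x)" for x
  proof -
    have "((\<lambda>x. complex_of_real (?\<phi> x)) has_vector_derivative complex_of_real (- x * ?\<phi> x)) (at x)"
      using D\<phi>[of x] by (intro has_vector_derivative_of_real) (simp add: has_real_derivative_iff_has_vector_derivative)
    moreover have "((\<lambda>x. iexp (t * x)) has_vector_derivative (\<i> * t) * iexp (t * x)) (at x)"
    proof -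
      have "((\<lambda>z. exp (\<i> * (t * z))) has_field_derivative (\<i> * t) * iexp (t * x)) (at (complex_of_real x))"
        by (auto intro!: derivative_eq_intros)
      from has_vector_derivative_real_field[OF this] show ?thesis by (simp add: o_def)
    qed
    ultimately have "((\<lambda>x. complex_of_real (?\<phi> x) * iexp (t * x)) has_vector_derivative
        (?\<phi> x * ((\<i> * t) * iexp (t * x)) + complex_of_real (- x * ?\<phi> x) * iexp (t * x))) (at x)"
      by (rule has_vector_derivative_mult)
    then show ?thesis unfolding G_def g_def by (simp add: algebra_simps)
  qed
  have norm_G: "norm (G x) = ?\<phi> x" for x
    by (simp add: G_def norm_mult normal_density_nonneg)
  have "(LBINT x=-\<infinity>..\<infinity>. g x) = 0 - 0"
  proof (rule interval_integral_FTC_integrable)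
    show "(G has_vector_derivative g x) (at x)" for x by (rule DG)
    show "isCont g x" for x unfolding g_def normal_density_def by (intro continuous_intros) auto
    show "set_integrable lborel (einterval (-\<infinity>) \<infinity>) g" using g_int by (simp add: set_integrable_def)
    show "((G \<circ> real_of_ereal) \<longlongrightarrow> 0) (at_right (- \<infinity>))"
      using std_normal_density_tendsto_0(2)
      by (simp add: ereal_tendsto_simps tendsto_norm_zero_iff[of G, symmetric] norm_G)
    show "((G \<circ> real_of_ereal) \<longlongrightarrow> 0) (at_left \<infinity>)"
      using std_normal_density_tendsto_0(1)
      by (simp add: ereal_tendsto_simps tendsto_norm_zero_iff[of G, symmetric] norm_G)
  qed auto
  then have "integral\<^sup>L lborel g = 0"
    by (simp add: interval_lebesgue_integral_def set_lebesgue_integral_def)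
  also have "integral\<^sup>L lborel g = (CLINT x|std_normal_distribution. iexp (t * x) * (\<i> * t) - x * iexp (t * x))"
    unfolding g_def by (subst integral_density) (auto simp: normal_density_nonneg scaleR_conv_of_real)
  also have "\<dots> = (CLINT x|std_normal_distribution. iexp (t * x)) * (\<i> * t) - (CLINT x|std_normal_distribution. x * iexp (t * x))"
    using int1 int2 by simp
  also have "(CLINT x|std_normal_distribution. iexp (t * x)) = exp (- (t\<^sup>2) / 2)"
    using fun_cong[OF char_std_normal_distribution, of t] by (simp add: char_def)
  finally show ?thesis by (simp add: algebra_simps)
qed

context prob_space
begin

text \<open>The cross moment of the linear factor 1 + iY with the conjugate of exp(iY). After
  normalisation by exp(\<sigma>^2 / 2) it equals 1 + \<sigma>^2, which is also the second moment of
  1 + iY; this coincidence drives the approximation of exponentials by products.\<close>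

lemma normal_iexp_expectation:
  assumes Y: "distributed M lborel Y (normal_density 0 \<sigma>)" and "0 < \<sigma>"
  shows "expectation (\<lambda>w. (1 + \<i> * Y w) * iexp (- Y w)) = (1 + \<sigma>\<^sup>2) * exp (- (\<sigma>\<^sup>2) / 2)"
    and "integrable M (\<lambda>w. (1 + \<i> * Y w) * iexp (- Y w))"
proof -
  interpret N: real_distribution std_normal_distribution by (rule real_dist_normal_dist)
  define X where "X w = Y w / \<sigma>" for w
  have "distributed M lborel X std_normal_density"
    using Y normal_standard_normal_convert[OF \<open>0 < \<sigma>\<close>, of Y 0] by (simp add: X_def[abs_def])
  then have D: "distr M borel X = std_normal_distribution" and [measurable]: "X \<in> borel_measurable M"
    by (auto simp: distributed_def cong: distr_cong)
  have YX: "Y w = \<sigma> * X w" for w using \<open>0 < \<sigma>\<close> by (simp add: X_def)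
  define h where "h x = (1 + \<i> * (\<sigma> * x)) * iexp (- \<sigma> * x)" for x :: real
  have [measurable]: "h \<in> borel_measurable borel" unfolding h_def by measurable
  have int1: "integrable std_normal_distribution (\<lambda>x. iexp (-\<sigma> * x))"
    by (rule N.integrable_const_bound[of _ 1]) auto
  have int2: "integrable std_normal_distribution (\<lambda>x. complex_of_real x * iexp (-\<sigma> * x))"
  proof (rule Bochner_Integration.integrable_bound)
    show "integrable std_normal_distribution (\<lambda>x::real. x)"
      using integrable_std_normal_distribution_moment[of 1] by simp
  qed (auto simp: norm_mult)
  have heq: "h x = iexp (-\<sigma> * x) + (\<i> * \<sigma>) * (x * iexp (-\<sigma> * x))" for x
    by (simp add: h_def algebra_simps)
  have hi: "integrable std_normal_distribution h"
    unfolding heq[abs_def] by (intro Bochner_Integration.integrable_add int1 Bochner_Integration.integrable_mult_right impI int2)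
  have hX: "h (X w) = (1 + \<i> * Y w) * iexp (- Y w)" for w by (simp add: h_def YX)
  show "integrable M (\<lambda>w. (1 + \<i> * Y w) * iexp (- Y w))"
    using hi unfolding D[symmetric] by (subst (asm) integrable_distr_eq) (auto simp: hX)
  have "expectation (\<lambda>w. h (X w)) = integral\<^sup>L std_normal_distribution h"
    unfolding D[symmetric] by (subst integral_distr) auto
  also have "\<dots> = (CLINT x|std_normal_distribution. iexp (-\<sigma> * x)) + (\<i> * \<sigma>) * (CLINT x|std_normal_distribution. x * iexp (-\<sigma> * x))"
    unfolding heq[abs_def]
    by (subst Bochner_Integration.integral_add[OF int1 Bochner_Integration.integrable_mult_right[OF int2]])
      (simp only: integral_mult_right_zero)
  also have "(CLINT x|std_normal_distribution. iexp (-\<sigma> * x)) = exp (- (\<sigma>\<^sup>2) / 2)"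
    using fun_cong[OF char_std_normal_distribution, of "-\<sigma>"] by (simp add: char_def)
  also have "(CLINT x|std_normal_distribution. x * iexp (-\<sigma> * x)) = - \<i> * \<sigma> * exp (- (\<sigma>\<^sup>2) / 2)"
    using integral_std_normal_id_iexp[of "-\<sigma>"] by simp
  finally show "expectation (\<lambda>w. (1 + \<i> * Y w) * iexp (- Y w)) = (1 + \<sigma>\<^sup>2) * exp (- (\<sigma>\<^sup>2) / 2)"
    by (simp add: hX algebra_simps power2_eq_square)
qed

lemma normal_sqint:
  assumes Y: "distributed M lborel Y (normal_density 0 \<sigma>)" and "0 < \<sigma>"
  shows "sqint M Y" "expectation Y = 0" "expectation (\<lambda>w. (Y w)\<^sup>2) = \<sigma>\<^sup>2"
proof -
  have [measurable]: "Y \<in> borel_measurable M" using Y by (auto simp: distributed_def)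
  show e: "expectation Y = 0" using normal_distributed_expectation[OF assms(2,1)] .
  show "expectation (\<lambda>w. (Y w)\<^sup>2) = \<sigma>\<^sup>2" using normal_distributed_variance[OF assms(2,1)] e by simp
  show "sqint M Y" unfolding sqint_real_iff
    using integrable_normal_moment[OF \<open>0 < \<sigma>\<close>, of 0 2]
    by (auto simp: distributed_integrable[OF Y, of "\<lambda>x. x^2", symmetric] )
qed

end

section \<open>Law and independence of increments under the augmented filtration\<close>

section \<open>The augmented Brownian filtration\<close>

locale brownian = prob_space M
  for M :: "'w measure" and T :: real and B :: "real \<Rightarrow> 'w \<Rightarrow> real^'d::finite" +
  assumes T_pos: "0 < T" and brownian: "standard_brownian_motion M T B"
begin

abbreviation F :: "real \<Rightarrow> 'w measure" where "F \<equiv> aug_filtration M B"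

lemma B_measurable [measurable (raw)]: "t \<in> {0..T} \<Longrightarrow> B t \<in> borel_measurable M"
  using brownian by (auto simp: standard_brownian_motion_def)

lemma B_zero: "AE w in M. B 0 w = 0"
  and B_continuous: "AE w in M. continuous_on {0..T} (\<lambda>t. B t w)"
  using brownian by (auto simp: standard_brownian_motion_def)

lemma space_nat: "space (nat_filtration M B t) = space M"
  unfolding nat_filtration_def by (intro space_measure_of) auto

lemma sets_nat: "sets (nat_filtration M B t) =
    sigma_sets (space M) (\<Union>s\<in>{0..t}. {B s -` A \<inter> space M | A. A \<in> sets borel})"
  unfolding nat_filtration_def by (intro sets_measure_of) auto

lemma space_F [simp]: "space (F t) = space M"
  unfolding aug_filtration_def
  using sets.space_closed[of "nat_filtration M B t"] sets.sets_into_space[of _ M]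
  by (intro space_measure_of) (auto simp: space_nat null_sets_def)

lemma sets_F: "sets (F t) = sigma_sets (space M) (sets (nat_filtration M B t) \<union> null_sets M)"
  unfolding aug_filtration_def
  using sets.space_closed[of "nat_filtration M B t"] sets.sets_into_space[of _ M]
  by (intro sets_measure_of) (auto simp: space_nat null_sets_def)

lemma sets_nat_sub: "t \<le> T \<Longrightarrow> sets (nat_filtration M B t) \<subseteq> sets M"
  unfolding sets_nat by (intro sets.sigma_sets_subset) (auto intro!: measurable_sets[OF B_measurable])

lemma sets_F_sub: "t \<le> T \<Longrightarrow> sets (F t) \<subseteq> sets M"
  unfolding sets_F using sets_nat_sub by (intro sets.sigma_sets_subset) auto

lemma sets_F_mono: "s \<le> t \<Longrightarrow> sets (F s) \<subseteq> sets (F t)"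
  unfolding sets_F sets_nat by (intro sigma_sets_mono' Un_mono order_refl UN_mono) auto

lemma measurable_F_mono: "X \<in> measurable (F s) N \<Longrightarrow> s \<le> t \<Longrightarrow> X \<in> measurable (F t) N"
  using sets_F_mono[of s t] by (auto simp: measurable_def)

lemma measurable_F_M: "X \<in> measurable (F s) N \<Longrightarrow> s \<le> T \<Longrightarrow> X \<in> measurable M N"
  using sets_F_sub[of s] by (auto simp: measurable_def)

lemma null_sets_F: "N \<in> null_sets M \<Longrightarrow> N \<in> sets (F t)"
  unfolding sets_F by (intro sigma_sets.Basic) auto

lemma B_measurable_F: "0 \<le> s \<Longrightarrow> s \<le> t \<Longrightarrow> B s \<in> borel_measurable (F t)"
  by (rule measurableI) (auto simp: sets_F sets_nat intro!: sigma_sets.Basic)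

text \<open>Agreeing almost surely with an event of the natural filtration is preserved by
  complements and countable unions and holds for null sets. Statements about probabilities thus
  transfer from the natural to the augmented filtration.\<close>

lemma sets_F_approx:
  assumes "A \<in> sets (F s)" "s \<le> T"
  shows "\<exists>A'\<in>sets (nat_filtration M B s). AE w in M. w \<in> A \<longleftrightarrow> w \<in> A'"
  using assms(1) unfolding sets_F
proof (induction rule: sigma_sets.induct)
  case (Basic a)
  then show ?case
  proof
    assume "a \<in> null_sets M"
    then show ?thesis by (intro bexI[of _ "{}"]) (auto intro: AE_not_in)
  qed auto
next
  case (Compl a)
  then obtain A' where A': "A' \<in> sets (nat_filtration M B s)" "AE w in M. w \<in> a \<longleftrightarrow> w \<in> A'" by auto
  then show ?case
    by (intro bexI[of _ "space M - A'"])
      (auto simp: space_nat[symmetric, of s] intro: sets.compl_sets)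
next
  case (Union a)
  then obtain A' where A': "\<And>i. A' i \<in> sets (nat_filtration M B s)" "\<And>i. AE w in M. w \<in> a i \<longleftrightarrow> w \<in> A' i"
    by metis
  have "AE w in M. \<forall>i. w \<in> a i \<longleftrightarrow> w \<in> A' i" using A'(2) by (simp add: AE_all_countable)
  then have "AE w in M. w \<in> (\<Union>i. a i) \<longleftrightarrow> w \<in> (\<Union>i. A' i)" by eventually_elim auto
  then show ?case using A'(1) by (intro bexI[of _ "\<Union>i. A' i"]) auto
qed (auto intro!: bexI[of _ "{}"])

lemma indep_increment:
  assumes st: "0 \<le> s" "s < t" "t \<le> T"
  shows "indep_set (sets (F s)) {(\<lambda>w. B t w - B s w) -` A \<inter> space M | A. A \<in> sets borel}"
proof (rule indep_setI)
  have [measurable]: "B t \<in> borel_measurable M" "B s \<in> borel_measurable M" using st by auto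
  show "sets (F s) \<subseteq> events" using st by (intro sets_F_sub) auto
  show "{(\<lambda>w. B t w - B s w) -` A \<inter> space M | A. A \<in> sets borel} \<subseteq> events" by auto
  fix a b assume a: "a \<in> sets (F s)" and b: "b \<in> {(\<lambda>w. B t w - B s w) -` A \<inter> space M | A. A \<in> sets borel}"
  obtain a' where a': "a' \<in> sets (nat_filtration M B s)" "AE w in M. w \<in> a \<longleftrightarrow> w \<in> a'"
    using sets_F_approx[OF a] st by auto
  have ev: "a \<in> events" "a' \<in> events" "b \<in> events"
    using a a' b sets_F_sub[of s] sets_nat_sub[of s] st by auto
  have "prob (a \<inter> b) = prob (a' \<inter> b)"
    using a'(2) ev by (intro measure_eq_AE) (auto elim: eventually_mono)
  also have "\<dots> = prob a' * prob b"
    using brownian st a'(1) b unfolding standard_brownian_motion_def by (intro indep_setD) auto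
  also have "prob a' = prob a"
    using a'(2) ev by (intro measure_eq_AE) (auto elim: eventually_mono)
  finally show "prob (a \<inter> b) = prob a * prob b" .
qed

lemma indep_var_increment:
  fixes x :: "'w \<Rightarrow> 'c::{topological_space}" and g :: "real^'d \<Rightarrow> 'c"
  assumes st: "0 \<le> s" "s < t" "t \<le> T" and x: "x \<in> borel_measurable (F s)" and g: "g \<in> borel_measurable borel"
  shows "indep_var borel x borel (\<lambda>w. g (B t w - B s w))"
  unfolding indep_var_eq
proof (intro conjI)
  have [measurable]: "B t \<in> borel_measurable M" "B s \<in> borel_measurable M" using st by auto
  show "x \<in> borel_measurable M" using measurable_F_M[OF x] st by auto
  show "(\<lambda>w. g (B t w - B s w)) \<in> borel_measurable M" using g by measurable
  let ?D = "\<lambda>w. B t w - B s w"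
  have 1: "sigma_sets (space M) {x -` A \<inter> space M | A. A \<in> sets borel} \<subseteq> sets (F s)"
    using measurable_sets[OF x] by (intro sets.sigma_sets_subset[of _ "F s", simplified]) auto
  have eq: "{(\<lambda>w. g (?D w)) -` A \<inter> space M | A. A \<in> sets borel} = {?D -` (g -` A) \<inter> space M | A. A \<in> sets borel}"
    by (auto simp: vimage_def)
  have "sigma_sets (space M) {?D -` (g -` A) \<inter> space M | A. A \<in> sets borel}
      \<subseteq> sets (vimage_algebra (space M) ?D borel)"
    using measurable_sets[OF g] 
    by (intro sets.sigma_sets_subset[of _ "vimage_algebra (space M) ?D borel", simplified]) (auto simp: sets_vimage_algebra2)
  then have 2: "sigma_sets (space M) {(\<lambda>w. g (?D w)) -` A \<inter> space M | A. A \<in> sets borel}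
      \<subseteq> {?D -` A \<inter> space M | A. A \<in> sets borel}"
    unfolding eq by (auto simp: sets_vimage_algebra2)
  show "indep_set (sigma_sets (space M) {x -` A \<inter> space M | A. A \<in> sets borel})
      (sigma_sets (space M) {(\<lambda>w. g (?D w)) -` A \<inter> space M | A. A \<in> sets borel})"
    using indep_increment[OF st] unfolding indep_set_def
    by (rule indep_sets_mono_sets) (use 1 2 in \<open>auto split: bool.split\<close>)
qed

text \<open>The field is left open because the rule is applied to real increments as well as to
  complex exponentials.\<close>

lemma increment_mult:
  fixes x :: "'w \<Rightarrow> 'c::{real_normed_field, banach, second_countable_topology}"
  assumes st: "0 \<le> s" "s < t" "t \<le> T" and x: "x \<in> borel_measurable (F s)" and g: "g \<in> borel_measurable borel"
    and int: "integrable M x" "integrable M (\<lambda>w. g (B t w - B s w))"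
  shows "integrable M (\<lambda>w. x w * g (B t w - B s w))"
    and "expectation (\<lambda>w. x w * g (B t w - B s w)) = expectation x * expectation (\<lambda>w. g (B t w - B s w))"
  using indep_var_integrable[OF indep_var_increment[OF st x g] int]
    indep_var_lebesgue_integral[OF indep_var_increment[OF st x g] int] by auto

lemma increment_normal:
  assumes st: "0 \<le> s" "s < t" "t \<le> T" and u: "u \<noteq> 0"
  shows "distributed M lborel (\<lambda>w. u \<bullet> (B t w - B s w)) (normal_density 0 (norm u * sqrt (t - s)))"
proof -
  \<comment> \<open>Coordinates with coefficient 0 have no density, so they are dropped before the
    sum of independent normal variables is formed.\<close>
  define I where "I = {i. u $ i \<noteq> 0}"
  let ?X = "\<lambda>i w. u $ i * (B t w - B s w) $ i"
  have I: "finite I" "I \<noteq> {}" using u by (auto simp: I_def vec_eq_iff)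
  have "indep_vars (\<lambda>_. borel) (\<lambda>i w. (B t w - B s w) $ i) UNIV"
    using brownian st by (auto simp: standard_brownian_motion_def)
  then have "indep_vars (\<lambda>_. borel) (\<lambda>i w. (B t w - B s w) $ i) I" by (rule indep_vars_subset) auto
  then have ind: "indep_vars (\<lambda>_. borel) ?X I" by (rule indep_vars_compose2) auto
  have "distributed M lborel (?X i) (normal_density 0 (\<bar>u $ i\<bar> * sqrt (t - s)))" if "i \<in> I" for i
  proof -
    have "distributed M lborel (\<lambda>w. (B t w - B s w) $ i) (normal_density 0 (sqrt (t - s)))"
      using brownian st by (auto simp: standard_brownian_motion_def)
    from normal_density_affine[OF this, of "u $ i" 0] st that show ?thesis by (simp add: I_def)
  qed
  then have "distributed M lborel (\<lambda>w. \<Sum>i\<in>I. ?X i w)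
     (normal_density (\<Sum>i\<in>I. 0) (sqrt (\<Sum>i\<in>I. (\<bar>u $ i\<bar> * sqrt (t - s))\<^sup>2)))"
    using st by (intro sum_indep_normal I ind) (auto simp: I_def)
  moreover have "(\<Sum>i\<in>I. ?X i w) = u \<bullet> (B t w - B s w)" for w
    unfolding inner_vec_def by (rule sum.mono_neutral_cong_left) (auto simp: I_def)
  moreover have "(\<Sum>i\<in>I. (\<bar>u $ i\<bar> * sqrt (t - s))\<^sup>2) = (norm u)\<^sup>2 * (t - s)"
  proof -
    have "(\<Sum>i\<in>I. (\<bar>u $ i\<bar> * sqrt (t - s))\<^sup>2) = (\<Sum>i\<in>I. (u $ i)\<^sup>2 * (t - s))"
      using st by (intro sum.cong) (auto simp: power_mult_distrib)
    also have "\<dots> = (\<Sum>i\<in>UNIV. (u $ i)\<^sup>2 * (t - s))"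
      by (rule sum.mono_neutral_cong_left) (auto simp: I_def)
    also have "\<dots> = (norm u)\<^sup>2 * (t - s)"
      unfolding power2_norm_eq_inner inner_vec_def by (simp add: sum_distrib_right power2_eq_square)
    finally show ?thesis .
  qed
  ultimately show ?thesis using st by (simp add: real_sqrt_mult)
qed

lemma increment_component:
  assumes st: "0 \<le> s" "s < t" "t \<le> T"
  shows "sqint M (\<lambda>w. (B t w - B s w) $ i)" "expectation (\<lambda>w. (B t w - B s w) $ i) = 0"
    "expectation (\<lambda>w. (B t w - B s w) $ i * (B t w - B s w) $ j) = (if i = j then t - s else 0)"
proof -
  have D: "distributed M lborel (\<lambda>w. (B t w - B s w) $ i) (normal_density 0 (sqrt (t - s)))" for i
    using brownian st by (auto simp: standard_brownian_motion_def)
  have s: "sqrt (t - s) > 0" using st by simp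
  note N = normal_sqint[OF D s]
  show 1: "sqint M (\<lambda>w. (B t w - B s w) $ i)" "expectation (\<lambda>w. (B t w - B s w) $ i) = 0" by (rule N)+
  show "expectation (\<lambda>w. (B t w - B s w) $ i * (B t w - B s w) $ j) = (if i = j then t - s else 0)"
  proof (cases "i = j")
    case True
    then show ?thesis using N(3)[of i] st by (simp add: power2_eq_square)
  next
    case False
    have "indep_vars (\<lambda>_. borel) (\<lambda>i w. (B t w - B s w) $ i) UNIV"
      using brownian st by (auto simp: standard_brownian_motion_def)
    then have "indep_vars (\<lambda>_. borel) (\<lambda>i w. (B t w - B s w) $ i) {i, j}" by (rule indep_vars_subset) auto
    from indep_vars_lebesgue_integral[OF _ this] False sqint_integrable[OF N(1)]
    show ?thesis using N(2) by (simp add: insert_commute)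
  qed
qed

lemma increment_iexp:
  fixes u :: "real^'d"
  assumes st: "0 \<le> s" "s < t" "t \<le> T"
  defines "Y \<equiv> \<lambda>w. u \<bullet> (B t w - B s w)" and "v \<equiv> (norm u)\<^sup>2 * (t - s)"
  shows "expectation (\<lambda>w. (1 + \<i> * Y w) * iexp (- Y w)) = (1 + v) * exp (- v / 2)"
    and "integrable M (\<lambda>w. (1 + \<i> * Y w) * iexp (- Y w))"
    and "sqint M Y" "expectation Y = 0" "expectation (\<lambda>w. (Y w)\<^sup>2) = v"
proof -
  have *: "expectation (\<lambda>w. (1 + \<i> * Y w) * iexp (- Y w)) = (1 + v) * exp (- v / 2) \<and>
     integrable M (\<lambda>w. (1 + \<i> * Y w) * iexp (- Y w)) \<and>
     sqint M Y \<and> expectation Y = 0 \<and> expectation (\<lambda>w. (Y w)\<^sup>2) = v"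
  proof (cases "u = 0")
    case True
    then show ?thesis by (simp add: Y_def v_def prob_space sqint_zero)
  next
    case False
    have D: "distributed M lborel Y (normal_density 0 (norm u * sqrt (t - s)))"
      unfolding Y_def by (rule increment_normal[OF st False])
    have p: "norm u * sqrt (t - s) > 0" using False st by simp
    have v: "(norm u * sqrt (t - s))\<^sup>2 = v" using st by (simp add: v_def power_mult_distrib)
    show ?thesis using normal_iexp_expectation[OF D p] normal_sqint[OF D p] unfolding v by auto
  qed
  then show "expectation (\<lambda>w. (1 + \<i> * Y w) * iexp (- Y w)) = (1 + v) * exp (- v / 2)"
    and "integrable M (\<lambda>w. (1 + \<i> * Y w) * iexp (- Y w))"
    and "sqint M Y" "expectation Y = 0" "expectation (\<lambda>w. (Y w)\<^sup>2) = v" by auto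
qed

end

section \<open>Isometry and martingale property for step integrands\<close>

section \<open>The stochastic integral of simple integrands\<close>

lemma borel_measurable_vec_nth [measurable (raw)]:
  fixes x :: "'a \<Rightarrow> real^'n::finite"
  assumes [measurable]: "x \<in> borel_measurable M"
  shows "(\<lambda>w. x w $ i) \<in> borel_measurable M"
proof -
  have "(\<lambda>w. x w \<bullet> axis i 1) \<in> borel_measurable M" by measurable
  then show ?thesis by (simp add: inner_axis)
qed

lemma integral_sum_sum:
  fixes f :: "nat \<Rightarrow> nat \<Rightarrow> 'a \<Rightarrow> real"
  assumes "\<And>i j. i < n \<Longrightarrow> j < n \<Longrightarrow> integrable M (f i j)"
  shows "(\<integral>w. (\<Sum>i<n. \<Sum>j<n. f i j w) \<partial>M) = (\<Sum>i<n. \<Sum>j<n. \<integral>w. f i j w \<partial>M)"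
  using assms by (subst Bochner_Integration.integral_sum)
    (auto intro!: Bochner_Integration.integrable_sum sum.cong Bochner_Integration.integral_sum)

lemma integral_indicator_Ioc_overlap:
  fixes a b a' b' T :: real
  assumes "0 \<le> a" "b \<le> T"
  shows "integrable lborel (\<lambda>s. indicator {0..T} s * (indicator {a<..b} s * indicator {a'<..b'} s) :: real)"
    and "(\<integral>s. indicator {0..T} s * (indicator {a<..b} s * indicator {a'<..b'} s) \<partial>lborel) = max 0 (min b b' - max a a')"
proof -
  have e: "emeasure lborel {l<..u::real} = ennreal (max 0 (u - l))" for l u
    by (cases "l \<le> u") (auto simp: max_def)
  have r: "enn2real (ennreal y) = max 0 y" for y
    by (cases "0 \<le> y") (auto simp: max_def ennreal_neg)
  have eq: "(\<lambda>s. indicator {0..T} s * (indicator {a<..b} s * indicator {a'<..b'} s) :: real) = indicator {max a a'<..min b b'}"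
    using assms by (auto simp: fun_eq_iff split: split_indicator)
  show "integrable lborel (\<lambda>s. indicator {0..T} s * (indicator {a<..b} s * indicator {a'<..b'} s) :: real)"
    unfolding eq by (intro integrable_real_indicator) (auto simp: e)
  show "(\<integral>s. indicator {0..T} s * (indicator {a<..b} s * indicator {a'<..b'} s) \<partial>lborel) = max 0 (min b b' - max a a')"
    unfolding eq by (simp add: measure_def e r)
qed

context brownian
begin

lemma vec_sqint: "sqint M x \<Longrightarrow> sqint M (\<lambda>w. x w $ i)" for x :: "'w \<Rightarrow> real^'d"
  by (rule sqint_mono[where K=1 and X=x]) (auto simp: sqint_def component_le_norm_cart intro: borel_measurable_vec_nth)

text \<open>A product of square integrable variables need not be square integrable. Here
  \<open>x\<close> is independent of the increment, so the second moments multiply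
  coordinatewise.\<close>

lemma elem_sqint:
  fixes x :: "'w \<Rightarrow> real^'d"
  assumes ab: "0 \<le> a" "a \<le> b" "b \<le> T" and x: "x \<in> borel_measurable (F a)" "sqint M x"
  shows "sqint M (\<lambda>w. x w \<bullet> (B b w - B a w))"
proof (cases "a = b")
  case False
  then have ab': "0 \<le> a" "a < b" "b \<le> T" using ab by auto
  have [measurable]: "B b \<in> borel_measurable M" "B a \<in> borel_measurable M" "x \<in> borel_measurable M"
    using ab measurable_F_M[OF x(1)] by auto
  have "sqint M (\<lambda>w. x w $ i * (B b w - B a w) $ i)" for i
    unfolding sqint_real_iff power_mult_distrib
  proof
    show "integrable M (\<lambda>w. (x w $ i)\<^sup>2 * ((B b w - B a w) $ i)\<^sup>2)"
      using vec_sqint[OF x(2), of i] increment_component(1)[OF ab', of i] x(1)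
      by (intro increment_mult(1)[OF ab', where g="\<lambda>v. (v $ i)\<^sup>2"]) (auto simp: sqint_def)
  qed measurable
  then show ?thesis by (auto simp: inner_vec_def intro!: sqint_sum)
qed (simp add: sqint_zero)

text \<open>Each \<open>y w * x w $ i\<close> is integrable and known at time \<open>a\<close>,
  hence independent of the increment, whose mean is 0.\<close>

lemma elem_orth:
  fixes x :: "'w \<Rightarrow> real^'d"
  assumes ab: "0 \<le> a" "a \<le> b" "b \<le> T" and x: "x \<in> borel_measurable (F a)" "sqint M x"
    and y: "y \<in> borel_measurable (F a)" "sqint M y"
  shows "expectation (\<lambda>w. y w * (x w \<bullet> (B b w - B a w))) = 0"
proof (cases "a = b")
  case False
  then have ab': "0 \<le> a" "a < b" "b \<le> T" using ab by auto
  have i: "integrable M (\<lambda>w. y w * x w $ i)" for i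
    by (intro sqint_mult_integrable y vec_sqint x)
  have m: "(\<lambda>w. y w * x w $ i) \<in> borel_measurable (F a)" for i using x y by measurable
  have D: "integrable M (\<lambda>w. (B b w - B a w) $ i)" for i
    by (rule sqint_integrable[OF increment_component(1)[OF ab']])
  note E = increment_mult[OF ab' m _ i D]
  have "expectation (\<lambda>w. y w * (x w \<bullet> (B b w - B a w)))
      = expectation (\<lambda>w. \<Sum>i\<in>UNIV. y w * x w $ i * (B b w - B a w) $ i)"
    by (simp add: inner_vec_def sum_distrib_left mult.assoc)
  also have "\<dots> = (\<Sum>i\<in>UNIV. expectation (\<lambda>w. y w * x w $ i * (B b w - B a w) $ i))"
    by (intro Bochner_Integration.integral_sum E) auto
  also have "\<dots> = 0"
    by (subst E) (simp_all add: increment_component(2)[OF ab', simplified])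
  finally show ?thesis .
qed simp

lemma elem_isometry:
  fixes x x' :: "'w \<Rightarrow> real^'d"
  assumes ab: "0 \<le> a" "a \<le> b" "b \<le> T" and x: "x \<in> borel_measurable (F a)" "sqint M x"
    and x': "x' \<in> borel_measurable (F a)" "sqint M x'"
  shows "expectation (\<lambda>w. (x w \<bullet> (B b w - B a w)) * (x' w \<bullet> (B b w - B a w))) = expectation (\<lambda>w. x w \<bullet> x' w) * (b - a)"
proof (cases "a = b")
  case False
  then have ab': "0 \<le> a" "a < b" "b \<le> T" using ab by auto
  let ?D = "\<lambda>w. B b w - B a w"
  have i: "integrable M (\<lambda>w. x w $ i * x' w $ j)" for i j
    by (intro sqint_mult_integrable vec_sqint x x')
  have m: "(\<lambda>w. x w $ i * x' w $ j) \<in> borel_measurable (F a)" for i j using x x' by measurable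
  have D: "integrable M (\<lambda>w. ?D w $ i * ?D w $ j)" for i j
    by (intro sqint_mult_integrable increment_component(1)[OF ab'])
  have E: "integrable M (\<lambda>w. x w $ i * x' w $ j * (?D w $ i * ?D w $ j))"
      "expectation (\<lambda>w. x w $ i * x' w $ j * (?D w $ i * ?D w $ j)) = expectation (\<lambda>w. x w $ i * x' w $ j) * (if i = j then b - a else 0)" for i j
    using increment_mult[OF ab' m _ i D, of i j] increment_component(3)[OF ab', of i j] by auto
  have "expectation (\<lambda>w. (x w \<bullet> ?D w) * (x' w \<bullet> ?D w))
      = expectation (\<lambda>w. \<Sum>i\<in>UNIV. \<Sum>j\<in>UNIV. x w $ i * x' w $ j * (?D w $ i * ?D w $ j))"
    by (simp add: inner_vec_def sum_product ac_simps)
  also have "\<dots> = (\<Sum>i\<in>UNIV. \<Sum>j\<in>UNIV. expectation (\<lambda>w. x w $ i * x' w $ j * (?D w $ i * ?D w $ j)))"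
    by (subst Bochner_Integration.integral_sum, intro Bochner_Integration.integrable_sum E, intro sum.cong refl Bochner_Integration.integral_sum E)
  also have "\<dots> = (\<Sum>i\<in>UNIV. expectation (\<lambda>w. x w $ i * x' w $ i) * (b - a))"
    unfolding E(2) by (intro sum.cong refl) (simp add: if_distrib[of "(*) _"] cong: if_cong)
  also have "\<dots> = expectation (\<lambda>w. x w \<bullet> x' w) * (b - a)"
    by (simp add: inner_vec_def sum_distrib_right Bochner_Integration.integral_sum i)
  finally show ?thesis .
qed simp

lemma elem_measurable_F:
  fixes x :: "'w \<Rightarrow> real^'d"
  assumes ab: "0 \<le> a" "a \<le> b" and x: "x \<in> borel_measurable (F a)"
  shows "(\<lambda>w. x w \<bullet> (B b w - B a w)) \<in> borel_measurable (F b)"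
proof -
  have [measurable]: "x \<in> borel_measurable (F b)" "B a \<in> borel_measurable (F b)" "B b \<in> borel_measurable (F b)"
    using measurable_F_mono[OF x ab(2)] B_measurable_F[of a b] B_measurable_F[of b b] ab by auto
  show ?thesis by measurable
qed

text \<open>If the intervals overlap, the first integral is cut at \<open>a'\<close> and
  \<open>c\<close> and the second at \<open>c\<close>. Of the six resulting products only the one
  over the common piece (a', c] has nonzero expectation; the others are orthogonal or vanish
  identically.\<close>

lemma elem_isometry_overlap_ordered:
  fixes x x' :: "'w \<Rightarrow> real^'d"
  assumes ab: "0 \<le> a" "a \<le> b" "b \<le> T" and x: "x \<in> borel_measurable (F a)" "sqint M x"
    and ab': "a \<le> a'" "a' \<le> b'" "b' \<le> T" and x': "x' \<in> borel_measurable (F a')" "sqint M x'"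
  shows "expectation (\<lambda>w. (x w \<bullet> (B b w - B a w)) * (x' w \<bullet> (B b' w - B a' w)))
    = expectation (\<lambda>w. x w \<bullet> x' w) * max 0 (min b b' - max a a')"
proof (cases "b \<le> a'")
  case True
  have "expectation (\<lambda>w. (x w \<bullet> (B b w - B a w)) * (x' w \<bullet> (B b' w - B a' w))) = 0"
    using ab ab' by (intro elem_orth x' elem_sqint x measurable_F_mono[OF elem_measurable_F[OF _ _ x(1)] True]) auto
  then show ?thesis using True by simp
next
  case False
  define c where "c = min b b'"
  define e where "e = (\<lambda>(y::'w \<Rightarrow> real^'d) p q w. y w \<bullet> (B q w - B p w))"
  have c: "a' \<le> c" "c \<le> b" "c \<le> b'" "c \<le> T" "0 \<le> c" "0 \<le> a'" using False ab ab' by (auto simp: c_def)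
  note xm = measurable_F_mono[OF x(1)] measurable_F_mono[OF x'(1)]
  have sq: "sqint M (e x a a')" "sqint M (e x a' c)" "sqint M (e x c b)" "sqint M (e x' a' c)" "sqint M (e x' c b')"
    unfolding e_def using ab ab' c False by (auto intro!: elem_sqint x(2) x'(2) xm)
  note int = sqint_mult_integrable[OF sq(1) sq(4)] sqint_mult_integrable[OF sq(1) sq(5)] sqint_mult_integrable[OF sq(2) sq(4)]
    sqint_mult_integrable[OF sq(2) sq(5)] sqint_mult_integrable[OF sq(3) sq(4)] sqint_mult_integrable[OF sq(3) sq(5)]
  have m: "e x a a' \<in> borel_measurable (F a')" "e x a' c \<in> borel_measurable (F c)" "e x' a' c \<in> borel_measurable (F c)"
     "e x a a' \<in> borel_measurable (F c)"
    unfolding e_def using ab ab' c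
    by (auto intro!: elem_measurable_F x'(1) xm measurable_F_mono[OF elem_measurable_F[OF _ _ x(1)]])
  have 1: "expectation (\<lambda>w. e x a a' w * e x' a' c w) = 0"
    using elem_orth[of a' c x' "e x a a'"] c ab ab' x' m sq unfolding e_def by auto
  have 2: "expectation (\<lambda>w. e x a a' w * e x' c b' w) = 0"
    using elem_orth[of c b' x' "e x a a'"] c ab ab' x' m sq xm unfolding e_def by auto
  have 3: "expectation (\<lambda>w. e x a' c w * e x' a' c w) = expectation (\<lambda>w. x w \<bullet> x' w) * (c - a')"
    using elem_isometry[of a' c x x'] c ab ab' x' x m sq xm(1)[of a'] unfolding e_def by auto
  have 4: "expectation (\<lambda>w. e x a' c w * e x' c b' w) = 0"
    using elem_orth[of c b' x' "e x a' c"] c ab ab' x' m sq xm unfolding e_def by auto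
  have 5: "expectation (\<lambda>w. e x c b w * e x' a' c w) = 0"
    using elem_orth[of c b x "e x' a' c"] c ab ab' x m sq xm(1)[of c] unfolding e_def by (auto simp: mult.commute)
  have 6: "expectation (\<lambda>w. e x c b w * e x' c b' w) = 0"
  proof -
    \<comment> \<open>One of the two pieces beyond \<open>c\<close> is empty because
      \<open>c\<close> is the smaller right endpoint.\<close>
    have "c = b \<or> c = b'" by (auto simp: c_def min_def)
    then show ?thesis by (auto simp: e_def)
  qed
  have "expectation (\<lambda>w. (x w \<bullet> (B b w - B a w)) * (x' w \<bullet> (B b' w - B a' w)))
     = expectation (\<lambda>w. e x a a' w * e x' a' c w + (e x a a' w * e x' c b' w + (e x a' c w * e x' a' c w
         + (e x a' c w * e x' c b' w + (e x c b w * e x' a' c w + e x c b w * e x' c b' w)))))"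
    by (intro Bochner_Integration.integral_cong) (auto simp: e_def algebra_simps inner_diff_right)
  also have "\<dots> = expectation (\<lambda>w. x w \<bullet> x' w) * (c - a')"
    by (simp add: int 1 2 3 4 5 6)
  also have "c - a' = max 0 (min b b' - max a a')" using c ab' by (auto simp: c_def)
  finally show ?thesis .
qed

lemma elem_isometry_overlap:
  fixes x x' :: "'w \<Rightarrow> real^'d"
  assumes ab: "0 \<le> a" "a \<le> b" "b \<le> T" and x: "x \<in> borel_measurable (F a)" "sqint M x"
    and ab': "0 \<le> a'" "a' \<le> b'" "b' \<le> T" and x': "x' \<in> borel_measurable (F a')" "sqint M x'"
  shows "expectation (\<lambda>w. (x w \<bullet> (B b w - B a w)) * (x' w \<bullet> (B b' w - B a' w)))
    = expectation (\<lambda>w. x w \<bullet> x' w) * max 0 (min b b' - max a a')"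
proof (cases "a \<le> a'")
  case True
  then show ?thesis using elem_isometry_overlap_ordered[of a b x a' b' x'] assms by auto
next
  case False
  then show ?thesis using elem_isometry_overlap_ordered[of a' b' x' a b x] assms
    by (simp add: mult.commute inner_commute min.commute max.commute)
qed

abbreviation simple :: "(real \<times> real \<times> ('w \<Rightarrow> real^'d)) list \<Rightarrow> bool"
  where "simple \<equiv> simple_integrand F T"

lemma simpleD:
  assumes "simple S" "(a, b, x) \<in> set S"
  shows "0 \<le> a" "a \<le> b" "b \<le> T" "x \<in> borel_measurable (F a)" "bounded (x ` space M)" "sqint M x"
proof -
  show *: "0 \<le> a" "a \<le> b" "b \<le> T" "x \<in> borel_measurable (F a)" "bounded (x ` space M)"
    using assms unfolding simple_integrand_def by (auto dest!: bspec[OF _ assms(2)])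
  then obtain K where "\<And>w. w \<in> space M \<Longrightarrow> norm (x w) \<le> K" by (auto simp: bounded_iff)
  then show "sqint M x" using measurable_F_M[OF *(4)] * by (intro sqint_bounded) auto
qed

lemma simple_append: "simple S \<Longrightarrow> simple S' \<Longrightarrow> simple (S @ S')"
  by (auto simp: simple_integrand_def)

lemma simple_integral_append: "simple_integral B (S @ S') t w = simple_integral B S t w + simple_integral B S' t w"
  by (simp add: simple_integral_def)

lemma simple_process_append: "simple_process (S @ S') t w = simple_process S t w + simple_process S' t w"
  by (simp add: simple_process_def)

definition scale_simple :: "real \<Rightarrow> (real \<times> real \<times> ('w \<Rightarrow> real^'d)) list \<Rightarrow> (real \<times> real \<times> ('w \<Rightarrow> real^'d)) list"
  where "scale_simple c S = map (\<lambda>(a, b, x). (a, b, \<lambda>w. c *\<^sub>R x w)) S"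

lemma simple_scale: "simple S \<Longrightarrow> simple (scale_simple c S)"
  unfolding simple_integrand_def
proof (clarify, goal_cases)
  case (1 a b x')
  then obtain x where ab: "(a, b, x) \<in> set S" "x' = (\<lambda>w. c *\<^sub>R x w)"
    by (auto simp: scale_simple_def)
  assume S: "\<forall>(a, b, x)\<in>set S. 0 \<le> a \<and> a \<le> b \<and> b \<le> T \<and> x \<in> borel_measurable (F a) \<and> bounded (x ` space (F a))"
  have "bounded ((\<lambda>v. c *\<^sub>R v) ` (x ` space M))"
    using bspec[OF S ab(1)] by (intro bounded_scaling) auto
  then show ?case using bspec[OF S ab(1)] ab(2) by (auto simp: image_image)
qed

lemma simple_integral_scale: "simple_integral B (scale_simple c S) t w = c * simple_integral B S t w"
  by (induction S) (auto simp: scale_simple_def simple_integral_def algebra_simps)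

lemma simple_process_scale: "simple_process (scale_simple c S) t w = c *\<^sub>R simple_process S t w"
  by (induction S) (auto simp: scale_simple_def simple_process_def algebra_simps)

text \<open>The outer \<open>max\<close> keeps the endpoints ordered when (a, b] misses (s, t], so
  that the piece becomes empty rather than ill-formed. Increments of an integral turn into terminal
  values of another simple integral, and the isometry has to be proved at \<open>T\<close>
  only.\<close>

definition restrict_simple :: "real \<Rightarrow> real \<Rightarrow> (real \<times> real \<times> ('w \<Rightarrow> real^'d)) list \<Rightarrow> (real \<times> real \<times> ('w \<Rightarrow> real^'d)) list"
  where "restrict_simple s t S = map (\<lambda>(a, b, x). (max a s, max (max a s) (min b t), x)) S"

lemma simple_restrict:
  assumes "simple S" "0 \<le> s" "s \<le> T"
  shows "simple (restrict_simple s t S)"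
  unfolding simple_integrand_def
proof (clarify, goal_cases)
  case (1 a' b' x)
  then obtain a b where ab: "(a, b, x) \<in> set S" "a' = max a s" "b' = max (max a s) (min b t)"
    by (auto simp: restrict_simple_def)
  note D = simpleD[OF assms(1) ab(1)]
  have "x \<in> borel_measurable (F a')" using ab by (intro measurable_F_mono[OF D(4)]) auto
  then show ?case using D(1,2,3,5) assms(2,3) ab(2,3) by auto
qed

lemma simple_integral_restrict:
  assumes "simple S" "0 \<le> s" "s \<le> t" "t \<le> T"
  shows "simple_integral B (restrict_simple s t S) T w = simple_integral B S t w - simple_integral B S s w"
  using assms(1)
proof (induction S)
  case (Cons z S)
  obtain a b x where z: "z = (a, b, x)" by (cases z)
  have ab: "0 \<le> a" "a \<le> b" "b \<le> T" using simpleD[OF Cons.prems, of a b x] z by auto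
  have S: "simple S" using Cons.prems by (simp add: simple_integrand_def)
  have "B (min (max (max a s) (min b t)) T) w - B (min (max a s) T) w =
     (B (min b t) w - B (min a t) w) - (B (min b s) w - B (min a s) w)"
    using assms(2-) ab by (auto simp: min_def max_def)
  from arg_cong[OF this, of "\<lambda>v. x w \<bullet> v"]
  have "x w \<bullet> (B (min (max (max a s) (min b t)) T) w - B (min (max a s) T) w) =
     x w \<bullet> (B (min b t) w - B (min a t) w) - x w \<bullet> (B (min b s) w - B (min a s) w)"
    by (simp only: inner_diff_right)
  then show ?case using Cons.IH[OF S]
    by (simp add: z restrict_simple_def simple_integral_def del: inner_diff_right)
qed (simp add: simple_integral_def restrict_simple_def)

lemma simple_process_restrict:
  "simple_process (restrict_simple s t S) r w = indicator {s<..t} r *\<^sub>R simple_process S r w"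
  by (induction S)
    (auto simp: simple_process_def restrict_simple_def scaleR_add_right split: split_indicator)

lemma simple_integral_T:
  assumes "simple S"
  shows "simple_integral B S T w = (\<Sum>(a, b, x)\<leftarrow>S. x w \<bullet> (B b w - B a w))"
  unfolding simple_integral_def using simpleD(1-3)[OF assms]
  by (intro arg_cong[where f=sum_list] map_cong) (fastforce simp: min_absorb1)+

lemma simple_integral_sqint_T:
  assumes "simple S" shows "sqint M (simple_integral B S T)"
  unfolding simple_integral_T[OF assms, abs_def] using simpleD[OF assms]
  by (intro sqint_sum_list) (auto intro!: elem_sqint)

lemma simple_integral_0:
  assumes "simple S" shows "simple_integral B S 0 w = 0"
proof -
  have "simple_integral B S 0 w = (\<Sum>(a, b, x)\<leftarrow>S. 0)"
    unfolding simple_integral_def using simpleD(1-2)[OF assms]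
    by (intro arg_cong[where f=sum_list] map_cong) (fastforce simp: min_absorb2)+
  then show ?thesis by (simp add: case_prod_unfold)
qed

lemma simple_integral_diff_sqint:
  assumes "simple S" "0 \<le> s" "s \<le> t" "t \<le> T"
  shows "sqint M (\<lambda>w. simple_integral B S t w - simple_integral B S s w)"
proof -
  have "(\<lambda>w. simple_integral B S t w - simple_integral B S s w) = simple_integral B (restrict_simple s t S) T"
    by (rule ext) (rule simple_integral_restrict[OF assms, symmetric])
  then show ?thesis using simple_integral_sqint_T[OF simple_restrict[OF assms(1,2)], of t] assms by simp
qed

lemma simple_integral_sqint:
  assumes "simple S" "0 \<le> t" "t \<le> T" shows "sqint M (simple_integral B S t)"
  using simple_integral_diff_sqint[of S 0 t] simple_integral_0[of S] assms by simp

lemma simple_integral_measurable: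
  assumes "simple S" "0 \<le> t" shows "simple_integral B S t \<in> borel_measurable (F t)"
  unfolding simple_integral_def
proof -
  show "(\<lambda>w. \<Sum>(a, b, x)\<leftarrow>S. x w \<bullet> (B (min b t) w - B (min a t) w)) \<in> borel_measurable (F t)"
    using assms(1)
  proof (induction S)
    case (Cons z S)
    obtain a b x where z: "z = (a, b, x)" by (cases z)
    note ab = simpleD[OF Cons.prems, of a b x, unfolded z, simplified]
    have S: "simple S" using Cons.prems by (simp add: simple_integrand_def)
    have "(\<lambda>w. x w \<bullet> (B (min b t) w - B (min a t) w)) \<in> borel_measurable (F t)"
    proof (cases "a \<le> t")
      case True
      have [measurable]: "x \<in> borel_measurable (F t)" by (rule measurable_F_mono[OF ab(4) True])
      have [measurable]: "B (min b t) \<in> borel_measurable (F t)" "B (min a t) \<in> borel_measurable (F t)"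
        using ab assms by (auto intro!: B_measurable_F)
      show ?thesis by measurable
    next
      case False
      then show ?thesis using ab by (simp add: min_absorb2)
    qed
    then show ?case using Cons.IH[OF S] by (simp add: z)
  qed simp
qed

lemma simple_integral_continuous:
  assumes "simple S" shows "AE w in M. continuous_on {0..T} (\<lambda>t. simple_integral B S t w)"
  using B_continuous
proof eventually_elim
  case (elim w)
  have "continuous_on {0..T} (\<lambda>t. \<Sum>(a, b, x)\<leftarrow>S. x w \<bullet> (B (min b t) w - B (min a t) w))"
    using assms
  proof (induction S)
    case (Cons z S)
    obtain a b x where z: "z = (a, b, x)" by (cases z)
    note ab = simpleD[OF Cons.prems, of a b x, unfolded z, simplified]
    have S: "simple S" using Cons.prems by (simp add: simple_integrand_def)
    show ?case using Cons.IH[OF S] ab unfolding z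
      by (auto intro!: continuous_intros continuous_on_compose2[OF elim])
  qed simp
  then show ?case by (simp add: simple_integral_def)
qed

lemma simple_integral_martingale:
  assumes S: "simple S" and st: "0 \<le> s" "s \<le> t" "t \<le> T"
    and y: "y \<in> borel_measurable (F s)" "sqint M y"
  shows "expectation (\<lambda>w. y w * (simple_integral B S t w - simple_integral B S s w)) = 0"
proof -
  \<comment> \<open>After restriction to (s, t] every left endpoint is at least \<open>s\<close>, so
    each term is orthogonal to \<open>y\<close> by itself.\<close>
  have *: "simple S' \<Longrightarrow> (\<And>a b x. (a, b, x) \<in> set S' \<Longrightarrow> s \<le> a) \<Longrightarrow>
     expectation (\<lambda>w. y w * simple_integral B S' T w) = 0" for S'
  proof (induction S')
    case (Cons z S')
    obtain a b x where z: "z = (a, b, x)" by (cases z)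
    note ab = simpleD[OF Cons.prems(1), of a b x, unfolded z, simplified]
    have S': "simple S'" using Cons.prems by (simp add: simple_integrand_def)
    have sa: "s \<le> a" using Cons.prems(2)[of a b x] z by simp
    have "simple_integral B (z # S') T w = x w \<bullet> (B b w - B a w) + simple_integral B S' T w" for w
      using ab by (simp add: z simple_integral_def min_absorb1)
    then have "expectation (\<lambda>w. y w * simple_integral B (z # S') T w)
       = expectation (\<lambda>w. y w * (x w \<bullet> (B b w - B a w)) + y w * simple_integral B S' T w)"
      by (simp add: distrib_left)
    also have "\<dots> = expectation (\<lambda>w. y w * (x w \<bullet> (B b w - B a w))) + expectation (\<lambda>w. y w * simple_integral B S' T w)"
      using ab by (intro Bochner_Integration.integral_add sqint_mult_integrable y simple_integral_sqint_T S' elem_sqint) auto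
    also have "\<dots> = 0"
      using elem_orth[of a b x y] ab y measurable_F_mono[OF y(1) sa] Cons.IH[OF S'] Cons.prems(2) by auto
    finally show ?case .
  qed (simp add: simple_integral_def)
  have "expectation (\<lambda>w. y w * simple_integral B (restrict_simple s t S) T w) = 0"
    using S st by (intro * simple_restrict) (auto simp: restrict_simple_def)
  then show ?thesis by (simp add: simple_integral_restrict[OF S st])
qed

text \<open>The intervals in the list may overlap. Instead of passing to a common refinement, both
  sides are expanded into the same double sum, weighted with the lengths \<open>o' i j\<close> of
  the pairwise overlaps.\<close>

lemma simple_integral_isometry_T:
  assumes S: "simple S"
  shows "(\<integral>\<^sup>+w. ennreal ((simple_integral B S T w)\<^sup>2) \<partial>M)
    = (\<integral>\<^sup>+w. (\<integral>\<^sup>+s\<in>{0..T}. ennreal ((norm (simple_process S s w))\<^sup>2) \<partial>lborel) \<partial>M)"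
proof -
  define n where "n = length S"
  define a b x where "a i = fst (S ! i)" and "b i = fst (snd (S ! i))" and "x i = snd (snd (S ! i))" for i
  note D = a_def b_def x_def
  have val: "0 \<le> a i" "a i \<le> b i" "b i \<le> T" "x i \<in> borel_measurable (F (a i))" "sqint M (x i)" if "i < n" for i
    using simpleD[OF S, of "a i" "b i" "x i"] that by (auto simp: D n_def)
  define o' where "o' i j = max 0 (min (b i) (b j) - max (a i) (a j))" for i j
  have J: "simple_integral B S T w = (\<Sum>i<n. x i w \<bullet> (B (b i) w - B (a i) w))" for w
    unfolding simple_integral_T[OF S] D n_def by (simp add: sum_list_sum_nth case_prod_unfold atLeast0LessThan)
  have P: "simple_process S s w = (\<Sum>i<n. indicator {a i<..b i} s *\<^sub>R x i w)" for s w
    unfolding simple_process_def D n_def by (simp add: sum_list_sum_nth case_prod_unfold atLeast0LessThan)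
  \<comment> \<open>\<open>Q w\<close> is the time integral of the squared norm along the path
    \<open>w\<close>.\<close>
  define Q where "Q w = (\<Sum>i<n. \<Sum>j<n. (x i w \<bullet> x j w) * o' i j)" for w
  have inner: "(\<integral>\<^sup>+s\<in>{0..T}. ennreal ((norm (simple_process S s w))\<^sup>2) \<partial>lborel) = ennreal (Q w)" and Q0: "Q w \<ge> 0" for w
  proof -
    let ?h = "\<lambda>s. \<Sum>i<n. \<Sum>j<n. (x i w \<bullet> x j w) * (indicator {0..T} s * (indicator {a i<..b i} s * indicator {a j<..b j} s))"
    have h: "?h s = (norm (simple_process S s w))\<^sup>2 * indicator {0..T} s" for s
      unfolding P power2_norm_eq_inner inner_sum_left inner_sum_right sum_distrib_right
      by (intro sum.cong refl) (auto simp: ac_simps inner_commute)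
    have hint: "integrable lborel ?h"
      using val by (intro Bochner_Integration.integrable_sum Bochner_Integration.integrable_mult_right integral_indicator_Ioc_overlap) auto
    have Q: "integral\<^sup>L lborel ?h = Q w"
      unfolding Q_def o'_def using val
      by (subst Bochner_Integration.integral_sum)
        (auto intro!: Bochner_Integration.integrable_sum integral_indicator_Ioc_overlap sum.cong
          simp: Bochner_Integration.integral_sum integral_indicator_Ioc_overlap)
    have "(\<integral>\<^sup>+s\<in>{0..T}. ennreal ((norm (simple_process S s w))\<^sup>2) \<partial>lborel) = (\<integral>\<^sup>+s. ennreal (?h s) \<partial>lborel)"
      unfolding h by (intro nn_integral_cong) (auto split: split_indicator)
    also have "\<dots> = ennreal (Q w)"
      unfolding Q[symmetric] using hint by (intro nn_integral_eq_integral) (auto simp: h)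
    finally show "(\<integral>\<^sup>+s\<in>{0..T}. ennreal ((norm (simple_process S s w))\<^sup>2) \<partial>lborel) = ennreal (Q w)" .
    show "Q w \<ge> 0" unfolding Q[symmetric] by (intro integral_nonneg_AE) (auto simp: h)
  qed
  have ii: "integrable M (\<lambda>w. x i w \<bullet> x j w)" if "i < n" "j < n" for i j
    using val that by (intro sqint_inner_integrable)
  have Qint: "integrable M Q"
    unfolding Q_def using ii by (intro Bochner_Integration.integrable_sum) auto
  have "(\<integral>\<^sup>+w. ennreal ((simple_integral B S T w)\<^sup>2) \<partial>M) = ennreal (expectation (\<lambda>w. (simple_integral B S T w)\<^sup>2))"
    using sqint_nn_integral[OF simple_integral_sqint_T[OF S]] by simp
  also have "expectation (\<lambda>w. (simple_integral B S T w)\<^sup>2)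
    = expectation (\<lambda>w. \<Sum>i<n. \<Sum>j<n. (x i w \<bullet> (B (b i) w - B (a i) w)) * (x j w \<bullet> (B (b j) w - B (a j) w)))"
    by (simp add: J power2_eq_square sum_product)
  also have "\<dots> = (\<Sum>i<n. \<Sum>j<n. expectation (\<lambda>w. (x i w \<bullet> (B (b i) w - B (a i) w)) * (x j w \<bullet> (B (b j) w - B (a j) w))))"
  proof -
    have "integrable M (\<lambda>w. (x i w \<bullet> (B (b i) w - B (a i) w)) * (x j w \<bullet> (B (b j) w - B (a j) w)))" if "i < n" "j < n" for i j
      using val that by (intro sqint_mult_integrable elem_sqint) auto
    then show ?thesis by (rule integral_sum_sum)
  qed
  also have "\<dots> = (\<Sum>i<n. \<Sum>j<n. expectation (\<lambda>w. x i w \<bullet> x j w) * o' i j)"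
    unfolding o'_def using val by (intro sum.cong refl elem_isometry_overlap) auto
  also have "\<dots> = expectation Q"
    unfolding Q_def using ii by (subst integral_sum_sum) auto
  also have "ennreal (expectation Q) = (\<integral>\<^sup>+w. ennreal (Q w) \<partial>M)"
    using Qint Q0 by (intro nn_integral_eq_integral[symmetric]) auto
  finally show ?thesis by (simp add: inner)
qed

lemma simple_integral_isometry:
  assumes S: "simple S" and st: "0 \<le> s" "s \<le> t" "t \<le> T"
  shows "(\<integral>\<^sup>+w. ennreal ((simple_integral B S t w - simple_integral B S s w)\<^sup>2) \<partial>M)
    = (\<integral>\<^sup>+w. (\<integral>\<^sup>+r\<in>{s<..t}. ennreal ((norm (simple_process S r w))\<^sup>2) \<partial>lborel) \<partial>M)"
proof -
  have "(\<integral>\<^sup>+w. ennreal ((simple_integral B S t w - simple_integral B S s w)\<^sup>2) \<partial>M)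
    = (\<integral>\<^sup>+w. (\<integral>\<^sup>+r\<in>{0..T}. ennreal ((norm (simple_process (restrict_simple s t S) r w))\<^sup>2) \<partial>lborel) \<partial>M)"
    using simple_integral_isometry_T[OF simple_restrict[OF S, of s t]] st
    by (simp add: simple_integral_restrict[OF S st])
  also have "\<dots> = (\<integral>\<^sup>+w. (\<integral>\<^sup>+r\<in>{s<..t}. ennreal ((norm (simple_process S r w))\<^sup>2) \<partial>lborel) \<partial>M)"
    using st by (intro nn_integral_cong) (auto simp: simple_process_restrict split: split_indicator)
  finally show ?thesis .
qed

end

section \<open>Maximal inequality in L2 by a pathwise argument\<close>

section \<open>Doob's maximal inequality\<close>

primrec running_max :: "(nat \<Rightarrow> real) \<Rightarrow> nat \<Rightarrow> real" where
  "running_max s 0 = s 0"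
| "running_max s (Suc k) = max (running_max s k) (s (Suc k))"

lemma running_max_ge: "i \<le> k \<Longrightarrow> s i \<le> running_max s k"
  by (induction k) (auto simp: le_Suc_eq)

text \<open>Pathwise form of Doob's inequality; the sum is a discrete stochastic integral of the
  running maximum. A new maximum s raises 4 S s - 2 S^2 by the square 2 (s - S)^2, which gives the
  induction, and the closing estimate is (2 s - S)^2 >= 0.\<close>

lemma running_max_pathwise:
  "running_max s n ^ 2 + 4 * (\<Sum>k<n. running_max s k * (s (Suc k) - s k)) \<le> 4 * (s n)\<^sup>2"
proof -
  let ?S = "running_max s"
  have "4 * (\<Sum>k<n. ?S k * (s (Suc k) - s k)) \<le> 4 * ?S n * s n - 2 * ?S n ^ 2"
  proof (induction n)
    case 0
    then show ?case by (simp add: power2_eq_square)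
  next
    case (Suc n)
    have "4 * (\<Sum>k<Suc n. ?S k * (s (Suc k) - s k)) \<le> 4 * ?S n * s (Suc n) - 2 * ?S n ^ 2"
      using Suc by (simp add: algebra_simps)
    also have "\<dots> \<le> 4 * ?S (Suc n) * s (Suc n) - 2 * ?S (Suc n) ^ 2"
      using zero_le_power2[of "s (Suc n) - ?S n"] by (simp add: max_def power2_eq_square algebra_simps)
    finally show ?case .
  qed
  moreover have "?S n ^ 2 + (4 * ?S n * s n - 2 * ?S n ^ 2) \<le> 4 * (s n)\<^sup>2"
    using zero_le_power2[of "2 * s n - ?S n"] by (simp add: power2_eq_square algebra_simps)
  ultimately show ?thesis by linarith
qed

lemma abs_diff_ge_sgn: "sgn x * (y - x) \<le> \<bar>y\<bar> - \<bar>x :: real\<bar>"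
  by (auto simp: sgn_if)

context brownian
begin

text \<open>Orthogonality to every square integrable variable known at time \<open>s\<close> encodes
  the conditional expectation identity by scalar products, which are continuous in L2.\<close>

definition L2_martingale :: "(real \<Rightarrow> 'w \<Rightarrow> real) \<Rightarrow> bool" where
  "L2_martingale X \<longleftrightarrow> (\<forall>t\<in>{0..T}. X t \<in> borel_measurable (F t) \<and> sqint M (X t)) \<and>
    (\<forall>s t y. 0 \<le> s \<and> s \<le> t \<and> t \<le> T \<and> y \<in> borel_measurable (F s) \<and> sqint M y \<longrightarrow>
      expectation (\<lambda>w. y w * (X t w - X s w)) = 0)"

lemma L2_martingaleD:
  assumes "L2_martingale X"
  shows "t \<in> {0..T} \<Longrightarrow> X t \<in> borel_measurable (F t)" "t \<in> {0..T} \<Longrightarrow> sqint M (X t)"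
    "0 \<le> s \<Longrightarrow> s \<le> t \<Longrightarrow> t \<le> T \<Longrightarrow> y \<in> borel_measurable (F s) \<Longrightarrow> sqint M y \<Longrightarrow>
      expectation (\<lambda>w. y w * (X t w - X s w)) = 0"
  using assms unfolding L2_martingale_def by auto

lemma simple_integral_L2_martingale: "simple S \<Longrightarrow> L2_martingale (simple_integral B S)"
  unfolding L2_martingale_def
  by (auto intro: simple_integral_measurable simple_integral_sqint simple_integral_martingale)

lemma running_max_measurable:
  assumes "\<And>i. i \<le> k \<Longrightarrow> X i \<in> borel_measurable N"
  shows "(\<lambda>w. running_max (\<lambda>i. \<bar>X i w :: real\<bar>) k) \<in> borel_measurable N"
  using assms by (induction k) auto

lemma Doob_discrete:
  assumes X: "L2_martingale X" and t: "\<And>k. k \<le> n \<Longrightarrow> t k \<in> {0..T}" "\<And>k. k < n \<Longrightarrow> t k \<le> t (Suc k)"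
  shows "(\<integral>\<^sup>+w. ennreal ((running_max (\<lambda>k. \<bar>X (t k) w\<bar>) n)\<^sup>2) \<partial>M) \<le> 4 * (\<integral>\<^sup>+w. ennreal ((X (t n) w)\<^sup>2) \<partial>M)"
proof -
  define S where "S k w = running_max (\<lambda>k. \<bar>X (t k) w\<bar>) k" for k w
  \<comment> \<open>By sgn(x) (y - x) <= |y| - |x| this factor replaces the increments of |X| by
    those of X, whose expectation against the past is 0. It does the work of the submartingale
    property of |X|.\<close>
  define y where "y k w = S k w * sgn (X (t k) w)" for k w
  note D = L2_martingaleD[OF X]
  have tm: "t i \<le> t k" if "i \<le> k" "k \<le> n" for i k
    using that
  proof (induction k)
    case (Suc k)
    then show ?case using t(2)[of k] by (cases "i = Suc k") auto
  qed simp
  have S0: "0 \<le> S k w" for k w unfolding S_def using running_max_ge[of 0 k "\<lambda>k. \<bar>X (t k) w\<bar>"] by linarith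
  have XF: "X (t i) \<in> borel_measurable (F (t k))" if "i \<le> k" "k \<le> n" for i k
    using that t(1)[of i] tm by (intro measurable_F_mono[OF D(1)]) auto
  have SF: "S k \<in> borel_measurable (F (t k))" if "k \<le> n" for k
    unfolding S_def using XF that by (intro running_max_measurable) auto
  have yF: "y k \<in> borel_measurable (F (t k))" if "k \<le> n" for k
    unfolding y_def[abs_def] using SF[OF that] XF[of k k] that by measurable
  have FM: "Z \<in> borel_measurable M" if "Z \<in> borel_measurable (F (t k))" "k \<le> n" for Z :: "'w \<Rightarrow> real" and k
    using that t(1)[of k] by (auto intro: measurable_F_M)
  have Ssq: "sqint M (S k)" if "k \<le> n" for k
    using that
  proof (induction k)
    case 0
    then show ?case using D(2)[OF t(1), of 0] by (auto simp: S_def sqint_def)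
  next
    case (Suc k)
    have "sqint M (\<lambda>w. S k w + \<bar>X (t (Suc k)) w\<bar>)"
      using Suc D(2)[OF t(1), of "Suc k"] by (intro sqint_add) (auto simp: sqint_def)
    then show ?case
    proof (rule sqint_mono[where K=1])
      show "AE w in M. norm (S (Suc k) w) \<le> 1 * norm (S k w + \<bar>X (t (Suc k)) w\<bar>)"
      proof (rule AE_I2)
        fix w
        have "S (Suc k) w = max (S k w) \<bar>X (t (Suc k)) w\<bar>" by (simp add: S_def)
        then show "norm (S (Suc k) w) \<le> 1 * norm (S k w + \<bar>X (t (Suc k)) w\<bar>)" using S0[of k w] by simp
      qed
    qed (rule FM[OF SF[OF Suc.prems] Suc.prems])
  qed
  have ysq: "sqint M (y k)" if "k \<le> n" for k
    using Ssq[OF that] FM[OF yF[OF that] that]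
    by (rule sqint_mono[where K=1]) (auto simp: y_def abs_mult abs_sgn_eq)
  have sq: "sqint M (X (t k))" if "k \<le> n" for k using D(2)[OF t(1)[OF that]] .
  have orth: "expectation (\<lambda>w. y k w * (X (t (Suc k)) w - X (t k) w)) = 0" if "k < n" for k
    using that t(1)[of k] t(1)[of "Suc k"] t(2)[of k] by (intro D(3) yF ysq) auto
  have int: "integrable M (\<lambda>w. y k w * (X (t (Suc k)) w - X (t k) w))" if "k < n" for k
    using that by (intro sqint_mult_integrable ysq sqint_diff sq) auto
  have path: "(S n w)\<^sup>2 \<le> 4 * (X (t n) w)\<^sup>2 - 4 * (\<Sum>k<n. y k w * (X (t (Suc k)) w - X (t k) w))" for w
  proof -
    have "(\<Sum>k<n. y k w * (X (t (Suc k)) w - X (t k) w)) \<le> (\<Sum>k<n. S k w * (\<bar>X (t (Suc k)) w\<bar> - \<bar>X (t k) w\<bar>))"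
      unfolding y_def mult.assoc by (intro sum_mono mult_left_mono abs_diff_ge_sgn S0)
    then show ?thesis using running_max_pathwise[of "\<lambda>k. \<bar>X (t k) w\<bar>" n] by (simp add: S_def)
  qed
  have "expectation (\<lambda>w. (S n w)\<^sup>2) \<le> expectation (\<lambda>w. 4 * (X (t n) w)\<^sup>2 - 4 * (\<Sum>k<n. y k w * (X (t (Suc k)) w - X (t k) w)))"
    using Ssq[of n] sq[of n] int path
    by (intro integral_mono Bochner_Integration.integrable_diff Bochner_Integration.integrable_mult_right
        Bochner_Integration.integrable_sum) (auto simp: sqint_def)
  also have "\<dots> = 4 * expectation (\<lambda>w. (X (t n) w)\<^sup>2) - 4 * (\<Sum>k<n. expectation (\<lambda>w. y k w * (X (t (Suc k)) w - X (t k) w)))"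
  proof -
    have "integrable M (\<lambda>w. \<Sum>k<n. y k w * (X (t (Suc k)) w - X (t k) w))"
      using int by (intro Bochner_Integration.integrable_sum) auto
    moreover have "expectation (\<lambda>w. \<Sum>k<n. y k w * (X (t (Suc k)) w - X (t k) w)) =
        (\<Sum>k<n. expectation (\<lambda>w. y k w * (X (t (Suc k)) w - X (t k) w)))"
      using int by (intro Bochner_Integration.integral_sum) auto
    ultimately show ?thesis using sq[of n] by (simp add: sqint_def)
  qed
  also have "\<dots> = 4 * expectation (\<lambda>w. (X (t n) w)\<^sup>2)" using orth by simp
  finally have le: "expectation (\<lambda>w. (S n w)\<^sup>2) \<le> 4 * expectation (\<lambda>w. (X (t n) w)\<^sup>2)" .
  have "(\<integral>\<^sup>+w. ennreal ((S n w)\<^sup>2) \<partial>M) = ennreal (expectation (\<lambda>w. (S n w)\<^sup>2))"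
    using sqint_nn_integral[OF Ssq[of n]] by simp
  also have "\<dots> \<le> 4 * ennreal (expectation (\<lambda>w. (X (t n) w)\<^sup>2))"
    using ennreal_leI[OF le] by (simp add: ennreal_mult)
  also have "ennreal (expectation (\<lambda>w. (X (t n) w)\<^sup>2)) = (\<integral>\<^sup>+w. ennreal ((X (t n) w)\<^sup>2) \<partial>M)"
    using sqint_nn_integral[OF sq[of n]] by simp
  finally show ?thesis by (simp add: S_def)
qed

text \<open>A countable supremum over dyadic times is measurable, and for continuous paths it
  dominates the value at every time.\<close>

definition grid_sup :: "(real \<Rightarrow> 'w \<Rightarrow> real) \<Rightarrow> 'w \<Rightarrow> ennreal"
  where "grid_sup X w = (SUP n. SUP k\<in>{..2^n::nat}. ennreal ((X (real k * T / 2^n) w)\<^sup>2))"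

lemma grid_in: "k \<le> 2^n \<Longrightarrow> real k * T / 2^n \<in> {0..T}"
  using T_pos of_nat_mono[of k "2^n", where ?'a = real]
  by (auto simp: field_simps)

lemma grid_sup_measurable:
  assumes "\<And>t. t \<in> {0..T} \<Longrightarrow> X t \<in> borel_measurable M"
  shows "grid_sup X \<in> borel_measurable M"
  unfolding grid_sup_def[abs_def] using assms grid_in
  by (intro borel_measurable_SUP) auto

lemma grid_sup_ge:
  assumes cont: "continuous_on {0..T} (\<lambda>t. X t w)" and t: "t \<in> {0..T}"
  shows "ennreal ((X t w)\<^sup>2) \<le> grid_sup X w"
proof -
  \<comment> \<open>Rounding down to the grid produces times of error at most T / 2^n; continuity of
    the path does the rest.\<close>
  define k where "k n = nat \<lfloor>t * 2^n / T\<rfloor>" for n :: nat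
  define r where "r n = real (k n) * T / 2^n" for n
  have kr: "real (k n) = of_int \<lfloor>t * 2^n / T\<rfloor>" for n
    unfolding k_def using t T_pos by (intro of_nat_nat) (auto intro!: divide_nonneg_pos)
  have kle: "k n \<le> 2^n" for n
  proof -
    have "real (k n) \<le> t * 2^n / T" unfolding kr by linarith
    also have "\<dots> \<le> 2^n" using t T_pos by (simp add: field_simps)
    finally show ?thesis by (metis of_nat_le_iff of_nat_numeral of_nat_power)
  qed
  have rin: "r n \<in> {0..T}" for n unfolding r_def by (rule grid_in[OF kle])
  have "r \<longlonglongrightarrow> t"
  proof (rule Lim_null[THEN iffD2], rule Lim_null_comparison[where g="\<lambda>n. T * (1/2)^n"])
    have "norm (r n - t) \<le> T * (1/2)^n" for n
    proof -
      have "\<bar>real (k n) - t * 2^n / T\<bar> \<le> 1" unfolding kr by linarith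
      then have "\<bar>real (k n) - t * 2^n / T\<bar> * (T / 2^n) \<le> 1 * (T / 2^n)"
        using T_pos by (intro mult_right_mono) auto
      moreover have "r n - t = (real (k n) - t * 2^n / T) * (T / 2^n)"
        unfolding r_def using T_pos by (simp add: field_simps)
      ultimately show ?thesis using T_pos by (simp add: abs_mult power_one_over)
    qed
    then show "\<forall>\<^sub>F n in sequentially. norm (r n - t) \<le> T * (1/2)^n" by simp
    show "(\<lambda>n. T * (1/2)^n) \<longlonglongrightarrow> 0" by (intro tendsto_mult_right_zero LIMSEQ_power_zero) auto
  qed
  then have "(\<lambda>n. X (r n) w) \<longlonglongrightarrow> X t w"
    using cont t rin by (auto simp: continuous_on_sequentially o_def)
  then have "(\<lambda>n. ennreal ((X (r n) w)\<^sup>2)) \<longlonglongrightarrow> ennreal ((X t w)\<^sup>2)" by (intro tendsto_intros) auto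
  then show ?thesis
  proof (rule LIMSEQ_le_const2, intro exI allI impI)
    fix n
    show "ennreal ((X (r n) w)\<^sup>2) \<le> grid_sup X w"
    unfolding grid_sup_def r_def using kle by (intro SUP_upper2[of n] SUP_upper) auto
  qed
qed

text \<open>The dyadic grids are nested, so monotone convergence applies, and the constant 4 of the
  discrete inequality does not depend on the grid.\<close>

lemma Doob_grid_sup:
  assumes X: "L2_martingale X"
  shows "(\<integral>\<^sup>+w. grid_sup X w \<partial>M) \<le> 4 * (\<integral>\<^sup>+w. ennreal ((X T w)\<^sup>2) \<partial>M)"
proof -
  define V where "V n w = (SUP k\<in>{..2^n::nat}. ennreal ((X (real k * T / 2^n) w)\<^sup>2))" for n w
  have XM: "X t \<in> borel_measurable M" if "t \<in> {0..T}" for t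
    using L2_martingaleD(2)[OF X that] by (rule sqint_measurable)
  have Vm: "V n \<in> borel_measurable M" for n
    unfolding V_def[abs_def] using XM grid_in by (intro borel_measurable_SUP) auto
  have "incseq V"
  proof (intro incseq_SucI le_funI)
    fix n w
    show "V n w \<le> V (Suc n) w" unfolding V_def
    proof (rule SUP_mono)
      fix k assume "k \<in> {..2^n::nat}"
      then show "\<exists>m\<in>{..2^Suc n}. ennreal ((X (real k * T / 2^n) w)\<^sup>2) \<le> ennreal ((X (real m * T / 2^Suc n) w)\<^sup>2)"
        by (intro bexI[of _ "2 * k"]) auto
    qed
  qed
  then have "(\<integral>\<^sup>+w. grid_sup X w \<partial>M) = (SUP n. \<integral>\<^sup>+w. V n w \<partial>M)"
    unfolding grid_sup_def V_def[symmetric] using Vm by (intro nn_integral_monotone_convergence_SUP) auto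
  also have "\<dots> \<le> 4 * (\<integral>\<^sup>+w. ennreal ((X T w)\<^sup>2) \<partial>M)"
  proof (rule SUP_least)
    fix n :: nat
    have "(\<integral>\<^sup>+w. V n w \<partial>M) \<le> (\<integral>\<^sup>+w. ennreal ((running_max (\<lambda>k. \<bar>X (real k * T / 2^n) w\<bar>) (2^n))\<^sup>2) \<partial>M)"
      unfolding V_def
    proof (intro nn_integral_mono SUP_least)
      fix w k assume "k \<in> {..2^n::nat}"
      then have "\<bar>X (real k * T / 2^n) w\<bar> \<le> running_max (\<lambda>k. \<bar>X (real k * T / 2^n) w\<bar>) (2^n)"
        by (intro running_max_ge[of k _ "\<lambda>k. \<bar>X (real k * T / 2^n) w\<bar>"]) auto
      then show "ennreal ((X (real k * T / 2^n) w)\<^sup>2) \<le> ennreal ((running_max (\<lambda>k. \<bar>X (real k * T / 2^n) w\<bar>) (2^n))\<^sup>2)"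
        by (intro ennreal_leI) (metis abs_ge_zero power2_abs power_mono)
    qed
    also have "\<dots> \<le> 4 * (\<integral>\<^sup>+w. ennreal ((X (real (2^n) * T / 2^n) w)\<^sup>2) \<partial>M)"
      using T_pos grid_in by (intro Doob_discrete[OF X]) (auto simp: field_simps)
    finally show "(\<integral>\<^sup>+w. V n w \<partial>M) \<le> 4 * (\<integral>\<^sup>+w. ennreal ((X T w)\<^sup>2) \<partial>M)" by simp
  qed
  finally show ?thesis .
qed

lemma Doob_L2:
  assumes X: "L2_martingale X" and cont: "AE w in M. continuous_on {0..T} (\<lambda>t. X t w)"
  shows "(\<integral>\<^sup>+w. (SUP t\<in>{0..T}. ennreal ((X t w)\<^sup>2)) \<partial>M) \<le> 4 * (\<integral>\<^sup>+w. ennreal ((X T w)\<^sup>2) \<partial>M)"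
proof -
  have "(\<integral>\<^sup>+w. (SUP t\<in>{0..T}. ennreal ((X t w)\<^sup>2)) \<partial>M) \<le> (\<integral>\<^sup>+w. grid_sup X w \<partial>M)"
    using cont by (intro nn_integral_mono_AE) (auto elim!: eventually_mono intro!: SUP_least grid_sup_ge)
  also note Doob_grid_sup[OF X]
  finally show ?thesis .
qed

end

section \<open>Ito integral in L2: isometry, linearity and construction\<close>

section \<open>The Ito integral\<close>

lemma finite_measure_restrict_lborel: "finite_measure (restrict_space lborel {0..T::real})"
  by (rule finite_measureI) (simp add: emeasure_restrict_space space_restrict_space emeasure_lborel_Icc_eq)

lemma L2_lim_norm_square:
  fixes X :: "nat \<Rightarrow> 'a \<Rightarrow> 'b::{banach, second_countable_topology}"
  assumes X: "\<And>n. sqint M (X n)" and Y: "sqint M Y"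
    and lim: "(\<lambda>n. \<integral>\<^sup>+w. ennreal ((norm (X n w - Y w))\<^sup>2) \<partial>M) \<longlonglongrightarrow> 0"
  shows "(\<lambda>n. \<integral>w. (norm (X n w))\<^sup>2 \<partial>M) \<longlonglongrightarrow> (\<integral>w. (norm (Y w))\<^sup>2 \<partial>M)"
proof (rule L2_lim_square)
  show "sqint M (\<lambda>w. norm (X n w))" for n using X[of n] by (auto simp: sqint_def)
  show "sqint M (\<lambda>w. norm (Y w))" using Y by (auto simp: sqint_def)
  show "(\<lambda>n. \<integral>\<^sup>+w. ennreal ((norm (X n w) - norm (Y w))\<^sup>2) \<partial>M) \<longlonglongrightarrow> 0"
  proof (rule tendsto_sandwich[OF _ _ tendsto_const lim])
    have "(norm (X n w) - norm (Y w))\<^sup>2 \<le> (norm (X n w - Y w))\<^sup>2" for n w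
      using norm_triangle_ineq3[of "X n w" "Y w"] by (metis abs_ge_zero power2_abs power_mono)
    then show "\<forall>\<^sub>F n in sequentially. (\<integral>\<^sup>+w. ennreal ((norm (X n w) - norm (Y w))\<^sup>2) \<partial>M)
      \<le> (\<integral>\<^sup>+w. ennreal ((norm (X n w - Y w))\<^sup>2) \<partial>M)"
      by (intro always_eventually allI nn_integral_mono ennreal_leI)
  qed auto
qed

context brownian
begin

abbreviation J where "J \<equiv> simple_integral B"

abbreviation Nm :: "('w \<times> real) measure" where "Nm \<equiv> M \<Otimes>\<^sub>M restrict_space lborel {0..T}"

abbreviation Pr :: "('w \<times> real) measure" where "Pr \<equiv> predictable_sigma M F T"

lemma space_Nm: "space Nm = space M \<times> {0..T}"
  by (simp add: space_pair_measure space_restrict_space)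

lemma nn_integral_Nm:
  assumes "g \<in> borel_measurable Nm"
  shows "(\<integral>\<^sup>+p. g p \<partial>Nm) = (\<integral>\<^sup>+w. (\<integral>\<^sup>+s\<in>{0..T}. g (w, s) \<partial>lborel) \<partial>M)"
proof -
  interpret R: finite_measure "restrict_space lborel {0..T}" by (rule finite_measure_restrict_lborel)
  show ?thesis
    by (simp add: R.nn_integral_fst[OF assms, symmetric] nn_integral_restrict_space)
qed

lemma predictable_gens:
  "({A \<times> {0} | A. A \<in> sets (F 0)} \<union>
     {A \<times> {s<..t} | A s t. 0 \<le> s \<and> s \<le> t \<and> t \<le> T \<and> A \<in> sets (F s)}) \<subseteq> Pow (space M \<times> {0..T})"
  using sets.sets_into_space[of _ "F _"] T_pos by fastforce

lemma space_Pr: "space Pr = space M \<times> {0..T}"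
  unfolding predictable_sigma_def by (rule space_measure_of[OF predictable_gens])

lemma sets_Pr: "sets Pr = sigma_sets (space M \<times> {0..T}) ({A \<times> {0} | A. A \<in> sets (F 0)} \<union>
     {A \<times> {s<..t} | A s t. 0 \<le> s \<and> s \<le> t \<and> t \<le> T \<and> A \<in> sets (F s)})"
  unfolding predictable_sigma_def by (rule sets_measure_of[OF predictable_gens])

lemma Ioc_in_Pr: "0 \<le> s \<Longrightarrow> s \<le> t \<Longrightarrow> t \<le> T \<Longrightarrow> A \<in> sets (F s) \<Longrightarrow> A \<times> {s<..t} \<in> sets Pr"
  unfolding sets_Pr by (intro sigma_sets.Basic UnI2) auto

lemma zero_in_Pr: "A \<in> sets (F 0) \<Longrightarrow> A \<times> {0} \<in> sets Pr"
  unfolding sets_Pr by (intro sigma_sets.Basic UnI1) auto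

lemma sets_Pr_sub: "sets Pr \<subseteq> sets Nm"
  unfolding sets_Pr space_Nm[symmetric]
proof (rule sets.sigma_sets_subset, safe)
  fix A assume "A \<in> sets (F 0)"
  then have "A \<in> sets M" using sets_F_sub[of 0] T_pos by auto
  then show "A \<times> {0} \<in> sets Nm"
    using T_pos by (intro pair_measureI) (auto simp: sets_restrict_space image_iff intro!: bexI[of _ "{0}"])
next
  fix A s t assume *: "A \<in> sets (F s)" "0 \<le> s" "s \<le> t" "t \<le> T"
  then have "A \<in> sets M" using sets_F_sub[of s] by auto
  moreover have "{s<..t} \<in> sets (restrict_space lborel {0..T})"
    using * by (auto simp: sets_restrict_space image_iff intro!: bexI[of _ "{s<..t}"])
  ultimately show "A \<times> {s<..t} \<in> sets Nm" by (intro pair_measureI)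
qed

lemma Pr_Nm: "g \<in> measurable Pr N' \<Longrightarrow> g \<in> measurable Nm N'"
  using sets_Pr_sub by (auto simp: measurable_def space_Nm space_Pr)

lemma simple_term_predictable:
  fixes x :: "'w \<Rightarrow> real^'d"
  assumes ab: "0 \<le> a" "a \<le> b" "b \<le> T" and x: "x \<in> borel_measurable (F a)"
  shows "(\<lambda>(w, t). indicator {a<..b} t *\<^sub>R x w) \<in> borel_measurable Pr"
proof (rule measurableI)
  fix U :: "(real^'d) set" assume U: "U \<in> sets borel"
  have 1: "(x -` U \<inter> space M) \<times> {a<..b} \<in> sets Pr"
    using measurable_sets[OF x U] ab by (intro Ioc_in_Pr) auto
  have 2: "space M \<times> {a<..b} \<in> sets Pr"
    using sets.top[of "F a"] ab by (intro Ioc_in_Pr) auto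
  have "(\<lambda>(w, t). indicator {a<..b} t *\<^sub>R x w) -` U \<inter> space Pr =
    (x -` U \<inter> space M) \<times> {a<..b} \<union> (if 0 \<in> U then space Pr - space M \<times> {a<..b} else {})"
    using ab by (auto simp: space_Pr split: split_indicator split_indicator_asm if_splits)
  also have "\<dots> \<in> sets Pr" using 1 2 by (auto intro: sets.compl_sets)
  finally show "(\<lambda>(w, t). indicator {a<..b} t *\<^sub>R x w) -` U \<inter> space Pr \<in> sets Pr" .
qed simp

lemma simple_process_predictable:
  assumes "simple S" shows "(\<lambda>(w, t). simple_process S t w) \<in> borel_measurable Pr"
  using assms
proof (induction S)
  case (Cons z S)
  obtain a b x where z: "z = (a, b, x)" by (cases z)
  note ab = simpleD[OF Cons.prems, of a b x, unfolded z, simplified]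
  have S: "simple S" using Cons.prems by (simp add: simple_integrand_def)
  have "(\<lambda>p. (\<lambda>(w, t). indicator {a<..b} t *\<^sub>R x w) p + (\<lambda>(w, t). simple_process S t w) p) \<in> borel_measurable Pr"
    by (intro borel_measurable_add simple_term_predictable Cons.IH S ab)
  then show ?case by (simp add: z simple_process_def case_prod_unfold)
qed (simp add: simple_process_def)

text \<open>Replaces the iterated integral by one integral over the product with time, where the
  general L2 lemmas apply.\<close>

lemma H2_iff:
  "Z \<in> H2 M F T \<longleftrightarrow> (\<lambda>(w, t). Z t w) \<in> borel_measurable Pr \<and> sqint Nm (\<lambda>(w, t). Z t w)"
  (is "_ \<longleftrightarrow> ?P \<and> _")
proof -
  have "(\<integral>\<^sup>+p. ennreal ((norm ((\<lambda>(w, t). Z t w) p))\<^sup>2) \<partial>Nm) =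
     (\<integral>\<^sup>+w. (\<integral>\<^sup>+s\<in>{0..T}. ennreal ((norm (Z s w))\<^sup>2) \<partial>lborel) \<partial>M)" if ?P
    using Pr_Nm[OF that] by (subst nn_integral_Nm) auto
  note eq = this
  show ?thesis
  proof (cases ?P)
    case True
    then show ?thesis unfolding H2_def sqint_iff mem_Collect_eq eq[OF True] using Pr_Nm[OF True] by simp
  qed (simp add: H2_def)
qed

lemma simple_process_sqint:
  assumes "simple S" shows "sqint Nm (\<lambda>(w, t). simple_process S t w)"
proof -
  have "(\<lambda>t w. simple_process S t w) \<in> H2 M F T"
    unfolding H2_def mem_Collect_eq simple_integral_isometry_T[OF assms, symmetric]
    using simple_process_predictable[OF assms] simple_integral_sqint_T[OF assms] by (simp add: sqint_iff)
  then show ?thesis by (simp add: H2_iff)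
qed

lemma nn_integral_Nm_process_diff:
  assumes "(\<lambda>(w, t). X t w) \<in> borel_measurable Nm" "(\<lambda>(w, t). Y t w) \<in> borel_measurable Nm"
  shows "(\<integral>\<^sup>+p. ennreal ((norm ((\<lambda>(w, t). X t w) p - (\<lambda>(w, t). Y t w) p))\<^sup>2) \<partial>Nm) =
     (\<integral>\<^sup>+w. (\<integral>\<^sup>+s\<in>{0..T}. ennreal ((norm (X s w - Y s w :: 'b::{banach, second_countable_topology}))\<^sup>2) \<partial>lborel) \<partial>M)"
  using assms by (subst nn_integral_Nm) auto

lemma ito_cases:
  assumes "is_ito_integral M T B Z I"
  obtains S where "\<And>n. simple (S n)"
    "(\<lambda>n. \<integral>\<^sup>+w. (\<integral>\<^sup>+s\<in>{0..T}. ennreal ((norm (simple_process (S n) s w - Z s w))\<^sup>2) \<partial>lborel) \<partial>M) \<longlonglongrightarrow> 0"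
    "\<And>t. t \<in> {0..T} \<Longrightarrow> (\<lambda>n. \<integral>\<^sup>+w. ennreal ((J (S n) t w - I t w)\<^sup>2) \<partial>M) \<longlonglongrightarrow> 0"
    "\<And>t. t \<in> {0..T} \<Longrightarrow> I t \<in> borel_measurable (F t)" "\<And>t. t \<in> {0..T} \<Longrightarrow> sqint M (I t)"
proof -
  from assms obtain S where S: "\<And>n. simple (S n)"
    and 1: "(\<lambda>n. \<integral>\<^sup>+w. (\<integral>\<^sup>+s\<in>{0..T}. ennreal ((norm (simple_process (S n) s w - Z s w))\<^sup>2) \<partial>lborel) \<partial>M) \<longlonglongrightarrow> 0"
    and lim: "\<And>t. t \<in> {0..T} \<Longrightarrow> (\<lambda>n. \<integral>\<^sup>+w. ennreal ((J (S n) t w - I t w)\<^sup>2) \<partial>M) \<longlonglongrightarrow> 0"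
    and I: "\<And>t. t \<in> {0..T} \<Longrightarrow> I t \<in> borel_measurable (F t)"
    unfolding is_ito_integral_def adapted_def by blast
  have "sqint M (I t)" if t: "t \<in> {0..T}" for t
  proof -
    have "\<forall>\<^sub>F n in sequentially. (\<integral>\<^sup>+w. ennreal ((J (S n) t w - I t w)\<^sup>2) \<partial>M) < 1"
      using lim[OF t] by (rule order_tendstoD) simp
    then obtain n where "(\<integral>\<^sup>+w. ennreal ((J (S n) t w - I t w)\<^sup>2) \<partial>M) < 1"
      by (auto simp: eventually_sequentially)
    then have *: "(\<integral>\<^sup>+w. ennreal ((J (S n) t w - I t w)\<^sup>2) \<partial>M) < \<infinity>" by (rule order.strict_trans) simp
    show ?thesis
      using measurable_F_M[OF I[OF t]] t * by (intro sqint_of_L2_close[OF simple_integral_sqint[OF S[of n]]]) auto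
  qed
  then show ?thesis using that S 1 lim I by blast
qed

lemma L2_lim_diff_zero:
  fixes X :: "nat \<Rightarrow> 'a \<Rightarrow> 'b::{banach, second_countable_topology}"
  assumes [measurable]: "\<And>n. X n \<in> borel_measurable N'" "\<And>n. X' n \<in> borel_measurable N'"
      "Y \<in> borel_measurable N'" "Y' \<in> borel_measurable N'"
    and lim: "(\<lambda>n. \<integral>\<^sup>+w. ennreal ((norm (X n w - Y w))\<^sup>2) \<partial>N') \<longlonglongrightarrow> 0"
      "(\<lambda>n. \<integral>\<^sup>+w. ennreal ((norm (X' n w - Y' w))\<^sup>2) \<partial>N') \<longlonglongrightarrow> 0"
  shows "(\<lambda>n. \<integral>\<^sup>+w. ennreal ((norm ((X n w - X' n w) - (Y w - Y' w)))\<^sup>2) \<partial>N') \<longlonglongrightarrow> 0"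
proof (rule tendsto_sandwich[OF _ _ tendsto_const])
  show "\<forall>\<^sub>F n in sequentially. (\<integral>\<^sup>+w. ennreal ((norm ((X n w - X' n w) - (Y w - Y' w)))\<^sup>2) \<partial>N')
     \<le> 2 * (\<integral>\<^sup>+w. ennreal ((norm (X n w - Y w))\<^sup>2) \<partial>N') + 2 * (\<integral>\<^sup>+w. ennreal ((norm (X' n w - Y' w))\<^sup>2) \<partial>N')"
  proof (rule always_eventually, rule allI)
    fix n
    have "(\<integral>\<^sup>+w. ennreal ((norm ((X n w - Y w) + (Y' w - X' n w)))\<^sup>2) \<partial>N') \<le>
      2 * (\<integral>\<^sup>+w. ennreal ((norm (X n w - Y w))\<^sup>2) \<partial>N') + 2 * (\<integral>\<^sup>+w. ennreal ((norm (Y' w - X' n w))\<^sup>2) \<partial>N')"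
      by (rule nn_integral_norm_add_le) auto
    then show "(\<integral>\<^sup>+w. ennreal ((norm ((X n w - X' n w) - (Y w - Y' w)))\<^sup>2) \<partial>N')
     \<le> 2 * (\<integral>\<^sup>+w. ennreal ((norm (X n w - Y w))\<^sup>2) \<partial>N') + 2 * (\<integral>\<^sup>+w. ennreal ((norm (X' n w - Y' w))\<^sup>2) \<partial>N')"
      by (simp add: norm_minus_commute algebra_simps)
  qed
  have "(\<lambda>n. 2 * (\<integral>\<^sup>+w. ennreal ((norm (X n w - Y w))\<^sup>2) \<partial>N') + 2 * (\<integral>\<^sup>+w. ennreal ((norm (X' n w - Y' w))\<^sup>2) \<partial>N')) \<longlonglongrightarrow> 2 * 0 + 2 * 0"
    by (intro tendsto_add ennreal_tendsto_cmult lim) auto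
  then show "(\<lambda>n. 2 * (\<integral>\<^sup>+w. ennreal ((norm (X n w - Y w))\<^sup>2) \<partial>N') + 2 * (\<integral>\<^sup>+w. ennreal ((norm (X' n w - Y' w))\<^sup>2) \<partial>N')) \<longlonglongrightarrow> 0"
    by simp
qed auto

lemma ito_increment_lim:
  assumes S: "\<And>n. simple (S n)" and I: "\<And>t. t \<in> {0..T} \<Longrightarrow> sqint M (I t)"
    and lim: "\<And>t. t \<in> {0..T} \<Longrightarrow> (\<lambda>n. \<integral>\<^sup>+w. ennreal ((J (S n) t w - I t w)\<^sup>2) \<partial>M) \<longlonglongrightarrow> 0"
    and st: "0 \<le> s" "s \<le> t" "t \<le> T"
  shows "(\<lambda>n. \<integral>\<^sup>+w. ennreal (((J (S n) t w - J (S n) s w) - (I t w - I s w))\<^sup>2) \<partial>M) \<longlonglongrightarrow> 0"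
proof -
  have t: "t \<in> {0..T}" and s: "s \<in> {0..T}" using st by auto
  note JM = sqint_measurable[OF simple_integral_sqint[OF S]]
  show ?thesis
    using L2_lim_diff_zero[OF JM[of t] JM[of s] sqint_measurable[OF I[OF t]] sqint_measurable[OF I[OF s]]]
      lim[OF t] lim[OF s] t s by simp
qed

text \<open>Orthogonality holds for the simple integrals and survives mean-square limits by
  Cauchy-Schwarz.\<close>

lemma ito_L2_martingale:
  assumes "is_ito_integral M T B Z I" shows "L2_martingale I"
proof -
  obtain S where S: "\<And>n. simple (S n)"
    and lim: "\<And>t. t \<in> {0..T} \<Longrightarrow> (\<lambda>n. \<integral>\<^sup>+w. ennreal ((J (S n) t w - I t w)\<^sup>2) \<partial>M) \<longlonglongrightarrow> 0"
    and I: "\<And>t. t \<in> {0..T} \<Longrightarrow> I t \<in> borel_measurable (F t)" "\<And>t. t \<in> {0..T} \<Longrightarrow> sqint M (I t)"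
    by (rule ito_cases[OF assms]) (rule that)
  have "expectation (\<lambda>w. y w * (I t w - I s w)) = 0"
    if st: "0 \<le> s" "s \<le> t" "t \<le> T" and y: "y \<in> borel_measurable (F s)" "sqint M y" for s t y
  proof -
    have "(\<lambda>n. expectation (\<lambda>w. (J (S n) t w - J (S n) s w) * y w)) \<longlonglongrightarrow> expectation (\<lambda>w. (I t w - I s w) * y w)"
      using st by (intro L2_lim_mult y sqint_diff simple_integral_sqint S I(2) ito_increment_lim[OF S I(2) lim]) auto
    moreover have "expectation (\<lambda>w. (J (S n) t w - J (S n) s w) * y w) = 0" for n
      using simple_integral_martingale[OF S st y] by (simp add: mult.commute)
    ultimately show ?thesis using LIMSEQ_unique[OF tendsto_const] by (force simp: mult.commute)
  qed
  with I show ?thesis unfolding L2_martingale_def by auto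
qed

lemma ito_isometry:
  assumes ito: "is_ito_integral M T B Z I" and Z: "Z \<in> H2 M F T" and st: "0 \<le> s" "s \<le> t" "t \<le> T"
  shows "(\<integral>\<^sup>+w. ennreal ((I t w - I s w)\<^sup>2) \<partial>M) = (\<integral>\<^sup>+w. (\<integral>\<^sup>+r\<in>{s<..t}. ennreal ((norm (Z r w))\<^sup>2) \<partial>lborel) \<partial>M)"
proof -
  obtain S where S: "\<And>n. simple (S n)"
    and limZ: "(\<lambda>n. \<integral>\<^sup>+w. (\<integral>\<^sup>+s\<in>{0..T}. ennreal ((norm (simple_process (S n) s w - Z s w))\<^sup>2) \<partial>lborel) \<partial>M) \<longlonglongrightarrow> 0"
    and lim: "\<And>t. t \<in> {0..T} \<Longrightarrow> (\<lambda>n. \<integral>\<^sup>+w. ennreal ((J (S n) t w - I t w)\<^sup>2) \<partial>M) \<longlonglongrightarrow> 0"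
    and I: "\<And>t. t \<in> {0..T} \<Longrightarrow> sqint M (I t)"
    by (rule ito_cases[OF ito]) (rule that)
  \<comment> \<open>Multiplication by the indicator of (s, t] turns the window of integration into
    an integrand on [0, T], so that convergence of norms on the product space applies.\<close>
  define P where "P X = (\<lambda>(w, r). indicator {s<..t} r *\<^sub>R X r w)" for X :: "real \<Rightarrow> 'w \<Rightarrow> real^'d"
  have PX: "sqint Nm (P X)" if "sqint Nm (\<lambda>(w, r). X r w)" for X
  proof (rule sqint_mono[OF that, where K=1])
    have [measurable]: "(\<lambda>(w, r). X r w) \<in> borel_measurable Nm" using that by (rule sqint_measurable)
    have [measurable]: "(\<lambda>p. indicator {s<..t} (snd p) :: real) \<in> borel_measurable Nm"
      by (rule measurable_compose[OF measurable_snd]) (auto intro!: measurable_restrict_space1)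
    have "(\<lambda>p. indicator {s<..t} (snd p) *\<^sub>R (\<lambda>(w, r). X r w) p) \<in> borel_measurable Nm" by measurable
    then show "P X \<in> borel_measurable Nm" by (simp add: P_def case_prod_unfold)
  qed (auto simp: P_def indicator_def)
  have PXn: "(\<integral>p. (norm (P X p))\<^sup>2 \<partial>Nm) = enn2real (\<integral>\<^sup>+w. (\<integral>\<^sup>+r\<in>{s<..t}. ennreal ((norm (X r w))\<^sup>2) \<partial>lborel) \<partial>M)"
     and PXe: "(\<integral>\<^sup>+w. (\<integral>\<^sup>+r\<in>{s<..t}. ennreal ((norm (X r w))\<^sup>2) \<partial>lborel) \<partial>M) < \<infinity>"
    if X: "sqint Nm (\<lambda>(w, r). X r w)" for X
  proof -
    have m: "(\<lambda>p. ennreal ((norm (P X p))\<^sup>2)) \<in> borel_measurable Nm" using sqint_measurable[OF PX[OF X]] by measurable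
    have "(\<integral>\<^sup>+p. ennreal ((norm (P X p))\<^sup>2) \<partial>Nm) = (\<integral>\<^sup>+w. (\<integral>\<^sup>+r\<in>{s<..t}. ennreal ((norm (X r w))\<^sup>2) \<partial>lborel) \<partial>M)"
      unfolding nn_integral_Nm[OF m] using st
      by (intro nn_integral_cong) (auto simp: P_def indicator_def)
    then have e: "(\<integral>\<^sup>+w. (\<integral>\<^sup>+r\<in>{s<..t}. ennreal ((norm (X r w))\<^sup>2) \<partial>lborel) \<partial>M) = ennreal (\<integral>p. (norm (P X p))\<^sup>2 \<partial>Nm)"
      using sqint_nn_integral[OF PX[OF X]] by simp
    show "(\<integral>p. (norm (P X p))\<^sup>2 \<partial>Nm) = enn2real (\<integral>\<^sup>+w. (\<integral>\<^sup>+r\<in>{s<..t}. ennreal ((norm (X r w))\<^sup>2) \<partial>lborel) \<partial>M)"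
     "(\<integral>\<^sup>+w. (\<integral>\<^sup>+r\<in>{s<..t}. ennreal ((norm (X r w))\<^sup>2) \<partial>lborel) \<partial>M) < \<infinity>"
      unfolding e by simp_all
  qed
  have Zs: "sqint Nm (\<lambda>(w, r). Z r w)" using Z by (simp add: H2_iff)
  note Ss = simple_process_sqint[OF S]
  have "(\<lambda>n. \<integral>p. (norm (P (simple_process (S n)) p))\<^sup>2 \<partial>Nm) \<longlonglongrightarrow> (\<integral>p. (norm (P Z p))\<^sup>2 \<partial>Nm)"
  proof (rule L2_lim_norm_square[OF PX[OF Ss] PX[OF Zs]])
    have *: "(\<lambda>n. \<integral>\<^sup>+p. ennreal ((norm ((\<lambda>(w, t). simple_process (S n) t w) p - (\<lambda>(w, t). Z t w) p))\<^sup>2) \<partial>Nm) \<longlonglongrightarrow> 0"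
      using limZ by (subst nn_integral_Nm_process_diff[OF sqint_measurable[OF Ss] sqint_measurable[OF Zs]])
    show "(\<lambda>n. \<integral>\<^sup>+p. ennreal ((norm (P (simple_process (S n)) p - P Z p))\<^sup>2) \<partial>Nm) \<longlonglongrightarrow> 0"
      by (rule tendsto_sandwich[OF _ _ tendsto_const *])
        (auto intro!: always_eventually nn_integral_mono simp: P_def indicator_def)
  qed
  moreover have "(\<integral>p. (norm (P (simple_process (S n)) p))\<^sup>2 \<partial>Nm) = expectation (\<lambda>w. (J (S n) t w - J (S n) s w)\<^sup>2)" for n
    using PXn[OF Ss[of n]] simple_integral_isometry[OF S[of n] st] sqint_nn_integral[OF simple_integral_diff_sqint[OF S[of n] st]]
    by simp
  moreover have "(\<lambda>n. expectation (\<lambda>w. (J (S n) t w - J (S n) s w)\<^sup>2)) \<longlonglongrightarrow> expectation (\<lambda>w. (I t w - I s w)\<^sup>2)"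
    using st by (intro L2_lim_square sqint_diff simple_integral_sqint S I ito_increment_lim[OF S I lim]) auto
  ultimately have "(\<integral>p. (norm (P Z p))\<^sup>2 \<partial>Nm) = expectation (\<lambda>w. (I t w - I s w)\<^sup>2)"
    using LIMSEQ_unique by fastforce
  moreover have "(\<integral>\<^sup>+w. ennreal ((I t w - I s w)\<^sup>2) \<partial>M) = ennreal (expectation (\<lambda>w. (I t w - I s w)\<^sup>2))"
    using sqint_nn_integral[OF sqint_diff[OF I[of t] I[of s]]] st by simp
  moreover have "ennreal (enn2real (\<integral>\<^sup>+w. (\<integral>\<^sup>+r\<in>{s<..t}. ennreal ((norm (Z r w))\<^sup>2) \<partial>lborel) \<partial>M))
      = (\<integral>\<^sup>+w. (\<integral>\<^sup>+r\<in>{s<..t}. ennreal ((norm (Z r w))\<^sup>2) \<partial>lborel) \<partial>M)"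
    using PXe[OF Zs] by (intro ennreal_enn2real) simp
  ultimately show ?thesis using PXn[OF Zs] by simp
qed

lemma ito_diff:
  assumes "is_ito_integral M T B Z I" "is_ito_integral M T B Z' I'" and Z: "Z \<in> H2 M F T" "Z' \<in> H2 M F T"
  shows "is_ito_integral M T B (\<lambda>t w. Z t w - Z' t w) (\<lambda>t w. I t w - I' t w)"
proof -
  obtain S where S: "\<And>n. simple (S n)"
    and limZ: "(\<lambda>n. \<integral>\<^sup>+w. (\<integral>\<^sup>+s\<in>{0..T}. ennreal ((norm (simple_process (S n) s w - Z s w))\<^sup>2) \<partial>lborel) \<partial>M) \<longlonglongrightarrow> 0"
    and lim: "\<And>t. t \<in> {0..T} \<Longrightarrow> (\<lambda>n. \<integral>\<^sup>+w. ennreal ((J (S n) t w - I t w)\<^sup>2) \<partial>M) \<longlonglongrightarrow> 0"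
    and I: "\<And>t. t \<in> {0..T} \<Longrightarrow> I t \<in> borel_measurable (F t)" "\<And>t. t \<in> {0..T} \<Longrightarrow> sqint M (I t)"
    by (rule ito_cases[OF assms(1)]) (rule that)
  obtain S' where S': "\<And>n. simple (S' n)"
    and limZ': "(\<lambda>n. \<integral>\<^sup>+w. (\<integral>\<^sup>+s\<in>{0..T}. ennreal ((norm (simple_process (S' n) s w - Z' s w))\<^sup>2) \<partial>lborel) \<partial>M) \<longlonglongrightarrow> 0"
    and lim': "\<And>t. t \<in> {0..T} \<Longrightarrow> (\<lambda>n. \<integral>\<^sup>+w. ennreal ((J (S' n) t w - I' t w)\<^sup>2) \<partial>M) \<longlonglongrightarrow> 0"
    and I': "\<And>t. t \<in> {0..T} \<Longrightarrow> I' t \<in> borel_measurable (F t)" "\<And>t. t \<in> {0..T} \<Longrightarrow> sqint M (I' t)"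
    by (rule ito_cases[OF assms(2)]) (rule that)
  define D where "D n = S n @ scale_simple (- 1) (S' n)" for n
  have D: "simple (D n)" for n unfolding D_def by (intro simple_append simple_scale S S')
  have DJ: "J (D n) t w = J (S n) t w - J (S' n) t w" and DP: "simple_process (D n) t w = simple_process (S n) t w - simple_process (S' n) t w" for n t w
    by (simp_all add: D_def simple_integral_append simple_integral_scale simple_process_append simple_process_scale)
  note Zm = sqint_measurable[OF conjunct2[OF Z(1)[unfolded H2_iff]]] sqint_measurable[OF conjunct2[OF Z(2)[unfolded H2_iff]]]
  note Sm = sqint_measurable[OF simple_process_sqint[OF S]] sqint_measurable[OF simple_process_sqint[OF S']] sqint_measurable[OF simple_process_sqint[OF D]]
  have "(\<lambda>n. \<integral>\<^sup>+p. ennreal ((norm (((\<lambda>(w, t). simple_process (S n) t w) p - (\<lambda>(w, t). simple_process (S' n) t w) p) -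
       ((\<lambda>(w, t). Z t w) p - (\<lambda>(w, t). Z' t w) p)))\<^sup>2) \<partial>Nm) \<longlonglongrightarrow> 0"
    using limZ limZ' by (intro L2_lim_diff_zero Zm Sm) (subst nn_integral_Nm_process_diff[OF Sm(1) Zm(1)] nn_integral_Nm_process_diff[OF Sm(2) Zm(2)], assumption)+
  then have "(\<lambda>n. \<integral>\<^sup>+p. ennreal ((norm ((\<lambda>(w, t). simple_process (D n) t w) p - (\<lambda>(w, t). Z t w - Z' t w) p))\<^sup>2) \<partial>Nm) \<longlonglongrightarrow> 0"
    by (simp add: DP case_prod_unfold)
  moreover have "(\<lambda>(w, t). Z t w - Z' t w) \<in> borel_measurable Nm"
    using borel_measurable_diff[OF Zm] by (simp add: case_prod_unfold)
  ultimately have 1: "(\<lambda>n. \<integral>\<^sup>+w. (\<integral>\<^sup>+s\<in>{0..T}. ennreal ((norm (simple_process (D n) s w - (Z s w - Z' s w)))\<^sup>2) \<partial>lborel) \<partial>M) \<longlonglongrightarrow> 0"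
    by (subst (asm) nn_integral_Nm_process_diff[OF Sm(3)])
  have 2: "(\<lambda>n. \<integral>\<^sup>+w. ennreal ((J (D n) t w - (I t w - I' t w))\<^sup>2) \<partial>M) \<longlonglongrightarrow> 0" if t: "t \<in> {0..T}" for t
    using L2_lim_diff_zero[OF sqint_measurable[OF simple_integral_sqint[OF S, of t]] sqint_measurable[OF simple_integral_sqint[OF S', of t]]
      sqint_measurable[OF I(2)[OF t]] sqint_measurable[OF I'(2)[OF t]]] t lim[OF t] lim'[OF t] by (simp add: DJ)
  show ?thesis
    unfolding is_ito_integral_def adapted_def
  proof (intro conjI ballI exI[of _ D] allI D 1 2)
    show "(\<lambda>w. I t w - I' t w) \<in> borel_measurable (F t)" if "t \<in> {0..T}" for t
      using I(1)[OF that] I'(1)[OF that] by measurable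
    show "continuous_on {0..T} (\<lambda>t. I t w - I' t w)" if "w \<in> space M" for w
      using assms(1,2) that by (auto simp: is_ito_integral_def intro!: continuous_intros)
  qed
qed

end

lemma ennreal_eq_0_of_le_power:
  fixes x :: ennreal
  assumes "\<And>n. x \<le> ennreal (C * (1/4)^n)" shows "x = 0"
proof -
  have "(\<lambda>n. ennreal (C * (1/4)^n)) \<longlonglongrightarrow> ennreal (C * 0)"
    by (intro tendsto_ennrealI tendsto_mult tendsto_const LIMSEQ_power_zero) auto
  then have "x \<le> ennreal (C * 0)" using assms by (intro LIMSEQ_le_const) auto
  then show ?thesis by simp
qed

lemma tendsto_0_of_le_power:
  fixes x :: "nat \<Rightarrow> ennreal"
  assumes "\<And>n. x n \<le> ennreal (C * (1/4)^n)" shows "x \<longlonglongrightarrow> 0"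
proof (rule tendsto_sandwich[OF _ _ tendsto_const])
  have "(\<lambda>n. ennreal (C * (1/4)^n)) \<longlonglongrightarrow> ennreal (C * 0)"
    by (intro tendsto_ennrealI tendsto_mult tendsto_const LIMSEQ_power_zero) auto
  then show "(\<lambda>n. ennreal (C * (1/4)^n)) \<longlonglongrightarrow> 0" by simp
qed (use assms in auto)

context brownian
begin

text \<open>Only convergence of terminal values is assumed. The isometry carries the Cauchy property
  over to the integrands, which yields \<open>Z\<close>; Doob's inequality carries it over to the
  suprema of the paths, which yields a continuous \<open>I\<close>. Both therefore come from one
  sequence.\<close>

lemma ito_exists:
  assumes S0: "\<And>n. simple (S0 n)" and \<zeta>: "\<zeta> \<in> borel_measurable M"
    and lim0: "(\<lambda>n. \<integral>\<^sup>+w. ennreal ((J (S0 n) T w - \<zeta> w)\<^sup>2) \<partial>M) \<longlonglongrightarrow> 0"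
  obtains Z I where "Z \<in> H2 M F T" "is_ito_integral M T B Z I" "AE w in M. I T w = \<zeta> w"
proof -
  \<comment> \<open>Geometric errors are chosen so that the suprema of successive path differences
    decay geometrically almost surely.\<close>
  have "\<exists>S. simple S \<and> (\<integral>\<^sup>+w. ennreal ((J S T w - \<zeta> w)\<^sup>2) \<partial>M) \<le> ennreal ((1/4)^k)" for k :: nat
  proof -
    have "\<forall>\<^sub>F n in sequentially. (\<integral>\<^sup>+w. ennreal ((J (S0 n) T w - \<zeta> w)\<^sup>2) \<partial>M) < ennreal ((1/4)^k)"
      using lim0 by (rule order_tendstoD) (simp add: ennreal_zero_less_one)
    then show ?thesis using S0 by (auto simp: eventually_sequentially intro: less_imp_le)
  qed
  then obtain S where S: "\<And>k. simple (S k)"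
      and close: "\<And>k. (\<integral>\<^sup>+w. ennreal ((J (S k) T w - \<zeta> w)\<^sup>2) \<partial>M) \<le> ennreal ((1/4)^k)" by metis
  have JM [measurable]: "J (S k) t \<in> borel_measurable M" if "t \<in> {0..T}" for k t
    using sqint_measurable[OF simple_integral_sqint[OF S]] that by auto
  define D where "D m n = S m @ scale_simple (- 1) (S n)" for m n
  have D: "simple (D m n)" for m n unfolding D_def by (intro simple_append simple_scale S)
  have DJ: "J (D m n) t w = J (S m) t w - J (S n) t w" and DP: "simple_process (D m n) t w = simple_process (S m) t w - simple_process (S n) t w" for m n t w
    by (simp_all add: D_def simple_integral_append simple_integral_scale simple_process_append simple_process_scale)
  have TT: "T \<in> {0..T}" using T_pos by simp
  have cauchy: "(\<integral>\<^sup>+w. ennreal ((J (S m) T w - J (S n) T w)\<^sup>2) \<partial>M) \<le> ennreal (4 * (1/4)^k)"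
    if "k \<le> m" "k \<le> n" for k m n
  proof -
    have "(\<integral>\<^sup>+w. ennreal ((norm ((J (S m) T w - \<zeta> w) + (\<zeta> w - J (S n) T w)))\<^sup>2) \<partial>M) \<le>
        2 * (\<integral>\<^sup>+w. ennreal ((norm (J (S m) T w - \<zeta> w))\<^sup>2) \<partial>M) + 2 * (\<integral>\<^sup>+w. ennreal ((norm (\<zeta> w - J (S n) T w))\<^sup>2) \<partial>M)"
      using \<zeta> JM[OF TT] by (intro nn_integral_norm_add_le) auto
    also have "\<dots> \<le> 2 * ennreal ((1/4)^k) + 2 * ennreal ((1/4)^k)"
    proof (intro add_mono mult_left_mono)
      have p: "ennreal ((1/4)^m) \<le> ennreal ((1/4)^k)" if "k \<le> m" for m
        using that by (intro ennreal_leI power_decreasing) auto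
      show "(\<integral>\<^sup>+w. ennreal ((norm (J (S m) T w - \<zeta> w))\<^sup>2) \<partial>M) \<le> ennreal ((1/4)^k)"
        using order_trans[OF close p[OF that(1)]] by simp
      show "(\<integral>\<^sup>+w. ennreal ((norm (\<zeta> w - J (S n) T w))\<^sup>2) \<partial>M) \<le> ennreal ((1/4)^k)"
        using order_trans[OF close p[OF that(2)]] by (simp add: power2_commute)
    qed auto
    also have "\<dots> = 4 * ennreal ((1/4)^k)" by (simp flip: distrib_right)
    also have "\<dots> = ennreal (4 * (1/4)^k)" by (simp add: ennreal_mult)
    finally show ?thesis by simp
  qed
  have cauchy_t: "(\<integral>\<^sup>+w. ennreal ((J (S m) t w - J (S n) t w)\<^sup>2) \<partial>M) \<le> ennreal (4 * (1/4)^k)"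
    if "k \<le> m" "k \<le> n" and t: "t \<in> {0..T}" for k m n t
  proof -
    \<comment> \<open>By the isometry the second moment of a simple integral grows with its upper
      limit, so the terminal bound is valid at every \<open>t\<close>.\<close>
    have "(\<integral>\<^sup>+w. ennreal ((J (D m n) t w)\<^sup>2) \<partial>M) \<le> (\<integral>\<^sup>+w. ennreal ((J (D m n) T w)\<^sup>2) \<partial>M)"
      using simple_integral_isometry[OF D[of m n], of 0 t] simple_integral_isometry[OF D[of m n], of 0 T] t
      by (auto simp: simple_integral_0[OF D] intro!: nn_integral_mono split: split_indicator)
    then show ?thesis using cauchy[OF that(1,2)] by (simp add: DJ)
  qed
  define X where "X n = (\<lambda>(w, t). simple_process (S n) t w)" for n
  have X: "X n \<in> borel_measurable Pr" for n unfolding X_def by (rule simple_process_predictable[OF S])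
  have Xsq: "sqint Nm (X n)" for n unfolding X_def by (rule simple_process_sqint[OF S])
  have XX: "(\<integral>\<^sup>+p. ennreal ((norm (X m p - X n p))\<^sup>2) \<partial>Nm) = (\<integral>\<^sup>+w. ennreal ((J (S m) T w - J (S n) T w)\<^sup>2) \<partial>M)" for m n
    unfolding X_def
    by (subst nn_integral_Nm_process_diff[OF simple_process_sqint[OF S, THEN sqint_measurable] simple_process_sqint[OF S, THEN sqint_measurable]])
      (simp add: simple_integral_isometry_T[OF D, of m n, unfolded DJ DP])
  have "\<exists>n0. \<forall>m\<ge>n0. \<forall>n\<ge>n0. (\<integral>\<^sup>+p. ennreal ((norm (X m p - X n p))\<^sup>2) \<partial>Nm) < ennreal e" if "e > 0" for e :: real
  proof -
    have "(\<lambda>k. 4 * (1/4::real)^k) \<longlonglongrightarrow> 4 * 0" by (intro tendsto_intros LIMSEQ_power_zero) auto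
    then have "\<forall>\<^sub>F k in sequentially. 4 * (1/4::real)^k < e" using that by (intro order_tendstoD) auto
    then obtain k where "4 * (1/4::real)^k < e" by (auto simp: eventually_sequentially)
    then have "ennreal (4 * (1/4)^k) < ennreal e" by (intro ennreal_lessI that)
    then show ?thesis unfolding XX using cauchy by (intro exI[of _ k]) (blast intro: order_le_less_trans)
  qed
  \<comment> \<open>Completeness is applied with the predictable sigma-algebra as the smaller one,
    so the limit integrand is predictable on the nose and not only up to a null set.\<close>
  then obtain Y where Y: "Y \<in> borel_measurable Pr" and limY: "(\<lambda>n. \<integral>\<^sup>+p. ennreal ((norm (X n p - Y p))\<^sup>2) \<partial>Nm) \<longlonglongrightarrow> 0"
    by (rule L2_complete[OF X _ sets_Pr_sub, rotated]) (auto simp: space_Nm space_Pr)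
  define Z where "Z t w = Y (w, t)" for t w
  have Ysq: "sqint Nm Y"
  proof -
    have "\<forall>\<^sub>F n in sequentially. (\<integral>\<^sup>+p. ennreal ((norm (X n p - Y p))\<^sup>2) \<partial>Nm) < 1"
      using limY by (rule order_tendstoD) simp
    then obtain n where "(\<integral>\<^sup>+p. ennreal ((norm (X n p - Y p))\<^sup>2) \<partial>Nm) < 1" by (auto simp: eventually_sequentially)
    then show ?thesis using Pr_Nm[OF Y] by (intro sqint_of_L2_close[OF Xsq[of n]]) (auto intro: order.strict_trans)
  qed
  have YZ: "(\<lambda>(w, t). Z t w) = Y" by (auto simp: Z_def)
  have Z: "Z \<in> H2 M F T" unfolding H2_iff YZ using Y Ysq by simp
  have limZ: "(\<lambda>n. \<integral>\<^sup>+w. (\<integral>\<^sup>+s\<in>{0..T}. ennreal ((norm (simple_process (S n) s w - Z s w))\<^sup>2) \<partial>lborel) \<partial>M) \<longlonglongrightarrow> 0"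
    using limY unfolding YZ[symmetric] X_def
    by (subst (asm) nn_integral_Nm_process_diff[OF simple_process_sqint[OF S, THEN sqint_measurable]])
      (use Pr_Nm[OF Y] in \<open>simp_all add: YZ\<close>)

  define V where "V n = grid_sup (J (D (Suc n) n))" for n
  have Vm: "V n \<in> borel_measurable M" for n
    unfolding V_def using simple_integral_sqint[OF D] by (intro grid_sup_measurable) (auto simp: sqint_def)
  have V: "(\<integral>\<^sup>+w. V n w \<partial>M) \<le> ennreal (16 * (1/4)^n)" for n
  proof -
    have "(\<integral>\<^sup>+w. V n w \<partial>M) \<le> 4 * (\<integral>\<^sup>+w. ennreal ((J (D (Suc n) n) T w)\<^sup>2) \<partial>M)"
      unfolding V_def by (rule Doob_grid_sup[OF simple_integral_L2_martingale[OF D]])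
    also have "\<dots> \<le> 4 * ennreal (4 * (1/4)^n)"
      unfolding DJ by (intro mult_left_mono cauchy) auto
    also have "\<dots> = ennreal (16 * (1/4)^n)" by (simp add: ennreal_mult'[symmetric] flip: ennreal_numeral)
    finally show ?thesis .
  qed
  have contJ: "AE w in M. \<forall>n. continuous_on {0..T} (\<lambda>t. J (S n) t w)"
    using simple_integral_continuous[OF S] by (simp add: AE_all_countable)
  have "AE w in M. \<exists>K. \<forall>n. V n w \<le> ennreal (K * (1/2)^n)"
    by (rule AE_geometric_bound[OF Vm _ V]) simp
  then have "AE w in M. (\<forall>n. continuous_on {0..T} (\<lambda>t. J (S n) t w)) \<and> uniformly_convergent_on {0..T} (\<lambda>n t. J (S n) t w)"
    using contJ
  proof eventually_elim
    case (elim w)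
    then obtain K where K: "\<And>n. V n w \<le> ennreal (K * (1/2)^n)" by auto
    have "uniformly_convergent_on {0..T} (\<lambda>n t. J (S n) t w)"
    proof (rule uniformly_convergent_geometric[where K="max K 0"])
      fix n t assume t: "t \<in> {0..T}"
      have "continuous_on {0..T} (\<lambda>t. J (D (Suc n) n) t w)"
        unfolding DJ using elim(2) by (intro continuous_on_diff) auto
      then have "ennreal ((J (D (Suc n) n) t w)\<^sup>2) \<le> V n w" unfolding V_def by (rule grid_sup_ge[OF _ t])
      also have "\<dots> \<le> ennreal (max K 0 * (1/2)^n)"
        by (rule order_trans[OF K]) (intro ennreal_leI mult_right_mono, auto)
      finally show "(norm (J (S (Suc n)) t w - J (S n) t w))\<^sup>2 \<le> max K 0 * (1/2)^n"
        by (subst (asm) ennreal_le_iff) (auto simp: DJ)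
    qed
    with elim show ?case by auto
  qed
  then obtain N0 where N0: "N0 \<in> null_sets M"
    and good: "\<And>w. w \<in> space M \<Longrightarrow> w \<notin> N0 \<Longrightarrow> (\<forall>n. continuous_on {0..T} (\<lambda>t. J (S n) t w)) \<and> uniformly_convergent_on {0..T} (\<lambda>n t. J (S n) t w)"
    by (auto simp: eventually_ae_filter)
  \<comment> \<open>The value 0 on the exceptional set makes every path continuous. Adaptedness
    survives because null sets belong to every \<open>F t\<close>.\<close>
  define I where "I t w = (if w \<in> N0 then 0 else lim (\<lambda>n. J (S n) t w))" for t w
  have ul: "uniform_limit {0..T} (\<lambda>n t. J (S n) t w) (\<lambda>t. I t w) sequentially" if "w \<in> space M" "w \<notin> N0" for w
    using good[OF that] that(2) uniformly_convergent_uniform_limit_iff[of "{0..T}" "\<lambda>n t. J (S n) t w"] by (simp add: I_def)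
  have limI: "(\<lambda>n. J (S n) t w) \<longlonglongrightarrow> I t w" if "w \<in> space M" "w \<notin> N0" "t \<in> {0..T}" for w t
    using tendsto_uniform_limitI[OF ul[OF that(1,2)] that(3)] .
  have IF: "I t \<in> borel_measurable (F t)" if t: "t \<in> {0..T}" for t
  proof -
    have "(\<lambda>w. lim (\<lambda>n. J (S n) t w)) \<in> borel_measurable (F t)"
      using t simple_integral_measurable[OF S] by (intro borel_measurable_lim_metric) auto
    moreover have "{w \<in> space (F t). w \<in> N0} \<in> sets (F t)"
    proof -
      have "{w \<in> space (F t). w \<in> N0} = N0" using sets.sets_into_space[of N0 M] N0 by auto
      then show ?thesis using null_sets_F[OF N0] by simp
    qed
    ultimately show ?thesis unfolding I_def[abs_def] by (intro measurable_If) auto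
  qed
  have IM: "I t \<in> borel_measurable M" if "t \<in> {0..T}" for t
    using measurable_F_M[OF IF[OF that]] that by auto
  have closeI: "(\<integral>\<^sup>+w. ennreal ((J (S n) t w - I t w)\<^sup>2) \<partial>M) \<le> ennreal (4 * (1/4)^n)" if t: "t \<in> {0..T}" for n t
  proof (rule nn_integral_le_of_AE_lim)
    show "(\<lambda>w. ennreal ((J (S n) t w - J (S k) t w)\<^sup>2)) \<in> borel_measurable M" for k
      using JM[OF t] by measurable
    show "AE w in M. (\<lambda>k. ennreal ((J (S n) t w - J (S k) t w)\<^sup>2)) \<longlonglongrightarrow> ennreal ((J (S n) t w - I t w)\<^sup>2)"
      using AE_not_in[OF N0] AE_space by eventually_elim (intro tendsto_intros limI t)
    show "\<forall>\<^sub>F k in sequentially. (\<integral>\<^sup>+w. ennreal ((J (S n) t w - J (S k) t w)\<^sup>2) \<partial>M) \<le> ennreal (4 * (1/4)^n)"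
      using cauchy_t[OF _ _ t, of n n] by (intro eventually_sequentiallyI[of n]) auto
  qed
  have ito: "is_ito_integral M T B Z I"
    unfolding is_ito_integral_def adapted_def
  proof (intro conjI ballI exI[of _ S] allI S limZ IF tendsto_0_of_le_power[OF closeI])
    fix w assume w: "w \<in> space M"
    show "continuous_on {0..T} (\<lambda>t. I t w)"
    proof (cases "w \<in> N0")
      case False
      then show ?thesis using good[OF w False] ul[OF w False] by (intro uniform_limit_theorem) auto
    qed (simp add: I_def)
  qed auto
  have "(\<integral>\<^sup>+w. ennreal ((I T w - \<zeta> w)\<^sup>2) \<partial>M) = 0"
  proof (rule ennreal_eq_0_of_le_power)
    fix n
    have "(\<integral>\<^sup>+w. ennreal ((norm ((I T w - J (S n) T w) + (J (S n) T w - \<zeta> w)))\<^sup>2) \<partial>M) \<le>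
      2 * (\<integral>\<^sup>+w. ennreal ((norm (I T w - J (S n) T w))\<^sup>2) \<partial>M) + 2 * (\<integral>\<^sup>+w. ennreal ((norm (J (S n) T w - \<zeta> w))\<^sup>2) \<partial>M)"
      using \<zeta> JM[OF TT] IM[OF TT] by (intro nn_integral_norm_add_le) auto
    also have "\<dots> \<le> 2 * ennreal (4 * (1/4)^n) + 2 * ennreal ((1/4)^n)"
      using closeI[OF TT, of n] close[of n]
      by (intro add_mono mult_left_mono) (auto simp: power2_commute)
    also have "\<dots> = ennreal (10 * (1/4)^n)"
      by (simp add: ennreal_mult'[symmetric] ennreal_plus[symmetric] del: ennreal_plus flip: ennreal_numeral)
    finally show "(\<integral>\<^sup>+w. ennreal ((I T w - \<zeta> w)\<^sup>2) \<partial>M) \<le> ennreal (10 * (1/4)^n)" by simp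
  qed
  then have "AE w in M. I T w = \<zeta> w"
    using \<zeta> IM[OF TT] by (subst (asm) nn_integral_0_iff_AE) auto
  with Z ito show ?thesis by (rule that)
qed

end

section \<open>Bounded limits of multiplicative classes\<close>

section \<open>A functional monotone class argument\<close>

text \<open>Multiplication is not among the rules: representability as a stochastic integral passes
  to sums, multiples and bounded limits, but not visibly to products. Rule induction then transfers
  it, while closure under products is derived separately.\<close>

inductive_set bounded_closure :: "'a set \<Rightarrow> ('a \<Rightarrow> real) set \<Rightarrow> ('a \<Rightarrow> real) set"
  for \<Omega> :: "'a set" and C :: "('a \<Rightarrow> real) set" where
  base: "g \<in> C \<Longrightarrow> g \<in> bounded_closure \<Omega> C"
| add: "g \<in> bounded_closure \<Omega> C \<Longrightarrow> h \<in> bounded_closure \<Omega> C \<Longrightarrow> (\<lambda>w. g w + h w) \<in> bounded_closure \<Omega> C"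
| cmult: "g \<in> bounded_closure \<Omega> C \<Longrightarrow> (\<lambda>w. c * g w) \<in> bounded_closure \<Omega> C"
| lim: "(\<And>n. g n \<in> bounded_closure \<Omega> C) \<Longrightarrow> (\<And>n w. w \<in> \<Omega> \<Longrightarrow> \<bar>g n w\<bar> \<le> K) \<Longrightarrow>
    (\<And>w. w \<in> \<Omega> \<Longrightarrow> (\<lambda>n. g n w) \<longlonglongrightarrow> h w) \<Longrightarrow> h \<in> bounded_closure \<Omega> C"

text \<open>Products of generators are only asked to lie in the closure. This fits the trigonometric
  case, where a product of cosines is a combination of cosines but in general not itself a
  cosine.\<close>

locale bounded_class =
  fixes \<Omega> :: "'a set" and C :: "('a \<Rightarrow> real) set"
  assumes bounded: "g \<in> C \<Longrightarrow> \<exists>K. \<forall>w\<in>\<Omega>. \<bar>g w\<bar> \<le> K"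
    and one: "(\<lambda>_. 1) \<in> C"
    and mult_C: "g \<in> C \<Longrightarrow> h \<in> C \<Longrightarrow> (\<lambda>w. g w * h w) \<in> bounded_closure \<Omega> C"
begin

abbreviation "Cl \<equiv> bounded_closure \<Omega> C"

lemma Cl_bounded: "g \<in> Cl \<Longrightarrow> \<exists>K. \<forall>w\<in>\<Omega>. \<bar>g w\<bar> \<le> K"
proof (induction rule: bounded_closure.induct)
  case (add g h)
  then obtain K L where "\<forall>w\<in>\<Omega>. \<bar>g w\<bar> \<le> K" "\<forall>w\<in>\<Omega>. \<bar>h w\<bar> \<le> L" by auto
  then have "\<forall>w\<in>\<Omega>. \<bar>g w + h w\<bar> \<le> K + L" by (meson abs_triangle_ineq add_mono order_trans)
  then show ?case by blast
next
  case (cmult g c)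
  then obtain K where "\<forall>w\<in>\<Omega>. \<bar>g w\<bar> \<le> K" by auto
  then have "\<forall>w\<in>\<Omega>. \<bar>c * g w\<bar> \<le> \<bar>c\<bar> * K" by (auto simp: abs_mult intro: mult_left_mono)
  then show ?case by blast
next
  case (lim g K h)
  have "\<bar>h w\<bar> \<le> K" if "w \<in> \<Omega>" for w
    using tendsto_rabs[OF lim.hyps(3)[OF that]] lim.hyps(2)[OF that] by (intro LIMSEQ_le_const2) auto
  then show ?case by blast
qed (rule bounded)

text \<open>The limit rule looks at points of \<Omega> only, and there the constant sequence
  \<open>g\<close> converges to \<open>h\<close>.\<close>

lemma Cl_cong: "g \<in> Cl \<Longrightarrow> (\<And>w. w \<in> \<Omega> \<Longrightarrow> g w = h w) \<Longrightarrow> h \<in> Cl"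
  using Cl_bounded[of g] by (auto intro!: bounded_closure.lim[of "\<lambda>_. g"])

lemma Cl_const: "(\<lambda>_. c) \<in> Cl"
  using bounded_closure.cmult[OF bounded_closure.base[OF one], where c=c] by simp

text \<open>Products are obtained by two inductions: here one factor is a generator, and afterwards
  this case is the base for an arbitrary second factor.\<close>

lemma Cl_mult_base: "g \<in> Cl \<Longrightarrow> c \<in> C \<Longrightarrow> (\<lambda>w. c w * g w) \<in> Cl"
proof (induction rule: bounded_closure.induct)
  case (base g)
  then show ?case by (intro mult_C)
next
  case (add g h)
  then show ?case by (simp add: distrib_left bounded_closure.add)
next
  case (cmult g d)
  then show ?case using bounded_closure.cmult[where g="\<lambda>w. c w * g w" and c=d] by (simp add: ac_simps)
next
  case (lim g K h)
  obtain L where L: "\<forall>w\<in>\<Omega>. \<bar>c w\<bar> \<le> L" using bounded[OF lim.prems] by auto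
  show ?case
  proof (rule bounded_closure.lim)
    show "(\<lambda>w. c w * g n w) \<in> Cl" for n using lim.IH lim.prems by auto
    show "\<bar>c w * g n w\<bar> \<le> L * K" if "w \<in> \<Omega>" for n w
      using L lim.hyps(2)[OF that, of n] that unfolding abs_mult by (intro mult_mono) (auto intro: order_trans[OF abs_ge_zero])
    show "(\<lambda>n. c w * g n w) \<longlonglongrightarrow> c w * h w" if "w \<in> \<Omega>" for w
      using lim.hyps(3)[OF that] by (intro tendsto_intros)
  qed
qed

lemma Cl_mult: "g \<in> Cl \<Longrightarrow> f \<in> Cl \<Longrightarrow> (\<lambda>w. f w * g w) \<in> Cl"
proof (induction rule: bounded_closure.induct)
  case (base g)
  then show ?case using Cl_mult_base[of f g] by (simp add: mult.commute)
next
  case (add g h)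
  then show ?case by (simp add: distrib_left bounded_closure.add)
next
  case (cmult g d)
  then show ?case using bounded_closure.cmult[where g="\<lambda>w. f w * g w" and c=d] by (simp add: ac_simps)
next
  case (lim g K h)
  obtain L where L: "\<forall>w\<in>\<Omega>. \<bar>f w\<bar> \<le> L" using Cl_bounded[OF lim.prems] by auto
  show ?case
  proof (rule bounded_closure.lim)
    show "(\<lambda>w. f w * g n w) \<in> Cl" for n using lim.IH lim.prems by auto
    show "\<bar>f w * g n w\<bar> \<le> L * K" if "w \<in> \<Omega>" for n w
      using L lim.hyps(2)[OF that, of n] that unfolding abs_mult by (intro mult_mono) (auto intro: order_trans[OF abs_ge_zero])
    show "(\<lambda>n. f w * g n w) \<longlonglongrightarrow> f w * h w" if "w \<in> \<Omega>" for w
      using lim.hyps(3)[OF that] by (intro tendsto_intros)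
  qed
qed

lemma Cl_poly:
  assumes "real_polynomial_function p" "g \<in> Cl" shows "(\<lambda>w. p (g w)) \<in> Cl"
  using assms(1)
proof (induction rule: real_polynomial_function.induct)
  case (linear f)
  have "f (g w) = f 1 * g w" for w
    using linear_simps(5)[OF linear, of "g w" 1] by simp
  then have "(\<lambda>w. f (g w)) = (\<lambda>w. f 1 * g w)" by (rule ext)
  then show ?case using bounded_closure.cmult[OF assms(2), where c="f 1"] by simp
next
  case (const c)
  then show ?case by (rule Cl_const)
next
  case (add f h)
  show ?case by (rule bounded_closure.add[OF add.IH])
next
  case (mult f h)
  show ?case by (rule Cl_mult[OF mult.IH(2,1)])
qed

text \<open>Weierstrass approximation on a compact interval containing the range of
  \<open>g\<close>. The polynomials are uniformly bounded there, as the limit rule demands.\<close>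

lemma Cl_continuous:
  assumes "continuous_on UNIV \<phi>" "g \<in> Cl" shows "(\<lambda>w. \<phi> (g w)) \<in> Cl"
proof -
  obtain K where K: "\<And>w. w \<in> \<Omega> \<Longrightarrow> \<bar>g w\<bar> \<le> K" using Cl_bounded[OF assms(2)] by auto
  have cont: "continuous_on {-K..K} \<phi>" by (rule continuous_on_subset[OF assms(1)]) simp
  have "\<exists>p. real_polynomial_function p \<and> (\<forall>x\<in>{-K..K}. \<bar>\<phi> x - p x\<bar> < 1 / Suc n)" for n
  proof -
    have "0 < 1 / real (Suc n)" by simp
    from Stone_Weierstrass_real_polynomial_function[OF compact_Icc cont this]
    show ?thesis by metis
  qed
  then obtain p where p: "\<And>n. real_polynomial_function (p n)" "\<And>n x. x \<in> {-K..K} \<Longrightarrow> \<bar>\<phi> x - p n x\<bar> < 1 / real (Suc n)"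
    by metis
  obtain L where L: "\<And>x. x \<in> {-K..K} \<Longrightarrow> \<bar>\<phi> x\<bar> \<le> L"
  proof -
    obtain L where "\<forall>x\<in>\<phi> ` {-K..K}. norm x \<le> L"
      using compact_imp_bounded[OF compact_continuous_image[OF cont compact_Icc]] unfolding bounded_iff by (rule exE)
    from bspec[OF this imageI] show ?thesis by (intro that) simp
  qed
  show ?thesis
  proof (rule bounded_closure.lim)
    show "(\<lambda>w. p n (g w)) \<in> Cl" for n by (rule Cl_poly[OF p(1) assms(2)])
    show "\<bar>p n (g w)\<bar> \<le> L + 1" if "w \<in> \<Omega>" for n w
    proof -
      have "g w \<in> {-K..K}" using K[OF that] by auto
      moreover have "1 / real (Suc n) \<le> 1" by simp
      ultimately show ?thesis using p(2)[of "g w" n] L[of "g w"] by linarith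
    qed
    show "(\<lambda>n. p n (g w)) \<longlonglongrightarrow> \<phi> (g w)" if "w \<in> \<Omega>" for w
    proof (rule LIM_zero_cancel, rule Lim_null_comparison)
      have "g w \<in> {-K..K}" using K[OF that] by auto
      then have "norm (p n (g w) - \<phi> (g w)) \<le> 1 / Suc n" for n
        using p(2)[of "g w" n] by (simp only: real_norm_def abs_minus_commute less_imp_le)
      then show "\<forall>\<^sub>F n in sequentially. norm (p n (g w) - \<phi> (g w)) \<le> 1 / Suc n"
        by (rule always_eventually[OF allI])
      show "(\<lambda>n. 1 / real (Suc n)) \<longlonglongrightarrow> 0" using LIMSEQ_Suc[OF lim_1_over_n] by simp
    qed
  qed
qed

lemma Cl_indicator_greater:
  assumes "g \<in> Cl" shows "indicator {w \<in> \<Omega>. a < g w} \<in> Cl"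
proof (rule bounded_closure.lim)
  \<comment> \<open>Ramps of slope k, cut off at 0 and 1, increase to the indicator of the open half
    line beyond \<open>a\<close>.\<close>
  define \<phi> where "\<phi> k x = min 1 (max 0 (real k * (x - a)))" for k :: nat and x
  show "(\<lambda>w. \<phi> k (g w)) \<in> Cl" for k
    unfolding \<phi>_def by (rule Cl_continuous[OF _ assms]) (intro continuous_intros)
  show "\<bar>\<phi> k (g w)\<bar> \<le> 1" for k w by (auto simp: \<phi>_def)
  show "(\<lambda>k. \<phi> k (g w)) \<longlonglongrightarrow> indicator {w \<in> \<Omega>. a < g w} w" if "w \<in> \<Omega>" for w
  proof (cases "a < g w")
    case True
    obtain k0 where k0: "1 / (g w - a) \<le> real k0" using real_arch_simple by blast
    have "\<phi> k (g w) = 1" if "k \<ge> k0" for k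
    proof -
      have "1 / (g w - a) \<le> real k" using that k0 by simp
      then have "1 \<le> real k * (g w - a)" using True by (simp add: field_simps)
      then show ?thesis by (simp add: \<phi>_def)
    qed
    then have "\<forall>\<^sub>F k in sequentially. \<phi> k (g w) = 1" by (auto simp: eventually_sequentially)
    then show ?thesis using True that by (auto intro: tendsto_eventually)
  next
    case False
    then have "\<phi> k (g w) = 0" for k by (simp add: \<phi>_def mult_nonneg_nonpos)
    then show ?thesis using False by simp
  qed
qed

definition "Cl_sets = {A. A \<subseteq> \<Omega> \<and> (indicator A :: 'a \<Rightarrow> real) \<in> Cl}"

text \<open>Closure under products supplies indicators of intersections, so finite unions follow by
  inclusion-exclusion and countable ones by bounded limits. No separate pi-system step
  occurs.\<close>

lemma sigma_algebra_Cl: "sigma_algebra \<Omega> Cl_sets"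
  unfolding sigma_algebra_iff2
proof (intro conjI ballI allI impI)
  show "Cl_sets \<subseteq> Pow \<Omega>" by (auto simp: Cl_sets_def)
  show "{} \<in> Cl_sets" using Cl_const[of 0] by (simp add: Cl_sets_def indicator_def[abs_def])
next
  fix A assume "A \<in> Cl_sets"
  then have "(\<lambda>w. 1 + (- 1) * indicator A w) \<in> Cl"
    by (intro bounded_closure.add Cl_const bounded_closure.cmult) (simp add: Cl_sets_def)
  then show "\<Omega> - A \<in> Cl_sets"
    unfolding Cl_sets_def by (auto elim!: Cl_cong split: split_indicator)
next
  fix A :: "nat \<Rightarrow> 'a set" assume A: "range A \<subseteq> Cl_sets"
  have fin: "indicator (\<Union>i<n. A i) \<in> Cl" for n
  proof (induction n)
    case 0
    then show ?case using Cl_const[of 0] by (simp add: indicator_def[abs_def])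
  next
    case (Suc n)
    have An: "indicator (A n) \<in> Cl" using A by (auto simp: Cl_sets_def)
    have "(\<lambda>w. (indicator (\<Union>i<n. A i) w + indicator (A n) w) + (- 1) * (indicator (\<Union>i<n. A i) w * indicator (A n) w)) \<in> Cl"
      by (intro bounded_closure.add bounded_closure.cmult Cl_mult Suc An)
    then show ?case by (rule Cl_cong) (auto simp: lessThan_Suc split: split_indicator)
  qed
  have "indicator (\<Union>i. A i) \<in> Cl"
  proof (rule bounded_closure.lim[OF fin, where K=1])
    show "(\<lambda>n. indicator (\<Union>i<n. A i) w :: real) \<longlonglongrightarrow> indicator (\<Union>i. A i) w" for w
    proof (cases "w \<in> (\<Union>i. A i)")
      case True
      then obtain i where "w \<in> A i" by auto
      then have "\<forall>\<^sub>F n in sequentially. indicator (\<Union>i<n. A i) w = (1::real)"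
        by (auto simp: eventually_sequentially indicator_def intro!: exI[of _ "Suc i"])
      then show ?thesis using True by (auto intro: tendsto_eventually)
    qed auto
  qed (auto split: split_indicator)
  then show "(\<Union>i. A i) \<in> Cl_sets" using A by (auto simp: Cl_sets_def)
qed

lemma Cl_measurable:
  assumes "g \<in> Cl" shows "g \<in> borel_measurable (sigma \<Omega> Cl_sets)"
proof -
  interpret sigma_algebra \<Omega> Cl_sets by (rule sigma_algebra_Cl)
  have "{w \<in> \<Omega>. a < g w} \<in> Cl_sets" for a
    using Cl_indicator_greater[OF assms] by (auto simp: Cl_sets_def)
  then show ?thesis by (simp add: borel_measurable_iff_greater)
qed

end

section \<open>Density of stochastic integrals in L2 of the Brownian filtration\<close>

section \<open>Martingale representation\<close>

context brownian
begin

text \<open>Approximability instead of an exact representation: closure under L2 limits becomes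
  immediate, and the integrand is constructed only once, at the very end.\<close>

definition representable :: "('w \<Rightarrow> real) \<Rightarrow> bool" where
  "representable X \<longleftrightarrow> X \<in> borel_measurable M \<and>
    (\<forall>e>0. \<exists>c S. simple S \<and> (\<integral>\<^sup>+w. ennreal ((X w - (c + J S T w))\<^sup>2) \<partial>M) \<le> ennreal e)"

lemma representableD:
  assumes "representable X" "e > 0"
  shows "\<exists>c S. simple S \<and> (\<integral>\<^sup>+w. ennreal ((X w - (c + J S T w))\<^sup>2) \<partial>M) \<le> ennreal e"
  using assms unfolding representable_def by blast

lemma representable_measurable: "representable X \<Longrightarrow> X \<in> borel_measurable M"
  by (simp add: representable_def)

lemma JT_measurable: "simple S \<Longrightarrow> J S T \<in> borel_measurable M"
  by (rule sqint_measurable[OF simple_integral_sqint_T])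

lemma nn_integral_add_le:
  fixes e :: real
  assumes "X \<in> borel_measurable M" "Y \<in> borel_measurable M" "e \<ge> 0"
    "(\<integral>\<^sup>+w. ennreal ((X w)\<^sup>2) \<partial>M) \<le> ennreal (e / 4)" "(\<integral>\<^sup>+w. ennreal ((Y w)\<^sup>2) \<partial>M) \<le> ennreal (e / 4)"
  shows "(\<integral>\<^sup>+w. ennreal ((X w + Y w)\<^sup>2) \<partial>M) \<le> ennreal e"
proof -
  have "(\<integral>\<^sup>+w. ennreal ((X w + Y w)\<^sup>2) \<partial>M) \<le> 2 * (\<integral>\<^sup>+w. ennreal ((X w)\<^sup>2) \<partial>M) + 2 * (\<integral>\<^sup>+w. ennreal ((Y w)\<^sup>2) \<partial>M)"
    using nn_integral_norm_add_le[OF assms(1,2)] by simp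
  also have "\<dots> \<le> 2 * ennreal (e / 4) + 2 * ennreal (e / 4)"
    by (intro add_mono mult_left_mono assms) auto
  also have "\<dots> = ennreal (2 * (e / 4) + 2 * (e / 4))"
    using assms(3) ennreal_mult'[of 2 "e / 4"] by (simp only: ennreal_plus) simp
  finally show ?thesis by simp
qed

lemma representable_const: "representable (\<lambda>_. c)"
  unfolding representable_def
  by (auto intro!: exI[of _ c] exI[of _ "[]"] simp: simple_integral_def simple_integrand_def)

lemma representable_add:
  assumes X: "representable X" and Y: "representable Y"
  shows "representable (\<lambda>w. X w + Y w)"
  unfolding representable_def
proof (intro conjI allI impI)
  note [measurable] = representable_measurable[OF X] representable_measurable[OF Y]
  show "(\<lambda>w. X w + Y w) \<in> borel_measurable M" by measurable
  fix e :: real assume e: "e > 0"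
  obtain c S where S: "simple S" "(\<integral>\<^sup>+w. ennreal ((X w - (c + J S T w))\<^sup>2) \<partial>M) \<le> ennreal (e / 4)"
    using representableD[OF X, of "e / 4"] e by (metis divide_pos_pos zero_less_numeral)
  obtain d R where R: "simple R" "(\<integral>\<^sup>+w. ennreal ((Y w - (d + J R T w))\<^sup>2) \<partial>M) \<le> ennreal (e / 4)"
    using representableD[OF Y, of "e / 4"] e by (metis divide_pos_pos zero_less_numeral)
  note [measurable] = JT_measurable[OF S(1)] JT_measurable[OF R(1)]
  have "(\<integral>\<^sup>+w. ennreal (((X w - (c + J S T w)) + (Y w - (d + J R T w)))\<^sup>2) \<partial>M) \<le> ennreal e"
    using e by (intro nn_integral_add_le S R) auto
  then show "\<exists>c S. simple S \<and> (\<integral>\<^sup>+w. ennreal ((X w + Y w - (c + J S T w))\<^sup>2) \<partial>M) \<le> ennreal e"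
    by (intro exI[of _ "c + d"] exI[of _ "S @ R"])
      (simp add: simple_append S R simple_integral_append algebra_simps)
qed

lemma representable_cmult:
  assumes X: "representable X" shows "representable (\<lambda>w. a * X w)"
  unfolding representable_def
proof (intro conjI allI impI)
  note [measurable] = representable_measurable[OF X]
  show "(\<lambda>w. a * X w) \<in> borel_measurable M" by measurable
  fix e :: real assume e: "e > 0"
  \<comment> \<open>The summand 1 keeps the quotient meaningful for \<open>a = 0\<close>.\<close>
  have p: "e / (a\<^sup>2 + 1) > 0" using e by (intro divide_pos_pos) (auto intro: add_nonneg_pos)
  obtain c S where S: "simple S" "(\<integral>\<^sup>+w. ennreal ((X w - (c + J S T w))\<^sup>2) \<partial>M) \<le> ennreal (e / (a\<^sup>2 + 1))"
    using representableD[OF X p] by blast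
  note [measurable] = JT_measurable[OF S(1)]
  have "(\<integral>\<^sup>+w. ennreal ((a * X w - (a * c + a * J S T w))\<^sup>2) \<partial>M) = ennreal (a\<^sup>2) * (\<integral>\<^sup>+w. ennreal ((X w - (c + J S T w))\<^sup>2) \<partial>M)"
    by (subst nn_integral_cmult[symmetric])
      (auto simp: ennreal_mult'[symmetric] power2_eq_square algebra_simps intro!: nn_integral_cong)
  also have "\<dots> \<le> ennreal (a\<^sup>2) * ennreal (e / (a\<^sup>2 + 1))" by (intro mult_left_mono S) auto
  also have "\<dots> = ennreal (a\<^sup>2 * (e / (a\<^sup>2 + 1)))" by (rule ennreal_mult'[symmetric]) simp
  also have "\<dots> \<le> ennreal e"
  proof (rule ennreal_leI)
    have "a\<^sup>2 + 1 > 0" by (intro add_nonneg_pos) auto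
    then show "a\<^sup>2 * (e / (a\<^sup>2 + 1)) \<le> e" using e by (simp add: field_simps)
  qed
  finally show "\<exists>c S. simple S \<and> (\<integral>\<^sup>+w. ennreal ((a * X w - (c + J S T w))\<^sup>2) \<partial>M) \<le> ennreal e"
    by (intro exI[of _ "a * c"] exI[of _ "scale_simple a S"]) (simp add: simple_scale S simple_integral_scale)
qed

lemma representable_diff: "representable X \<Longrightarrow> representable Y \<Longrightarrow> representable (\<lambda>w. X w - Y w)"
  using representable_add[OF _ representable_cmult[of Y "-1"], of X] by simp

lemma representable_lim:
  assumes X: "\<And>n. representable (X n)" and Y: "Y \<in> borel_measurable M"
    and lim: "(\<lambda>n. \<integral>\<^sup>+w. ennreal ((X n w - Y w)\<^sup>2) \<partial>M) \<longlonglongrightarrow> 0"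
  shows "representable Y"
  unfolding representable_def
proof (intro conjI allI impI Y)
  fix e :: real assume e: "e > 0"
  have "\<forall>\<^sub>F n in sequentially. (\<integral>\<^sup>+w. ennreal ((X n w - Y w)\<^sup>2) \<partial>M) < ennreal (e / 4)"
    using lim by (rule order_tendstoD) (use e in simp)
  then obtain n where n: "(\<integral>\<^sup>+w. ennreal ((X n w - Y w)\<^sup>2) \<partial>M) < ennreal (e / 4)"
    by (auto simp: eventually_sequentially)
  obtain c S where S: "simple S" "(\<integral>\<^sup>+w. ennreal ((X n w - (c + J S T w))\<^sup>2) \<partial>M) \<le> ennreal (e / 4)"
    using representableD[OF X[of n], of "e / 4"] e by (metis divide_pos_pos zero_less_numeral)
  note [measurable] = JT_measurable[OF S(1)] Y representable_measurable[OF X]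
  have "(\<integral>\<^sup>+w. ennreal (((Y w - X n w) + (X n w - (c + J S T w)))\<^sup>2) \<partial>M) \<le> ennreal e"
    using e S n by (intro nn_integral_add_le) (auto simp: power2_commute)
  moreover have "(Y w - X n w) + (X n w - (c + J S T w)) = Y w - (c + J S T w)" for w by simp
  ultimately have "(\<integral>\<^sup>+w. ennreal ((Y w - (c + J S T w))\<^sup>2) \<partial>M) \<le> ennreal e" by (simp only:)
  then show "\<exists>c S. simple S \<and> (\<integral>\<^sup>+w. ennreal ((Y w - (c + J S T w))\<^sup>2) \<partial>M) \<le> ennreal e"
    using S by blast
qed

lemma representable_cong_AE:
  assumes X: "representable X" and Y: "Y \<in> borel_measurable M" and "AE w in M. X w = Y w"
  shows "representable Y"
proof (rule representable_lim[of "\<lambda>_. X", OF X Y])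
  have "(\<integral>\<^sup>+w. ennreal ((X w - Y w)\<^sup>2) \<partial>M) = (\<integral>\<^sup>+w. 0 \<partial>M)"
    using assms(3) by (intro nn_integral_cong_AE) auto
  then show "(\<lambda>n. \<integral>\<^sup>+w. ennreal ((X w - Y w)\<^sup>2) \<partial>M) \<longlonglongrightarrow> 0" by simp
qed

lemma L2_dominated_convergence:
  fixes X :: "nat \<Rightarrow> 'w \<Rightarrow> real"
  assumes [measurable]: "\<And>n. X n \<in> borel_measurable M" "Y \<in> borel_measurable M" and Z: "sqint M Z"
    and bnd: "\<And>n. AE w in M. \<bar>X n w - Y w\<bar> \<le> \<bar>Z w :: real\<bar>"
    and lim: "AE w in M. (\<lambda>n. X n w) \<longlonglongrightarrow> Y w"
  shows "(\<lambda>n. \<integral>\<^sup>+w. ennreal ((X n w - Y w)\<^sup>2) \<partial>M) \<longlonglongrightarrow> 0"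
proof -
  have "(\<lambda>n. \<integral>\<^sup>+w. ennreal ((X n w - Y w)\<^sup>2) \<partial>M) \<longlonglongrightarrow> (\<integral>\<^sup>+w. 0 \<partial>M)"
  proof (rule nn_integral_dominated_convergence)
    show "(\<integral>\<^sup>+w. ennreal ((Z w)\<^sup>2) \<partial>M) < \<infinity>" using Z by (simp add: sqint_iff)
    show "(\<lambda>w. ennreal ((Z w)\<^sup>2)) \<in> borel_measurable M" using sqint_measurable[OF Z] by measurable
    show "AE w in M. ennreal ((X n w - Y w)\<^sup>2) \<le> ennreal ((Z w)\<^sup>2)" for n
      using bnd[of n] by eventually_elim (intro ennreal_leI, simp add: abs_le_square_iff)
    show "AE w in M. (\<lambda>n. ennreal ((X n w - Y w)\<^sup>2)) \<longlonglongrightarrow> 0"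
      using lim
    proof eventually_elim
      case (elim w)
      have "(\<lambda>n. ennreal ((X n w - Y w)\<^sup>2)) \<longlonglongrightarrow> ennreal ((Y w - Y w)\<^sup>2)" by (intro tendsto_intros elim)
      then show ?case by simp
    qed
  qed auto
  then show ?thesis by simp
qed

text \<open>Simple integrands must be bounded, whereas \<open>y\<close> is only square integrable.
  Truncations of \<open>y\<close> give simple integrals, dominated by the square integrable product
  itself.\<close>

lemma representable_elem:
  assumes ab: "0 \<le> a" "a \<le> b" "b \<le> T" and y: "y \<in> borel_measurable (F a)" "sqint M y"
  shows "representable (\<lambda>w. y w * (u \<bullet> (B b w - B a w)))"
proof (rule representable_lim)
  define yn where "yn n w = (if \<bar>y w\<bar> \<le> real n then y w else 0)" for n w
  define Y where "Y w = u \<bullet> (B b w - B a w)" for w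
  have ynF: "yn n \<in> borel_measurable (F a)" for n unfolding yn_def[abs_def] using y(1) by measurable
  have aT: "a \<le> T" using ab by auto
  have S: "simple [(a, b, \<lambda>w. yn n w *\<^sub>R u)]" for n
    unfolding simple_integrand_def
  proof (clarsimp simp: ab, intro conjI)
    show "(\<lambda>w. yn n w *\<^sub>R u) \<in> borel_measurable (F a)" using ynF[of n] by measurable
    show "bounded ((\<lambda>w. yn n w *\<^sub>R u) ` space M)"
      by (auto intro!: boundedI[where B="real n * norm u"] mult_right_mono simp: yn_def)
  qed
  have JS: "J [(a, b, \<lambda>w. yn n w *\<^sub>R u)] T w = yn n w * Y w" for n w
    using ab by (simp add: simple_integral_def min_absorb1 Y_def)
  have "(\<integral>\<^sup>+w. ennreal ((yn n w * Y w - (0 + J [(a, b, \<lambda>w. yn n w *\<^sub>R u)] T w))\<^sup>2) \<partial>M) = 0" for n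
    by (simp add: JS)
  then show "representable (\<lambda>w. yn n w * (u \<bullet> (B b w - B a w)))" for n
    unfolding Y_def[symmetric] representable_def using S[of n] JT_measurable[OF S[of n]]
    by (auto simp: JS[abs_def] intro!: exI[of _ 0] exI[of _ "[(a, b, \<lambda>w. yn n w *\<^sub>R u)]"])
  have Zs: "sqint M (\<lambda>w. y w * Y w)"
    using elem_sqint[OF ab, of "\<lambda>w. y w *\<^sub>R u"] y sqint_mono[of M y "\<lambda>w. y w *\<^sub>R u" "norm u"] sqint_measurable[OF y(2)]
    by (simp add: Y_def mult.commute)
  have [measurable]: "B a \<in> borel_measurable M" "B b \<in> borel_measurable M" using ab by auto
  have YM: "Y \<in> borel_measurable M" unfolding Y_def by measurable
  show "(\<lambda>w. y w * (u \<bullet> (B b w - B a w))) \<in> borel_measurable M"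
    using sqint_measurable[OF Zs] by (simp add: Y_def)
  show "(\<lambda>n. \<integral>\<^sup>+w. ennreal ((yn n w * (u \<bullet> (B b w - B a w)) - y w * (u \<bullet> (B b w - B a w)))\<^sup>2) \<partial>M) \<longlonglongrightarrow> 0"
    unfolding Y_def[symmetric]
  proof (rule L2_dominated_convergence[OF _ _ Zs])
    show "(\<lambda>w. yn n w * Y w) \<in> borel_measurable M" for n
      using measurable_F_M[OF ynF aT] YM by measurable
    show "(\<lambda>w. y w * Y w) \<in> borel_measurable M" by (rule sqint_measurable[OF Zs])
    show "AE w in M. \<bar>yn n w * Y w - y w * Y w\<bar> \<le> \<bar>y w * Y w\<bar>" for n by (auto simp: yn_def)
    show "AE w in M. (\<lambda>n. yn n w * Y w) \<longlonglongrightarrow> y w * Y w"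
    proof (intro AE_I2 tendsto_mult tendsto_const)
      fix w
      obtain n0 where "\<bar>y w\<bar> \<le> real n0" using real_arch_simple by blast
      then have "\<forall>\<^sub>F n in sequentially. yn n w = y w"
        by (auto simp: yn_def eventually_sequentially intro!: exI[of _ n0])
      then show "(\<lambda>n. yn n w) \<longlonglongrightarrow> y w" by (rule tendsto_eventually)
    qed
  qed
qed

definition crep :: "('w \<Rightarrow> complex) \<Rightarrow> bool"
  where "crep X \<longleftrightarrow> representable (\<lambda>w. Re (X w)) \<and> representable (\<lambda>w. Im (X w))"

lemma crep_cmult:
  assumes "crep X" shows "crep (\<lambda>w. c * X w)"
proof -
  have R: "representable (\<lambda>w. Re (X w))" and I: "representable (\<lambda>w. Im (X w))"
    using assms by (auto simp: crep_def)
  have "representable (\<lambda>w. Re c * Re (X w) - Im c * Im (X w))"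
    by (rule representable_diff[OF representable_cmult[OF R] representable_cmult[OF I]])
  moreover have "representable (\<lambda>w. Re c * Im (X w) + Im c * Re (X w))"
    by (rule representable_add[OF representable_cmult[OF I] representable_cmult[OF R]])
  ultimately show ?thesis by (simp add: crep_def)
qed

lemma crep_cong_AE:
  assumes "crep X" "Y \<in> borel_measurable M" "AE w in M. X w = Y w"
  shows "crep Y"
  unfolding crep_def
proof
  note X = assms(1)[unfolded crep_def]
  show "representable (\<lambda>w. Re (Y w))"
    using assms(2,3) by (intro representable_cong_AE[OF conjunct1[OF X]]) auto
  show "representable (\<lambda>w. Im (Y w))"
    using assms(2,3) by (intro representable_cong_AE[OF conjunct2[OF X]]) auto
qed

lemma crep_lim:
  assumes X: "\<And>n. crep (X n)" and Y: "Y \<in> borel_measurable M"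
    and lim: "(\<lambda>n. \<integral>\<^sup>+w. ennreal ((norm (X n w - Y w))\<^sup>2) \<partial>M) \<longlonglongrightarrow> 0"
  shows "crep Y"
  unfolding crep_def
proof
  have Xr: "representable (\<lambda>w. Re (X n w))" "representable (\<lambda>w. Im (X n w))" for n
    using X[of n] by (auto simp: crep_def)
  have le1: "(\<integral>\<^sup>+w. ennreal ((Re (X n w) - Re (Y w))\<^sup>2) \<partial>M) \<le> (\<integral>\<^sup>+w. ennreal ((norm (X n w - Y w))\<^sup>2) \<partial>M)" for n
    by (intro nn_integral_mono ennreal_leI) (simp add: cmod_power2)
  have le2: "(\<integral>\<^sup>+w. ennreal ((Im (X n w) - Im (Y w))\<^sup>2) \<partial>M) \<le> (\<integral>\<^sup>+w. ennreal ((norm (X n w - Y w))\<^sup>2) \<partial>M)" for n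
    by (intro nn_integral_mono ennreal_leI) (simp add: cmod_power2)
  show "representable (\<lambda>w. Re (Y w))"
    by (rule representable_lim[OF Xr(1)])
      (use Y in measurable, rule tendsto_sandwich[OF always_eventually[OF allI[OF zero_le]] always_eventually[OF allI[OF le1]] tendsto_const lim])
  show "representable (\<lambda>w. Im (Y w))"
    by (rule representable_lim[OF Xr(2)])
      (use Y in measurable, rule tendsto_sandwich[OF always_eventually[OF allI[OF zero_le]] always_eventually[OF allI[OF le2]] tendsto_const lim])
qed

end

lemma norm_diff_squared_complex: "(norm (p - q))\<^sup>2 = (norm p)\<^sup>2 + (norm q)\<^sup>2 - 2 * Re (p * cnj q)"
  unfolding cmod_power2 by (simp add: power2_eq_square algebra_simps)

context brownian
begin

text \<open>The factor adds \<open>\<i> * X w * Y w\<close> to \<open>X w\<close>, which is an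
  elementary integral since \<open>X\<close> is known at time \<open>a\<close>. Independence makes
  the second moment grow by exactly the factor 1 + |u|^2 (b - a).\<close>

lemma crep_step:
  fixes u :: "real^'d"
  assumes ab: "0 \<le> a" "a < b" "b \<le> T" and X: "X \<in> borel_measurable (F a)" "sqint M X" "crep X"
  defines "Y \<equiv> \<lambda>w. u \<bullet> (B b w - B a w)"
  shows "(\<lambda>w. X w * (1 + \<i> * Y w)) \<in> borel_measurable (F b)" (is ?m)
    and "sqint M (\<lambda>w. X w * (1 + \<i> * Y w))" (is ?s)
    and "crep (\<lambda>w. X w * (1 + \<i> * Y w))" (is ?c)
    and "expectation (\<lambda>w. (norm (X w * (1 + \<i> * Y w)))\<^sup>2) = (1 + (norm u)\<^sup>2 * (b - a)) * expectation (\<lambda>w. (norm (X w))\<^sup>2)" (is ?e)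
proof -
  have [measurable]: "B b \<in> borel_measurable M" "B a \<in> borel_measurable M" "X \<in> borel_measurable M"
    using ab measurable_F_M[OF X(1)] by auto
  have [measurable]: "B b \<in> borel_measurable (F b)" "B a \<in> borel_measurable (F b)" "X \<in> borel_measurable (F b)"
    using ab measurable_F_mono[OF X(1)] by (auto intro: B_measurable_F)
  show ?m unfolding Y_def by measurable
  note I = increment_iexp[OF ab, of u, folded Y_def]
  have n: "(norm (X w * (1 + \<i> * Y w)))\<^sup>2 = (norm (X w))\<^sup>2 * (1 + (Y w)\<^sup>2)" for w
    by (simp add: norm_mult power_mult_distrib cmod_power2)
  have X2: "(\<lambda>w. (norm (X w))\<^sup>2) \<in> borel_measurable (F a)" "integrable M (\<lambda>w. (norm (X w))\<^sup>2)"
    using X by (auto simp: sqint_def)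
  have Y2: "integrable M (\<lambda>w. 1 + (Y w)\<^sup>2)" "expectation (\<lambda>w. 1 + (Y w)\<^sup>2) = 1 + (norm u)\<^sup>2 * (b - a)"
    using sqint_square_integrable[OF I(3)] I(5) unfolding Y_def by (auto simp: prob_space)
  note E = increment_mult[OF ab X2(1) _ X2(2), of "\<lambda>z. 1 + (u \<bullet> z)\<^sup>2", folded Y_def]
  show ?e unfolding n using E(2) Y2 unfolding Y_def by simp
  show ?s unfolding sqint_def n using E(1) Y2 unfolding Y_def by auto
  have R: "representable (\<lambda>w. Re (X w))" and Im: "representable (\<lambda>w. Im (X w))" using X by (auto simp: crep_def)
  have sq: "sqint M (\<lambda>w. Re (X w))" "sqint M (\<lambda>w. Im (X w))"
    using sqint_mono[OF X(2), of "\<lambda>w. Re (X w)" 1] sqint_mono[OF X(2), of "\<lambda>w. Im (X w)" 1] abs_Re_le_cmod abs_Im_le_cmod by auto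
  have m: "(\<lambda>w. Re (X w)) \<in> borel_measurable (F a)" "(\<lambda>w. Im (X w)) \<in> borel_measurable (F a)" using X(1) by measurable
  have "representable (\<lambda>w. Re (X w) - Im (X w) * Y w)"
    unfolding Y_def using ab by (intro representable_diff[OF R] representable_elem m sq) auto
  moreover have "representable (\<lambda>w. Im (X w) + Re (X w) * Y w)"
    unfolding Y_def using ab by (intro representable_add[OF Im] representable_elem m sq) auto
  ultimately show ?c by (simp add: crep_def add.commute)
qed

text \<open>The product of the martingale differences \<open>1 + \<i> u \<bullet> \<Delta>B\<close> over an equidistant partition is a
  stochastic integral of a step process plus a constant, and converges in mean square to the stochastic exponential.\<close>

lemma crep_iexp_approx:
  fixes u :: "real^'d"
  assumes ab: "0 \<le> a" "a < b" "b \<le> T" and X: "X \<in> borel_measurable (F a)" "sqint M X" "crep X" and N: "N > 0"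
  defines "c \<equiv> (norm u)\<^sup>2 * (b - a)"
  obtains P where "crep P" "sqint M P"
    "expectation (\<lambda>w. (norm (P w - X w * iexp (u \<bullet> (B b w - B a w)) * exp (c / 2)))\<^sup>2)
      = (exp c - (1 + c / real N) ^ N) * expectation (\<lambda>w. (norm (X w))\<^sup>2)"
proof -
  define \<delta> where "\<delta> = (b - a) / real N"
  define t where "t k = a + real k * \<delta>" for k
  define v where "v = (norm u)\<^sup>2 * \<delta>"
  define Y where "Y k w = u \<bullet> (B (t (Suc k)) w - B (t k) w)" for k w
  define P where "P k w = X w * (\<Prod>j<k. 1 + \<i> * Y j w)" for k w
  \<comment> \<open>The real factor is the normalisation of the stochastic exponential of
    \<open>\<i> * u \<bullet> B\<close>, started from \<open>X\<close> at time
    \<open>a\<close>.\<close>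
  define Q where "Q k w = X w * iexp (u \<bullet> (B (t k) w - B a w)) * exp (real k * v / 2)" for k w
  define e0 where "e0 = expectation (\<lambda>w. (norm (X w))\<^sup>2)"
  have \<delta>: "\<delta> > 0" using ab N by (simp add: \<delta>_def)
  have tN: "t N = b" using N by (simp add: t_def \<delta>_def)
  have t0: "t 0 = a" by (simp add: t_def)
  have tS: "t k < t (Suc k)" "t (Suc k) - t k = \<delta>" for k using \<delta> by (auto simp: t_def algebra_simps)
  have ta: "a \<le> t k" for k using \<delta> by (simp add: t_def)
  have tb: "t k \<le> b" if "k \<le> N" for k
  proof -
    have "real k * \<delta> \<le> real N * \<delta>" using that \<delta> by (intro mult_right_mono) auto
    then show ?thesis using tN by (simp add: t_def)
  qed
  have step: "0 \<le> t k" "t k < t (Suc k)" "t (Suc k) \<le> T" if "k < N" for k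
    using that ta[of k] tb[of "Suc k"] tS ab by auto
  have PS: "P (Suc k) = (\<lambda>w. P k w * (1 + \<i> * Y k w))" for k by (simp add: P_def mult.assoc fun_eq_iff)
  have P: "P k \<in> borel_measurable (F (t k)) \<and> sqint M (P k) \<and> crep (P k) \<and> expectation (\<lambda>w. (norm (P k w))\<^sup>2) = (1 + v) ^ k * e0" if "k \<le> N" for k
    using that
  proof (induction k)
    case 0
    then show ?case using X by (simp add: P_def t0 e0_def)
  next
    case (Suc k)
    then have k: "k < N" and IH: "P k \<in> borel_measurable (F (t k))" "sqint M (P k)" "crep (P k)"
       "expectation (\<lambda>w. (norm (P k w))\<^sup>2) = (1 + v) ^ k * e0" by auto
    note C = crep_step[OF step[OF k] IH(1-3), of u, folded Y_def, folded PS]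
    show ?case using C(1-3) C(4) IH(4) by (simp add: PS tS v_def mult_ac)
  qed
  have XM: "X \<in> borel_measurable M" by (rule sqint_measurable[OF X(2)])
  have nQ: "norm (Q k w) = exp (real k * v / 2) * norm (X w)" for k w by (simp add: Q_def norm_mult)
  have nQ2: "(norm (Q k w))\<^sup>2 = exp (real k * v) * (norm (X w))\<^sup>2" for k w
    by (simp add: nQ power_mult_distrib exp_double[symmetric])
  have QF: "Q k \<in> borel_measurable (F (t k))" if "k \<le> N" for k
  proof -
    have [measurable]: "X \<in> borel_measurable (F (t k))" "B (t k) \<in> borel_measurable (F (t k))" "B a \<in> borel_measurable (F (t k))"
      using ta[of k] ab by (auto intro!: B_measurable_F measurable_F_mono[OF X(1)])
    show ?thesis unfolding Q_def[abs_def] by measurable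
  qed
  have Qsq: "sqint M (Q k)" if "k \<le> N" for k
    using measurable_F_M[OF QF[OF that]] tb[OF that] ab
    by (intro sqint_mono[OF X(2), where K="exp (real k * v / 2)"]) (auto simp: nQ)
  have Q2: "expectation (\<lambda>w. (norm (Q k w))\<^sup>2) = exp (real k * v) * e0" for k
    by (simp add: nQ2 e0_def)
  \<comment> \<open>The cross moment of \<open>P k\<close> and \<open>Q k\<close> is real and equals
    the second moment of \<open>P k\<close>. Hence E|P - Q|^2 = E|Q|^2 - E|P|^2, which only involves
    exp(c) and (1 + c/N)^N.\<close>
  have cross: "expectation (\<lambda>w. P k w * cnj (Q k w)) = (1 + v) ^ k * e0" if "k \<le> N" for k
    using that
  proof (induction k)
    case 0
    have "P 0 w * cnj (Q 0 w) = of_real ((norm (X w))\<^sup>2)" for w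
      by (simp add: P_def Q_def t0 complex_norm_square[symmetric])
    then have "expectation (\<lambda>w. P 0 w * cnj (Q 0 w)) = expectation (\<lambda>w. complex_of_real ((norm (X w))\<^sup>2))"
      by (simp only:)
    also have "\<dots> = complex_of_real e0" unfolding e0_def by (rule integral_complex_of_real)
    finally show ?case by simp
  next
    case (Suc k)
    then have k: "k < N" "k \<le> N" by auto
    have cQ: "sqint M (\<lambda>w. cnj (Q k w))" "(\<lambda>w. cnj (Q k w)) \<in> borel_measurable (F (t k))"
      using Qsq[OF k(2)] QF[OF k(2)] by (auto simp: sqint_def borel_measurable_complex_iff)
    have PQ: "integrable M (\<lambda>w. P k w * cnj (Q k w))" "(\<lambda>w. P k w * cnj (Q k w)) \<in> borel_measurable (F (t k))"
      using P[OF k(2)] cQ by (auto intro: sqint_mult_integrable)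
    have arg: "- (u \<bullet> (B (t (Suc k)) w - B a w)) = - (u \<bullet> (B (t k) w - B a w)) + (- Y k w)" for w
      by (simp add: Y_def inner_diff_right)
    have "P (Suc k) w * cnj (Q (Suc k) w) = exp (v / 2) * (P k w * cnj (Q k w) * ((1 + \<i> * Y k w) * iexp (- Y k w)))" for w
    proof -
      have "cnj (Q (Suc k) w) = cnj (X w) * iexp (- (u \<bullet> (B (t (Suc k)) w - B a w))) * exp (real (Suc k) * v / 2)"
        by (simp add: Q_def exp_cnj)
      also have "\<dots> = cnj (X w) * (iexp (- (u \<bullet> (B (t k) w - B a w))) * iexp (- Y k w)) * (exp (real k * v / 2) * exp (v / 2))"
        unfolding arg by (simp add: exp_add[symmetric] distrib_left algebra_simps add_divide_distrib)
      also have "\<dots> = cnj (Q k w) * iexp (- Y k w) * exp (v / 2)"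
        by (simp add: Q_def exp_cnj)
      finally show ?thesis by (simp add: PS)
    qed
    then have "expectation (\<lambda>w. P (Suc k) w * cnj (Q (Suc k) w))
       = exp (v / 2) * expectation (\<lambda>w. P k w * cnj (Q k w) * ((1 + \<i> * Y k w) * iexp (- Y k w)))"
      by simp
    also have "expectation (\<lambda>w. P k w * cnj (Q k w) * ((1 + \<i> * Y k w) * iexp (- Y k w)))
       = expectation (\<lambda>w. P k w * cnj (Q k w)) * expectation (\<lambda>w. (1 + \<i> * Y k w) * iexp (- Y k w))"
      using increment_mult(2)[OF step[OF k(1)] PQ(2) _ PQ(1), of "\<lambda>z. (1 + \<i> * (u \<bullet> z)) * iexp (- (u \<bullet> z))"]
        increment_iexp(2)[OF step[OF k(1)], of u] by (simp add: Y_def)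
    also have "expectation (\<lambda>w. (1 + \<i> * Y k w) * iexp (- Y k w)) = (1 + v) * exp (- v / 2)"
      using increment_iexp(1)[OF step[OF k(1)], of u] by (simp add: Y_def tS v_def)
    also have "complex_of_real (exp (v / 2)) * (expectation (\<lambda>w. P k w * cnj (Q k w)) * complex_of_real ((1 + v) * exp (- v / 2)))
        = expectation (\<lambda>w. P k w * cnj (Q k w)) * (1 + v) * complex_of_real (exp (v / 2) * exp (- v / 2))"
      by (simp add: mult_ac)
    also have "exp (v / 2) * exp (- v / 2) = 1" by (simp flip: exp_add)
    finally show ?case using Suc by (simp add: mult_ac)
  qed
  have PN: "sqint M (P N)" "crep (P N)" "expectation (\<lambda>w. (norm (P N w))\<^sup>2) = (1 + v) ^ N * e0" using P by auto
  have cQ: "sqint M (\<lambda>w. cnj (Q N w))" using Qsq[of N] by (auto simp: sqint_def borel_measurable_complex_iff)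
  have PQ: "integrable M (\<lambda>w. P N w * cnj (Q N w))" by (rule sqint_mult_integrable[OF PN(1) cQ])
  have "expectation (\<lambda>w. (norm (P N w - Q N w))\<^sup>2)
    = expectation (\<lambda>w. (norm (P N w))\<^sup>2) + expectation (\<lambda>w. (norm (Q N w))\<^sup>2) - 2 * expectation (\<lambda>w. Re (P N w * cnj (Q N w)))"
  proof -
    have "integrable M (\<lambda>w. Re (P N w * cnj (Q N w)))" by (rule integrable_Re[OF PQ])
    then show ?thesis
      unfolding norm_diff_squared_complex using PN(1) Qsq[of N]
      by (simp add: sqint_def del: times_complex.sel complex_cnj_mult)
  qed
  also have "expectation (\<lambda>w. Re (P N w * cnj (Q N w))) = Re (expectation (\<lambda>w. P N w * cnj (Q N w)))"
    by (rule integral_Re[OF PQ])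
  also have "expectation (\<lambda>w. P N w * cnj (Q N w)) = of_real ((1 + v) ^ N * e0)" using cross[of N] by simp
  finally have "expectation (\<lambda>w. (norm (P N w - Q N w))\<^sup>2) = (exp (real N * v) - (1 + v) ^ N) * e0"
    by (simp add: PN Q2 algebra_simps)
  moreover have Nv: "real N * v = c" using N by (simp add: v_def c_def \<delta>_def)
  moreover have "v = c / real N" using Nv N by (simp add: field_simps)
  ultimately show ?thesis
    using PN by (intro that[of "P N"]) (simp_all add: Q_def tN e0_def)
qed

lemma crep_iexp:
  fixes u :: "real^'d"
  assumes ab: "0 \<le> a" "a < b" "b \<le> T" and X: "X \<in> borel_measurable (F a)" "sqint M X" "crep X"
  shows "crep (\<lambda>w. X w * iexp (u \<bullet> (B b w - B a w)))"
proof -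
  define c where "c = (norm u)\<^sup>2 * (b - a)"
  define Q where "Q w = X w * iexp (u \<bullet> (B b w - B a w)) * exp (c / 2)" for w
  have "\<exists>P. crep P \<and> sqint M P \<and> expectation (\<lambda>w. (norm (P w - Q w))\<^sup>2)
      = (exp c - (1 + c / real (Suc n)) ^ Suc n) * expectation (\<lambda>w. (norm (X w))\<^sup>2)" for n
    unfolding Q_def c_def by (rule crep_iexp_approx[OF ab X zero_less_Suc[of n], of u], rule exI, intro conjI)
  then obtain P where P: "\<And>n. crep (P n)" "\<And>n. sqint M (P n)" "\<And>n. expectation (\<lambda>w. (norm (P n w - Q w))\<^sup>2)
      = (exp c - (1 + c / real (Suc n)) ^ Suc n) * expectation (\<lambda>w. (norm (X w))\<^sup>2)" by metis
  have [measurable]: "B b \<in> borel_measurable M" "B a \<in> borel_measurable M" "X \<in> borel_measurable M"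
    using ab sqint_measurable[OF X(2)] by auto
  have Qm: "Q \<in> borel_measurable M" unfolding Q_def by measurable
  have Qsq: "sqint M Q" using Qm by (intro sqint_mono[OF X(2), where K="exp (c / 2)"]) (auto simp: Q_def norm_mult)
  have "(\<lambda>n. (exp c - (1 + c / real (Suc n)) ^ Suc n) * expectation (\<lambda>w. (norm (X w))\<^sup>2)) \<longlonglongrightarrow> (exp c - exp c) * expectation (\<lambda>w. (norm (X w))\<^sup>2)"
    by (intro tendsto_intros LIMSEQ_Suc[OF tendsto_exp_limit_sequentially])
  then have "(\<lambda>n. ennreal (expectation (\<lambda>w. (norm (P n w - Q w))\<^sup>2))) \<longlonglongrightarrow> ennreal 0"
    unfolding P(3) by (intro tendsto_ennrealI) simp
  then have "(\<lambda>n. \<integral>\<^sup>+w. ennreal ((norm (P n w - Q w))\<^sup>2) \<partial>M) \<longlonglongrightarrow> 0"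
    by (subst sqint_nn_integral[OF sqint_diff[OF P(2) Qsq]]) simp
  then have "crep Q" by (rule crep_lim[OF P(1) Qm])
  \<comment> \<open>The deterministic normalisation exp(c / 2) is divided out again.\<close>
  from crep_cmult[OF this, of "exp (- c / 2)"]
  have "crep (\<lambda>w. X w * iexp (u \<bullet> (B b w - B a w)) * complex_of_real (exp (- c / 2) * exp (c / 2)))"
    by (simp add: Q_def mult_ac)
  also have "exp (- c / 2) * exp (c / 2) = 1" by (simp flip: exp_add)
  finally show ?thesis by simp
qed

text \<open>Induction on the largest time \<open>b\<close>: writing B_b = B_a + (B_b - B_a) with
  \<open>a\<close> the preceding time, the first part is absorbed into the exponential over the
  earlier times and the increment is handled by \<open>crep_iexp\<close>. Time 0 is always included
  so that a preceding time exists.\<close>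

lemma crep_trig:
  assumes "finite G" "G \<subseteq> {0<..T}"
  shows "crep (\<lambda>w. iexp (\<Sum>t\<in>insert 0 G. v t \<bullet> B t w))"
  using assms
proof (induction G arbitrary: v rule: finite_linorder_max_induct)
  case empty
  have 1: "crep (\<lambda>w. 1)" by (simp add: crep_def representable_const)
  have 2: "AE w in M. 1 = iexp (\<Sum>t\<in>insert 0 {}. v t \<bullet> B t w)" using B_zero by eventually_elim simp
  have [measurable]: "B 0 \<in> borel_measurable M" using T_pos by auto
  have 3: "(\<lambda>w. iexp (\<Sum>t\<in>insert 0 {}. v t \<bullet> B t w)) \<in> borel_measurable M" by simp
  show ?case by (rule crep_cong_AE[OF 1 3 2])
next
  case (insert b G)
  define a where "a = Max (insert 0 G)"
  have a: "a \<in> insert 0 G" "\<And>t. t \<in> insert 0 G \<Longrightarrow> t \<le> a"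
    unfolding a_def using insert.hyps(1) Max_in[of "insert 0 G"] Max_ge[of "insert 0 G"] by blast+
  have bT: "0 < b" "b \<le> T" using insert.prems by auto
  have ab: "0 \<le> a" "a < b" using a insert.hyps(2) bT by auto
  have bJ: "b \<notin> insert 0 G" using insert.hyps(2) bT by auto
  \<comment> \<open>The coefficient of \<open>b\<close> is shifted to \<open>a\<close>.\<close>
  define v' where "v' = v(a := v a + v b)"
  define X where "X w = iexp (\<Sum>t\<in>insert 0 G. v' t \<bullet> B t w)" for w
  have X: "crep X" unfolding X_def using insert.prems by (intro insert.IH) auto
  have XF: "X \<in> borel_measurable (F a)"
  proof -
    have [measurable]: "B t \<in> borel_measurable (F a)" if "t \<in> insert 0 G" for t
      using a(2)[OF that] that insert.prems by (intro B_measurable_F) auto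
    show ?thesis unfolding X_def by measurable
  qed
  have Xsq: "sqint M X" using measurable_F_M[OF XF] ab bT by (intro sqint_bounded[where K=1]) (auto simp: X_def)
  have "crep (\<lambda>w. X w * iexp (v b \<bullet> (B b w - B a w)))"
    by (rule crep_iexp[OF ab bT(2) XF Xsq X])
  moreover have "X w * iexp (v b \<bullet> (B b w - B a w)) = iexp (\<Sum>t\<in>insert 0 (insert b G). v t \<bullet> B t w)" for w
  proof -
    have fin: "finite (insert 0 G)" using insert.hyps by simp
    have "(\<Sum>t\<in>insert 0 G. v' t \<bullet> B t w) = (\<Sum>t\<in>insert 0 G. v t \<bullet> B t w) + v b \<bullet> B a w"
      unfolding sum.remove[OF fin a(1)] by (simp add: v'_def inner_add_left)
    moreover have "(\<Sum>t\<in>insert 0 (insert b G). v t \<bullet> B t w) = (\<Sum>t\<in>insert 0 G. v t \<bullet> B t w) + v b \<bullet> B b w"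
      unfolding insert_commute[of 0 b] using bJ fin by (subst sum.insert) auto
    ultimately have "(\<Sum>t\<in>insert 0 (insert b G). v t \<bullet> B t w) = (\<Sum>t\<in>insert 0 G. v' t \<bullet> B t w) + v b \<bullet> (B b w - B a w)"
      by (simp add: inner_diff_right)
    then show ?thesis by (simp add: X_def exp_add distrib_left del: sum.insert sum.insert_if)
  qed
  ultimately show ?case by simp
qed

end

lemma mult_sin_divide_tendsto: "(\<lambda>m. real (Suc m) * sin (x / real (Suc m))) \<longlonglongrightarrow> x"
proof -
  have "((\<lambda>y. sin (x * y)) has_real_derivative x) (at 0)" by (auto intro!: derivative_eq_intros)
  then have "((\<lambda>h. sin (x * h) / h) \<longlongrightarrow> x) (at 0)" by (simp add: DERIV_def)
  moreover have "filterlim (\<lambda>m. 1 / real (Suc m)) (at 0) sequentially"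
    by (intro filterlim_atI LIMSEQ_Suc[OF lim_1_over_n]) auto
  ultimately have "(\<lambda>m. sin (x * (1 / real (Suc m))) / (1 / real (Suc m))) \<longlonglongrightarrow> x"
    by (rule filterlim_compose)
  then show ?thesis by (simp add: mult.commute)
qed

context brownian
begin

text \<open>The phase \<theta> puts the sines into the class too and keeps everything
  real-valued.\<close>

definition cosines :: "('w \<Rightarrow> real) set" where
  "cosines = {(\<lambda>w. cos (\<theta> + (\<Sum>t\<in>G. v t \<bullet> B t w))) | \<theta> G v. finite G \<and> G \<subseteq> {0..T}}"

lemma cosinesI: "finite G \<Longrightarrow> G \<subseteq> {0..T} \<Longrightarrow> (\<lambda>w. cos (\<theta> + (\<Sum>t\<in>G. v t \<bullet> B t w))) \<in> cosines"
  unfolding cosines_def by blast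

lemma representable_cosine:
  assumes "finite G" "G \<subseteq> {0..T}"
  shows "representable (\<lambda>w. cos (\<theta> + (\<Sum>t\<in>G. v t \<bullet> B t w)))"
proof -
  \<comment> \<open>\<open>crep_trig\<close> requires time 0 in the index set; coefficient 0 makes
    its presence harmless.\<close>
  define v' where "v' t = (if t \<in> G then v t else 0)" for t
  have "crep (\<lambda>w. iexp \<theta> * iexp (\<Sum>t\<in>insert 0 (G - {0}). v' t \<bullet> B t w))"
    using assms by (intro crep_cmult crep_trig) fastforce+
  moreover have "(\<Sum>t\<in>insert 0 (G - {0}). v' t \<bullet> B t w) = (\<Sum>t\<in>G. v t \<bullet> B t w)" for w
    using assms by (intro sum.mono_neutral_cong_right) (auto simp: v'_def)
  moreover have "iexp \<theta> * iexp y = iexp (\<theta> + y)" for y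
    by (simp add: exp_add distrib_left)
  ultimately have "crep (\<lambda>w. iexp (\<theta> + (\<Sum>t\<in>G. v t \<bullet> B t w)))" by (simp only:)
  then show ?thesis unfolding crep_def by (simp add: Re_exp)
qed

lemma bounded_class_cosines: "bounded_class (space M) cosines"
proof
  show "\<exists>K. \<forall>w\<in>space M. \<bar>g w\<bar> \<le> K" if "g \<in> cosines" for g
    using that by (auto simp: cosines_def intro!: exI[of _ 1])
  show "(\<lambda>_. 1) \<in> cosines" using cosinesI[of "{}" 0] by simp
  fix g h assume "g \<in> cosines" "h \<in> cosines"
  then obtain \<theta> G v \<theta>' G' v' where G: "finite G" "G \<subseteq> {0..T}" "finite G'" "G' \<subseteq> {0..T}"
    and g: "g = (\<lambda>w. cos (\<theta> + (\<Sum>t\<in>G. v t \<bullet> B t w)))" and h: "h = (\<lambda>w. cos (\<theta>' + (\<Sum>t\<in>G'. v' t \<bullet> B t w)))"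
    unfolding cosines_def by blast
  \<comment> \<open>Extension by zero gives both phases the same index set before the product-to-sum
    formula is used.\<close>
  define u where "u t = (if t \<in> G then v t else 0)" for t
  define u' where "u' t = (if t \<in> G' then v' t else 0)" for t
  have s: "(\<Sum>t\<in>G. v t \<bullet> B t w) = (\<Sum>t\<in>G\<union>G'. u t \<bullet> B t w)" "(\<Sum>t\<in>G'. v' t \<bullet> B t w) = (\<Sum>t\<in>G\<union>G'. u' t \<bullet> B t w)" for w
    using G by (auto intro!: sum.mono_neutral_cong_left simp: u_def u'_def)
  have "(\<lambda>w. 1/2 * cos ((\<theta> - \<theta>') + (\<Sum>t\<in>G\<union>G'. (u t - u' t) \<bullet> B t w)) + 1/2 * cos ((\<theta> + \<theta>') + (\<Sum>t\<in>G\<union>G'. (u t + u' t) \<bullet> B t w)))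
    \<in> bounded_closure (space M) cosines"
    using G by (intro bounded_closure.add bounded_closure.cmult bounded_closure.base cosinesI) auto
  also have "(\<lambda>w. 1/2 * cos ((\<theta> - \<theta>') + (\<Sum>t\<in>G\<union>G'. (u t - u' t) \<bullet> B t w)) + 1/2 * cos ((\<theta> + \<theta>') + (\<Sum>t\<in>G\<union>G'. (u t + u' t) \<bullet> B t w)))
     = (\<lambda>w. g w * h w)"
    unfolding g h s inner_diff_left inner_add_left sum.distrib sum_subtractf
  proof
    fix w
    let ?S = "\<Sum>t\<in>G \<union> G'. u t \<bullet> B t w" and ?S' = "\<Sum>t\<in>G \<union> G'. u' t \<bullet> B t w"
    have "(\<theta> + ?S) - (\<theta>' + ?S') = (\<theta> - \<theta>') + (?S - ?S')" "(\<theta> + ?S) + (\<theta>' + ?S') = (\<theta> + \<theta>') + (?S + ?S')"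
      by simp_all
    note e = this
    show "1/2 * cos ((\<theta> - \<theta>') + (?S - ?S')) + 1/2 * cos ((\<theta> + \<theta>') + (?S + ?S')) = cos (\<theta> + ?S) * cos (\<theta>' + ?S')"
      unfolding cos_times_cos e by simp
  qed
  finally show "(\<lambda>w. g w * h w) \<in> bounded_closure (space M) cosines" .
qed

lemma representable_closure:
  assumes "g \<in> bounded_closure (space M) cosines" shows "representable g"
  using assms
proof (induction rule: bounded_closure.induct)
  case (base g)
  then show ?case by (auto simp: cosines_def intro: representable_cosine)
next
  case (add g h)
  then show ?case by (intro representable_add)
next
  case (cmult g c)
  then show ?case by (intro representable_cmult)
next
  case (lim g K h)
  have gm: "g n \<in> borel_measurable M" for n using lim.IH by (rule representable_measurable)
  have hm: "h \<in> borel_measurable M" by (rule borel_measurable_LIMSEQ_metric[OF gm lim.hyps(3)])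
  show ?case
  proof (rule representable_lim[OF lim.IH hm], rule L2_dominated_convergence[OF gm hm sqint_const[of "2 * K"]])
    show "AE w in M. (\<lambda>n. g n w) \<longlonglongrightarrow> h w" using lim.hyps(3) by auto
    show "AE w in M. \<bar>g n w - h w\<bar> \<le> \<bar>2 * K\<bar>" for n
    proof (rule AE_I2)
      fix w assume w: "w \<in> space M"
      have "\<bar>h w\<bar> \<le> K"
        using tendsto_rabs[OF lim.hyps(3)[OF w]] lim.hyps(2)[OF w] by (intro LIMSEQ_le_const2) auto
      then show "\<bar>g n w - h w\<bar> \<le> \<bar>2 * K\<bar>" using lim.hyps(2)[OF w, of n] by linarith
    qed
  qed
qed

text \<open>The coordinates of B are unbounded and hence outside the class. They are recovered as
  limits of m sin(B / m), so the events carried by the class include the natural filtration;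
  augmentation changes them only by null sets.\<close>

lemma representable_indicator:
  assumes A: "A \<in> sets (F T)" shows "representable (indicator A)"
proof -
  interpret C: bounded_class "space M" cosines by (rule bounded_class_cosines)
  let ?N = "sigma (space M) C.Cl_sets"
  have setsN: "sets ?N = C.Cl_sets" by (rule sigma_algebra.sets_measure_of_eq[OF C.sigma_algebra_Cl])
  have spN: "space ?N = space M" by (rule space_measure_of) (auto simp: C.Cl_sets_def)
  have Bc: "(\<lambda>w. B t w $ i) \<in> borel_measurable ?N" if t: "t \<in> {0..T}" for t i
  proof (rule borel_measurable_LIMSEQ_metric)
    show "(\<lambda>m. real (Suc m) * sin (B t w $ i / real (Suc m))) \<longlonglongrightarrow> B t w $ i" for w
      by (rule mult_sin_divide_tendsto)
    fix m
    \<comment> \<open>The phase -pi/2 turns the cosine into a sine, and the axis vector selects one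
      coordinate, scaled by 1/m with m replaced by \<open>Suc m\<close>.\<close>
    have "(\<lambda>w. cos (- pi / 2 + (\<Sum>s\<in>{t}. axis i (1 / real (Suc m)) \<bullet> B s w))) \<in> cosines"
      using t by (intro cosinesI) auto
    then have "(\<lambda>w. cos (- pi / 2 + (\<Sum>s\<in>{t}. axis i (1 / real (Suc m)) \<bullet> B s w))) \<in> borel_measurable ?N"
      by (intro C.Cl_measurable bounded_closure.base)
    moreover have "cos (- pi / 2 + (\<Sum>s\<in>{t}. axis i (1 / real (Suc m)) \<bullet> B s w)) = sin (B t w $ i / real (Suc m))" for w
      using cos_diff[of "B t w $ i / real (Suc m)" "pi / 2"] by (simp add: inner_axis' )
    ultimately show "(\<lambda>w. real (Suc m) * sin (B t w $ i / real (Suc m))) \<in> borel_measurable ?N" by simp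
  qed
  have Bm: "B t \<in> borel_measurable ?N" if t: "t \<in> {0..T}" for t
    using Bc[OF t] unfolding borel_measurable_euclidean_space[of "B t"]
    by (auto simp: Basis_vec_def inner_axis)
  have "sets (nat_filtration M B T) \<subseteq> C.Cl_sets"
  proof -
    have "(\<Union>s\<in>{0..T}. {B s -` A \<inter> space M |A. A \<in> sets borel}) \<subseteq> sets ?N"
      using measurable_sets[OF Bm] spN by auto
    from sets.sigma_sets_subset[OF this] show ?thesis unfolding sets_nat spN setsN .
  qed
  moreover obtain A' where A': "A' \<in> sets (nat_filtration M B T)" "AE w in M. w \<in> A \<longleftrightarrow> w \<in> A'"
    using sets_F_approx[OF A] by auto
  ultimately have "representable (indicator A')"
    by (intro representable_closure) (auto simp: C.Cl_sets_def)
  then show ?thesis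
  proof (rule representable_cong_AE)
    show "indicator A \<in> borel_measurable M" using A sets_F_sub[of T] by auto
    show "AE w in M. indicator A' w = (indicator A w :: real)" using A'(2) by eventually_elim (auto simp: indicator_def)
  qed
qed

lemma representable_sum: "(\<And>i. i \<in> A \<Longrightarrow> representable (X i)) \<Longrightarrow> representable (\<lambda>w. \<Sum>i\<in>A. X i w)"
proof (induction A rule: infinite_finite_induct)
  case (insert i A)
  then have "representable (\<lambda>w. X i w + (\<Sum>i\<in>A. X i w))" by (intro representable_add) auto
  then show ?case using insert by simp
qed (simp_all add: representable_const)

lemma representable_L2:
  assumes X: "X \<in> borel_measurable (F T)" "sqint M X" shows "representable X"
proof -
  obtain s where s: "\<And>i. simple_function (F T) (s i)" "\<And>w. w \<in> space M \<Longrightarrow> (\<lambda>i. s i w) \<longlonglongrightarrow> X w"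
     "\<And>i w. w \<in> space M \<Longrightarrow> \<bar>s i w\<bar> \<le> 2 * \<bar>X w\<bar>"
  proof -
    from borel_measurable_implies_sequence_metric[OF X(1), of 0] obtain s where
      "(\<forall>i. simple_function (F T) (s i)) \<and> (\<forall>w\<in>space (F T). (\<lambda>i. s i w) \<longlonglongrightarrow> X w) \<and>
        (\<forall>i. \<forall>w\<in>space (F T). dist (s i w) 0 \<le> 2 * dist (X w) 0)" by (rule exE)
    then show ?thesis by (intro that[of s]) auto
  qed
  have XM: "X \<in> borel_measurable M" by (rule sqint_measurable[OF X(2)])
  have sM: "s i \<in> borel_measurable M" for i
    using borel_measurable_simple_function[OF s(1)[of i]] by (rule measurable_F_M) simp
  have "representable (s i)" for i
  proof (rule representable_cong_AE[OF _ sM])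
    show "representable (\<lambda>w. \<Sum>y\<in>s i ` space M. y * indicator (s i -` {y} \<inter> space M) w)"
      using simple_functionD(2)[OF s(1)[of i]] by (intro representable_sum representable_cmult representable_indicator) auto
    show "AE w in M. (\<Sum>y\<in>s i ` space M. y * indicator (s i -` {y} \<inter> space M) w) = s i w"
    proof (rule AE_I2)
      fix w assume w: "w \<in> space M"
      have fin: "finite (s i ` space M)" using simple_functionD(1)[OF s(1)[of i]] by simp
      have "(\<Sum>y\<in>s i ` space M. y * indicator (s i -` {y} \<inter> space M) w) = (\<Sum>y\<in>s i ` space M. if y = s i w then y else 0)"
        using w by (intro sum.cong) (auto simp: indicator_def)
      then show "(\<Sum>y\<in>s i ` space M. y * indicator (s i -` {y} \<inter> space M) w) = s i w"
        using fin w by simp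
    qed
  qed
  then show ?thesis
  proof (rule representable_lim[OF _ XM])
    show "(\<lambda>n. \<integral>\<^sup>+w. ennreal ((s n w - X w)\<^sup>2) \<partial>M) \<longlonglongrightarrow> 0"
    \<comment> \<open>The factor 3 comes from |s - X| <= |s| + |X| together with the bound |s| <= 2
      |X| of the approximation theorem.\<close>
    proof (rule L2_dominated_convergence[OF sM XM sqint_cmult[OF X(2), of 3]])
      show "AE w in M. (\<lambda>n. s n w) \<longlonglongrightarrow> X w" using s(2) by auto
      show "AE w in M. \<bar>s n w - X w\<bar> \<le> \<bar>3 * X w\<bar>" for n
      proof (rule AE_I2)
        fix w assume "w \<in> space M"
        then show "\<bar>s n w - X w\<bar> \<le> \<bar>3 * X w\<bar>" using s(3)[of w n] by linarith
      qed
    qed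
  qed
qed

theorem martingale_representation:
  assumes \<zeta>: "\<zeta> \<in> borel_measurable (F T)" "sqint M \<zeta>"
  obtains Z I where "Z \<in> H2 M F T" "is_ito_integral M T B Z I" "AE w in M. I T w = \<zeta> w - expectation \<zeta>"
proof -
  have "\<exists>c S. simple S \<and> (\<integral>\<^sup>+w. ennreal ((\<zeta> w - (c + J S T w))\<^sup>2) \<partial>M) \<le> ennreal (1 / real (Suc n))" for n
    using representableD[OF representable_L2[OF \<zeta>], of "1 / real (Suc n)"] by simp
  then obtain c S where S: "\<And>n. simple (S n)"
      and close: "\<And>n. (\<integral>\<^sup>+w. ennreal ((\<zeta> w - (c n + J (S n) T w))\<^sup>2) \<partial>M) \<le> ennreal (1 / real (Suc n))" by metis
  \<comment> \<open>The constants \<open>c n\<close> may be replaced by the mean of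
    \<open>\<zeta>\<close>: simple integrals have mean 0, so the new error is the old one minus its
    mean, and a variance never exceeds the second moment.\<close>
  have le: "(\<integral>\<^sup>+w. ennreal ((J (S n) T w - (\<zeta> w - expectation \<zeta>))\<^sup>2) \<partial>M) \<le> ennreal (1 / real (Suc n))" for n
  proof -
    define D where "D w = \<zeta> w - (c n + J (S n) T w)" for w
    have Js: "sqint M (J (S n) T)" by (rule simple_integral_sqint_T[OF S])
    have D: "sqint M D" unfolding D_def by (intro sqint_diff sqint_add sqint_const \<zeta> Js)
    have "expectation (J (S n) T) = 0"
      using simple_integral_martingale[OF S[of n], of 0 T "\<lambda>_. 1"] T_pos
      by (simp add: simple_integral_0[OF S] sqint_const)
    then have ED: "expectation D = expectation \<zeta> - c n"
      unfolding D_def using sqint_integrable[OF \<zeta>(2)] sqint_integrable[OF Js] by (simp add: prob_space)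
    have "J (S n) T w - (\<zeta> w - expectation \<zeta>) = - (D w - expectation D)" for w by (simp add: ED D_def)
    then have "(\<integral>\<^sup>+w. ennreal ((J (S n) T w - (\<zeta> w - expectation \<zeta>))\<^sup>2) \<partial>M) = (\<integral>\<^sup>+w. ennreal ((D w - expectation D)\<^sup>2) \<partial>M)"
      by (simp add: power2_commute)
    also have "\<dots> = ennreal (variance D)"
      using sqint_nn_integral[OF sqint_diff[OF D sqint_const[of "expectation D"]]] by simp
    also have "variance D \<le> expectation (\<lambda>w. (D w)\<^sup>2)"
      using variance_eq[OF sqint_integrable[OF D] sqint_square_integrable[OF D]] by simp
    also have "ennreal (expectation (\<lambda>w. (D w)\<^sup>2)) = (\<integral>\<^sup>+w. ennreal ((D w)\<^sup>2) \<partial>M)"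
      using sqint_nn_integral[OF D] by simp
    also note close[of n, folded D_def]
    finally show ?thesis by (simp add: ennreal_leI)
  qed
  have "(\<lambda>n. ennreal (1 / real (Suc n))) \<longlonglongrightarrow> ennreal 0"
    by (intro tendsto_ennrealI LIMSEQ_Suc[OF lim_1_over_n])
  then have "(\<lambda>n. ennreal (1 / real (Suc n))) \<longlonglongrightarrow> 0" by simp
  then have lim: "(\<lambda>n. \<integral>\<^sup>+w. ennreal ((J (S n) T w - (\<zeta> w - expectation \<zeta>))\<^sup>2) \<partial>M) \<longlonglongrightarrow> 0"
    by (rule tendsto_sandwich[OF always_eventually[OF allI[OF zero_le]] always_eventually[OF allI[OF le]] tendsto_const])
  have "(\<lambda>w. \<zeta> w - expectation \<zeta>) \<in> borel_measurable M" using sqint_measurable[OF \<zeta>(2)] by measurable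
  from S this lim show ?thesis by (rule ito_exists) (rule that)
qed

end

section \<open>Reflection of deterministic functions: flatness, comparison, existence\<close>

section \<open>The deterministic Skorokhod problem\<close>

lemma emeasure_stieltjes_Ioc:
  assumes T: "0 \<le> T" and K: "continuous_on {0..T} K" "mono_on {0..T} K" and "a \<le> b"
  shows "emeasure (stieltjes_measure T K) {a<..b} = ennreal (K (max 0 (min b T)) - K (max 0 (min a T)))"
  unfolding stieltjes_measure_def
proof (rule emeasure_interval_measure_Ioc[OF \<open>a \<le> b\<close>])
  show "K (max 0 (min x T)) \<le> K (max 0 (min y T))" if "x \<le> y" for x y
    using K(2) that T by (auto simp: mono_on_def)
  have "continuous_on UNIV (\<lambda>t. K (max 0 (min t T)))"
    by (intro continuous_on_compose2[OF K(1)] continuous_intros) (use T in auto)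
  then show "continuous (at_right a) (\<lambda>t. K (max 0 (min t T)))" for a
    by (simp add: continuous_on_eq_continuous_at continuous_at_imp_continuous_at_within)
qed

lemma sets_stieltjes [measurable_cong]: "sets (stieltjes_measure T K) = sets borel"
  by (simp add: stieltjes_measure_def)

text \<open>Each point of \<open>U\<close> lies in a null interval with rational endpoints, and
  there are only countably many of these. \<open>U\<close> itself need not be measurable, being
  covered by their union.\<close>

lemma stieltjes_locally_constant_null:
  assumes T: "0 \<le> T" and K: "continuous_on {0..T} K" "mono_on {0..T} K"
    and loc: "\<And>t. t \<in> U \<Longrightarrow> \<exists>p q. p < t \<and> t < q \<and> K (max 0 (min p T)) = K (max 0 (min q T))"
  shows "AE t in stieltjes_measure T K. t \<notin> U"
proof -
  let ?N = "stieltjes_measure T K" and ?K = "\<lambda>t. K (max 0 (min t T))"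
  define R where "R = {(p, q). p \<in> \<rat> \<and> q \<in> \<rat> \<and> emeasure ?N {p<..q::real} = 0}"
  have "countable R" by (rule countable_subset[of _ "\<rat> \<times> \<rat>"]) (auto simp: R_def countable_rat)
  then have "(\<Union>(p, q)\<in>R. {p<..q}) \<in> null_sets ?N"
    by (intro null_sets_UN') (auto simp: R_def null_sets_def)
  moreover have "U \<subseteq> (\<Union>(p, q)\<in>R. {p<..q})"
  proof
    fix t assume "t \<in> U"
    then obtain p q where pq: "p < t" "t < q" "?K p = ?K q" using loc by blast
    obtain p' where p': "p' \<in> \<rat>" "p < p'" "p' < t" using Rats_dense_in_real[OF pq(1)] by auto
    obtain q' where q': "q' \<in> \<rat>" "t < q'" "q' < q" using Rats_dense_in_real[OF pq(2)] by auto
    have mono: "?K x \<le> ?K y" if "x \<le> y" for x y using K(2) that T by (auto simp: mono_on_def)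
    have "?K q' - ?K p' \<le> 0" using mono[of p p'] mono[of q' q] p' q' pq by linarith
    then have "emeasure ?N {p'<..q'} = 0"
      using emeasure_stieltjes_Ioc[OF T K, of p' q'] p' q' by (simp add: ennreal_neg)
    then have "(p', q') \<in> R" using p' q' by (simp add: R_def)
    then show "t \<in> (\<Union>(p, q)\<in>R. {p<..q})"
      using p' q' by (intro UN_I[of "(p', q')"]) auto
  qed
  ultimately show ?thesis by (intro AE_I'[where N="\<Union>(p, q)\<in>R. {p<..q}"]) auto
qed

text \<open>Vanishing mass gives constancy before \<open>b\<close>, and continuity of
  \<open>K\<close> extends it to \<open>b\<close>. The right end is left open because flatness is
  only available strictly before the first contact.\<close>

lemma stieltjes_null_imp_constant:
  assumes T: "0 \<le> T" and K: "continuous_on {0..T} K" "mono_on {0..T} K"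
    and ab: "0 \<le> a" "a < b" "b \<le> T" and null: "AE t in stieltjes_measure T K. t \<notin> {a..<b}"
  shows "K a = K b"
proof -
  have eq: "K t = K a" if t: "t \<in> {a..<b}" for t
  proof -
    have "{a<..t} \<in> null_sets (stieltjes_measure T K)"
    proof (subst AE_iff_null_sets)
      show "AE s in stieltjes_measure T K. s \<notin> {a<..t}" using null by eventually_elim (use t in auto)
    qed (simp add: sets_stieltjes)
    then have "ennreal (K t - K a) = 0"
      using emeasure_stieltjes_Ioc[OF T K, of a t] ab t by (simp add: null_setsD1)
    moreover have "K a \<le> K t" using K(2) ab t by (auto simp: mono_on_def)
    ultimately show ?thesis by (simp add: ennreal_eq_0_iff)
  qed
  have "(K \<longlongrightarrow> K b) (at b within {0..T})" using K(1) ab by (auto simp: continuous_on_def)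
  then have "(K \<longlongrightarrow> K b) (at b within {0..b})" by (rule tendsto_within_subset) (use ab in auto)
  then have "(K \<longlongrightarrow> K b) (at_left b)" using ab by (simp add: at_within_Icc_at_left)
  moreover have "(K \<longlongrightarrow> K a) (at_left b)"
  proof (rule Lim_transform_eventually[OF tendsto_const])
    show "\<forall>\<^sub>F t in at_left b. K a = K t"
      using eventually_at_left_real[OF ab(2)] by eventually_elim (rule eq[symmetric], auto)
  qed
  ultimately show ?thesis using tendsto_unique[OF trivial_limit_at_left_real] by blast
qed

lemma stieltjes_integral_zero_AE:
  fixes g :: "real \<Rightarrow> real"
  assumes T: "0 \<le> T" and K: "continuous_on {0..T} K" "mono_on {0..T} K"
    and g: "continuous_on {0..T} g" "\<And>t. t \<in> {0..T} \<Longrightarrow> 0 \<le> g t"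
    and int: "(LINT t:{0..T}|stieltjes_measure T K. g t) = 0"
  shows "AE t in stieltjes_measure T K. t \<in> {0..T} \<longrightarrow> g t = 0"
proof -
  obtain C where C: "\<And>t. t \<in> {0..T} \<Longrightarrow> \<bar>g t\<bar> \<le> C"
  proof -
    obtain C where "\<forall>x\<in>g ` {0..T}. norm x \<le> C"
      using compact_imp_bounded[OF compact_continuous_image[OF g(1) compact_Icc]] unfolding bounded_iff by (rule exE)
    from bspec[OF this imageI] show ?thesis by (intro that) simp
  qed
  \<comment> \<open>The known formula concerns left-open intervals; starting at -1 includes the
    point 0, and \<open>K\<close> is extended constantly to the left.\<close>
  have "emeasure (stieltjes_measure T K) {0..T} \<le> emeasure (stieltjes_measure T K) {-1<..T}"
    by (intro emeasure_mono) (auto simp: sets_stieltjes)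
  also have "\<dots> < \<infinity>" using emeasure_stieltjes_Ioc[OF T K, of "-1" T] T by simp
  finally have fin: "emeasure (stieltjes_measure T K) {0..T} < \<infinity>" .
  have m: "(\<lambda>t. indicator {0..T} t *\<^sub>R g t) \<in> borel_measurable (stieltjes_measure T K)"
    using borel_measurable_continuous_on_indicator[OF _ g(1)] by (simp add: measurable_cong_sets[OF sets_stieltjes refl])
  \<comment> \<open>The Bochner integral of a non-integrable function is 0 as well, so integrability
    must be settled before a zero integral says anything about \<open>g\<close>.\<close>
  have "integrable (stieltjes_measure T K) (\<lambda>t. indicator {0..T} t *\<^sub>R g t)"
    using C by (intro integrableI_bounded_set[where A="{0..T}" and B=C] m fin) (auto simp: sets_stieltjes)
  then have "AE t in stieltjes_measure T K. indicator {0..T} t *\<^sub>R g t = 0"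
    using int g(2) unfolding set_lebesgue_integral_def
    by (subst (asm) integral_nonneg_eq_0_iff_AE) (auto simp: indicator_def)
  then show ?thesis by eventually_elim (auto simp: indicator_def)
qed

text \<open>If the bound failed at \<open>t0\<close>, consider the first later time \<open>u\<close>
  at which it holds. Before \<open>u\<close> the push of \<open>K\<close> exceeds what feasibility
  of \<open>K'\<close> demands, so the constraint is strictly slack and flatness forbids
  \<open>K\<close> to grow: \<open>K t0 = K u\<close>. As \<open>K'\<close> is nondecreasing, the
  bound at \<open>u\<close> then implies the bound at \<open>t0\<close>.\<close>

lemma skorokhod_comparison:
  assumes T: "0 \<le> T" and K: "continuous_on {0..T} K" "mono_on {0..T} K" and K': "continuous_on {0..T} K'" "mono_on {0..T} K'"
    and g: "continuous_on {0..T} (\<lambda>t. m t (K T - K t))" "\<And>t. t \<in> {0..T} \<Longrightarrow> 0 \<le> m t (K T - K t)"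
    and int: "(LINT t:{0..T}|stieltjes_measure T K. m t (K T - K t)) = 0"
    and m: "\<And>t x y. t \<in> {0..T} \<Longrightarrow> x < y \<Longrightarrow> m t x < (m t y :: real)"
    and g': "\<And>t. t \<in> {0..T} \<Longrightarrow> 0 \<le> m' t (K' T - K' t)"
    and t0: "t0 \<in> {0..T}" and D: "0 \<le> D" "\<And>t x. t \<in> {t0..T} \<Longrightarrow> m' t x \<le> m t (x + D)"
  shows "K T - K t0 \<le> K' T - K' t0 + D"
proof (rule ccontr)
  assume neg: "\<not> ?thesis"
  define A where "A = {s \<in> {t0..T}. K T - K s \<le> K' T - K' s + D}"
  define u where "u = Inf A"
  \<comment> \<open>At \<open>T\<close> both remaining pushes are 0, so the set is never
    empty.\<close>
  have "T \<in> A" using D(1) t0 by (simp add: A_def)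
  have cK: "continuous_on {t0..T} K" "continuous_on {t0..T} K'"
    using t0 by (auto intro: continuous_on_subset[OF K(1)] continuous_on_subset[OF K'(1)])
  have "closed A"
  proof -
    have "closed ({t0..T} \<inter> (\<lambda>s. K T - K s - (K' T - K' s + D)) -` {..0})"
      by (intro continuous_closed_preimage continuous_intros cK)
    also have "{t0..T} \<inter> (\<lambda>s. K T - K s - (K' T - K' s + D)) -` {..0} = A" by (auto simp: A_def)
    finally show ?thesis .
  qed
  then have uA: "u \<in> A" unfolding u_def using \<open>T \<in> A\<close>
    by (intro closed_contains_Inf) (auto simp: A_def intro!: bdd_belowI[of _ t0])
  have u: "t0 < u" "u \<le> T" using uA neg by (auto simp: A_def less_le)
  have pos: "m s (K T - K s) \<noteq> 0" if "s \<in> {t0..<u}" for s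
  proof -
    have "bdd_below A" by (auto simp: A_def intro!: bdd_belowI[of _ t0])
    then have "s \<notin> A" using cInf_lower[of s A] that unfolding u_def by auto
    then have "K' T - K' s + D < K T - K s" using that u by (auto simp: A_def)
    then have "m s (K' T - K' s + D) < m s (K T - K s)" using that u t0 by (intro m) auto
    moreover have "0 \<le> m' s (K' T - K' s)" using that u t0 by (intro g') auto
    moreover have "m' s (K' T - K' s) \<le> m s (K' T - K' s + D)" using that u by (intro D) auto
    ultimately show ?thesis by linarith
  qed
  have "AE t in stieltjes_measure T K. t \<notin> {t0..<u}"
    using stieltjes_integral_zero_AE[OF T K g int] pos u t0
    by (auto elim!: eventually_mono)
  then have "K t0 = K u" using u t0 by (intro stieltjes_null_imp_constant[OF T K]) auto
  moreover have "K' t0 \<le> K' u" using K'(2) u t0 by (auto simp: mono_on_def)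
  ultimately show False using uA neg by (auto simp: A_def)
qed

lemma skorokhod_exists:
  fixes m :: "real \<Rightarrow> real \<Rightarrow> real" and c C :: real
  assumes T: "0 \<le> T" and cont: "\<And>x. continuous_on {0..T} (\<lambda>t. m t x)" and c: "0 < c"
    and lower: "\<And>t x y. t \<in> {0..T} \<Longrightarrow> x \<le> y \<Longrightarrow> c * (y - x) \<le> m t y - m t x"
    and lip: "\<And>t x y. t \<in> {0..T} \<Longrightarrow> \<bar>m t x - m t y\<bar> \<le> C * \<bar>x - y\<bar>"
    and mT: "0 \<le> m T 0"
  obtains K where "continuous_on {0..T} K" "mono_on {0..T} K" "K 0 = 0"
    "\<And>t. t \<in> {0..T} \<Longrightarrow> 0 \<le> m t (K T - K t)" "(LINT t:{0..T}|stieltjes_measure T K. m t (K T - K t)) = 0"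
proof -
  have mono: "m t x \<le> m t y" if "t \<in> {0..T}" "x \<le> y" for t x y
  proof -
    have "0 \<le> c * (y - x)" using c that by (intro mult_nonneg_nonneg) auto
    then show ?thesis using lower[OF that] by linarith
  qed
  have strict: "x \<le> y" if "t \<in> {0..T}" "m t x \<le> m t y" for t x y
  proof (rule ccontr)
    assume "\<not> x \<le> y"
    then have "0 < c * (x - y)" "y \<le> x" using c by auto
    then show False using lower[OF that(1), of y x] that(2) by linarith
  qed
  have "\<exists>x. m t x = 0" if t: "t \<in> {0..T}" for t
  proof -
    \<comment> \<open>The lower slope bound confines the root to distance |m t 0| / c from
      0.\<close>
    define R where "R = \<bar>m t 0\<bar> / c"
    have R: "0 \<le> R" "c * R = \<bar>m t 0\<bar>" using c by (auto simp: R_def)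
    have "m t (- R) \<le> 0" "0 \<le> m t R" using lower[OF t, of "-R" 0] lower[OF t, of 0 R] R by auto
    moreover have "continuous_on {-R..R} (m t)"
    proof (rule lipschitz_on_continuous_on[where L="max C 0"], rule lipschitz_onI)
      fix x y
      have "\<bar>m t x - m t y\<bar> \<le> C * \<bar>x - y\<bar>" by (rule lip[OF t])
      also have "\<dots> \<le> max C 0 * \<bar>x - y\<bar>" by (intro mult_right_mono) auto
      finally show "dist (m t x) (m t y) \<le> max C 0 * dist x y" by (simp add: dist_real_def)
    qed simp
    ultimately show ?thesis using IVT'[of "m t" "-R" 0 R] R by auto
  qed
  then obtain \<rho> where \<rho>: "\<And>t. t \<in> {0..T} \<Longrightarrow> m t (\<rho> t) = 0" by metis
  \<comment> \<open>A slope of at least \<open>c\<close> converts smallness of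
    \<open>m t (\<rho> s)\<close> into closeness of the roots at \<open>t\<close> and
    \<open>s\<close>; continuity of \<rho> then follows from continuity in time alone.\<close>
  have \<rho>_diff: "c * \<bar>\<rho> t - \<rho> s\<bar> \<le> \<bar>m t (\<rho> s)\<bar>" if "t \<in> {0..T}" for t s
    using lower[OF that, of "\<rho> t" "\<rho> s"] lower[OF that, of "\<rho> s" "\<rho> t"] \<rho>[OF that] by (cases "\<rho> t \<le> \<rho> s") (auto simp: abs_if)
  have \<rho>_cont: "continuous_on {0..T} \<rho>"
    unfolding continuous_on_def
  proof
    fix s assume s: "s \<in> {0..T}"
    have "((\<lambda>t. m t (\<rho> s)) \<longlongrightarrow> 0) (at s within {0..T})"
      using cont[of "\<rho> s", unfolded continuous_on_def, rule_format, OF s] \<rho>[OF s] by simp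
    then have "((\<lambda>t. \<bar>m t (\<rho> s)\<bar> / c) \<longlongrightarrow> \<bar>0\<bar> / c) (at s within {0..T})" using c by (intro tendsto_intros) auto
    then have "((\<lambda>t. \<rho> t - \<rho> s) \<longlongrightarrow> 0) (at s within {0..T})"
      using \<rho>_diff[of _ s] c
      by (intro Lim_null_comparison[of "\<lambda>t. \<rho> t - \<rho> s" "\<lambda>t. \<bar>m t (\<rho> s)\<bar> / c"])
        (auto simp: eventually_at_filter field_simps)
    then show "(\<rho> \<longlongrightarrow> \<rho> s) (at s within {0..T})" by (rule LIM_zero_cancel)
  qed
  define L where "L t = max 0 (\<rho> t)" for t
  have L_cont: "continuous_on {0..T} L" unfolding L_def by (intro continuous_intros \<rho>_cont)
  have \<rho>T: "\<rho> T \<le> 0" using strict[of T "\<rho> T" 0] \<rho>[of T] mT T by auto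
  define k where "k t = Sup (L ` {t..T})" for t
  have att: "\<exists>r\<in>{t..T}. k t = L r \<and> (\<forall>s\<in>{t..T}. L s \<le> k t)" if t: "t \<in> {0..T}" for t
  proof -
    have "continuous_on {t..T} L" using t by (intro continuous_on_subset[OF L_cont]) auto
    then obtain r where r: "r \<in> {t..T}" "\<And>s. s \<in> {t..T} \<Longrightarrow> L s \<le> L r"
      using continuous_attains_sup[of "{t..T}" L] t by auto
    then have "k t = L r" unfolding k_def by (intro cSup_eq_maximum) auto
    with r show ?thesis by auto
  qed
  have kL: "L s \<le> k t" if "t \<in> {0..T}" "s \<in> {t..T}" for s t using att[OF that(1)] that(2) by auto
  have k_le: "k t \<le> x" if "t \<in> {0..T}" "\<And>s. s \<in> {t..T} \<Longrightarrow> L s \<le> x" for t x using att[OF that(1)] that(2) by auto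
  have anti: "k t \<le> k s" if "s \<in> {0..T}" "s \<le> t" "t \<le> T" for s t
    using that by (intro k_le kL) auto
  have kT: "k T = 0" using \<rho>T by (simp add: k_def L_def)
  have k_cont: "continuous_on {0..T} k"
    unfolding continuous_on_iff
  proof (intro ballI allI impI)
    fix t e :: real assume t: "t \<in> {0..T}" and e: "0 < e"
    have uc: "uniformly_continuous_on {0..T} L" by (rule compact_uniformly_continuous[OF L_cont compact_Icc])
    obtain d where d: "0 < d" "\<And>x y. x \<in> {0..T} \<Longrightarrow> y \<in> {0..T} \<Longrightarrow> dist x y < d \<Longrightarrow> dist (L x) (L y) < e / 2"
      using uc e unfolding uniformly_continuous_on_def by (metis half_gt_zero)
    have *: "k s \<le> k t + e / 2" if "s \<in> {0..T}" "t \<in> {0..T}" "s \<le> t" "t - s < d" for s t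
    proof (rule k_le[OF that(1)])
      fix r assume r: "r \<in> {s..T}"
      show "L r \<le> k t + e / 2"
      proof (cases "t \<le> r")
        case True
        then show ?thesis using kL[of t r] that r e by auto
      next
        case False
        then have "dist (L r) (L t) < e / 2" using that r by (intro d(2)) (auto simp: dist_real_def)
        moreover have "L t \<le> k t" using kL[of t t] that by auto
        ultimately show ?thesis using abs_ge_self[of "L r - L t"] unfolding dist_real_def by linarith
      qed
    qed
    show "\<exists>d>0. \<forall>s\<in>{0..T}. dist s t < d \<longrightarrow> dist (k s) (k t) < e"
    proof (intro exI[of _ d] conjI ballI impI d(1))
      fix s assume s: "s \<in> {0..T}" "dist s t < d"
      show "dist (k s) (k t) < e"
        using *[of s t] *[of t s] anti[of s t] anti[of t s] s t e by (cases "s \<le> t") (auto simp: dist_real_def)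
    qed
  qed
  define K where "K t = k 0 - k t" for t
  have Kk: "K T - K t = k t" for t by (simp add: K_def kT)
  have K: "continuous_on {0..T} K" "mono_on {0..T} K" "K 0 = 0"
    unfolding K_def using k_cont anti by (auto intro!: continuous_intros mono_onI)
  have k\<rho>: "\<rho> t \<le> k t" if "t \<in> {0..T}" for t using kL[OF that, of t] that by (auto simp: L_def)
  have pos: "0 \<le> m t (k t)" if "t \<in> {0..T}" for t using mono[OF that k\<rho>[OF that]] \<rho>[OF that] by simp
  \<comment> \<open>Where \<rho> lies strictly below \<open>k\<close>, the supremum defining
    \<open>k\<close> is attained away from the current time or equals 0. In both cases
    \<open>k\<close> is locally constant, so \<open>K\<close> puts no mass there.\<close>
  have "AE t in stieltjes_measure T K. t \<notin> {t \<in> {0..T}. \<rho> t < k t}"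
  proof (rule stieltjes_locally_constant_null[OF T K(1,2)])
    fix t assume "t \<in> {t \<in> {0..T}. \<rho> t < k t}"
    then have t: "t \<in> {0..T}" "\<rho> t < k t" by auto
    have "\<exists>d>0. \<forall>s\<in>{0..T}. dist s t < d \<longrightarrow> \<rho> s < k t"
    proof -
      have "k t - \<rho> t > 0" using t by simp
      then obtain d where d: "d > 0" "\<And>s. s \<in> {0..T} \<Longrightarrow> dist s t < d \<Longrightarrow> dist (\<rho> s) (\<rho> t) < k t - \<rho> t"
        using \<rho>_cont t(1) unfolding continuous_on_iff by meson
      have "\<rho> s < k t" if "s \<in> {0..T}" "dist s t < d" for s
        using d(2)[OF that] abs_ge_self[of "\<rho> s - \<rho> t"] unfolding dist_real_def by linarith
      with d(1) show ?thesis by blast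
    qed
    then obtain d where d: "d > 0" "\<And>s. s \<in> {0..T} \<Longrightarrow> dist s t < d \<Longrightarrow> \<rho> s < k t" by auto
    have k0: "0 \<le> k t" using kL[OF t(1), of t] t(1) by (auto simp: L_def)
    have const: "k s = k t" if s: "s \<in> {0..T}" "dist s t < d" for s
    proof (cases "s \<le> t")
      case True
      have "k s \<le> k t"
      proof (rule k_le[OF s(1)])
        fix r assume r: "r \<in> {s..T}"
        show "L r \<le> k t"
        proof (cases "t \<le> r")
          case False
          then have "\<rho> r < k t" using r s True by (intro d(2)) (auto simp: dist_real_def)
          then show ?thesis using k0 by (simp add: L_def)
        qed (use kL[OF t(1)] r in auto)
      qed
      then show ?thesis using anti[of s t] s t True by auto
    next
      case False
      obtain r where r: "r \<in> {t..T}" "k t = L r" using att[OF t(1)] by auto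
      have "k t \<le> k s"
      proof (cases "s \<le> r")
        case True
        then show ?thesis using kL[of s r] s r by auto
      next
        \<comment> \<open>A maximiser between \<open>t\<close> and \<open>s\<close> lies in the zone
          where \<rho> is below \<open>k t\<close>; then the positive part can only reach
          \<open>k t\<close> if that value is 0.\<close>
        case rs: False
        then have "\<rho> r < k t" using r s False t by (intro d(2)) (auto simp: dist_real_def)
        then have "k t = 0" using r(2) by (auto simp: L_def max_def split: if_splits)
        then show ?thesis using kL[of s s] s by (auto simp: L_def)
      qed
      then show ?thesis using anti[of t s] s t False by auto
    qed
    have "k (max 0 (min (t - d / 2) T)) = k t" "k (max 0 (min (t + d / 2) T)) = k t"
      using T t d(1) by (intro const; auto simp: dist_real_def max_def min_def abs_if)+
    then show "\<exists>p q. p < t \<and> t < q \<and> K (max 0 (min p T)) = K (max 0 (min q T))"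
      using d(1) by (intro exI[of _ "t - d / 2"] exI[of _ "t + d / 2"]) (simp add: K_def)
  qed
  then have "AE t in stieltjes_measure T K. indicator {0..T} t *\<^sub>R m t (K T - K t) = 0"
  proof eventually_elim
    case (elim t)
    then show ?case using k\<rho>[of t] \<rho>[of t] by (cases "t \<in> {0..T}") (auto simp: Kk)
  qed
  then have "(LINT t:{0..T}|stieltjes_measure T K. m t (K T - K t)) = 0"
    unfolding set_lebesgue_integral_def by (rule integral_eq_zero_AE)
  with K pos show ?thesis by (intro that[of K]) (auto simp: Kk)
qed

section \<open>Joint measurability in time and sample point\<close>

section \<open>Progressive and predictable processes\<close>

context brownian
begin

abbreviation Pg :: "('w \<times> real) measure" where "Pg \<equiv> progressive_sigma M F T"

lemma space_Pg: "space Pg = space M \<times> {0..T}"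
  unfolding progressive_sigma_def by (rule space_measure_of) auto

lemma sets_Pg: "sets Pg = sigma_sets (space M \<times> {0..T}) {A. A \<subseteq> space M \<times> {0..T} \<and>
        (\<forall>t\<in>{0..T}. A \<inter> (space M \<times> {0..t}) \<in> sets (F t \<Otimes>\<^sub>M restrict_space borel {0..t}))}"
  unfolding progressive_sigma_def by (rule sets_measure_of) auto

text \<open>The iterates are predictable while \<open>f\<close> is progressive; the inclusion makes
  the driver along an iterate progressive.\<close>

lemma sets_Pr_Pg: "sets Pr \<subseteq> sets Pg"
  unfolding sets_Pr sets_Pg
proof (intro sigma_sets_mono' subsetI)
  let ?P = "\<lambda>A. A \<subseteq> space M \<times> {0..T} \<and>
        (\<forall>t\<in>{0..T}. A \<inter> (space M \<times> {0..t}) \<in> sets (F t \<Otimes>\<^sub>M restrict_space borel {0..t}))"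
  have prod: "A \<times> S \<inter> (space M \<times> {0..t}) \<in> sets (F t \<Otimes>\<^sub>M restrict_space borel {0..t})"
    if "A \<in> sets (F t)" "S \<in> sets borel" for A S t
  proof -
    have "A \<times> S \<inter> (space M \<times> {0..t}) = A \<times> (S \<inter> {0..t})"
      using sets.sets_into_space[OF that(1)] by auto
    also have "\<dots> \<in> sets (F t \<Otimes>\<^sub>M restrict_space borel {0..t})"
      using that by (intro pair_measureI) (auto simp: sets_restrict_space)
    finally show ?thesis .
  qed
  fix A assume "A \<in> {A \<times> {0} | A. A \<in> sets (F 0)} \<union>
     {A \<times> {s<..t} | A s t. 0 \<le> s \<and> s \<le> t \<and> t \<le> T \<and> A \<in> sets (F s)}"
  then have "?P A"
  proof
    assume "A \<in> {A \<times> {0} | A. A \<in> sets (F 0)}"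
    then obtain A' where A: "A = A' \<times> {0}" "A' \<in> sets (F 0)" by auto
    then show ?thesis
      using sets.sets_into_space[OF A(2)] subsetD[OF sets_F_mono[of 0] A(2)] T_pos by (auto intro!: prod)
  next
    assume "A \<in> {A \<times> {s<..t} | A s t. 0 \<le> s \<and> s \<le> t \<and> t \<le> T \<and> A \<in> sets (F s)}"
    then obtain A' s r where A: "A = A' \<times> {s<..r}" "0 \<le> s" "s \<le> r" "r \<le> T" "A' \<in> sets (F s)" by auto
    have "A \<inter> (space M \<times> {0..t}) \<in> sets (F t \<Otimes>\<^sub>M restrict_space borel {0..t})" for t
    proof (cases "s \<le> t")
      case True
      then show ?thesis unfolding A(1) using A(5) sets_F_mono[of s t] by (intro prod) auto
    next
      case False
      then have "A \<inter> (space M \<times> {0..t}) = {}" using A by auto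
      then show ?thesis by simp
    qed
    then show ?thesis using sets.sets_into_space[OF A(5)] A by auto
  qed
  then show "A \<in> Collect ?P" by simp
qed

lemma Pr_Pg: "g \<in> measurable Pr N \<Longrightarrow> g \<in> measurable Pg N"
  using sets_Pr_Pg by (auto simp: measurable_def space_Pg space_Pr)

text \<open>Restriction to times up to \<open>t\<close> lowers the sigma-algebra to
  \<open>F t\<close>. This is what makes the running time integral of a progressive process
  adapted.\<close>

lemma Pg_restrict:
  assumes g: "g \<in> borel_measurable Pg" and t: "t \<in> {0..T}"
  shows "g \<in> borel_measurable (F t \<Otimes>\<^sub>M restrict_space borel {0..t})"
proof -
  have "(\<lambda>p. p) \<in> measurable (F t \<Otimes>\<^sub>M restrict_space borel {0..t}) Pg"
    unfolding progressive_sigma_def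
  proof (rule measurable_measure_of)
    fix A assume "A \<in> {A. A \<subseteq> space M \<times> {0..T} \<and>
        (\<forall>t\<in>{0..T}. A \<inter> (space M \<times> {0..t}) \<in> sets (F t \<Otimes>\<^sub>M restrict_space borel {0..t}))}"
    then show "(\<lambda>p. p) -` A \<inter> space (F t \<Otimes>\<^sub>M restrict_space borel {0..t}) \<in> sets (F t \<Otimes>\<^sub>M restrict_space borel {0..t})"
      using t by (auto simp: space_pair_measure space_restrict_space)
  qed (use t in \<open>auto simp: space_pair_measure space_restrict_space\<close>)
  from measurable_compose[OF this g] show ?thesis by simp
qed

lemma Pg_Nm:
  fixes g :: "'w \<times> real \<Rightarrow> 'b::topological_space"
  assumes g: "g \<in> borel_measurable Pg" shows "g \<in> borel_measurable Nm"
proof -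
  have TT: "T \<in> {0..T}" using T_pos by simp
  have "(\<lambda>w. w) \<in> measurable M (F T)" by (rule measurableI) (use sets_F_sub[of T] in auto)
  then have "(\<lambda>p. (fst p, snd p)) \<in> measurable Nm (F T \<Otimes>\<^sub>M restrict_space borel {0..T})"
    by (intro measurable_Pair measurable_compose[OF measurable_fst])
      (auto intro: measurable_compose[OF measurable_snd] simp: measurable_cong_sets[OF refl sets_restrict_space_cong[OF sets_lborel]])
  from measurable_compose[OF this Pg_restrict[OF g TT]] show ?thesis by simp
qed

lemma AE_Nm_fst:
  assumes "AE w in M. P w" shows "AE p in Nm. P (fst p)"
proof -
  interpret R: finite_measure "restrict_space lborel {0..T}" by (rule finite_measure_restrict_lborel)
  obtain N0 where N0: "N0 \<in> null_sets M" "\<And>w. w \<in> space M \<Longrightarrow> w \<notin> N0 \<Longrightarrow> P w"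
    using assms by (auto simp: eventually_ae_filter)
  have "N0 \<times> {0..T} \<in> null_sets Nm"
    using N0(1) R.emeasure_pair_measure_Times[of N0 M "{0..T}"]
    by (auto simp: null_sets_def sets_restrict_space_iff intro!: pair_measureI)
  then show ?thesis
  proof (rule AE_I')
    show "{p \<in> space Nm. \<not> P (fst p)} \<subseteq> N0 \<times> {0..T}"
    proof
      fix p assume "p \<in> {p \<in> space Nm. \<not> P (fst p)}"
      then show "p \<in> N0 \<times> {0..T}" using N0(2)[of "fst p"] by (cases p) (auto simp: space_Nm)
    qed
  qed
qed

lemma continuous_adapted_predictable:
  fixes Y :: "real \<Rightarrow> 'w \<Rightarrow> real"
  assumes Y: "\<And>t. t \<in> {0..T} \<Longrightarrow> Y t \<in> borel_measurable (F t)"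
    and cont: "\<And>w. w \<in> space M \<Longrightarrow> continuous_on {0..T} (\<lambda>t. Y t w)"
  shows "(\<lambda>(w, t). Y t w) \<in> borel_measurable Pr"
proof (rule borel_measurable_LIMSEQ_metric)
  define r where "r n k = real k * T / 2^n" for n k
  \<comment> \<open>Ceiling minus one instead of floor: the predictable rectangles are open on the
    left, so a grid point belongs to the interval ending there and the process is sampled strictly
    before it.\<close>
  define j where "j n t = nat (\<lceil>t * 2^n / T\<rceil> - 1)" for n t
  have rin: "r n k \<in> {0..T}" if "k \<le> 2^n" for n k unfolding r_def by (rule grid_in[OF that])
  have j_iff: "j n t = k \<longleftrightarrow> r n k < t \<and> t \<le> r n (Suc k)" if t: "0 < t" for n t k
  proof -
    have p: "0 < t * 2^n / T" using t T_pos by simp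
    have "j n t = k \<longleftrightarrow> \<lceil>t * 2^n / T\<rceil> = int k + 1" using p unfolding j_def by (auto simp: nat_eq_iff)
    also have "\<dots> \<longleftrightarrow> real k < t * 2^n / T \<and> t * 2^n / T \<le> real (Suc k)"
      by (auto simp: ceiling_eq_iff)
    also have "\<dots> \<longleftrightarrow> r n k < t \<and> t \<le> r n (Suc k)"
      using T_pos by (simp add: r_def field_simps)
    finally show ?thesis .
  qed
  have j_lt: "j n t < 2^n" if "0 < t" "t \<le> T" for n t
  proof -
    have "r n (j n t) < t" using j_iff[OF that(1), of n "j n t"] by simp
    then have "real (j n t) * T / 2^n < T" using that(2) unfolding r_def by linarith
    then have "real (j n t) * T < 2^n * T" by (simp add: field_simps)
    then have "real (j n t) < 2^n" using T_pos by simp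
    then show ?thesis by (metis of_nat_less_iff of_nat_numeral of_nat_power)
  qed
  define Yn where "Yn n p = (if snd p \<le> 0 then Y 0 (fst p) else Y (r n (j n (snd p))) (fst p))" for n p
  show "Yn n \<in> borel_measurable Pr" for n
  proof (rule measurableI)
    fix U :: "real set" assume U: "U \<in> sets borel"
    have "Yn n -` U \<inter> space Pr = (Y 0 -` U \<inter> space M) \<times> {0} \<union> (\<Union>k<2^n. (Y (r n k) -` U \<inter> space M) \<times> {r n k<..r n (Suc k)})"
      (is "?L = ?R")
    proof (intro set_eqI iffI)
      fix p assume p: "p \<in> ?L"
      then have sp: "fst p \<in> space M" "0 \<le> snd p" "snd p \<le> T" by (auto simp: space_Pr)
      show "p \<in> ?R"
      proof (cases "snd p = 0")
        case True
        then show ?thesis using p sp by (cases p) (auto simp: Yn_def)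
      next
        case False
        then have "0 < snd p" using sp by simp
        with p sp j_iff[OF this, of n "j n (snd p)"] j_lt[OF this, of n] show ?thesis
          by (cases p) (auto simp: Yn_def intro!: bexI[of _ "j n (snd p)"])
      qed
    next
      fix p assume "p \<in> ?R"
      then show "p \<in> ?L"
      proof
        assume "p \<in> (Y 0 -` U \<inter> space M) \<times> {0}"
        then show ?thesis using T_pos by (auto simp: Yn_def space_Pr)
      next
        assume "p \<in> (\<Union>k<2^n. (Y (r n k) -` U \<inter> space M) \<times> {r n k<..r n (Suc k)})"
        then obtain k where k: "k < 2^n" "fst p \<in> space M" "Y (r n k) (fst p) \<in> U" "r n k < snd p" "snd p \<le> r n (Suc k)" by auto
        have "0 < snd p" "snd p \<le> T" using k rin[of k n] rin[of "Suc k" n] by auto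
        moreover have "j n (snd p) = k" using j_iff[OF \<open>0 < snd p\<close>] k by auto
        ultimately show ?thesis using k by (cases p) (auto simp: Yn_def space_Pr)
      qed
    qed
    also have "?R \<in> sets Pr"
    proof (intro sets.Un sets.finite_UN)
      show "(Y 0 -` U \<inter> space M) \<times> {0} \<in> sets Pr"
        using measurable_sets[OF Y[of 0] U] T_pos by (intro zero_in_Pr) auto
      show "(Y (r n k) -` U \<inter> space M) \<times> {r n k<..r n (Suc k)} \<in> sets Pr" if "k \<in> {..<2^n}" for k
        using measurable_sets[OF Y[OF rin[of k n]] U] rin[of k n] rin[of "Suc k" n] that T_pos
        by (intro Ioc_in_Pr) (auto simp: r_def field_simps)
    qed auto
    finally show "Yn n -` U \<inter> space Pr \<in> sets Pr" .
  qed simp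
  fix p assume "p \<in> space Pr"
  then have sp: "fst p \<in> space M" "0 \<le> snd p" "snd p \<le> T" by (auto simp: space_Pr)
  show "(\<lambda>n. Yn n p) \<longlonglongrightarrow> (\<lambda>(w, t). Y t w) p"
  proof (cases "snd p = 0")
    case True
    then show ?thesis by (simp add: Yn_def case_prod_unfold)
  next
    case False
    then have t: "0 < snd p" using sp by simp
    have "(\<lambda>n. r n (j n (snd p))) \<longlonglongrightarrow> snd p"
    proof (rule LIM_zero_cancel, rule Lim_null_comparison[where g="\<lambda>n. T * (1/2)^n"])
      have "\<bar>r n (j n (snd p)) - snd p\<bar> \<le> T * (1/2)^n" for n
      proof -
        have "r n (Suc (j n (snd p))) = r n (j n (snd p)) + T * (1/2)^n"
          by (simp add: r_def field_simps power_one_over)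
        then show ?thesis using j_iff[OF t, of n "j n (snd p)"] by auto
      qed
      then show "\<forall>\<^sub>F n in sequentially. norm (r n (j n (snd p)) - snd p) \<le> T * (1/2)^n" by simp
      show "(\<lambda>n. T * (1/2)^n) \<longlonglongrightarrow> 0" by (intro tendsto_mult_right_zero LIMSEQ_power_zero) auto
    qed
    then have "(\<lambda>n. Y (r n (j n (snd p))) (fst p)) \<longlonglongrightarrow> Y (snd p) (fst p)"
      using cont[OF sp(1)] sp rin[OF less_imp_le[OF j_lt[OF t sp(3)]]]
      by (auto simp: continuous_on_sequentially o_def)
    then show ?thesis using t by (simp add: Yn_def case_prod_unfold)
  qed
qed

lemma S2D:
  assumes "Y \<in> S2 M F T"
  shows "t \<in> {0..T} \<Longrightarrow> Y t \<in> borel_measurable (F t)" "t \<in> {0..T} \<Longrightarrow> Y t \<in> borel_measurable M"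
    "w \<in> space M \<Longrightarrow> continuous_on {0..T} (\<lambda>t. Y t w)"
    "\<exists>W. sqint M W \<and> (AE w in M. \<forall>t\<in>{0..T}. \<bar>Y t w\<bar> \<le> W w)"
    "t \<in> {0..T} \<Longrightarrow> sqint M (Y t)"
proof -
  show F: "Y t \<in> borel_measurable (F t)" if "t \<in> {0..T}" for t using assms that by (auto simp: S2_def adapted_def)
  show YM: "Y t \<in> borel_measurable M" if "t \<in> {0..T}" for t using measurable_F_M[OF F[OF that]] that by auto
  show cont: "continuous_on {0..T} (\<lambda>t. Y t w)" if "w \<in> space M" for w using assms that by (auto simp: S2_def)
  have gm: "grid_sup Y \<in> borel_measurable M" by (rule grid_sup_measurable[OF YM])
  have "(\<integral>\<^sup>+w. grid_sup Y w \<partial>M) \<le> (\<integral>\<^sup>+w. (SUP t\<in>{0..T}. ennreal (\<bar>Y t w\<bar>\<^sup>2)) \<partial>M)"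
    unfolding grid_sup_def using grid_in by (intro nn_integral_mono SUP_least) (auto intro!: SUP_upper2)
  also have "\<dots> < \<infinity>" using assms by (simp add: S2_def)
  finally have fin: "(\<integral>\<^sup>+w. grid_sup Y w \<partial>M) < \<infinity>" .
  then have fin_AE: "AE w in M. grid_sup Y w < \<infinity>" by (rule finite_nn_integral_imp_ae_finite[OF gm])
  \<comment> \<open>The dyadic supremum is used because it is measurable; by continuity its root
    bounds the whole path.\<close>
  define W where "W w = sqrt (enn2real (grid_sup Y w))" for w
  have "sqint M W"
    unfolding sqint_iff
  proof
    show "W \<in> borel_measurable M" unfolding W_def using gm by measurable
    have "(\<integral>\<^sup>+w. ennreal ((norm (W w))\<^sup>2) \<partial>M) \<le> (\<integral>\<^sup>+w. grid_sup Y w \<partial>M)"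
      using fin_AE by (intro nn_integral_mono_AE) (auto elim!: eventually_mono simp: W_def ennreal_enn2real_if)
    then show "(\<integral>\<^sup>+w. ennreal ((norm (W w))\<^sup>2) \<partial>M) < \<infinity>" using fin by auto
  qed
  moreover have "AE w in M. \<forall>t\<in>{0..T}. \<bar>Y t w\<bar> \<le> W w"
    using fin_AE AE_space
  proof eventually_elim
    case (elim w)
    have "\<bar>Y t w\<bar> \<le> W w" if "t \<in> {0..T}" for t
    proof -
      have "ennreal ((Y t w)\<^sup>2) \<le> ennreal (enn2real (grid_sup Y w))"
        using grid_sup_ge[where X=Y and w=w and t=t, OF cont[OF elim(2)] that] elim(1) by simp
      then have "(Y t w)\<^sup>2 \<le> enn2real (grid_sup Y w)" by (subst (asm) ennreal_le_iff) auto
      then show ?thesis unfolding W_def using real_le_rsqrt by (metis real_sqrt_abs real_sqrt_le_iff)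
    qed
    then show ?case by blast
  qed
  ultimately show W: "\<exists>W. sqint M W \<and> (AE w in M. \<forall>t\<in>{0..T}. \<bar>Y t w\<bar> \<le> W w)" by blast
  then obtain W where W: "sqint M W" "AE w in M. \<forall>t\<in>{0..T}. \<bar>Y t w\<bar> \<le> W w" by blast
  show "sqint M (Y t)" if t: "t \<in> {0..T}" for t
  proof (rule sqint_mono[OF W(1) YM[OF t], where K=1])
    show "AE w in M. norm (Y t w) \<le> 1 * norm (W w)"
      using W(2) by eventually_elim (use t in \<open>auto intro: order_trans[OF _ abs_ge_self]\<close>)
  qed
qed

lemma S2_predictable: "Y \<in> S2 M F T \<Longrightarrow> (\<lambda>(w, t). Y t w) \<in> borel_measurable Pr"
  by (intro continuous_adapted_predictable S2D)

lemma sqint_Nm_fst: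
  assumes W: "sqint M (W :: 'w \<Rightarrow> real)" shows "sqint Nm (\<lambda>p. W (fst p))"
proof -
  have [measurable]: "W \<in> borel_measurable M" by (rule sqint_measurable[OF W])
  have "(\<integral>\<^sup>+p. ennreal ((W (fst p))\<^sup>2) \<partial>Nm) = (\<integral>\<^sup>+w. ennreal ((W w)\<^sup>2) * ennreal T \<partial>M)"
    using T_pos by (subst nn_integral_Nm) (auto simp: nn_integral_cmult_indicator)
  also have "\<dots> < \<infinity>" using W by (simp add: nn_integral_multc sqint_iff ennreal_mult_less_top)
  finally show ?thesis by (simp add: sqint_iff)
qed

lemma S2_sqint_Nm:
  assumes Y: "Y \<in> S2 M F T" shows "sqint Nm (\<lambda>(w, t). Y t w)"
proof -
  obtain W where W: "sqint M W" "AE w in M. \<forall>t\<in>{0..T}. \<bar>Y t w\<bar> \<le> W w" using S2D(4)[OF Y] by blast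
  show ?thesis
  proof (rule sqint_mono[OF sqint_Nm_fst[OF W(1)] Pr_Nm[OF S2_predictable[OF Y]], where K=1])
    show "AE p in Nm. norm ((\<lambda>(w, t). Y t w) p) \<le> 1 * norm (W (fst p))"
      using AE_Nm_fst[OF W(2)] AE_space
      by eventually_elim (auto simp: space_Nm intro: order_trans[OF _ abs_ge_self])
  qed
qed

end

section \<open>Explicit solution for a driver independent of the unknowns\<close>

section \<open>The mean reflected equation with a fixed driver\<close>

text \<open>Continuity in time at a fixed argument and a Lipschitz constant uniform in time give
  convergence along a moving argument. It is applied with \<open>h n\<close> the loss at the n-th
  time.\<close>

lemma tendsto_Lipschitz_family:
  fixes h :: "nat \<Rightarrow> real \<Rightarrow> real"
  assumes lip: "\<And>n x y. \<bar>h n x - h n y\<bar> \<le> C * \<bar>x - y\<bar>" and y: "y \<longlonglongrightarrow> y0" and h: "(\<lambda>n. h n y0) \<longlonglongrightarrow> v"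
  shows "(\<lambda>n. h n (y n)) \<longlonglongrightarrow> v"
proof -
  have "(\<lambda>n. C * \<bar>y n - y0\<bar>) \<longlonglongrightarrow> C * \<bar>y0 - y0\<bar>" by (intro tendsto_intros y)
  then have "(\<lambda>n. h n (y n) - h n y0) \<longlonglongrightarrow> 0"
    using lip by (intro Lim_null_comparison[of "\<lambda>n. h n (y n) - h n y0" "\<lambda>n. C * \<bar>y n - y0\<bar>"]) auto
  from tendsto_add[OF this h] show ?thesis by simp
qed

context brownian
begin

lemma S2I:
  assumes "\<And>t. t \<in> {0..T} \<Longrightarrow> Y t \<in> borel_measurable (F t)"
    and "\<And>w. w \<in> space M \<Longrightarrow> continuous_on {0..T} (\<lambda>t. Y t w)"
    and W: "sqint M W" "AE w in M. \<forall>t\<in>{0..T}. \<bar>Y t w\<bar> \<le> W w"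
  shows "Y \<in> S2 M F T"
proof -
  have "(\<integral>\<^sup>+w. (SUP t\<in>{0..T}. ennreal (\<bar>Y t w\<bar>\<^sup>2)) \<partial>M) \<le> (\<integral>\<^sup>+w. ennreal ((norm (W w))\<^sup>2) \<partial>M)"
    using W(2) by (intro nn_integral_mono_AE)
      (auto elim!: eventually_mono intro!: SUP_least ennreal_leI simp: abs_le_square_iff[symmetric] intro: order_trans[OF _ abs_ge_self])
  also have "\<dots> < \<infinity>" using W(1) by (simp add: sqint_iff)
  finally show ?thesis using assms(1,2) by (simp add: S2_def adapted_def)
qed

lemma S2_add:
  assumes X: "X \<in> S2 M F T" and Y: "Y \<in> S2 M F T"
  shows "(\<lambda>t w. X t w + Y t w) \<in> S2 M F T"
proof -
  obtain W where W: "sqint M W" "AE w in M. \<forall>t\<in>{0..T}. \<bar>X t w\<bar> \<le> W w" using S2D(4)[OF X] by blast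
  obtain V where V: "sqint M V" "AE w in M. \<forall>t\<in>{0..T}. \<bar>Y t w\<bar> \<le> V w" using S2D(4)[OF Y] by blast
  show ?thesis
  proof (rule S2I[OF _ _ sqint_add[OF W(1) V(1)]])
    show "AE w in M. \<forall>t\<in>{0..T}. \<bar>X t w + Y t w\<bar> \<le> W w + V w"
      using W(2) V(2) by eventually_elim (meson abs_triangle_ineq add_mono order_trans)
    show "(\<lambda>w. X t w + Y t w) \<in> borel_measurable (F t)" if "t \<in> {0..T}" for t
      using S2D(1)[OF X that] S2D(1)[OF Y that] by measurable
  qed (intro continuous_intros S2D(3)[OF X] S2D(3)[OF Y])
qed

lemma S2_deterministic:
  assumes "continuous_on {0..T} k" shows "(\<lambda>t w. k t) \<in> S2 M F T"
proof -
  obtain K where K: "\<forall>x\<in>k ` {0..T}. norm x \<le> K"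
    using compact_imp_bounded[OF compact_continuous_image[OF assms compact_Icc]] unfolding bounded_iff by (rule exE)
  show ?thesis
    by (rule S2I[OF _ assms sqint_const[of K]]) (use K in auto)
qed

lemma S2_minus: "Y \<in> S2 M F T \<Longrightarrow> (\<lambda>t w. - Y t w) \<in> S2 M F T"
  by (auto simp: S2_def adapted_def intro!: continuous_intros)

lemma S2_diff: "X \<in> S2 M F T \<Longrightarrow> Y \<in> S2 M F T \<Longrightarrow> (\<lambda>t w. X t w - Y t w) \<in> S2 M F T"
  using S2_add[OF _ S2_minus, of X Y] by simp

lemma ito_S2:
  assumes "is_ito_integral M T B Z I" shows "I \<in> S2 M F T"
proof -
  have TT: "T \<in> {0..T}" using T_pos by simp
  note Im = ito_L2_martingale[OF assms]
  have cont: "continuous_on {0..T} (\<lambda>t. I t w)" if "w \<in> space M" for w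
    using assms that by (simp add: is_ito_integral_def)
  have "(\<integral>\<^sup>+w. (SUP t\<in>{0..T}. ennreal ((I t w)\<^sup>2)) \<partial>M) \<le> 4 * (\<integral>\<^sup>+w. ennreal ((I T w)\<^sup>2) \<partial>M)"
    using cont by (intro Doob_L2[OF Im]) auto
  also have "\<dots> < \<infinity>" using L2_martingaleD(2)[OF Im TT] by (simp add: sqint_iff ennreal_mult_less_top)
  finally show ?thesis
    using cont L2_martingaleD(1)[OF Im] by (simp add: S2_def adapted_def)
qed

definition driver :: "('w \<Rightarrow> real \<Rightarrow> real) \<Rightarrow> bool" where
  "driver g \<longleftrightarrow> (\<lambda>(w, s). g w s) \<in> borel_measurable Pg \<and> sqint Nm (\<lambda>(w, s). g w s)"

abbreviation "RT \<equiv> restrict_space lborel {0..T}"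

lemma driver_slice:
  assumes g: "driver g" and w: "w \<in> space M" shows "g w \<in> borel_measurable RT"
  using measurable_Pair2[of "\<lambda>(w, s). g w s" M RT borel w] g w by (auto simp: driver_def sqint_def)

lemma driver_energy:
  assumes g: "driver g"
  shows "(\<lambda>w. \<integral>\<^sup>+s. ennreal ((g w s)\<^sup>2) \<partial>RT) \<in> borel_measurable M"
    and "(\<integral>\<^sup>+w. (\<integral>\<^sup>+s. ennreal ((g w s)\<^sup>2) \<partial>RT) \<partial>M) < \<infinity>"
    and "AE w in M. sqint RT (g w)"
proof -
  interpret R: finite_measure RT by (rule finite_measure_restrict_lborel)
  have m: "(\<lambda>p. ennreal (((\<lambda>(w, s). g w s) p)\<^sup>2)) \<in> borel_measurable Nm"
    using g by (auto simp: driver_def sqint_def)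
  show 1: "(\<lambda>w. \<integral>\<^sup>+s. ennreal ((g w s)\<^sup>2) \<partial>RT) \<in> borel_measurable M"
    using R.borel_measurable_nn_integral_fst[OF m] by simp
  show 2: "(\<integral>\<^sup>+w. (\<integral>\<^sup>+s. ennreal ((g w s)\<^sup>2) \<partial>RT) \<partial>M) < \<infinity>"
    using R.nn_integral_fst[OF m] g by (simp add: driver_def sqint_iff)
  show "AE w in M. sqint RT (g w)"
    using finite_nn_integral_imp_ae_finite[OF 1 2] AE_space
    by eventually_elim (simp add: sqint_iff driver_slice[OF g])
qed

lemma set_integrable_RT: "integrable RT h \<Longrightarrow> set_integrable lborel {0..T} (h :: real \<Rightarrow> real)"
  unfolding set_integrable_def by (subst (asm) integrable_restrict_space) auto

lemma time_integral:
  assumes g: "driver g"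
  obtains A where "A \<in> S2 M F T"
    "AE w in M. \<forall>t\<in>{0..T}. (LINT s:{t..T}|lborel. g w s) = A T w - A t w"
proof -
  interpret R: finite_measure RT by (rule finite_measure_restrict_lborel)
  obtain N0 where N0: "N0 \<in> null_sets M" "\<And>w. w \<in> space M \<Longrightarrow> w \<notin> N0 \<Longrightarrow> sqint RT (g w)"
    using driver_energy(3)[OF g] by (auto simp: eventually_ae_filter)
  \<comment> \<open>Paths that fail to be square integrable form a null set and are set to 0, so
    that all paths of \<open>A\<close> are continuous and adaptedness is kept.\<close>
  define A where "A t w = (if w \<in> N0 then 0 else LINT s:{0..t}|lborel. g w s)" for t w
  have int: "set_integrable lborel {0..T} (g w)" if "w \<in> space M" "w \<notin> N0" for w
    by (rule set_integrable_RT[OF R.sqint_integrable[OF N0(2)[OF that]]])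
  have sub: "set_integrable lborel {a..b} (g w)" if "w \<in> space M" "w \<notin> N0" "0 \<le> a" "b \<le> T" for w a b
    using that by (intro set_integrable_subset[OF int]) auto
  note HK = set_borel_integral_eq_integral[OF sub]
  have A_HK: "A t w = integral {0..t} (g w)" if "w \<in> space M" "w \<notin> N0" "t \<le> T" for t w
    using HK(2)[of w 0 t] that by (simp add: A_def)
  have cont: "continuous_on {0..T} (\<lambda>t. A t w)" if w: "w \<in> space M" for w
  proof (cases "w \<in> N0")
    case False
    have "continuous_on {0..T} (\<lambda>t. integral {0..t} (g w))"
      using HK(1)[of w 0 T] w False by (intro indefinite_integral_continuous_1) auto
    then show ?thesis
      by (rule continuous_on_cong[THEN iffD1, rotated 2]) (use A_HK[OF w False] in auto)
  qed (simp add: A_def)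
  have AF: "A t \<in> borel_measurable (F t)" if t: "t \<in> {0..T}" for t
  proof -
    have f: "finite_measure (restrict_space lborel {0..t})" by (rule finite_measure_restrict_lborel)
    have "(\<lambda>(w, s). g w s) \<in> borel_measurable (F t \<Otimes>\<^sub>M restrict_space lborel {0..t})"
    proof (subst measurable_cong_sets[OF sets_pair_measure_cong[OF refl sets_restrict_space_cong[OF sets_lborel]] refl])
      show "(\<lambda>(w, s). g w s) \<in> borel_measurable (F t \<Otimes>\<^sub>M restrict_space borel {0..t})"
        using g t by (intro Pg_restrict) (simp_all add: driver_def)
    qed
    then have "(\<lambda>w. \<integral>s. g w s \<partial>restrict_space lborel {0..t}) \<in> borel_measurable (F t)"
      using sigma_finite_measure.borel_measurable_lebesgue_integral[OF finite_measure.axioms(1)[OF f]] by blast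
    then have m: "(\<lambda>w. LINT s:{0..t}|lborel. g w s) \<in> borel_measurable (F t)"
      by (simp add: integral_restrict_space set_lebesgue_integral_def)
    have "{w \<in> space (F t). w \<in> N0} = N0" using sets.sets_into_space[of N0 M] N0 by auto
    then have "{w \<in> space (F t). w \<in> N0} \<in> sets (F t)" using null_sets_F[OF N0(1)] by simp
    then show ?thesis unfolding A_def[abs_def] using m by (intro measurable_If) auto
  qed
  \<comment> \<open>Cauchy-Schwarz bounds |A_t|^2 by \<open>T\<close> times the energy of the path,
    simultaneously for all t.\<close>
  define W where "W w = sqrt (T * enn2real (\<integral>\<^sup>+s. ennreal ((g w s)\<^sup>2) \<partial>RT))" for w
  have Wm: "W \<in> borel_measurable M" unfolding W_def using driver_energy(1)[OF g] by measurable
  have W: "sqint M W"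
    unfolding sqint_iff
  proof
    have "(\<integral>\<^sup>+w. ennreal ((norm (W w))\<^sup>2) \<partial>M) \<le> (\<integral>\<^sup>+w. ennreal T * (\<integral>\<^sup>+s. ennreal ((g w s)\<^sup>2) \<partial>RT) \<partial>M)"
      using T_pos
      by (intro nn_integral_mono) (auto simp: W_def ennreal_mult ennreal_enn2real_if top_unique intro!: mult_left_mono)
    also have "\<dots> < \<infinity>"
      using driver_energy(2)[OF g] by (simp add: nn_integral_cmult driver_energy(1)[OF g] ennreal_mult_less_top)
    finally show "(\<integral>\<^sup>+w. ennreal ((norm (W w))\<^sup>2) \<partial>M) < \<infinity>" .
  qed fact
  have AW: "\<bar>A t w\<bar> \<le> W w" if w: "w \<in> space M" "w \<notin> N0" and t: "t \<in> {0..T}" for t w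
  proof -
    have sq: "sqint RT (g w)" by (rule N0(2)[OF w])
    have i: "sqint RT (\<lambda>s. indicator {0..t} s :: real)"
      by (rule R.sqint_bounded[where K=1]) (auto simp: indicator_def intro!: measurable_restrict_space1)
    have "A t w = (\<integral>s. indicator {0..t} s * g w s \<partial>RT)"
      using t w(2) by (simp add: A_def set_lebesgue_integral_def integral_restrict_space)
        (auto intro!: Bochner_Integration.integral_cong simp: indicator_def)
    then have "(A t w)\<^sup>2 \<le> (\<integral>s. (indicator {0..t} s)\<^sup>2 \<partial>RT) * (\<integral>s. (g w s)\<^sup>2 \<partial>RT)"
      using Cauchy_Schwarz_integral[OF i sq] by simp
    also have "\<dots> \<le> T * (\<integral>s. (g w s)\<^sup>2 \<partial>RT)"
    proof (rule mult_right_mono)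
      have "(\<integral>s. (indicator {0..t} s :: real)\<^sup>2 \<partial>RT) \<le> (\<integral>s. 1 \<partial>RT)"
        using i by (intro integral_mono) (auto simp: sqint_def indicator_def)
      also have "\<dots> = T" using T_pos
        by (simp add: measure_def emeasure_restrict_space space_restrict_space)
      finally show "(\<integral>s. (indicator {0..t} s :: real)\<^sup>2 \<partial>RT) \<le> T" .
    qed simp
    also have "(\<integral>s. (g w s)\<^sup>2 \<partial>RT) = enn2real (\<integral>\<^sup>+s. ennreal ((g w s)\<^sup>2) \<partial>RT)"
      using sqint_nn_integral[OF sq] by simp
    finally show ?thesis unfolding W_def by (metis real_sqrt_abs real_sqrt_le_iff)
  qed
  have "A \<in> S2 M F T"
    by (rule S2I[OF AF cont W]) (use AE_not_in[OF N0(1)] AE_space AW in \<open>auto elim!: eventually_elim2\<close>)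
  moreover have "AE w in M. \<forall>t\<in>{0..T}. (LINT s:{t..T}|lborel. g w s) = A T w - A t w"
    using AE_not_in[OF N0(1)] AE_space
  proof eventually_elim
    case (elim w)
    show ?case
    proof
      fix t assume t: "t \<in> {0..T}"
      have "integral {0..t} (g w) + integral {t..T} (g w) = integral {0..T} (g w)"
        using t HK(1)[of w 0 T] elim by (intro Henstock_Kurzweil_Integration.integral_combine) auto
      then show "(LINT s:{t..T}|lborel. g w s) = A T w - A t w"
        using A_HK[of w t] A_HK[of w T] HK(2)[of w t T] elim t by auto
    qed
  qed
  ultimately show ?thesis by (rule that)
qed

end

locale mean_reflected = brownian M T B
  for M :: "'w measure" and T :: real and B :: "real \<Rightarrow> 'w \<Rightarrow> real^'d::finite" +
  fixes l :: "'w \<Rightarrow> real \<Rightarrow> real \<Rightarrow> real" and c C :: real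
  assumes l_meas: "(\<lambda>(w, t, y). l w t y) \<in> borel_measurable (aug_filtration M B T \<Otimes>\<^sub>M restrict_space borel {0..T} \<Otimes>\<^sub>M borel)"
    and c_pos: "0 < c" and c_le: "c \<le> C"
    and l_AE: "AE w in M. (\<forall>y. continuous_on {0..T} (\<lambda>t. l w t y)) \<and>
        (\<forall>t\<in>{0..T}. strict_mono (\<lambda>y. l w t y)) \<and>
        (\<forall>t\<in>{0..T}. \<forall>y. \<bar>l w t y\<bar> \<le> C * (1 + \<bar>y\<bar>)) \<and>
        (\<forall>t\<in>{0..T}. \<forall>x y. c * \<bar>x - y\<bar> \<le> \<bar>l w t x - l w t y\<bar> \<and>
                                \<bar>l w t x - l w t y\<bar> \<le> C * \<bar>x - y\<bar>)"
begin

lemma l_measurable: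
  assumes Y: "Y \<in> borel_measurable M" and t: "t \<in> {0..T}" shows "(\<lambda>w. l w t (Y w)) \<in> borel_measurable M"
proof -
  have "(\<lambda>w. w) \<in> measurable M (F T)" by (rule measurableI) (use sets_F_sub[of T] in auto)
  moreover have "(\<lambda>w. t) \<in> measurable M (restrict_space borel {0..T})"
    using t by (intro measurable_const) (simp add: space_restrict_space)
  ultimately have "(\<lambda>w. (w, t, Y w)) \<in> measurable M (F T \<Otimes>\<^sub>M restrict_space borel {0..T} \<Otimes>\<^sub>M borel)"
    using Y by (intro measurable_Pair)
  from measurable_compose[OF this l_meas] show ?thesis by simp
qed

lemma l_integrable:
  assumes Y: "integrable M Y" and t: "t \<in> {0..T}" shows "integrable M (\<lambda>w. l w t (Y w))"
proof (rule Bochner_Integration.integrable_bound)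
  show "integrable M (\<lambda>w. C * (1 + \<bar>Y w\<bar>))" using Y by simp
  show "(\<lambda>w. l w t (Y w)) \<in> borel_measurable M" using Y by (intro l_measurable t) auto
  show "AE w in M. norm (l w t (Y w)) \<le> norm (C * (1 + \<bar>Y w\<bar>))"
    using l_AE by eventually_elim (use t in \<open>auto intro: order_trans[OF _ abs_ge_self]\<close>)
qed

lemma l_Lipschitz:
  assumes Y: "integrable M Y" and Y': "integrable M Y'" and t: "t \<in> {0..T}"
  shows "\<bar>expectation (\<lambda>w. l w t (Y w)) - expectation (\<lambda>w. l w t (Y' w))\<bar> \<le> C * expectation (\<lambda>w. \<bar>Y w - Y' w\<bar>)"
proof -
  have "\<bar>expectation (\<lambda>w. l w t (Y w)) - expectation (\<lambda>w. l w t (Y' w))\<bar> = \<bar>expectation (\<lambda>w. l w t (Y w) - l w t (Y' w))\<bar>"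
    using l_integrable[OF Y t] l_integrable[OF Y' t] by simp
  also have "\<dots> \<le> expectation (\<lambda>w. \<bar>l w t (Y w) - l w t (Y' w)\<bar>)" by (rule integral_abs_bound)
  also have "\<dots> \<le> expectation (\<lambda>w. C * \<bar>Y w - Y' w\<bar>)"
  proof (rule integral_mono_AE)
    show "AE w in M. \<bar>l w t (Y w) - l w t (Y' w)\<bar> \<le> C * \<bar>Y w - Y' w\<bar>"
      using l_AE by eventually_elim (use t in auto)
  qed (use Y Y' l_integrable[OF Y t] l_integrable[OF Y' t] in auto)
  finally show ?thesis by simp
qed

text \<open>The two-sided estimate controls only the absolute value of a difference of losses.
  Monotonicity fixes its sign, and only then does the lower bound pass to expectations.\<close>

lemma l_lower:
  assumes Y: "integrable M Y" and t: "t \<in> {0..T}" and "x \<le> y"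
  shows "c * (y - x) \<le> expectation (\<lambda>w. l w t (Y w + y)) - expectation (\<lambda>w. l w t (Y w + x))"
proof -
  have i: "integrable M (\<lambda>w. l w t (Y w + y))" "integrable M (\<lambda>w. l w t (Y w + x))" using Y by (auto intro!: l_integrable t)
  have "expectation (\<lambda>w. c * (y - x)) \<le> expectation (\<lambda>w. l w t (Y w + y) - l w t (Y w + x))"
  proof (rule integral_mono_AE)
    show "AE w in M. c * (y - x) \<le> l w t (Y w + y) - l w t (Y w + x)"
      using l_AE
    proof eventually_elim
      case (elim w)
      have "c * \<bar>(Y w + y) - (Y w + x)\<bar> \<le> \<bar>l w t (Y w + y) - l w t (Y w + x)\<bar>" using elim t by blast
      moreover have "l w t (Y w + x) \<le> l w t (Y w + y)"
        using elim t \<open>x \<le> y\<close> by (auto simp: strict_mono_less_eq)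
      ultimately show ?case using \<open>x \<le> y\<close> by simp
    qed
  qed (use i in auto)
  then show ?thesis using i by (simp add: prob_space)
qed

lemma l_continuous:
  assumes Y: "Y \<in> S2 M F T" shows "continuous_on {0..T} (\<lambda>t. expectation (\<lambda>w. l w t (Y t w)))"
  unfolding continuous_on_sequentially o_def
proof (intro ballI allI impI, elim conjE)
  fix t and r :: "nat \<Rightarrow> real" assume t: "t \<in> {0..T}" and r: "\<forall>n. r n \<in> {0..T}" "r \<longlonglongrightarrow> t"
  obtain W where W: "sqint M W" "AE w in M. \<forall>t\<in>{0..T}. \<bar>Y t w\<bar> \<le> W w" using S2D(4)[OF Y] by blast
  show "(\<lambda>n. expectation (\<lambda>w. l w (r n) (Y (r n) w))) \<longlonglongrightarrow> expectation (\<lambda>w. l w t (Y t w))"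
  proof (rule integral_dominated_convergence)
    show "integrable M (\<lambda>w. C * (1 + W w))" using sqint_integrable[OF W(1)] by simp
    show "(\<lambda>w. l w t (Y t w)) \<in> borel_measurable M" by (intro l_measurable S2D[OF Y] t)
    show "(\<lambda>w. l w (r n) (Y (r n) w)) \<in> borel_measurable M" for n using r by (intro l_measurable S2D[OF Y]) auto
    show "AE w in M. norm (l w (r n) (Y (r n) w)) \<le> C * (1 + W w)" for n
      using l_AE W(2)
    proof eventually_elim
      case (elim w)
      have "\<bar>l w (r n) (Y (r n) w)\<bar> \<le> C * (1 + \<bar>Y (r n) w\<bar>)" using elim(1) r by auto
      also have "\<dots> \<le> C * (1 + W w)" using elim(2) r c_pos c_le by (intro mult_left_mono) auto
      finally show ?case by simp
    qed
    show "AE w in M. (\<lambda>n. l w (r n) (Y (r n) w)) \<longlonglongrightarrow> l w t (Y t w)"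
      using l_AE AE_space
    proof eventually_elim
      case (elim w)
      show ?case
      proof (rule tendsto_Lipschitz_family[where C=C and h="\<lambda>n. l w (r n)" and y="\<lambda>n. Y (r n) w"])
        show "\<bar>l w (r n) x - l w (r n) y\<bar> \<le> C * \<bar>x - y\<bar>" for n x y using elim(1) r by auto
        show "(\<lambda>n. Y (r n) w) \<longlonglongrightarrow> Y t w"
          using S2D(3)[OF Y elim(2)] r t by (auto simp: continuous_on_sequentially o_def)
        have "continuous_on {0..T} (\<lambda>s. l w s (Y t w))" using elim(1) by blast
        then show "(\<lambda>n. l w (r n) (Y t w)) \<longlonglongrightarrow> l w t (Y t w)"
          using r t by (auto simp: continuous_on_sequentially o_def)
      qed
    qed
  qed
qed

lemma fixed_driver_exists:
  assumes g: "driver g" and \<xi>: "H_xi M F T l \<xi>"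
  shows "\<exists>Y Z K. deterministic_flat_solution M T B \<xi> (\<lambda>w s _ _. g w s) l Y Z K"
proof -
  have TT: "T \<in> {0..T}" and T0: "0 \<le> T" using T_pos by auto
  obtain A where A: "A \<in> S2 M F T" "AE w in M. \<forall>t\<in>{0..T}. (LINT s:{t..T}|lborel. g w s) = A T w - A t w"
    by (rule time_integral[OF g])
  have \<xi>1: "\<xi> \<in> borel_measurable (F T)" and \<xi>3: "expectation (\<lambda>w. l w T (\<xi> w)) \<ge> 0"
    and \<xi>i: "integrable M (\<lambda>w. (\<xi> w)\<^sup>2)"
    using \<xi> unfolding H_xi_def by blast+
  have \<xi>2: "sqint M \<xi>" unfolding sqint_real_iff using measurable_F_M[OF \<xi>1] \<xi>i by simp
  note \<xi>' = \<xi>1 \<xi>2 \<xi>3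
  \<comment> \<open>For the reflection-free solution X the sum X + A is a martingale with this
    terminal value, so its representation supplies \<open>Z\<close>.\<close>
  define \<zeta> where "\<zeta> w = \<xi> w + A T w" for w
  have \<zeta>: "\<zeta> \<in> borel_measurable (F T)" "sqint M \<zeta>"
    unfolding \<zeta>_def using \<xi>'(1) S2D(1)[OF A(1) TT] by (measurable, intro sqint_add \<xi>' S2D[OF A(1)] TT)
  obtain Z I where Z: "Z \<in> H2 M F T" and I: "is_ito_integral M T B Z I" "AE w in M. I T w = \<zeta> w - expectation \<zeta>"
    by (rule martingale_representation[OF \<zeta>])
  \<comment> \<open>The process is read off from the Ito integral as a constant plus adapted terms;
    no conditional expectation of \<zeta> has to be chosen.\<close>
  define X where "X t w = expectation \<zeta> + I t w - A t w" for t w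
  have X: "X \<in> S2 M F T"
    unfolding X_def by (intro S2_diff S2_add S2_deterministic ito_S2[OF I(1)] A(1)) auto
  have X_eq: "AE w in M. \<forall>t\<in>{0..T}. X t w = \<xi> w + (LINT s:{t..T}|lborel. g w s) - (I T w - I t w)"
    using A(2) I(2) by eventually_elim (auto simp: X_def \<zeta>_def)
  have XT: "AE w in M. X T w = \<xi> w" using I(2) by eventually_elim (simp add: X_def \<zeta>_def)
  define m where "m t x = expectation (\<lambda>w. l w t (X t w + x))" for t x
  have Xi: "integrable M (X t)" if "t \<in> {0..T}" for t by (rule sqint_integrable[OF S2D(5)[OF X that]])
  obtain K where K: "continuous_on {0..T} K" "mono_on {0..T} K" "K 0 = 0"
    "\<And>t. t \<in> {0..T} \<Longrightarrow> 0 \<le> m t (K T - K t)" "(LINT t:{0..T}|stieltjes_measure T K. m t (K T - K t)) = 0"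
  proof (rule skorokhod_exists[of T m c C])
    show "continuous_on {0..T} (\<lambda>t. m t x)" for x
      unfolding m_def by (rule l_continuous) (intro S2_add X S2_deterministic continuous_intros)
    show "c * (y - x) \<le> m t y - m t x" if "t \<in> {0..T}" "x \<le> y" for t x y
      unfolding m_def by (rule l_lower[OF Xi[OF that(1)] that])
    show "\<bar>m t x - m t y\<bar> \<le> C * \<bar>x - y\<bar>" if "t \<in> {0..T}" for t x y
      using l_Lipschitz[of "\<lambda>w. X t w + x" "\<lambda>w. X t w + y" t] Xi[OF that] that by (simp add: m_def prob_space)
    have "m T 0 = expectation (\<lambda>w. l w T (\<xi> w))"
      unfolding m_def using XT sqint_measurable[OF \<xi>'(2)] S2D(2)[OF X TT]
      by (intro integral_cong_AE l_measurable TT) auto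
    then show "0 \<le> m T 0" using \<xi>'(3) by simp
  qed (use T0 c_pos in auto)
  define Y where "Y t w = X t w + (K T - K t)" for t w
  have Y: "Y \<in> S2 M F T"
    unfolding Y_def by (intro S2_add X S2_deterministic continuous_intros K)
  have "K \<in> A2D M F T"
    using S2_deterministic[OF K(1)] K(2,3) by (simp add: A2D_def A2_def)
  moreover have "AE w in M. \<forall>t\<in>{0..T}. Y t w = \<xi> w + (LINT s:{t..T}|lborel. g w s) - (I T w - I t w) + K T - K t"
    using X_eq by eventually_elim (simp add: Y_def)
  ultimately have "deterministic_flat_solution M T B \<xi> (\<lambda>w s _ _. g w s) l Y Z K"
    unfolding deterministic_flat_solution_def using Y Z I(1) K(4,5) by (auto simp: Y_def m_def)
  then show ?thesis by blast
qed

end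

section \<open>Exponential weights and tail integrals\<close>

section \<open>Exponentially weighted estimates\<close>

context
  fixes T :: real and RT :: "real measure"
  defines "RT \<equiv> restrict_space lborel {0..T}"
begin

lemma RT_id [measurable]: "(\<lambda>x. x) \<in> borel_measurable RT"
  unfolding RT_def by (intro measurable_restrict_space1) simp

lemma nn_integral_exp_le:
  assumes \<gamma>: "0 < \<gamma>" and t: "0 \<le> t" "t \<le> T"
  shows "(\<integral>\<^sup>+s. ennreal (exp (\<gamma> * s)) * (if s \<le> t then 1 else 0) \<partial>RT) = ennreal ((exp (\<gamma> * t) - 1) / \<gamma>)"
    and "(\<integral>\<^sup>+s. ennreal (exp (- \<gamma> * s)) * (if t \<le> s then 1 else 0) \<partial>RT) \<le> ennreal (exp (- \<gamma> * t) / \<gamma>)"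
proof -
  have "(\<integral>\<^sup>+s. ennreal (exp (\<gamma> * s)) * (if s \<le> t then 1 else 0) \<partial>RT) = (\<integral>\<^sup>+s. ennreal (exp (\<gamma> * s)) * indicator {0..t} s \<partial>lborel)"
    unfolding RT_def using t
    by (subst nn_integral_restrict_space) (auto intro!: nn_integral_cong simp: indicator_def)
  also have "\<dots> = ennreal (exp (\<gamma> * t) / \<gamma> - exp (\<gamma> * 0) / \<gamma>)"
    using \<gamma> t by (intro nn_integral_FTC_Icc) (auto intro!: derivative_eq_intros)
  finally show "(\<integral>\<^sup>+s. ennreal (exp (\<gamma> * s)) * (if s \<le> t then 1 else 0) \<partial>RT) = ennreal ((exp (\<gamma> * t) - 1) / \<gamma>)"
    by (simp add: diff_divide_distrib)
  have "(\<integral>\<^sup>+s. ennreal (exp (- \<gamma> * s)) * (if t \<le> s then 1 else 0) \<partial>RT) = (\<integral>\<^sup>+s. ennreal (exp (- \<gamma> * s)) * indicator {t..T} s \<partial>lborel)"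
    unfolding RT_def using t
    by (subst nn_integral_restrict_space) (auto intro!: nn_integral_cong simp: indicator_def)
  also have "\<dots> = ennreal ((- exp (- \<gamma> * T) / \<gamma>) - (- exp (- \<gamma> * t) / \<gamma>))"
    using \<gamma> t by (intro nn_integral_FTC_Icc) (auto intro!: derivative_eq_intros)
  also have "\<dots> \<le> ennreal (exp (- \<gamma> * t) / \<gamma>)" using \<gamma> by (intro ennreal_leI) simp
  finally show "(\<integral>\<^sup>+s. ennreal (exp (- \<gamma> * s)) * (if t \<le> s then 1 else 0) \<partial>RT) \<le> ennreal (exp (- \<gamma> * t) / \<gamma>)" .
qed

lemma nn_integral_triangle_swap:
  assumes [measurable]: "b \<in> borel_measurable RT" "a \<in> borel_measurable RT"
  shows "(\<integral>\<^sup>+t. a t * (\<integral>\<^sup>+r. (if t \<le> r then 1 else 0) * b r \<partial>RT) \<partial>RT) =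
     (\<integral>\<^sup>+r. b r * (\<integral>\<^sup>+t. a t * (if t \<le> r then 1 else 0) \<partial>RT) \<partial>RT :: ennreal)"
proof -
  interpret R: finite_measure RT unfolding RT_def by (rule finite_measure_restrict_lborel)
  interpret P: pair_sigma_finite RT RT ..
  have m: "(\<lambda>(t, r). a t * ((if t \<le> r then 1 else 0) * b r)) \<in> borel_measurable (RT \<Otimes>\<^sub>M RT)"
    unfolding case_prod_unfold by measurable
  have "(\<integral>\<^sup>+t. a t * (\<integral>\<^sup>+r. (if t \<le> r then 1 else 0) * b r \<partial>RT) \<partial>RT) = (\<integral>\<^sup>+t. (\<integral>\<^sup>+r. a t * ((if t \<le> r then 1 else 0) * b r) \<partial>RT) \<partial>RT)"
    by (intro nn_integral_cong nn_integral_cmult[symmetric]) measurable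
  also have "\<dots> = (\<integral>\<^sup>+r. (\<integral>\<^sup>+t. a t * ((if t \<le> r then 1 else 0) * b r) \<partial>RT) \<partial>RT)"
    by (rule P.Fubini'[OF m, symmetric])
  also have "\<dots> = (\<integral>\<^sup>+r. b r * (\<integral>\<^sup>+t. a t * (if t \<le> r then 1 else 0) \<partial>RT) \<partial>RT)"
    by (intro nn_integral_cong, subst nn_integral_cmult[symmetric]) (measurable, simp add: mult_ac)
  finally show ?thesis .
qed

text \<open>After exchanging the order of integration the inner integral of exp(\<gamma> t) up to r
  is at most exp(\<gamma> r) / \<gamma>. This gain is the second small factor in the final
  estimate.\<close>

lemma nn_integral_exp_tail_le:
  assumes \<gamma>: "0 < \<gamma>" and b: "b \<in> borel_measurable RT"
  shows "(\<integral>\<^sup>+t. ennreal (exp (\<gamma> * t)) * (\<integral>\<^sup>+r. (if t \<le> r then 1 else 0) * b r \<partial>RT) \<partial>RT)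
    \<le> ennreal (1 / \<gamma>) * (\<integral>\<^sup>+r. ennreal (exp (\<gamma> * r)) * b r \<partial>RT)"
proof -
  note [measurable] = b
  have sp: "space RT = {0..T}" by (simp add: RT_def space_restrict_space)
  have "(\<integral>\<^sup>+t. ennreal (exp (\<gamma> * t)) * (\<integral>\<^sup>+r. (if t \<le> r then 1 else 0) * b r \<partial>RT) \<partial>RT)
     = (\<integral>\<^sup>+r. b r * (\<integral>\<^sup>+t. ennreal (exp (\<gamma> * t)) * (if t \<le> r then 1 else 0) \<partial>RT) \<partial>RT)"
    by (intro nn_integral_triangle_swap b) measurable
  also have "\<dots> \<le> (\<integral>\<^sup>+r. ennreal (1 / \<gamma>) * (ennreal (exp (\<gamma> * r)) * b r) \<partial>RT)"
  proof (rule nn_integral_mono)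
    fix r assume "r \<in> space RT"
    then have r: "0 \<le> r" "r \<le> T" by (auto simp: sp)
    have "b r * ennreal ((exp (\<gamma> * r) - 1) / \<gamma>) \<le> b r * ennreal (1 / \<gamma> * exp (\<gamma> * r))"
      using \<gamma> by (intro mult_left_mono ennreal_leI) (auto simp: divide_right_mono)
    also have "\<dots> = ennreal (1 / \<gamma>) * (ennreal (exp (\<gamma> * r)) * b r)"
      using \<gamma> by (subst ennreal_mult) (auto simp: mult_ac)
    finally show "b r * (\<integral>\<^sup>+t. ennreal (exp (\<gamma> * t)) * (if t \<le> r then 1 else 0) \<partial>RT) \<le> ennreal (1 / \<gamma>) * (ennreal (exp (\<gamma> * r)) * b r)"
      unfolding nn_integral_exp_le(1)[OF \<gamma> r] .
  qed
  also have "\<dots> = ennreal (1 / \<gamma>) * (\<integral>\<^sup>+r. ennreal (exp (\<gamma> * r)) * b r \<partial>RT)"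
    by (rule nn_integral_cmult) measurable
  finally show ?thesis .
qed

text \<open>Written from exp(\<gamma> r) = 1 + \<gamma> times the integral of exp(\<gamma> t) over
  [0, r]. For \<open>Z\<close> only integrals over [t, T] can be bounded, and this identity converts
  them into a weighted norm.\<close>

lemma nn_integral_exp_by_tails:
  assumes \<gamma>: "0 < \<gamma>" and b: "b \<in> borel_measurable RT"
  shows "(\<integral>\<^sup>+r. ennreal (exp (\<gamma> * r)) * b r \<partial>RT) =
    (\<integral>\<^sup>+r. b r \<partial>RT) + ennreal \<gamma> * (\<integral>\<^sup>+t. ennreal (exp (\<gamma> * t)) * (\<integral>\<^sup>+r. (if t \<le> r then 1 else 0) * b r \<partial>RT) \<partial>RT)"
proof -
  note [measurable] = b
  have sp: "space RT = {0..T}" by (simp add: RT_def space_restrict_space)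
  have "ennreal \<gamma> * (\<integral>\<^sup>+t. ennreal (exp (\<gamma> * t)) * (\<integral>\<^sup>+r. (if t \<le> r then 1 else 0) * b r \<partial>RT) \<partial>RT)
     = ennreal \<gamma> * (\<integral>\<^sup>+r. b r * (\<integral>\<^sup>+t. ennreal (exp (\<gamma> * t)) * (if t \<le> r then 1 else 0) \<partial>RT) \<partial>RT)"
    by (subst nn_integral_triangle_swap[OF b]) measurable
  also have "\<dots> = ennreal \<gamma> * (\<integral>\<^sup>+r. b r * ennreal ((exp (\<gamma> * r) - 1) / \<gamma>) \<partial>RT)"
    by (intro arg_cong[where f="(*) _"] nn_integral_cong) (simp add: sp nn_integral_exp_le(1)[OF \<gamma>])
  also have "\<dots> = (\<integral>\<^sup>+r. ennreal \<gamma> * (b r * ennreal ((exp (\<gamma> * r) - 1) / \<gamma>)) \<partial>RT)"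
    by (rule nn_integral_cmult[symmetric]) measurable
  also have "\<dots> = (\<integral>\<^sup>+r. ennreal (exp (\<gamma> * r) - 1) * b r \<partial>RT)"
  proof (rule nn_integral_cong)
    fix r assume "r \<in> space RT"
    then have "0 \<le> \<gamma> * r" using \<gamma> by (simp add: sp)
    then have "ennreal \<gamma> * ennreal ((exp (\<gamma> * r) - 1) / \<gamma>) = ennreal (exp (\<gamma> * r) - 1)"
      using \<gamma> by (subst ennreal_mult[symmetric]) auto
    then show "ennreal \<gamma> * (b r * ennreal ((exp (\<gamma> * r) - 1) / \<gamma>)) = ennreal (exp (\<gamma> * r) - 1) * b r"
      by (metis mult.assoc mult.commute)
  qed
  finally have "(\<integral>\<^sup>+r. b r \<partial>RT) + ennreal \<gamma> * (\<integral>\<^sup>+t. ennreal (exp (\<gamma> * t)) * (\<integral>\<^sup>+r. (if t \<le> r then 1 else 0) * b r \<partial>RT) \<partial>RT)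
     = (\<integral>\<^sup>+r. b r + ennreal (exp (\<gamma> * r) - 1) * b r \<partial>RT)"
    by (simp add: nn_integral_add)
  also have "\<dots> = (\<integral>\<^sup>+r. ennreal (exp (\<gamma> * r)) * b r \<partial>RT)"
  proof (rule nn_integral_cong)
    fix r assume "r \<in> space RT"
    then have "0 \<le> \<gamma> * r" using \<gamma> by (simp add: sp)
    then have "1 + ennreal (exp (\<gamma> * r) - 1) = ennreal (exp (\<gamma> * r))"
      by (subst ennreal_1[symmetric], subst ennreal_plus[symmetric]) auto
    then show "b r + ennreal (exp (\<gamma> * r) - 1) * b r = ennreal (exp (\<gamma> * r)) * b r"
      by (metis distrib_right mult_1)
  qed
  finally show ?thesis by simp
qed

end

context brownian
begin

lemma driver_diff:
  assumes "driver g" "driver g'" shows "driver (\<lambda>w s. g w s - g' w s)"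
proof -
  have eq: "(\<lambda>(w, s). g w s - g' w s) = (\<lambda>p. (\<lambda>(w, s). g w s) p - (\<lambda>(w, s). g' w s) p)" by auto
  show ?thesis unfolding driver_def eq
  proof
    show "(\<lambda>p. (\<lambda>(w, s). g w s) p - (\<lambda>(w, s). g' w s) p) \<in> borel_measurable Pg"
      using assms by (intro borel_measurable_diff) (auto simp: driver_def)
    show "sqint Nm (\<lambda>p. (\<lambda>(w, s). g w s) p - (\<lambda>(w, s). g' w s) p)"
      using assms by (intro sqint_diff) (auto simp: driver_def)
  qed
qed

lemma nn_integral_Nm_swap:
  assumes m: "h \<in> borel_measurable Nm"
  shows "(\<integral>\<^sup>+w. (\<integral>\<^sup>+s. h (w, s) \<partial>RT) \<partial>M) = (\<integral>\<^sup>+s. (\<integral>\<^sup>+w. h (w, s) \<partial>M) \<partial>RT)"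
    and "(\<integral>\<^sup>+p. h p \<partial>Nm) = (\<integral>\<^sup>+s. (\<integral>\<^sup>+w. h (w, s) \<partial>M) \<partial>RT)"
    and "(\<lambda>s. \<integral>\<^sup>+w. h (w, s) \<partial>M) \<in> borel_measurable RT"
proof -
  interpret R: finite_measure RT by (rule finite_measure_restrict_lborel)
  interpret P: pair_sigma_finite M RT ..
  show "(\<integral>\<^sup>+w. (\<integral>\<^sup>+s. h (w, s) \<partial>RT) \<partial>M) = (\<integral>\<^sup>+s. (\<integral>\<^sup>+w. h (w, s) \<partial>M) \<partial>RT)"
    by (rule P.Fubini[OF m, symmetric])
  show "(\<integral>\<^sup>+p. h p \<partial>Nm) = (\<integral>\<^sup>+s. (\<integral>\<^sup>+w. h (w, s) \<partial>M) \<partial>RT)"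
    by (rule P.nn_integral_snd[OF m, symmetric])
  show "(\<lambda>s. \<integral>\<^sup>+w. h (w, s) \<partial>M) \<in> borel_measurable RT"
    using borel_measurable_nn_integral_fst[of "\<lambda>(s, w). h (w, s)" RT] measurable_pair_swap[OF m] by simp
qed

lemma driver_tail_estimate:
  assumes G: "driver G" and \<gamma>: "0 < \<gamma>" and t: "t \<in> {0..T}"
  shows "(\<integral>\<^sup>+w. ennreal ((LINT s:{t..T}|lborel. G w s)\<^sup>2) \<partial>M) \<le>
    ennreal (exp (- \<gamma> * t) / \<gamma>) * (\<integral>\<^sup>+r. (if t \<le> r then 1 else 0) * (ennreal (exp (\<gamma> * r)) * (\<integral>\<^sup>+w. ennreal ((G w r)\<^sup>2) \<partial>M)) \<partial>RT)"
proof -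
  interpret R: finite_measure RT by (rule finite_measure_restrict_lborel)
  have Gm [measurable]: "(\<lambda>(w, s). G w s) \<in> borel_measurable Nm" using G by (simp add: driver_def sqint_def)
  have Gm' [measurable]: "(\<lambda>p. G (fst p) (snd p)) \<in> borel_measurable Nm" using Gm by (simp add: case_prod_unfold)
  have sm [measurable]: "snd \<in> borel_measurable Nm" by (rule measurable_compose[OF measurable_snd RT_id])
  define h where "h p = (if t \<le> snd p then 1 else 0) * (ennreal (exp (\<gamma> * snd p)) * ennreal ((G (fst p) (snd p))\<^sup>2))" for p
  have hm: "h \<in> borel_measurable Nm" unfolding h_def by measurable
  have "(\<integral>\<^sup>+w. ennreal ((LINT s:{t..T}|lborel. G w s)\<^sup>2) \<partial>M) \<le> (\<integral>\<^sup>+w. ennreal (exp (- \<gamma> * t) / \<gamma>) * (\<integral>\<^sup>+s. h (w, s) \<partial>RT) \<partial>M)"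
  proof (rule nn_integral_mono_AE)
    show "AE w in M. ennreal ((LINT s:{t..T}|lborel. G w s)\<^sup>2) \<le> ennreal (exp (- \<gamma> * t) / \<gamma>) * (\<integral>\<^sup>+s. h (w, s) \<partial>RT)"
      using driver_energy(3)[OF G]
    proof eventually_elim
      case (elim w)
      \<comment> \<open>Cauchy-Schwarz after inserting 1 = exp(- \<gamma> s / 2) exp(\<gamma> s /
        2): the first factor has squared norm at most exp(- \<gamma> t) / \<gamma>, and the second
        leaves the weight on the driver.\<close>
      define X where "X s = (if t \<le> s then exp (- \<gamma> * s / 2) else 0)" for s
      define Y where "Y s = (if t \<le> s then exp (\<gamma> * s / 2) else 0) * G w s" for s
      have [measurable]: "G w \<in> borel_measurable RT" by (rule sqint_measurable[OF elim])
      have X: "sqint RT X"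
        using t \<gamma> by (intro R.sqint_bounded[where K=1]) (auto simp: X_def[abs_def] space_restrict_space)
      have Y: "sqint RT Y"
        unfolding Y_def
        by (rule sqint_mult_bounded[OF elim, where K="exp (\<gamma> * T / 2)"])
          (use \<gamma> in \<open>auto simp: space_restrict_space\<close>)
      have "(LINT s:{t..T}|lborel. G w s) = (\<integral>s. X s * Y s \<partial>RT)"
        unfolding set_lebesgue_integral_def using t
        by (auto simp: integral_restrict_space X_def Y_def indicator_def mult_exp_exp intro!: Bochner_Integration.integral_cong)
      then have "(LINT s:{t..T}|lborel. G w s)\<^sup>2 \<le> (\<integral>s. (X s)\<^sup>2 \<partial>RT) * (\<integral>s. (Y s)\<^sup>2 \<partial>RT)"
        using Cauchy_Schwarz_integral[OF X Y] by simp
      then have "ennreal ((LINT s:{t..T}|lborel. G w s)\<^sup>2) \<le> ennreal (\<integral>s. (X s)\<^sup>2 \<partial>RT) * ennreal (\<integral>s. (Y s)\<^sup>2 \<partial>RT)"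
        by (subst ennreal_mult[symmetric]) (auto intro: ennreal_leI)
      also have "ennreal (\<integral>s. (X s)\<^sup>2 \<partial>RT) = (\<integral>\<^sup>+s. ennreal (exp (- \<gamma> * s)) * (if t \<le> s then 1 else 0) \<partial>RT)"
        unfolding sqint_nn_integral[OF X, symmetric, simplified real_norm_def power2_abs]
        by (intro nn_integral_cong) (simp add: X_def exp_double[symmetric])
      also have "ennreal (\<integral>s. (Y s)\<^sup>2 \<partial>RT) = (\<integral>\<^sup>+s. h (w, s) \<partial>RT)"
        unfolding sqint_nn_integral[OF Y, symmetric, simplified real_norm_def power2_abs]
        by (intro nn_integral_cong) (simp add: Y_def h_def power_mult_distrib exp_double[symmetric] ennreal_mult)
      also have "(\<integral>\<^sup>+s. ennreal (exp (- \<gamma> * s)) * (if t \<le> s then 1 else 0) \<partial>RT) * (\<integral>\<^sup>+s. h (w, s) \<partial>RT) \<le>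
          ennreal (exp (- \<gamma> * t) / \<gamma>) * (\<integral>\<^sup>+s. h (w, s) \<partial>RT)"
        using t by (intro mult_right_mono nn_integral_exp_le(2)[OF \<gamma>]) auto
      finally show ?case .
    qed
  qed
  also have "\<dots> = ennreal (exp (- \<gamma> * t) / \<gamma>) * (\<integral>\<^sup>+w. (\<integral>\<^sup>+s. h (w, s) \<partial>RT) \<partial>M)"
    by (rule nn_integral_cmult) (rule R.borel_measurable_nn_integral_fst[OF hm])
  also have "(\<integral>\<^sup>+w. (\<integral>\<^sup>+s. h (w, s) \<partial>RT) \<partial>M) = (\<integral>\<^sup>+s. (\<integral>\<^sup>+w. h (w, s) \<partial>M) \<partial>RT)"
    by (rule nn_integral_Nm_swap[OF hm])
  also have "\<dots> = (\<integral>\<^sup>+r. (if t \<le> r then 1 else 0) * (ennreal (exp (\<gamma> * r)) * (\<integral>\<^sup>+w. ennreal ((G w r)\<^sup>2) \<partial>M)) \<partial>RT)"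
  proof (rule nn_integral_cong)
    fix r assume r: "r \<in> space RT"
    have "(\<lambda>w. G w r) \<in> borel_measurable M" using measurable_Pair1[OF Gm r] by simp
    then show "(\<integral>\<^sup>+w. h (w, r) \<partial>M) = (if t \<le> r then 1 else 0) * (ennreal (exp (\<gamma> * r)) * (\<integral>\<^sup>+w. ennreal ((G w r)\<^sup>2) \<partial>M))"
      by (simp add: h_def nn_integral_cmult)
  qed
  finally show ?thesis .
qed

end

section \<open>Dependence of the solution on its driver\<close>

section \<open>Stability of flat solutions\<close>

context mean_reflected
begin

abbreviation flat_solution :: "('w \<Rightarrow> real) \<Rightarrow> ('w \<Rightarrow> real \<Rightarrow> real) \<Rightarrow> (real \<Rightarrow> 'w \<Rightarrow> real) \<Rightarrow> (real \<Rightarrow> 'w \<Rightarrow> real^'d) \<Rightarrow> (real \<Rightarrow> real) \<Rightarrow> bool"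
  where "flat_solution \<xi> g Y Z K \<equiv> deterministic_flat_solution M T B \<xi> (\<lambda>w s _ _. g w s) l Y Z K"

lemma flat_solutionD:
  assumes "flat_solution \<xi> g Y Z K"
  shows "Y \<in> S2 M F T" "Z \<in> H2 M F T" "continuous_on {0..T} K" "mono_on {0..T} K" "K 0 = 0"
    "\<exists>I. is_ito_integral M T B Z I \<and> (AE w in M. \<forall>t\<in>{0..T}.
        Y t w = \<xi> w + (LINT s:{t..T}|lborel. g w s) - (I T w - I t w) + K T - K t)"
    "\<And>t. t \<in> {0..T} \<Longrightarrow> expectation (\<lambda>w. l w t (Y t w)) \<ge> 0"
    "(LINT t:{0..T}|stieltjes_measure T K. expectation (\<lambda>w. l w t (Y t w))) = 0"
proof -
  show "Y \<in> S2 M F T" "Z \<in> H2 M F T"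
    "\<exists>I. is_ito_integral M T B Z I \<and> (AE w in M. \<forall>t\<in>{0..T}.
        Y t w = \<xi> w + (LINT s:{t..T}|lborel. g w s) - (I T w - I t w) + K T - K t)"
    "(LINT t:{0..T}|stieltjes_measure T K. expectation (\<lambda>w. l w t (Y t w))) = 0"
    using assms unfolding deterministic_flat_solution_def by blast+
  show "expectation (\<lambda>w. l w t (Y t w)) \<ge> 0" if "t \<in> {0..T}" for t
    using assms that unfolding deterministic_flat_solution_def by blast
  have "K \<in> A2D M F T" using assms unfolding deterministic_flat_solution_def by blast
  \<comment> \<open>Membership in \<open>A2D\<close> is a statement about a process constant in the
    sample point; evaluating at any one point gives the properties of the function.\<close>
  moreover obtain w where "w \<in> space M" using not_empty by blast
  ultimately show "continuous_on {0..T} K" "mono_on {0..T} K" "K 0 = 0"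
    unfolding A2D_def A2_def S2_def by auto
qed

text \<open>Moving from X' to X changes the expected loss by at most \<open>C * q\<close>, and a
  shift of the argument by \<open>C / c * q\<close> raises it by at least that much. This shift is
  the \<open>D\<close> of the comparison principle.\<close>

lemma flat_comparison:
  assumes s: "flat_solution \<xi> g Y Z K" and s': "flat_solution \<xi> g' Y' Z' K'"
    and t: "t \<in> {0..T}" and q: "0 \<le> q"
    "\<And>s. s \<in> {t..T} \<Longrightarrow> expectation (\<lambda>w. \<bar>(Y s w - (K T - K s)) - (Y' s w - (K' T - K' s))\<bar>) \<le> q"
  shows "K T - K t \<le> K' T - K' t + C / c * q"
proof -
  note S = flat_solutionD[OF s] and S' = flat_solutionD[OF s']
  define X where "X s w = Y s w - (K T - K s)" for s w
  define X' where "X' s w = Y' s w - (K' T - K' s)" for s w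
  have X: "integrable M (X s)" "integrable M (X' s)" if "s \<in> {0..T}" for s
    unfolding X_def X'_def using sqint_integrable[OF S2D(5)[OF S(1) that]] sqint_integrable[OF S2D(5)[OF S'(1) that]] by auto
  have YX: "Y s w = X s w + (K T - K s)" "Y' s w = X' s w + (K' T - K' s)" for s w by (simp_all add: X_def X'_def)
  show ?thesis
  proof (rule skorokhod_comparison[where m="\<lambda>s x. expectation (\<lambda>w. l w s (X s w + x))" and m'="\<lambda>s x. expectation (\<lambda>w. l w s (X' s w + x))"])
    show "0 \<le> T" using T_pos by simp
    show "continuous_on {0..T} (\<lambda>s. expectation (\<lambda>w. l w s (X s w + (K T - K s))))"
      unfolding YX[symmetric] by (rule l_continuous[OF S(1)])
    show "0 \<le> expectation (\<lambda>w. l w s (X s w + (K T - K s)))" if "s \<in> {0..T}" for s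
      unfolding YX[symmetric] by (rule S(7)[OF that])
    show "0 \<le> expectation (\<lambda>w. l w s (X' s w + (K' T - K' s)))" if "s \<in> {0..T}" for s
      unfolding YX[symmetric] by (rule S'(7)[OF that])
    show "(LINT s:{0..T}|stieltjes_measure T K. expectation (\<lambda>w. l w s (X s w + (K T - K s)))) = 0"
      unfolding YX[symmetric] by (rule S(8))
    show "expectation (\<lambda>w. l w s (X s w + x)) < expectation (\<lambda>w. l w s (X s w + y))" if "s \<in> {0..T}" "x < y" for s x y
    proof -
      have "0 < c * (y - x)" using c_pos that by simp
      then show ?thesis using l_lower[OF X(1)[OF that(1)] that(1), of x y] that by linarith
    qed
    show "0 \<le> C / c * q" using c_pos c_le q by simp
    show "expectation (\<lambda>w. l w s (X' s w + x)) \<le> expectation (\<lambda>w. l w s (X s w + (x + C / c * q)))" if "s \<in> {t..T}" for s x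
    proof -
      have s: "s \<in> {0..T}" using that t by auto
      have "\<bar>expectation (\<lambda>w. l w s (X s w + x)) - expectation (\<lambda>w. l w s (X' s w + x))\<bar> \<le> C * expectation (\<lambda>w. \<bar>X s w - X' s w\<bar>)"
        using l_Lipschitz[of "\<lambda>w. X s w + x" "\<lambda>w. X' s w + x" s] X[OF s] s by simp
      also have "\<dots> \<le> C * q" using q(2)[OF that] c_pos c_le by (intro mult_left_mono) (auto simp: X_def X'_def)
      finally have 1: "expectation (\<lambda>w. l w s (X' s w + x)) \<le> expectation (\<lambda>w. l w s (X s w + x)) + C * q" by linarith
      have "x \<le> x + C / c * q" using c_pos c_le q by simp
      from l_lower[OF X(1)[OF s] s this]
      have "C * q \<le> expectation (\<lambda>w. l w s (X s w + (x + C / c * q))) - expectation (\<lambda>w. l w s (X s w + x))"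
        using c_pos by simp
      with 1 show ?thesis by linarith
    qed
  qed (use S S' t in auto)
qed

text \<open>The adapted part of the difference is orthogonal to the increment of the stochastic integral, which
  replaces the use of Ito's formula.\<close>

lemma stability_orthogonal:
  assumes s: "flat_solution \<xi> g Y Z K" and s': "flat_solution \<xi> g' Y' Z' K'" and g: "driver g" "driver g'"
    and t: "t \<in> {0..T}"
  shows "(\<integral>\<^sup>+w. ennreal (((Y t w - (K T - K t)) - (Y' t w - (K' T - K' t)))\<^sup>2) \<partial>M) +
     (\<integral>\<^sup>+w. (\<integral>\<^sup>+r\<in>{t<..T}. ennreal ((norm (Z r w - Z' r w))\<^sup>2) \<partial>lborel) \<partial>M)
    = (\<integral>\<^sup>+w. ennreal ((LINT s:{t..T}|lborel. g w s - g' w s)\<^sup>2) \<partial>M)"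
proof -
  interpret R: finite_measure RT by (rule finite_measure_restrict_lborel)
  note S = flat_solutionD[OF s] and S' = flat_solutionD[OF s']
  obtain I where I: "is_ito_integral M T B Z I" and eq: "AE w in M. \<forall>t\<in>{0..T}.
        Y t w = \<xi> w + (LINT s:{t..T}|lborel. g w s) - (I T w - I t w) + K T - K t" using S(6) by blast
  obtain I' where I': "is_ito_integral M T B Z' I'" and eq': "AE w in M. \<forall>t\<in>{0..T}.
        Y' t w = \<xi> w + (LINT s:{t..T}|lborel. g' w s) - (I' T w - I' t w) + K' T - K' t" using S'(6) by blast
  define V where "V = (\<lambda>t w. I t w - I' t w)"
  have ito: "is_ito_integral M T B (\<lambda>t w. Z t w - Z' t w) V"
    unfolding V_def by (rule ito_diff[OF I I' S(2) S'(2)])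
  have ZZ: "(\<lambda>t w. Z t w - Z' t w) \<in> H2 M F T"
  proof -
    have e: "(\<lambda>(w, t). Z t w - Z' t w) = (\<lambda>p. (\<lambda>(w, t). Z t w) p - (\<lambda>(w, t). Z' t w) p)" by auto
    show ?thesis unfolding H2_iff e
    proof
      show "(\<lambda>p. (\<lambda>(w, t). Z t w) p - (\<lambda>(w, t). Z' t w) p) \<in> borel_measurable Pr"
        using S(2) S'(2) by (intro borel_measurable_diff) (auto simp: H2_iff)
      show "sqint Nm (\<lambda>p. (\<lambda>(w, t). Z t w) p - (\<lambda>(w, t). Z' t w) p)"
        using S(2) S'(2) by (intro sqint_diff) (auto simp: H2_iff)
    qed
  qed
  have TT: "T \<in> {0..T}" and tT: "0 \<le> t" "t \<le> T" using t T_pos by auto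
  note Vm = L2_martingaleD[OF ito_L2_martingale[OF ito]]
  define D where "D w = (Y t w - (K T - K t)) - (Y' t w - (K' T - K' t))" for w
  define N where "N w = V T w - V t w" for w
  \<comment> \<open>\<open>K T\<close> and \<open>K' T\<close> are constants; random terminal pushes
    would not be known at time \<open>t\<close>, and the orthogonality would be lost.\<close>
  have D: "D \<in> borel_measurable (F t)" "sqint M D"
  proof -
    have [measurable]: "Y t \<in> borel_measurable (F t)" "Y' t \<in> borel_measurable (F t)"
      using S2D(1)[OF S(1) t] S2D(1)[OF S'(1) t] .
    show "D \<in> borel_measurable (F t)" unfolding D_def by measurable
    show "sqint M D" unfolding D_def by (intro sqint_diff sqint_const S2D(5)[OF S(1) t] S2D(5)[OF S'(1) t])
  qed
  have N: "sqint M N" unfolding N_def by (intro sqint_diff Vm(2) TT t)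
  have orth: "expectation (\<lambda>w. D w * N w) = 0" unfolding N_def by (rule Vm(3)[OF tT order_refl D])
  have "AE w in M. (LINT s:{t..T}|lborel. g w s - g' w s) = (LINT s:{t..T}|lborel. g w s) - (LINT s:{t..T}|lborel. g' w s)"
    using driver_energy(3)[OF g(1)] driver_energy(3)[OF g(2)]
  proof eventually_elim
    case (elim w)
    have "set_integrable lborel {t..T} (g w)" "set_integrable lborel {t..T} (g' w)"
      using set_integrable_RT[OF R.sqint_integrable[OF elim(1)]] set_integrable_RT[OF R.sqint_integrable[OF elim(2)]] tT
      by (auto intro: set_integrable_subset)
    then show ?case by (rule set_integral_diff(2))
  qed
  then have DN: "AE w in M. (LINT s:{t..T}|lborel. g w s - g' w s) = D w + N w"
    using eq eq'
  proof eventually_elim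
    case (elim w)
    show ?case using bspec[OF elim(2) t] bspec[OF elim(3) t] elim(1) by (simp add: D_def N_def V_def)
  qed
  \<comment> \<open>With the cross term gone, the square of D + N splits into the two second
    moments; the isometry identifies that of N.\<close>
  have "(\<integral>\<^sup>+w. ennreal ((LINT s:{t..T}|lborel. g w s - g' w s)\<^sup>2) \<partial>M) = (\<integral>\<^sup>+w. ennreal ((norm (D w + N w))\<^sup>2) \<partial>M)"
    using DN by (intro nn_integral_cong_AE) auto
  also have "\<dots> = ennreal (expectation (\<lambda>w. (D w + N w)\<^sup>2))"
    using sqint_nn_integral[OF sqint_add[OF D(2) N]] by simp
  also have "expectation (\<lambda>w. (D w + N w)\<^sup>2) = expectation (\<lambda>w. (D w)\<^sup>2 + (N w)\<^sup>2 + 2 * (D w * N w))"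
    by (intro Bochner_Integration.integral_cong) (auto simp: power2_sum)
  also have "\<dots> = expectation (\<lambda>w. (D w)\<^sup>2) + expectation (\<lambda>w. (N w)\<^sup>2)"
    using sqint_square_integrable[OF D(2)] sqint_square_integrable[OF N] sqint_mult_integrable[OF D(2) N] orth by simp
  also have "ennreal \<dots> = ennreal (expectation (\<lambda>w. (D w)\<^sup>2)) + ennreal (expectation (\<lambda>w. (N w)\<^sup>2))"
    by (rule ennreal_plus) auto
  also have "ennreal (expectation (\<lambda>w. (D w)\<^sup>2)) = (\<integral>\<^sup>+w. ennreal ((D w)\<^sup>2) \<partial>M)"
    using sqint_nn_integral[OF D(2)] by simp
  also have "ennreal (expectation (\<lambda>w. (N w)\<^sup>2)) = (\<integral>\<^sup>+w. ennreal ((V T w - V t w)\<^sup>2) \<partial>M)"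
    using sqint_nn_integral[OF N] by (simp add: N_def)
  also have "\<dots> = (\<integral>\<^sup>+w. (\<integral>\<^sup>+r\<in>{t<..T}. ennreal ((norm (Z r w - Z' r w))\<^sup>2) \<partial>lborel) \<partial>M)"
    by (rule ito_isometry[OF ito ZZ tT order_refl])
  finally show ?thesis by (simp add: D_def)
qed

text \<open>The right-hand side of \<open>driver_tail_estimate\<close>. Both factors decrease in t,
  and this monotonicity is the reason for working with the weighted bound instead of the tail
  integral itself.\<close>

definition tail_bound :: "real \<Rightarrow> ('w \<Rightarrow> real \<Rightarrow> real) \<Rightarrow> real \<Rightarrow> ennreal" where
  "tail_bound \<gamma> G t = ennreal (exp (- \<gamma> * t) / \<gamma>) *
     (\<integral>\<^sup>+r. (if t \<le> r then 1 else 0) * (ennreal (exp (\<gamma> * r)) * (\<integral>\<^sup>+w. ennreal ((G w r)\<^sup>2) \<partial>M)) \<partial>RT)"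

lemma driver_square_measurable:
  assumes G: "driver G"
  shows "(\<lambda>p. ennreal ((G (fst p) (snd p))\<^sup>2)) \<in> borel_measurable Nm"
    "(\<lambda>r. \<integral>\<^sup>+w. ennreal ((G w r)\<^sup>2) \<partial>M) \<in> borel_measurable RT"
    "(\<integral>\<^sup>+r. (\<integral>\<^sup>+w. ennreal ((G w r)\<^sup>2) \<partial>M) \<partial>RT) < \<infinity>"
proof -
  have "(\<lambda>p. G (fst p) (snd p)) \<in> borel_measurable Nm" using G by (simp add: driver_def sqint_def case_prod_unfold)
  then show m: "(\<lambda>p. ennreal ((G (fst p) (snd p))\<^sup>2)) \<in> borel_measurable Nm" by measurable
  show "(\<lambda>r. \<integral>\<^sup>+w. ennreal ((G w r)\<^sup>2) \<partial>M) \<in> borel_measurable RT" using nn_integral_Nm_swap(3)[OF m] by simp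
  have "(\<integral>\<^sup>+r. (\<integral>\<^sup>+w. ennreal ((G w r)\<^sup>2) \<partial>M) \<partial>RT) = (\<integral>\<^sup>+p. ennreal ((G (fst p) (snd p))\<^sup>2) \<partial>Nm)"
    using nn_integral_Nm_swap(2)[OF m] by simp
  also have "\<dots> < \<infinity>" using G by (simp add: driver_def sqint_iff case_prod_unfold)
  finally show "(\<integral>\<^sup>+r. (\<integral>\<^sup>+w. ennreal ((G w r)\<^sup>2) \<partial>M) \<partial>RT) < \<infinity>" .
qed

lemma tail_bound_finite:
  assumes G: "driver G" and \<gamma>: "0 < \<gamma>" shows "tail_bound \<gamma> G t < \<infinity>"
proof -
  note [measurable] = driver_square_measurable(2)[OF G]
  have "(\<integral>\<^sup>+r. (if t \<le> r then 1 else 0) * (ennreal (exp (\<gamma> * r)) * (\<integral>\<^sup>+w. ennreal ((G w r)\<^sup>2) \<partial>M)) \<partial>RT)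
    \<le> (\<integral>\<^sup>+r. ennreal (exp (\<gamma> * T)) * (\<integral>\<^sup>+w. ennreal ((G w r)\<^sup>2) \<partial>M) \<partial>RT)"
    using \<gamma> by (intro nn_integral_mono) (auto simp: space_restrict_space intro!: mult_right_mono ennreal_leI)
  also have "\<dots> < \<infinity>" using driver_square_measurable(3)[OF G] by (simp add: nn_integral_cmult ennreal_mult_less_top)
  finally show ?thesis unfolding tail_bound_def by (simp add: ennreal_mult_less_top)
qed

lemma tail_bound_antimono:
  assumes \<gamma>: "0 < \<gamma>" and "t \<le> s" shows "tail_bound \<gamma> G s \<le> tail_bound \<gamma> G t"
  unfolding tail_bound_def using assms
  by (intro mult_mono nn_integral_mono ennreal_leI divide_right_mono) auto

lemma stability_pointwise:
  assumes s: "flat_solution \<xi> g Y Z K" and s': "flat_solution \<xi> g' Y' Z' K'" and g: "driver g" "driver g'"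
    and t: "t \<in> {0..T}" and \<gamma>: "0 < \<gamma>"
  defines "h \<equiv> tail_bound \<gamma> (\<lambda>w s. g w s - g' w s)"
  shows "(\<integral>\<^sup>+w. ennreal ((Y t w - Y' t w)\<^sup>2) \<partial>M) \<le> ennreal (2 + 2 * (C / c)\<^sup>2) * h t"
    and "(\<integral>\<^sup>+w. (\<integral>\<^sup>+r\<in>{t<..T}. ennreal ((norm (Z r w - Z' r w))\<^sup>2) \<partial>lborel) \<partial>M) \<le> h t"
    and "\<bar>(K T - K t) - (K' T - K' t)\<bar> \<le> C / c * sqrt (enn2real (h t))"
proof -
  note S = flat_solutionD[OF s] and S' = flat_solutionD[OF s'] and G = driver_diff[OF g]
  define D where "D s w = (Y s w - (K T - K s)) - (Y' s w - (K' T - K' s))" for s w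
  have Dsq: "sqint M (D r)" if "r \<in> {0..T}" for r
    unfolding D_def by (intro sqint_diff sqint_const S2D(5)[OF S(1) that] S2D(5)[OF S'(1) that])
  have hfin: "h r < \<infinity>" for r unfolding h_def by (rule tail_bound_finite[OF G \<gamma>])
  have hmono: "h r' \<le> h r" if "r \<le> r'" for r r' unfolding h_def by (rule tail_bound_antimono[OF \<gamma> that])
  have total: "(\<integral>\<^sup>+w. ennreal ((D r w)\<^sup>2) \<partial>M) + (\<integral>\<^sup>+w. (\<integral>\<^sup>+x\<in>{r<..T}. ennreal ((norm (Z x w - Z' x w))\<^sup>2) \<partial>lborel) \<partial>M) \<le> h r"
    if "r \<in> {0..T}" for r
    using stability_orthogonal[OF s s' g that] driver_tail_estimate[OF G \<gamma> that]
    by (simp add: D_def h_def tail_bound_def)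
  have Dh: "(\<integral>\<^sup>+w. ennreal ((D r w)\<^sup>2) \<partial>M) \<le> h r" if "r \<in> {0..T}" for r
    using total[OF that] by (rule order_trans[rotated]) simp
  show "(\<integral>\<^sup>+w. (\<integral>\<^sup>+r\<in>{t<..T}. ennreal ((norm (Z r w - Z' r w))\<^sup>2) \<partial>lborel) \<partial>M) \<le> h t"
    using total[OF t] by (rule order_trans[rotated]) simp
  \<comment> \<open>As the tail bound is antitone, its value at \<open>t\<close> bounds the second
    moment of the adapted difference at every later time, which is exactly the uniform bound needed
    for comparing the pushes.\<close>
  define q where "q = sqrt (enn2real (h t))"
  have q: "0 \<le> q" by (simp add: q_def)
  have Dq: "expectation (\<lambda>w. \<bar>D r w\<bar>) \<le> q" if r: "r \<in> {t..T}" for r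
  proof -
    have r0: "r \<in> {0..T}" using r t by auto
    have "ennreal (expectation (\<lambda>w. (D r w)\<^sup>2)) \<le> h t"
      using sqint_nn_integral[OF Dsq[OF r0]] Dh[OF r0] hmono[of t r] r by (auto intro: order_trans)
    then have 1: "expectation (\<lambda>w. (D r w)\<^sup>2) \<le> enn2real (h t)"
      using hfin[of t] enn2real_mono[of "ennreal (expectation (\<lambda>w. (D r w)\<^sup>2))" "h t"] by simp
    have "(expectation (\<lambda>w. \<bar>D r w\<bar> * 1))\<^sup>2 \<le> expectation (\<lambda>w. \<bar>D r w\<bar>\<^sup>2) * expectation (\<lambda>w. 1\<^sup>2)"
      using Dsq[OF r0] by (intro Cauchy_Schwarz_integral sqint_const) (auto simp: sqint_def)
    then have "(expectation (\<lambda>w. \<bar>D r w\<bar>))\<^sup>2 \<le> enn2real (h t)" using 1 by (simp add: prob_space)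
    then show ?thesis unfolding q_def by (rule real_le_rsqrt)
  qed
  have "K T - K t \<le> K' T - K' t + C / c * q"
    using Dq by (intro flat_comparison[OF s s' t q]) (simp add: D_def)
  moreover have "K' T - K' t \<le> K T - K t + C / c * q"
    using Dq by (intro flat_comparison[OF s' s t q]) (simp add: D_def abs_minus_commute)
  ultimately have k: "\<bar>(K T - K t) - (K' T - K' t)\<bar> \<le> C / c * q" by linarith
  then show "\<bar>(K T - K t) - (K' T - K' t)\<bar> \<le> C / c * sqrt (enn2real (h t))" by (simp add: q_def)
  \<comment> \<open>Y - Y' is the adapted difference plus this constant, so squaring with factor 2
    on each part produces 2 + 2 (C/c)^2.\<close>
  define k where "k = (K T - K t) - (K' T - K' t)"
  have k2: "ennreal (k\<^sup>2) \<le> ennreal ((C / c)\<^sup>2) * h t"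
  proof -
    have "k\<^sup>2 \<le> (C / c * q)\<^sup>2" using k by (metis abs_ge_zero k_def power2_abs power_mono)
    also have "\<dots> = (C / c)\<^sup>2 * enn2real (h t)" by (simp add: q_def power_mult_distrib power_divide)
    finally have "ennreal (k\<^sup>2) \<le> ennreal ((C / c)\<^sup>2) * ennreal (enn2real (h t))"
      by (subst ennreal_mult[symmetric]) (auto intro: ennreal_leI)
    then show ?thesis using hfin[of t] by simp
  qed
  have "(\<integral>\<^sup>+w. ennreal ((Y t w - Y' t w)\<^sup>2) \<partial>M) = (\<integral>\<^sup>+w. ennreal ((norm (D t w + k))\<^sup>2) \<partial>M)"
    by (simp add: D_def k_def algebra_simps)
  also have "\<dots> \<le> 2 * (\<integral>\<^sup>+w. ennreal ((norm (D t w))\<^sup>2) \<partial>M) + 2 * (\<integral>\<^sup>+w. ennreal ((norm k)\<^sup>2) \<partial>M)"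
    using sqint_measurable[OF Dsq[OF t]] by (intro nn_integral_norm_add_le) auto
  also have "\<dots> \<le> 2 * h t + 2 * (ennreal ((C / c)\<^sup>2) * h t)"
    using Dh[OF t] k2 by (intro add_mono mult_left_mono) (auto simp: emeasure_space_1)
  also have "\<dots> = ennreal (2 + 2 * (C / c)\<^sup>2) * h t"
  proof -
    have "ennreal (2 + 2 * (C / c)\<^sup>2) = 2 + 2 * ennreal ((C / c)\<^sup>2)"
      by (simp add: ennreal_mult del: power_divide)
    then show ?thesis by (simp only: distrib_right mult.assoc)
  qed
  finally show "(\<integral>\<^sup>+w. ennreal ((Y t w - Y' t w)\<^sup>2) \<partial>M) \<le> ennreal (2 + 2 * (C / c)\<^sup>2) * h t" .
qed

section \<open>Picard map in the weighted norm: contraction, uniqueness, existence\<close>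

section \<open>The Picard iteration\<close>

definition weighted :: "real \<Rightarrow> ('w \<times> real \<Rightarrow> 'b::real_normed_vector) \<Rightarrow> ennreal" where
  "weighted \<beta> P = (\<integral>\<^sup>+p. ennreal (exp (\<beta> * snd p)) * ennreal ((norm (P p))\<^sup>2) \<partial>Nm)"

lemma snd_Nm [measurable]: "snd \<in> borel_measurable Nm"
  by (rule measurable_compose[OF measurable_snd RT_id])

lemma weighted_swap:
  fixes P :: "'w \<times> real \<Rightarrow> 'b::{real_normed_vector, second_countable_topology}"
  assumes P: "P \<in> borel_measurable Nm"
  shows "weighted \<beta> P = (\<integral>\<^sup>+r. ennreal (exp (\<beta> * r)) * (\<integral>\<^sup>+w. ennreal ((norm (P (w, r)))\<^sup>2) \<partial>M) \<partial>RT)"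
    and "(\<lambda>r. \<integral>\<^sup>+w. ennreal ((norm (P (w, r)))\<^sup>2) \<partial>M) \<in> borel_measurable RT"
proof -
  note [measurable] = P
  show "(\<lambda>r. \<integral>\<^sup>+w. ennreal ((norm (P (w, r)))\<^sup>2) \<partial>M) \<in> borel_measurable RT"
    by (rule nn_integral_Nm_swap(3)[of "\<lambda>p. ennreal ((norm (P p))\<^sup>2)"]) measurable
  have "weighted \<beta> P = (\<integral>\<^sup>+r. (\<integral>\<^sup>+w. ennreal (exp (\<beta> * r)) * ennreal ((norm (P (w, r)))\<^sup>2) \<partial>M) \<partial>RT)"
    unfolding weighted_def by (subst nn_integral_Nm_swap(2)) auto
  also have "\<dots> = (\<integral>\<^sup>+r. ennreal (exp (\<beta> * r)) * (\<integral>\<^sup>+w. ennreal ((norm (P (w, r)))\<^sup>2) \<partial>M) \<partial>RT)"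
  proof (rule nn_integral_cong, rule nn_integral_cmult)
    fix r assume "r \<in> space RT"
    then have "(\<lambda>w. P (w, r)) \<in> borel_measurable M" by (rule measurable_Pair1[OF P])
    then show "(\<lambda>w. ennreal ((norm (P (w, r)))\<^sup>2)) \<in> borel_measurable M" by measurable
  qed
  finally show "weighted \<beta> P = \<dots>" .
qed

lemma weighted_ge:
  assumes "0 \<le> \<beta>" shows "(\<integral>\<^sup>+p. ennreal ((norm (P p))\<^sup>2) \<partial>Nm) \<le> weighted \<beta> P"
  unfolding weighted_def
proof (rule nn_integral_mono)
  fix p assume "p \<in> space Nm"
  then have "1 \<le> exp (\<beta> * snd p)" using assms by (auto simp: space_Nm)
  then have "1 * ennreal ((norm (P p))\<^sup>2) \<le> ennreal (exp (\<beta> * snd p)) * ennreal ((norm (P p))\<^sup>2)"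
    by (intro mult_right_mono) (auto simp flip: ennreal_1 intro: ennreal_leI)
  then show "ennreal ((norm (P p))\<^sup>2) \<le> ennreal (exp (\<beta> * snd p)) * ennreal ((norm (P p))\<^sup>2)" by simp
qed

lemma weighted_le:
  assumes "0 \<le> \<beta>" "P \<in> borel_measurable Nm"
  shows "weighted \<beta> P \<le> ennreal (exp (\<beta> * T)) * (\<integral>\<^sup>+p. ennreal ((norm (P p :: 'b::{real_normed_vector, second_countable_topology}))\<^sup>2) \<partial>Nm)"
proof -
  have "weighted \<beta> P \<le> (\<integral>\<^sup>+p. ennreal (exp (\<beta> * T)) * ennreal ((norm (P p))\<^sup>2) \<partial>Nm)"
    unfolding weighted_def using assms
    by (intro nn_integral_mono mult_right_mono ennreal_leI) (auto simp: space_Nm intro!: mult_left_mono)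
  also have "\<dots> = ennreal (exp (\<beta> * T)) * (\<integral>\<^sup>+p. ennreal ((norm (P p))\<^sup>2) \<partial>Nm)"
    by (rule nn_integral_cmult, rule measurable_compose[OF assms(2), of "\<lambda>x. ennreal ((norm x)\<^sup>2)"]) measurable
  finally show ?thesis .
qed

text \<open>The prefactor exp(- \<gamma> t) / \<gamma> cancels half of the weight exp(2 \<gamma> t)
  and gives 1/\<gamma>; the remaining tail integral gives another 1/\<gamma>. At time 0 there is no
  time integration and only one factor is gained.\<close>

lemma tail_bound_weighted:
  assumes G: "driver G" and \<gamma>: "0 < \<gamma>"
  shows "(\<integral>\<^sup>+t. ennreal (exp (2 * \<gamma> * t)) * tail_bound \<gamma> G t \<partial>RT) \<le> ennreal (1 / \<gamma>\<^sup>2) * weighted (2 * \<gamma>) (\<lambda>(w, s). G w s)"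
    and "tail_bound \<gamma> G 0 \<le> ennreal (1 / \<gamma>) * weighted (2 * \<gamma>) (\<lambda>(w, s). G w s)"
proof -
  interpret R: finite_measure RT by (rule finite_measure_restrict_lborel)
  define \<eta> where "\<eta> r = (\<integral>\<^sup>+w. ennreal ((G w r)\<^sup>2) \<partial>M)" for r
  have [measurable]: "\<eta> \<in> borel_measurable RT" unfolding \<eta>_def by (rule driver_square_measurable(2)[OF G])
  have [measurable]: "(\<lambda>x. x) \<in> borel_measurable RT" by (rule RT_id)
  define b where "b r = ennreal (exp (\<gamma> * r)) * \<eta> r" for r
  have bm: "b \<in> borel_measurable RT" unfolding b_def by measurable
  note [measurable] = bm
  have W: "weighted (2 * \<gamma>) (\<lambda>(w, s). G w s) = (\<integral>\<^sup>+r. ennreal (exp (2 * \<gamma> * r)) * \<eta> r \<partial>RT)"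
    using G by (subst weighted_swap) (auto simp: driver_def sqint_def \<eta>_def)
  have eb: "ennreal (exp (\<gamma> * r)) * b r = ennreal (exp (2 * \<gamma> * r)) * \<eta> r" for r
  proof -
    have "exp (2 * \<gamma> * r) = exp (\<gamma> * r) * exp (\<gamma> * r)" by (simp flip: exp_add)
    then show ?thesis unfolding b_def by (simp add: ennreal_mult mult_ac)
  qed
  have tm: "(\<lambda>t. \<integral>\<^sup>+r. (if t \<le> r then 1 else 0) * b r \<partial>RT) \<in> borel_measurable RT"
    by measurable
  have "(\<integral>\<^sup>+t. ennreal (exp (2 * \<gamma> * t)) * tail_bound \<gamma> G t \<partial>RT)
    = (\<integral>\<^sup>+t. ennreal (1 / \<gamma>) * (ennreal (exp (\<gamma> * t)) * (\<integral>\<^sup>+r. (if t \<le> r then 1 else 0) * b r \<partial>RT)) \<partial>RT)"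
  proof (rule nn_integral_cong)
    fix t
    have "exp (2 * \<gamma> * t) * (exp (- \<gamma> * t) / \<gamma>) = 1 / \<gamma> * exp (\<gamma> * t)" by (simp add: field_simps flip: exp_add)
    then have e: "ennreal (exp (2 * \<gamma> * t)) * ennreal (exp (- \<gamma> * t) / \<gamma>) = ennreal (1 / \<gamma>) * ennreal (exp (\<gamma> * t))"
      using \<gamma> by (simp add: ennreal_mult[symmetric])
    show "ennreal (exp (2 * \<gamma> * t)) * tail_bound \<gamma> G t = ennreal (1 / \<gamma>) * (ennreal (exp (\<gamma> * t)) * (\<integral>\<^sup>+r. (if t \<le> r then 1 else 0) * b r \<partial>RT))"
      unfolding tail_bound_def \<eta>_def[symmetric] b_def[symmetric] mult.assoc[symmetric] e ..
  qed
  also have "\<dots> = ennreal (1 / \<gamma>) * (\<integral>\<^sup>+t. ennreal (exp (\<gamma> * t)) * (\<integral>\<^sup>+r. (if t \<le> r then 1 else 0) * b r \<partial>RT) \<partial>RT)"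
    using tm by (intro nn_integral_cmult) measurable
  also have "\<dots> \<le> ennreal (1 / \<gamma>) * (ennreal (1 / \<gamma>) * (\<integral>\<^sup>+r. ennreal (exp (\<gamma> * r)) * b r \<partial>RT))"
    by (intro mult_left_mono nn_integral_exp_tail_le[OF \<gamma> bm]) auto
  also have "\<dots> = ennreal (1 / \<gamma>\<^sup>2) * weighted (2 * \<gamma>) (\<lambda>(w, s). G w s)"
    unfolding eb W[symmetric] mult.assoc[symmetric] using \<gamma>
    by (subst ennreal_mult[symmetric]) (auto simp: power2_eq_square)
  finally show "(\<integral>\<^sup>+t. ennreal (exp (2 * \<gamma> * t)) * tail_bound \<gamma> G t \<partial>RT) \<le> ennreal (1 / \<gamma>\<^sup>2) * weighted (2 * \<gamma>) (\<lambda>(w, s). G w s)" .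
  have "tail_bound \<gamma> G 0 = ennreal (1 / \<gamma>) * (\<integral>\<^sup>+r. (if 0 \<le> r then 1 else 0) * (ennreal (exp (\<gamma> * r)) * \<eta> r) \<partial>RT)"
    by (simp add: tail_bound_def \<eta>_def)
  also have "\<dots> \<le> ennreal (1 / \<gamma>) * (\<integral>\<^sup>+r. ennreal (exp (2 * \<gamma> * r)) * \<eta> r \<partial>RT)"
    using \<gamma> by (intro mult_left_mono nn_integral_mono) (auto simp: space_restrict_space intro!: mult_right_mono ennreal_leI)
  finally show "tail_bound \<gamma> G 0 \<le> ennreal (1 / \<gamma>) * weighted (2 * \<gamma>) (\<lambda>(w, s). G w s)" by (simp add: W)
qed

text \<open>Both components in one Euclidean-valued process: the squared norms add, and one
  completeness argument serves both.\<close>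

definition pair_process :: "(real \<Rightarrow> 'w \<Rightarrow> real) \<Rightarrow> (real \<Rightarrow> 'w \<Rightarrow> real^'d) \<Rightarrow> 'w \<times> real \<Rightarrow> real \<times> (real^'d)" where
  "pair_process Y Z = (\<lambda>(w, t). (Y t w, Z t w))"

lemma pair_process:
  assumes "Y \<in> S2 M F T" "Z \<in> H2 M F T"
  shows "pair_process Y Z \<in> borel_measurable Pr" "sqint Nm (pair_process Y Z)"
proof -
  have Y: "(\<lambda>(w, t). Y t w) \<in> borel_measurable Pr" "sqint Nm (\<lambda>(w, t). Y t w)"
    using assms by (auto intro: S2_predictable S2_sqint_Nm)
  have Z: "(\<lambda>(w, t). Z t w) \<in> borel_measurable Pr" "sqint Nm (\<lambda>(w, t). Z t w)"
    using assms by (auto simp: H2_iff)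
  have e: "pair_process Y Z = (\<lambda>p. ((\<lambda>(w, t). Y t w) p, (\<lambda>(w, t). Z t w) p))" by (auto simp: pair_process_def)
  show m: "pair_process Y Z \<in> borel_measurable Pr" unfolding e by (intro borel_measurable_Pair Y Z)
  have n: "(norm (pair_process Y Z p))\<^sup>2 = (norm ((\<lambda>(w, t). Y t w) p))\<^sup>2 + (norm ((\<lambda>(w, t). Z t w) p))\<^sup>2" for p
    by (simp add: e norm_Pair)
  show "sqint Nm (pair_process Y Z)"
    unfolding sqint_def n using Pr_Nm[OF m] Y(2) Z(2) by (auto simp: sqint_def)
qed

text \<open>The first summand comes from Y through the tail bound at each time. The term 3/\<gamma>
  comes from Z: one 1/\<gamma> from the unweighted part of the tail identity, and 2 \<gamma> *
  (1/\<gamma>^2) from its weighted part.\<close>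

theorem stability_weighted:
  assumes s: "flat_solution \<xi> g Y Z K" and s': "flat_solution \<xi> g' Y' Z' K'" and g: "driver g" "driver g'" and \<gamma>: "0 < \<gamma>"
  shows "weighted (2 * \<gamma>) (\<lambda>p. pair_process Y Z p - pair_process Y' Z' p)
    \<le> ennreal ((2 + 2 * (C / c)\<^sup>2) / \<gamma>\<^sup>2 + 3 / \<gamma>) * weighted (2 * \<gamma>) (\<lambda>(w, s). g w s - g' w s)"
proof -
  interpret R: finite_measure RT by (rule finite_measure_restrict_lborel)
  note S = flat_solutionD[OF s] and S' = flat_solutionD[OF s'] and G = driver_diff[OF g]
  define h where "h = tail_bound \<gamma> (\<lambda>w s. g w s - g' w s)"
  define N where "N = weighted (2 * \<gamma>) (\<lambda>(w, s). g w s - g' w s)"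
  define DY where "DY = (\<lambda>(w, t). Y t w - Y' t w)"
  define DZ where "DZ = (\<lambda>(w, t). Z t w - Z' t w)"
  have DYm: "DY \<in> borel_measurable Nm"
    using borel_measurable_diff[OF Pr_Nm[OF S2_predictable[OF S(1)]] Pr_Nm[OF S2_predictable[OF S'(1)]]]
    by (simp add: DY_def case_prod_unfold)
  have DZm: "DZ \<in> borel_measurable Nm"
  proof -
    have "(\<lambda>(w, t). Z t w) \<in> borel_measurable Nm" "(\<lambda>(w, t). Z' t w) \<in> borel_measurable Nm"
      using S(2) S'(2) by (auto simp: H2_iff sqint_def)
    from borel_measurable_diff[OF this] show ?thesis by (simp add: DZ_def case_prod_unfold)
  qed
  have RT: "t \<in> {0..T}" if "t \<in> space RT" for t using that by (simp add: space_restrict_space)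
  have Y: "weighted (2 * \<gamma>) DY \<le> ennreal ((2 + 2 * (C / c)\<^sup>2) / \<gamma>\<^sup>2) * N"
  proof -
    have "weighted (2 * \<gamma>) DY = (\<integral>\<^sup>+r. ennreal (exp (2 * \<gamma> * r)) * (\<integral>\<^sup>+w. ennreal ((norm (DY (w, r)))\<^sup>2) \<partial>M) \<partial>RT)"
      by (rule weighted_swap[OF DYm])
    also have "\<dots> \<le> (\<integral>\<^sup>+r. ennreal (2 + 2 * (C / c)\<^sup>2) * (ennreal (exp (2 * \<gamma> * r)) * h r) \<partial>RT)"
    proof (rule nn_integral_mono)
      fix r assume r: "r \<in> space RT"
      have "(\<integral>\<^sup>+w. ennreal ((norm (DY (w, r)))\<^sup>2) \<partial>M) \<le> ennreal (2 + 2 * (C / c)\<^sup>2) * h r"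
        using stability_pointwise(1)[OF s s' g RT[OF r] \<gamma>] by (simp add: DY_def h_def)
      then show "ennreal (exp (2 * \<gamma> * r)) * (\<integral>\<^sup>+w. ennreal ((norm (DY (w, r)))\<^sup>2) \<partial>M) \<le> ennreal (2 + 2 * (C / c)\<^sup>2) * (ennreal (exp (2 * \<gamma> * r)) * h r)"
        by (subst mult.left_commute) (rule mult_left_mono, auto)
    qed
    also have "\<dots> = ennreal (2 + 2 * (C / c)\<^sup>2) * (\<integral>\<^sup>+r. ennreal (exp (2 * \<gamma> * r)) * h r \<partial>RT)"
    proof (rule nn_integral_cmult)
      have [measurable]: "(\<lambda>x. x) \<in> borel_measurable RT" "(\<lambda>r. \<integral>\<^sup>+w. ennreal ((g w r - g' w r)\<^sup>2) \<partial>M) \<in> borel_measurable RT"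
        using RT_id driver_square_measurable(2)[OF G] by auto
      show "(\<lambda>r. ennreal (exp (2 * \<gamma> * r)) * h r) \<in> borel_measurable RT" unfolding h_def tail_bound_def by measurable
    qed
    also have "\<dots> \<le> ennreal (2 + 2 * (C / c)\<^sup>2) * (ennreal (1 / \<gamma>\<^sup>2) * N)"
      unfolding h_def N_def by (intro mult_left_mono tail_bound_weighted(1)[OF G \<gamma>]) auto
    also have "\<dots> = ennreal ((2 + 2 * (C / c)\<^sup>2) / \<gamma>\<^sup>2) * N"
      using \<gamma> by (subst mult.assoc[symmetric], subst ennreal_mult[symmetric]) (auto simp: add_nonneg_nonneg)
    finally show ?thesis .
  qed
  have Z: "weighted (2 * \<gamma>) DZ \<le> ennreal (3 / \<gamma>) * N"
  proof -
    define z where "z r = (\<integral>\<^sup>+w. ennreal ((norm (DZ (w, r)))\<^sup>2) \<partial>M)" for r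
    have zm: "z \<in> borel_measurable RT" unfolding z_def by (rule weighted_swap(2)[OF DZm])
    have tail: "(\<integral>\<^sup>+r. (if t \<le> r then 1 else 0) * z r \<partial>RT) \<le> h t" if t: "t \<in> {0..T}" for t
    proof -
      have m: "(\<lambda>p. (if t \<le> snd p then 1 else 0) * ennreal ((norm (DZ p))\<^sup>2)) \<in> borel_measurable Nm"
        using DZm by measurable
      have "(\<integral>\<^sup>+r. (if t \<le> r then 1 else 0) * z r \<partial>RT) = (\<integral>\<^sup>+r. (\<integral>\<^sup>+w. (if t \<le> r then 1 else 0) * ennreal ((norm (DZ (w, r)))\<^sup>2) \<partial>M) \<partial>RT)"
        unfolding z_def by (intro nn_integral_cong) simp
      also have "\<dots> = (\<integral>\<^sup>+w. (\<integral>\<^sup>+r. (if t \<le> r then 1 else 0) * ennreal ((norm (DZ (w, r)))\<^sup>2) \<partial>RT) \<partial>M)"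
        using nn_integral_Nm_swap(1)[OF m] by simp
      also have "\<dots> = (\<integral>\<^sup>+w. (\<integral>\<^sup>+r\<in>{t<..T}. ennreal ((norm (Z r w - Z' r w))\<^sup>2) \<partial>lborel) \<partial>M)"
      proof (rule nn_integral_cong)
        fix w
        \<comment> \<open>The isometry uses (t, T] and the tail identity uses [t, T]; they differ by
          a single point.\<close>
        have "AE r in lborel. r \<noteq> t" by (rule AE_lborel_singleton)
        then show "(\<integral>\<^sup>+r. (if t \<le> r then 1 else 0) * ennreal ((norm (DZ (w, r)))\<^sup>2) \<partial>RT) = (\<integral>\<^sup>+r\<in>{t<..T}. ennreal ((norm (Z r w - Z' r w))\<^sup>2) \<partial>lborel)"
          using t by (subst nn_integral_restrict_space) (auto intro!: nn_integral_cong_AE simp: DZ_def indicator_def elim!: eventually_mono)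
      qed
      also have "\<dots> \<le> h t" unfolding h_def by (rule stability_pointwise(2)[OF s s' g t \<gamma>])
      finally show ?thesis .
    qed
    have "weighted (2 * \<gamma>) DZ = (\<integral>\<^sup>+r. ennreal (exp (2 * \<gamma> * r)) * z r \<partial>RT)"
      unfolding z_def by (rule weighted_swap[OF DZm])
    also have "\<dots> = (\<integral>\<^sup>+r. z r \<partial>RT) + ennreal (2 * \<gamma>) * (\<integral>\<^sup>+t. ennreal (exp (2 * \<gamma> * t)) * (\<integral>\<^sup>+r. (if t \<le> r then 1 else 0) * z r \<partial>RT) \<partial>RT)"
      using \<gamma> by (intro nn_integral_exp_by_tails zm) auto
    also have "\<dots> \<le> h 0 + ennreal (2 * \<gamma>) * (\<integral>\<^sup>+t. ennreal (exp (2 * \<gamma> * t)) * h t \<partial>RT)"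
    proof (intro add_mono mult_left_mono nn_integral_mono)
      have "(\<integral>\<^sup>+r. z r \<partial>RT) = (\<integral>\<^sup>+r. (if 0 \<le> r then 1 else 0) * z r \<partial>RT)"
        by (intro nn_integral_cong) (auto simp: space_restrict_space)
      then show "(\<integral>\<^sup>+r. z r \<partial>RT) \<le> h 0" using tail[of 0] T_pos by simp
    qed (auto intro: tail RT)
    also have "\<dots> \<le> ennreal (1 / \<gamma>) * N + ennreal (2 * \<gamma>) * (ennreal (1 / \<gamma>\<^sup>2) * N)"
      unfolding h_def N_def by (intro add_mono mult_left_mono tail_bound_weighted[OF G \<gamma>]) auto
    also have "\<dots> = (ennreal (1 / \<gamma>) + ennreal (2 * \<gamma>) * ennreal (1 / \<gamma>\<^sup>2)) * N"
      by (simp only: distrib_right mult.assoc)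
    also have "ennreal (1 / \<gamma>) + ennreal (2 * \<gamma>) * ennreal (1 / \<gamma>\<^sup>2) = ennreal (1 / \<gamma> + 2 * \<gamma> * (1 / \<gamma>\<^sup>2))"
      using \<gamma> by (simp add: ennreal_mult[symmetric] ennreal_plus[symmetric] del: ennreal_plus)
    also have "1 / \<gamma> + 2 * \<gamma> * (1 / \<gamma>\<^sup>2) = 3 / \<gamma>" using \<gamma> by (simp add: field_simps power2_eq_square)
    finally show ?thesis .
  qed
  have "weighted (2 * \<gamma>) (\<lambda>p. pair_process Y Z p - pair_process Y' Z' p) = weighted (2 * \<gamma>) DY + weighted (2 * \<gamma>) DZ"
    unfolding weighted_def using DYm DZm
    by (subst nn_integral_add[symmetric])
      (auto simp: pair_process_def DY_def DZ_def norm_Pair distrib_left[symmetric] case_prod_unfold intro!: nn_integral_cong)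
  also have "\<dots> \<le> ennreal ((2 + 2 * (C / c)\<^sup>2) / \<gamma>\<^sup>2) * N + ennreal (3 / \<gamma>) * N"
    by (intro add_mono Y Z)
  also have "\<dots> = ennreal ((2 + 2 * (C / c)\<^sup>2) / \<gamma>\<^sup>2 + 3 / \<gamma>) * N"
    using \<gamma> by (subst ennreal_plus) (auto simp: distrib_right)
  finally show ?thesis by (simp add: N_def)
qed

end

locale lipschitz_mean_reflected = mean_reflected M T B l c C
  for M :: "'w measure" and T :: real and B :: "real \<Rightarrow> 'w \<Rightarrow> real^'d::finite"
    and l :: "'w \<Rightarrow> real \<Rightarrow> real \<Rightarrow> real" and c C :: real +
  fixes f :: "'w \<Rightarrow> real \<Rightarrow> real \<Rightarrow> real^'d \<Rightarrow> real" and L :: real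
  assumes f_meas: "(\<lambda>((w, t), y, z). f w t y z) \<in> borel_measurable (progressive_sigma M (aug_filtration M B) T \<Otimes>\<^sub>M borel \<Otimes>\<^sub>M borel)"
    and L_nonneg: "0 \<le> L"
    and f_Lipschitz: "AE w in M. \<forall>t\<in>{0..T}. \<forall>y p z q.
       \<bar>f w t y z - f w t p q\<bar> \<le> L * (\<bar>y - p\<bar> + norm (z - q))"
    and f_zero: "(\<integral>\<^sup>+w. (\<integral>\<^sup>+t\<in>{0..T}. ennreal (\<bar>f w t 0 0\<bar>\<^sup>2) \<partial>lborel) \<partial>M) < \<infinity>"
begin

definition f_along :: "('w \<times> real \<Rightarrow> real \<times> (real^'d)) \<Rightarrow> 'w \<Rightarrow> real \<Rightarrow> real" where
  "f_along P w t = f w t (fst (P (w, t))) (snd (P (w, t)))"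

lemma f_along_measurable:
  assumes P: "P \<in> borel_measurable Pg" shows "(\<lambda>(w, t). f_along P w t) \<in> borel_measurable Pg"
proof -
  have "P \<in> measurable Pg (borel \<Otimes>\<^sub>M borel)" using P by (simp add: borel_prod)
  then have "(\<lambda>p. (p, fst (P p), snd (P p))) \<in> measurable Pg (Pg \<Otimes>\<^sub>M borel \<Otimes>\<^sub>M borel)" by measurable
  from measurable_compose[OF this f_meas] show ?thesis by (simp add: f_along_def case_prod_unfold)
qed

text \<open>The factor 2 pays for |y| + |z| <= 2 |(y, z)| in the Euclidean norm of the pair.\<close>

lemma AE_f_along_diff:
  "AE p in Nm. norm (f_along P (fst p) (snd p) - f_along Q (fst p) (snd p)) \<le> 2 * L * norm (P p - Q p)"
  using AE_Nm_fst[OF f_Lipschitz] AE_space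
proof eventually_elim
  case (elim p)
  have "\<bar>f_along P (fst p) (snd p) - f_along Q (fst p) (snd p)\<bar> \<le> L * (\<bar>fst (P p) - fst (Q p)\<bar> + norm (snd (P p) - snd (Q p)))"
    using elim by (auto simp: f_along_def space_Nm)
  also have "\<dots> \<le> L * (norm (P p - Q p) + norm (P p - Q p))"
    using L_nonneg norm_fst_le[of "fst (P p - Q p)" "snd (P p - Q p)", unfolded prod.collapse]
      norm_snd_le[of "snd (P p - Q p)" "fst (P p - Q p)", unfolded prod.collapse]
    by (intro mult_left_mono add_mono) auto
  finally show ?case by simp
qed

lemma driver_zero: "driver (f_along (\<lambda>_. 0))"
proof -
  have m: "(\<lambda>(w, t). f_along (\<lambda>_. 0) w t) \<in> borel_measurable Pg" by (rule f_along_measurable) simp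
  have "(\<integral>\<^sup>+p. ennreal ((norm ((\<lambda>(w, t). f_along (\<lambda>_. 0) w t) p))\<^sup>2) \<partial>Nm) < \<infinity>"
  proof (subst nn_integral_Nm)
    show "(\<lambda>p. ennreal ((norm ((\<lambda>(w, t). f_along (\<lambda>_. 0) w t) p))\<^sup>2)) \<in> borel_measurable Nm"
      by (rule measurable_compose[OF Pg_Nm[OF m]]) measurable
  qed (use f_zero in \<open>simp add: f_along_def\<close>)
  then show ?thesis using m Pg_Nm[OF m] by (simp add: driver_def sqint_iff)
qed

text \<open>Square integrability is compared with the driver along the zero pair, which is covered
  by the growth assumption on \<open>f\<close>; the difference is controlled by the Lipschitz
  bound.\<close>

lemma driver_f_along:
  assumes P: "P \<in> borel_measurable Pr" "sqint Nm P" shows "driver (f_along P)"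
  unfolding driver_def
proof
  show m: "(\<lambda>(w, t). f_along P w t) \<in> borel_measurable Pg" by (rule f_along_measurable[OF Pr_Pg[OF P(1)]])
  have m0: "sqint Nm (\<lambda>(w, t). f_along (\<lambda>_. 0) w t)" using driver_zero by (simp add: driver_def)
  have d: "(\<lambda>p. (\<lambda>(w, t). f_along P w t) p - (\<lambda>(w, t). f_along (\<lambda>_. 0) w t) p) \<in> borel_measurable Nm"
    by (rule borel_measurable_diff[OF Pg_Nm[OF m] sqint_measurable[OF m0]])
  have "sqint Nm (\<lambda>p. (\<lambda>(w, t). f_along P w t) p - (\<lambda>(w, t). f_along (\<lambda>_. 0) w t) p)"
    using AE_f_along_diff[of P "\<lambda>_. 0"] by (intro sqint_mono[OF P(2) d, where K="2 * L"]) (simp add: case_prod_unfold)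
  from sqint_add[OF this m0] show "sqint Nm (\<lambda>(w, t). f_along P w t)" by (simp only: diff_add_cancel)
qed

text \<open>With \<kappa> = (C/c)^2 and \<gamma> >= 1 the stability constant is at most (5 + 2
  \<kappa>) / \<gamma>, and the driver costs 4 L^2. The value is chosen to make the product at most
  1/4.\<close>

definition \<gamma> :: real where "\<gamma> = max 1 (16 * L\<^sup>2 * (5 + 2 * (C / c)\<^sup>2))"

abbreviation "wnorm \<equiv> weighted (2 * \<gamma>)"

lemma \<gamma>_ge_1: "1 \<le> \<gamma>" by (simp add: \<gamma>_def)

text \<open>The ratio refers to squared norms; 1/4 is the geometric rate on which the Cauchy
  estimate in L2 is built.\<close>

theorem contraction:
  assumes s: "flat_solution \<xi> (f_along P) Y Z K" and s': "flat_solution \<xi> (f_along Q) Y' Z' K'"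
    and P: "P \<in> borel_measurable Pr" "sqint Nm P" and Q: "Q \<in> borel_measurable Pr" "sqint Nm Q"
  shows "wnorm (\<lambda>p. pair_process Y Z p - pair_process Y' Z' p) \<le> ennreal (1 / 4) * wnorm (\<lambda>p. P p - Q p)"
proof -
  define \<kappa> where "\<kappa> = (C / c)\<^sup>2"
  have \<gamma>: "0 < \<gamma>" using \<gamma>_ge_1 by simp
  have \<kappa>: "0 \<le> \<kappa>" by (simp add: \<kappa>_def)
  have "wnorm (\<lambda>(w, s). f_along P w s - f_along Q w s) \<le> (\<integral>\<^sup>+p. ennreal (4 * L\<^sup>2) * (ennreal (exp (2 * \<gamma> * snd p)) * ennreal ((norm (P p - Q p))\<^sup>2)) \<partial>Nm)"
    unfolding weighted_def
  proof (rule nn_integral_mono_AE)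
    show "AE p in Nm. ennreal (exp (2 * \<gamma> * snd p)) * ennreal ((norm (case p of (w, s) \<Rightarrow> f_along P w s - f_along Q w s))\<^sup>2)
      \<le> ennreal (4 * L\<^sup>2) * (ennreal (exp (2 * \<gamma> * snd p)) * ennreal ((norm (P p - Q p))\<^sup>2))"
      using AE_f_along_diff[of P Q]
    proof eventually_elim
      case (elim p)
      from power_mono[OF elim, of 2]
      have "ennreal ((norm (f_along P (fst p) (snd p) - f_along Q (fst p) (snd p)))\<^sup>2) \<le> ennreal (4 * L\<^sup>2 * (norm (P p - Q p))\<^sup>2)"
        by (intro ennreal_leI) (simp add: power_mult_distrib)
      also have "\<dots> = ennreal (4 * L\<^sup>2) * ennreal ((norm (P p - Q p))\<^sup>2)" by (rule ennreal_mult) auto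
      finally show ?case
        by (subst mult.left_commute) (auto simp: case_prod_unfold intro!: mult_left_mono)
    qed
  qed
  also have "\<dots> = ennreal (4 * L\<^sup>2) * wnorm (\<lambda>p. P p - Q p)"
    unfolding weighted_def
  proof (rule nn_integral_cmult)
    have [measurable]: "P \<in> borel_measurable Nm" "Q \<in> borel_measurable Nm" using P Q by (auto simp: sqint_def)
    have "(\<lambda>p. P p - Q p) \<in> borel_measurable Nm" by measurable
    from measurable_compose[OF this, of "\<lambda>x. ennreal ((norm x)\<^sup>2)"]
    have [measurable]: "(\<lambda>p. ennreal ((norm (P p - Q p))\<^sup>2)) \<in> borel_measurable Nm" by measurable
    have [measurable]: "(\<lambda>p. ennreal (exp (2 * \<gamma> * snd p))) \<in> borel_measurable Nm"
      by (rule measurable_compose[OF snd_Nm]) measurable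
    show "(\<lambda>p. ennreal (exp (2 * \<gamma> * snd p)) * ennreal ((norm (P p - Q p))\<^sup>2)) \<in> borel_measurable Nm"
      by (intro borel_measurable_times_ennreal) fact+
  qed
  finally have 1: "wnorm (\<lambda>(w, s). f_along P w s - f_along Q w s) \<le> ennreal (4 * L\<^sup>2) * wnorm (\<lambda>p. P p - Q p)" .
  have "((2 + 2 * \<kappa>) / \<gamma>\<^sup>2 + 3 / \<gamma>) * (4 * L\<^sup>2) \<le> 1 / 4"
  proof -
    have "(2 + 2 * \<kappa>) / \<gamma>\<^sup>2 \<le> (2 + 2 * \<kappa>) / \<gamma>"
      using \<gamma>_ge_1 \<kappa> by (intro divide_left_mono) (auto simp: power2_eq_square intro!: mult_pos_pos)
    then have "(2 + 2 * \<kappa>) / \<gamma>\<^sup>2 + 3 / \<gamma> \<le> (5 + 2 * \<kappa>) / \<gamma>" by (simp add: add_divide_distrib)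
    then have "((2 + 2 * \<kappa>) / \<gamma>\<^sup>2 + 3 / \<gamma>) * (4 * L\<^sup>2) \<le> (5 + 2 * \<kappa>) / \<gamma> * (4 * L\<^sup>2)" by (intro mult_right_mono) auto
    also have "\<dots> = (16 * L\<^sup>2 * (5 + 2 * \<kappa>)) / (4 * \<gamma>)"
      using \<gamma> by (simp add: divide_simps)
    also have "\<dots> \<le> \<gamma> / (4 * \<gamma>)" using \<gamma> by (intro divide_right_mono) (auto simp: \<gamma>_def \<kappa>_def)
    also have "\<dots> = 1 / 4" using \<gamma> by simp
    finally show ?thesis .
  qed
  then have 2: "ennreal ((2 + 2 * \<kappa>) / \<gamma>\<^sup>2 + 3 / \<gamma>) * ennreal (4 * L\<^sup>2) \<le> ennreal (1 / 4)"
    using \<gamma> \<kappa> by (subst ennreal_mult[symmetric]) (auto intro!: ennreal_leI add_nonneg_nonneg divide_nonneg_nonneg)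
  have "wnorm (\<lambda>p. pair_process Y Z p - pair_process Y' Z' p)
      \<le> ennreal ((2 + 2 * \<kappa>) / \<gamma>\<^sup>2 + 3 / \<gamma>) * wnorm (\<lambda>(w, s). f_along P w s - f_along Q w s)"
    unfolding \<kappa>_def by (rule stability_weighted[OF s s' driver_f_along[OF P] driver_f_along[OF Q] \<gamma>])
  also have "\<dots> \<le> ennreal ((2 + 2 * \<kappa>) / \<gamma>\<^sup>2 + 3 / \<gamma>) * (ennreal (4 * L\<^sup>2) * wnorm (\<lambda>p. P p - Q p))"
    by (intro mult_left_mono 1) auto
  also have "\<dots> \<le> ennreal (1 / 4) * wnorm (\<lambda>p. P p - Q p)"
    unfolding mult.assoc[symmetric] by (intro mult_right_mono 2) auto
  finally show ?thesis .
qed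

lemma wnorm_finite: "sqint Nm P \<Longrightarrow> wnorm P < \<infinity>"
  using weighted_le[of "2 * \<gamma>" P] \<gamma>_ge_1 by (auto simp: sqint_iff ennreal_mult_less_top intro: order_le_less_trans)

lemma wnorm_0_AE:
  assumes "P \<in> borel_measurable Nm" "wnorm P = 0" shows "AE p in Nm. P p = 0"
proof -
  have "(\<integral>\<^sup>+p. ennreal ((norm (P p))\<^sup>2) \<partial>Nm) = 0"
    using weighted_ge[of "2 * \<gamma>" P] assms(2) \<gamma>_ge_1 by simp
  moreover have "(\<lambda>p. ennreal ((norm (P p))\<^sup>2)) \<in> borel_measurable Nm"
    by (rule measurable_compose[OF assms(1)]) measurable
  ultimately show ?thesis by (subst (asm) nn_integral_0_iff_AE) auto
qed

lemma deterministic_flat_solution_iff: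
  assumes "\<And>w t. w \<in> space M \<Longrightarrow> t \<in> {0..T} \<Longrightarrow> f w t (Y t w) (Z t w) = g w t"
  shows "deterministic_flat_solution M T B \<xi> f l Y Z K \<longleftrightarrow> flat_solution \<xi> g Y Z K"
proof -
  have "(LINT s:{t..T}|lborel. f w s (Y s w) (Z s w)) = (LINT s:{t..T}|lborel. g w s)" if "t \<in> {0..T}" "w \<in> space M" for w t
    using that assms by (intro set_lebesgue_integral_cong) auto
  then have "(AE w in M. \<forall>t\<in>{0..T}. Y t w = \<xi> w + (LINT s:{t..T}|lborel. f w s (Y s w) (Z s w)) - (I T w - I t w) + K T - K t) \<longleftrightarrow>
     (AE w in M. \<forall>t\<in>{0..T}. Y t w = \<xi> w + (LINT s:{t..T}|lborel. g w s) - (I T w - I t w) + K T - K t)" for I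
    by (intro AE_cong) auto
  then show ?thesis unfolding deterministic_flat_solution_def by simp
qed

text \<open>Solutions are fixed points of the Picard map: freezing the driver along the solution
  itself does not alter the equation.\<close>

lemma solution_as_fixed_driver:
  "deterministic_flat_solution M T B \<xi> f l Y Z K \<longleftrightarrow> flat_solution \<xi> (f_along (pair_process Y Z)) Y Z K"
  by (rule deterministic_flat_solution_iff) (simp add: f_along_def pair_process_def)

theorem uniqueness:
  assumes s: "deterministic_flat_solution M T B \<xi> f l Y Z K" and s': "deterministic_flat_solution M T B \<xi> f l Y' Z' K'"
  shows "AE w in M. \<forall>t\<in>{0..T}. Y t w = Y' t w" "AE (w, t) in Nm. Z t w = Z' t w" "\<forall>t\<in>{0..T}. K t = K' t"
proof -
  note s1 = s[unfolded solution_as_fixed_driver] and s2 = s'[unfolded solution_as_fixed_driver]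
  note S = flat_solutionD[OF s1] and S' = flat_solutionD[OF s2]
  define P where "P = pair_process Y Z"
  define Q where "Q = pair_process Y' Z'"
  note P = pair_process[OF S(1,2), folded P_def] and Q = pair_process[OF S'(1,2), folded Q_def]
  note gP = driver_f_along[OF P] and gQ = driver_f_along[OF Q]
  have PQ: "sqint Nm (\<lambda>p. P p - Q p)" by (rule sqint_diff[OF P(2) Q(2)])
  have "wnorm (\<lambda>p. P p - Q p) \<le> ennreal (1 / 4) * wnorm (\<lambda>p. P p - Q p)"
    using contraction[OF s1[folded P_def] s2[folded Q_def] P Q] by (simp add: P_def Q_def)
  \<comment> \<open>Finiteness is essential, as infinity also satisfies x <= x / 4.\<close>
  moreover obtain x where x: "0 \<le> x" "wnorm (\<lambda>p. P p - Q p) = ennreal x"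
    using wnorm_finite[OF PQ] by (cases "wnorm (\<lambda>p. P p - Q p)") auto
  ultimately have "x \<le> 1 / 4 * x" by (simp add: ennreal_mult[symmetric])
  then have W0: "wnorm (\<lambda>p. P p - Q p) = 0" using x by simp
  then have AE0: "AE p in Nm. P p - Q p = 0" using sqint_measurable[OF PQ] by (intro wnorm_0_AE)
  then show "AE (w, t) in Nm. Z t w = Z' t w"
    by eventually_elim (auto simp: P_def Q_def pair_process_def zero_prod_def split: prod.splits)
  have "AE p in Nm. f_along P (fst p) (snd p) - f_along Q (fst p) (snd p) = 0"
    using AE_f_along_diff[of P Q] AE0 by eventually_elim simp
  then have "wnorm (\<lambda>(w, s). f_along P w s - f_along Q w s) = (\<integral>\<^sup>+p. 0 \<partial>Nm)"
    unfolding weighted_def by (intro nn_integral_cong_AE) (auto elim!: eventually_mono simp: case_prod_unfold)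
  then have N0: "wnorm (\<lambda>(w, s). f_along P w s - f_along Q w s) = 0" by simp
  have \<gamma>: "0 < \<gamma>" using \<gamma>_ge_1 by simp
  \<comment> \<open>The pairs agree almost everywhere, hence so do the drivers and every tail bound
    vanishes. The pointwise estimates now yield equality at each single time instead of almost every
    time.\<close>
  have h0: "tail_bound \<gamma> (\<lambda>w s. f_along P w s - f_along Q w s) t = 0" if t: "t \<in> {0..T}" for t
  proof -
    have "tail_bound \<gamma> (\<lambda>w s. f_along P w s - f_along Q w s) t \<le> tail_bound \<gamma> (\<lambda>w s. f_along P w s - f_along Q w s) 0"
      using t by (intro tail_bound_antimono \<gamma>) auto
    also have "\<dots> \<le> 0" using tail_bound_weighted(2)[OF driver_diff[OF gP gQ] \<gamma>] N0 by simp
    finally show ?thesis by simp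
  qed
  note st = stability_pointwise[OF s1[folded P_def] s2[folded Q_def] gP gQ _ \<gamma>]
  have k: "K T - K t = K' T - K' t" if t: "t \<in> {0..T}" for t using st(3)[OF t] h0[OF t] by simp
  have "K T = K' T" using k[of 0] T_pos S(5) S'(5) by simp
  then show "\<forall>t\<in>{0..T}. K t = K' t" using k by auto
  have Yt: "AE w in M. Y t w - Y' t w = 0" if t: "t \<in> {0..T}" for t
  proof -
    have "(\<integral>\<^sup>+w. ennreal ((Y t w - Y' t w)\<^sup>2) \<partial>M) = 0" using st(1)[OF t] h0[OF t] by simp
    moreover have "(\<lambda>w. ennreal ((Y t w - Y' t w)\<^sup>2)) \<in> borel_measurable M"
      using S2D(2)[OF S(1) t] S2D(2)[OF S'(1) t] by measurable
    ultimately show ?thesis by (subst (asm) nn_integral_0_iff_AE) auto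
  qed
  \<comment> \<open>Countably many dyadic times share one null set, and continuity of the paths
    extends the equality to all times.\<close>
  have "AE w in M. \<forall>n. \<forall>k\<in>{..2^n::nat}. Y (real k * T / 2^n) w - Y' (real k * T / 2^n) w = 0"
    unfolding AE_all_countable by (intro allI AE_finite_allI Yt grid_in) auto
  then show "AE w in M. \<forall>t\<in>{0..T}. Y t w = Y' t w"
    using AE_space
  proof eventually_elim
    case (elim w)
    have "grid_sup (\<lambda>t w. Y t w - Y' t w) w = (SUP n. SUP k\<in>{..2^n::nat}. 0)"
      unfolding grid_sup_def using elim(1) by (intro SUP_cong refl) auto
    then have g0: "grid_sup (\<lambda>t w. Y t w - Y' t w) w = 0" by simp
    have "continuous_on {0..T} (\<lambda>t. Y t w - Y' t w)"
      using S2D(3)[OF S(1) elim(2)] S2D(3)[OF S'(1) elim(2)] by (intro continuous_intros)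
    then have "ennreal ((Y t w - Y' t w)\<^sup>2) \<le> 0" if "t \<in> {0..T}" for t
      using grid_sup_ge[where X="\<lambda>t w. Y t w - Y' t w" and w=w, OF _ that] g0 by simp
    then show ?case by (auto simp: ennreal_eq_0_iff)
  qed
qed

theorem existence:
  assumes \<xi>: "H_xi M F T l \<xi>"
  shows "\<exists>Y Z K. deterministic_flat_solution M T B \<xi> f l Y Z K"
proof -
  interpret R: finite_measure RT by (rule finite_measure_restrict_lborel)
  interpret PP: pair_sigma_finite M RT ..
  define step where "step P Q \<longleftrightarrow> (\<exists>Y Z K. flat_solution \<xi> (f_along P) Y Z K \<and> Q = pair_process Y Z)" for P Q
  define good where "good P \<longleftrightarrow> P \<in> borel_measurable Pr \<and> sqint Nm P" for P :: "'w \<times> real \<Rightarrow> real \<times> (real^'d)"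
  have ex_step: "\<exists>Q. good Q \<and> step P Q" if gP: "good P" for P
  proof -
    obtain Y Z K where s: "flat_solution \<xi> (f_along P) Y Z K"
      using fixed_driver_exists[OF driver_f_along[of P] \<xi>] gP unfolding good_def by blast
    note S = flat_solutionD[OF s]
    show ?thesis using s pair_process[OF S(1,2)] unfolding step_def good_def by blast
  qed
  \<comment> \<open>The Picard step is a relation, since solutions for a fixed driver are only known
    to exist; the sequence is formed by dependent choice from the zero pair.\<close>
  have "\<exists>P. \<forall>n. good (P n) \<and> step (P n) (P (Suc n))"
    by (rule dependent_nat_choice) (use ex_step in \<open>auto simp: good_def sqint_zero intro!: exI[of _ "\<lambda>_. 0"]\<close>)
  then obtain P where P: "\<And>n. P n \<in> borel_measurable Pr" "\<And>n. sqint Nm (P n)" and step: "\<And>n. step (P n) (P (Suc n))"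
    unfolding good_def by blast
  have Pm: "P n \<in> borel_measurable Nm" for n by (rule sqint_measurable[OF P(2)])
  \<comment> \<open>Stated for an arbitrary competitor \<open>Q\<close>, so that it serves both the
    successive iterates and the comparison with their limit.\<close>
  have contr: "wnorm (\<lambda>p. Q' p - P (Suc n) p) \<le> ennreal (1 / 4) * wnorm (\<lambda>p. Q p - P n p)"
    if Q: "Q \<in> borel_measurable Pr" "sqint Nm Q" "step Q Q'" for Q Q' n
  proof -
    obtain Y Z K where 1: "flat_solution \<xi> (f_along Q) Y Z K" "Q' = pair_process Y Z"
      using Q(3) unfolding step_def by blast
    obtain Y' Z' K' where 2: "flat_solution \<xi> (f_along (P n)) Y' Z' K'" "P (Suc n) = pair_process Y' Z'"
      using step[of n] unfolding step_def by blast
    show ?thesis unfolding 1(2) 2(2) by (rule contraction[OF 1(1) 2(1) Q(1,2) P])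
  qed
  define x where "x = enn2real (wnorm (\<lambda>p. P 1 p - P 0 p))"
  have x: "wnorm (\<lambda>p. P 1 p - P 0 p) = ennreal x" "0 \<le> x"
    using wnorm_finite[OF sqint_diff[OF P(2)[of 1] P(2)[of 0]]] by (auto simp: x_def)
  have geo: "wnorm (\<lambda>p. P (Suc n) p - P n p) \<le> ennreal (x * (1 / 4) ^ n)" for n
  proof (induction n)
    case 0
    then show ?case using x by simp
  next
    case (Suc n)
    have "wnorm (\<lambda>p. P (Suc (Suc n)) p - P (Suc n) p) \<le> ennreal (1 / 4) * wnorm (\<lambda>p. P (Suc n) p - P n p)"
      by (rule contr[OF P step])
    also have "\<dots> \<le> ennreal (1 / 4) * ennreal (x * (1 / 4) ^ n)" by (intro mult_left_mono Suc) auto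
    also have "\<dots> = ennreal (x * (1 / 4) ^ Suc n)" using x(2) by (subst ennreal_mult[symmetric]) (auto simp: mult_ac)
    finally show ?case .
  qed
  have gap: "(\<integral>\<^sup>+p. ennreal ((norm (P (n + m) p - P n p))\<^sup>2) \<partial>Nm) \<le> ennreal (4 * x * (1 / 4) ^ n)" for n m
  proof (rule L2_Cauchy_geometric[OF Pm _ x(2)])
    show "(\<integral>\<^sup>+p. ennreal ((norm (P (Suc n) p - P n p))\<^sup>2) \<partial>Nm) \<le> ennreal (x * (1 / 4) ^ n)" for n
      using order_trans[OF weighted_ge geo[of n]] \<gamma>_ge_1 by simp
  qed
  have "\<exists>n0. \<forall>m\<ge>n0. \<forall>n\<ge>n0. (\<integral>\<^sup>+p. ennreal ((norm (P m p - P n p))\<^sup>2) \<partial>Nm) < ennreal e" if "0 < e" for e :: real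
  proof -
    have "(\<lambda>k. 4 * x * (1 / 4::real) ^ k) \<longlonglongrightarrow> 4 * x * 0" by (intro tendsto_intros LIMSEQ_power_zero) auto
    then have "\<forall>\<^sub>F k in sequentially. 4 * x * (1 / 4::real) ^ k < e" using that by (intro order_tendstoD) auto
    then obtain k where k: "\<And>n. k \<le> n \<Longrightarrow> 4 * x * (1 / 4) ^ n < e" by (auto simp: eventually_sequentially)
    have le: "(\<integral>\<^sup>+p. ennreal ((norm (P m p - P n p))\<^sup>2) \<partial>Nm) < ennreal e" if "k \<le> n" "n \<le> m" for m n
      using gap[of n "m - n"] k[OF that(1)] that(2) \<open>0 < e\<close> by (simp add: order_le_less_trans ennreal_lessI)
    have "(\<integral>\<^sup>+p. ennreal ((norm (P m p - P n p))\<^sup>2) \<partial>Nm) < ennreal e" if "k \<le> n" "k \<le> m" for m n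
      using le[of n m] le[of m n] that by (cases "n \<le> m") (simp_all add: norm_minus_commute)
    then show ?thesis by blast
  qed
  then obtain Q where Q: "Q \<in> borel_measurable Pr" and lim: "(\<lambda>n. \<integral>\<^sup>+p. ennreal ((norm (P n p - Q p))\<^sup>2) \<partial>Nm) \<longlonglongrightarrow> 0"
    by (rule L2_complete[OF P(1) _ sets_Pr_sub, rotated]) (auto simp: space_Nm space_Pr)
  have Qm: "Q \<in> borel_measurable Nm" by (rule Pr_Nm[OF Q])
  have Qsq: "sqint Nm Q"
  proof -
    have "\<forall>\<^sub>F n in sequentially. (\<integral>\<^sup>+p. ennreal ((norm (P n p - Q p))\<^sup>2) \<partial>Nm) < 1"
      using lim by (rule order_tendstoD) simp
    then obtain n where "(\<integral>\<^sup>+p. ennreal ((norm (P n p - Q p))\<^sup>2) \<partial>Nm) < 1" by (auto simp: eventually_sequentially)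
    then show ?thesis by (intro sqint_of_L2_close[OF P(2)[of n] Qm]) (auto intro: order.strict_trans)
  qed
  \<comment> \<open>The limit \<open>Q\<close> is merely a predictable square integrable pair,
    without continuous paths. One more Picard step produces a genuine solution, whose pair
    \<open>Q'\<close> is then shown to agree with \<open>Q\<close> almost everywhere.\<close>
  obtain Y Z K where s: "flat_solution \<xi> (f_along Q) Y Z K"
    using fixed_driver_exists[OF driver_f_along[OF Q Qsq] \<xi>] by blast
  note S = flat_solutionD[OF s]
  define Q' where "Q' = pair_process Y Z"
  note Q' = pair_process[OF S(1,2), folded Q'_def]
  have stepQ: "step Q Q'" using s unfolding step_def Q'_def by blast
  have limw: "(\<lambda>n. wnorm (\<lambda>p. Q p - P n p)) \<longlonglongrightarrow> 0"
  proof (rule tendsto_sandwich[OF always_eventually[OF allI[OF zero_le]] always_eventually[OF allI] tendsto_const])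
    show "wnorm (\<lambda>p. Q p - P n p) \<le> ennreal (exp (2 * \<gamma> * T)) * (\<integral>\<^sup>+p. ennreal ((norm (P n p - Q p))\<^sup>2) \<partial>Nm)" for n
      using weighted_le[of "2 * \<gamma>" "\<lambda>p. Q p - P n p"] \<gamma>_ge_1 borel_measurable_diff[OF Qm Pm[of n]] by (simp add: norm_minus_commute)
    have "(\<lambda>n. ennreal (exp (2 * \<gamma> * T)) * (\<integral>\<^sup>+p. ennreal ((norm (P n p - Q p))\<^sup>2) \<partial>Nm)) \<longlonglongrightarrow> ennreal (exp (2 * \<gamma> * T)) * 0"
      by (intro ennreal_tendsto_cmult lim) simp
    then show "(\<lambda>n. ennreal (exp (2 * \<gamma> * T)) * (\<integral>\<^sup>+p. ennreal ((norm (P n p - Q p))\<^sup>2) \<partial>Nm)) \<longlonglongrightarrow> 0" by simp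
  qed
  have "(\<integral>\<^sup>+p. ennreal ((norm (Q' p - Q p))\<^sup>2) \<partial>Nm) \<le> 0"
  proof (rule LIMSEQ_le_const)
    have "(\<lambda>n. 2 * (ennreal (1 / 4) * wnorm (\<lambda>p. Q p - P n p)) + 2 * (\<integral>\<^sup>+p. ennreal ((norm (P (Suc n) p - Q p))\<^sup>2) \<partial>Nm))
       \<longlonglongrightarrow> 2 * (ennreal (1 / 4) * 0) + 2 * 0"
      by (intro tendsto_add ennreal_tendsto_cmult limw LIMSEQ_Suc[OF lim]) auto
    then show "(\<lambda>n. 2 * (ennreal (1 / 4) * wnorm (\<lambda>p. Q p - P n p)) + 2 * (\<integral>\<^sup>+p. ennreal ((norm (P (Suc n) p - Q p))\<^sup>2) \<partial>Nm)) \<longlonglongrightarrow> 0"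
      by simp
    have "(\<integral>\<^sup>+p. ennreal ((norm (Q' p - Q p))\<^sup>2) \<partial>Nm)
       \<le> 2 * (ennreal (1 / 4) * wnorm (\<lambda>p. Q p - P n p)) + 2 * (\<integral>\<^sup>+p. ennreal ((norm (P (Suc n) p - Q p))\<^sup>2) \<partial>Nm)" for n
    proof -
      have "(\<integral>\<^sup>+p. ennreal ((norm (Q' p - Q p))\<^sup>2) \<partial>Nm) = (\<integral>\<^sup>+p. ennreal ((norm ((Q' p - P (Suc n) p) + (P (Suc n) p - Q p)))\<^sup>2) \<partial>Nm)"
        by simp
      also have "\<dots> \<le> 2 * (\<integral>\<^sup>+p. ennreal ((norm (Q' p - P (Suc n) p))\<^sup>2) \<partial>Nm) + 2 * (\<integral>\<^sup>+p. ennreal ((norm (P (Suc n) p - Q p))\<^sup>2) \<partial>Nm)"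
        by (rule nn_integral_norm_add_le[OF borel_measurable_diff[OF sqint_measurable[OF Q'(2)] Pm] borel_measurable_diff[OF Pm Qm]])
      also have "\<dots> \<le> 2 * (ennreal (1 / 4) * wnorm (\<lambda>p. Q p - P n p)) + 2 * (\<integral>\<^sup>+p. ennreal ((norm (P (Suc n) p - Q p))\<^sup>2) \<partial>Nm)"
        using \<gamma>_ge_1 by (intro add_mono mult_left_mono order_trans[OF weighted_ge contr[OF Q Qsq stepQ]]) auto
      finally show ?thesis .
    qed
    then show "\<exists>N. \<forall>n\<ge>N. (\<integral>\<^sup>+p. ennreal ((norm (Q' p - Q p))\<^sup>2) \<partial>Nm)
       \<le> 2 * (ennreal (1 / 4) * wnorm (\<lambda>p. Q p - P n p)) + 2 * (\<integral>\<^sup>+p. ennreal ((norm (P (Suc n) p - Q p))\<^sup>2) \<partial>Nm)" by blast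
  qed
  moreover have "(\<lambda>p. ennreal ((norm (Q' p - Q p))\<^sup>2)) \<in> borel_measurable Nm"
    by (rule measurable_compose[OF borel_measurable_diff[OF sqint_measurable[OF Q'(2)] Qm]]) measurable
  ultimately have "AE p in Nm. ennreal ((norm (Q' p - Q p))\<^sup>2) = 0"
    by (subst (asm) le_zero_eq, subst (asm) nn_integral_0_iff_AE) auto
  then have "AE p in Nm. Q' p = Q p" by eventually_elim simp
  then have "AE w in M. AE t in RT. Q' (w, t) = Q (w, t)" by (rule PP.AE_pair)
  \<comment> \<open>Almost everywhere equal pairs give the same time integrals, so the driver frozen
    along \<open>Q\<close> may be exchanged for the one along the solution itself.\<close>
  then have eq: "AE w in M. \<forall>t\<in>{0..T}. (LINT s:{t..T}|lborel. f_along Q' w s) = (LINT s:{t..T}|lborel. f_along Q w s)"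
    using AE_space
  proof eventually_elim
    case (elim w)
    have m: "f_along Q' w \<in> borel_measurable RT" "f_along Q w \<in> borel_measurable RT"
      by (rule driver_slice[OF driver_f_along[OF Q'] elim(2)], rule driver_slice[OF driver_f_along[OF Q Qsq] elim(2)])
    have RTeq: "(LINT s:{t..T}|lborel. h s) = (\<integral>s. indicator {t..T} s * h s \<partial>RT)" if "t \<in> {0..T}" for t and h :: "real \<Rightarrow> real"
      using that by (auto simp: set_lebesgue_integral_def integral_restrict_space indicator_def intro!: Bochner_Integration.integral_cong)
    have i: "(\<lambda>s. indicator {t..T} s :: real) \<in> borel_measurable RT" for t
      by (rule measurable_restrict_space1) simp
    show ?case
    proof
      fix t assume t: "t \<in> {0..T}"
      have "AE s in RT. indicator {t..T} s * f_along Q' w s = indicator {t..T} s * f_along Q w s"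
        using elim(1) by eventually_elim (simp add: f_along_def)
      then show "(LINT s:{t..T}|lborel. f_along Q' w s) = (LINT s:{t..T}|lborel. f_along Q w s)"
        unfolding RTeq[OF t] by (intro integral_cong_AE borel_measurable_times i m)
    qed
  qed
  have "flat_solution \<xi> (f_along Q') Y Z K"
  proof -
    obtain I where I: "is_ito_integral M T B Z I" "AE w in M. \<forall>t\<in>{0..T}.
        Y t w = \<xi> w + (LINT s:{t..T}|lborel. f_along Q w s) - (I T w - I t w) + K T - K t" using S(6) by blast
    have "AE w in M. \<forall>t\<in>{0..T}.
        Y t w = \<xi> w + (LINT s:{t..T}|lborel. f_along Q' w s) - (I T w - I t w) + K T - K t"
      using I(2) eq by eventually_elim simp
    then show ?thesis using s I(1) unfolding deterministic_flat_solution_def by blast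
  qed
  then show ?thesis unfolding Q'_def solution_as_fixed_driver[symmetric] by blast
qed

end

theorem corollary11:
  fixes M :: "'w measure" and T :: real and B :: "real \<Rightarrow> 'w \<Rightarrow> real^'d::finite"
    and \<xi> :: "'w \<Rightarrow> real" and f :: "'w \<Rightarrow> real \<Rightarrow> real \<Rightarrow> real^'d \<Rightarrow> real"
    and l :: "'w \<Rightarrow> real \<Rightarrow> real \<Rightarrow> real"
  assumes "prob_space M" and "complete_measure M" and "0 < T"
    and "standard_brownian_motion M T B"
    and "H_xi M (aug_filtration M B) T l \<xi>"
    and "H_f M (aug_filtration M B) T f"
    and "H_bl M (aug_filtration M B) T l"
  shows "(\<exists>Y Z K. deterministic_flat_solution M T B \<xi> f l Y Z K) \<and>
    (\<forall>Y Z K Y' Z' K'.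
      deterministic_flat_solution M T B \<xi> f l Y Z K \<longrightarrow>
      deterministic_flat_solution M T B \<xi> f l Y' Z' K' \<longrightarrow>
      (AE w in M. \<forall>t\<in>{0..T}. Y t w = Y' t w) \<and>
      (AE (w, t) in M \<Otimes>\<^sub>M restrict_space lborel {0..T}. Z t w = Z' t w) \<and>
      (\<forall>t\<in>{0..T}. K t = K' t))"
proof -
  have "brownian M T B" using assms(1,3,4) by (simp add: brownian_def brownian_axioms_def)
  obtain c C where l: "(\<lambda>(w, t, y). l w t y) \<in> borel_measurable (aug_filtration M B T \<Otimes>\<^sub>M restrict_space borel {0..T} \<Otimes>\<^sub>M borel)"
      "0 < c" "c \<le> C" "AE w in M. (\<forall>y. continuous_on {0..T} (\<lambda>t. l w t y)) \<and>
        (\<forall>t\<in>{0..T}. strict_mono (\<lambda>y. l w t y)) \<and>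
        (\<forall>t\<in>{0..T}. \<forall>y. \<bar>l w t y\<bar> \<le> C * (1 + \<bar>y\<bar>)) \<and>
        (\<forall>t\<in>{0..T}. \<forall>x y. c * \<bar>x - y\<bar> \<le> \<bar>l w t x - l w t y\<bar> \<and> \<bar>l w t x - l w t y\<bar> \<le> C * \<bar>x - y\<bar>)"
    using assms(7) unfolding H_bl_def by blast
  obtain L where f: "(\<lambda>((w, t), y, z). f w t y z) \<in> borel_measurable (progressive_sigma M (aug_filtration M B) T \<Otimes>\<^sub>M borel \<Otimes>\<^sub>M borel)"
      "0 \<le> L" "AE w in M. \<forall>t\<in>{0..T}. \<forall>y p z q. \<bar>f w t y z - f w t p q\<bar> \<le> L * (\<bar>y - p\<bar> + norm (z - q))"
      "(\<integral>\<^sup>+w. (\<integral>\<^sup>+t\<in>{0..T}. ennreal (\<bar>f w t 0 0\<bar>\<^sup>2) \<partial>lborel) \<partial>M) < \<infinity>"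
    using assms(6) unfolding H_f_def by blast
  interpret brownian M T B by fact
  interpret lipschitz_mean_reflected M T B l c C f L
    by unfold_locales (fact l f)+
  show ?thesis
    using existence[OF assms(5)] uniqueness[where \<xi>=\<xi>] by blast
qed

end
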